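(* Let $\mathbf{M}$ be a bicomplete closed symmetric monoidal category and let $\overline{\mathbf{C}}=(\mathbf{C},\perp)$ be an orthogonal category. Then the category $\mathbf{Alg}_{\mathcal{O}_{\overline{\mathbf{C}}}}(\mathbf{M})$ of algebras in $\mathbf{M}$ over the colored operad $\mathcal{O}_{\overline{\mathbf{C}}}$ is (canonically isomorphic to) the category $\mathbf{Alg}(\mathbf{M})^{\overline{\mathbf{C}}}$ of $\perp$-commutative functors from $\mathbf{C}$ to associative and unital algebras in $\mathbf{M}$.
   Context: Colored operads are symmetric and $\mathbf{Set}$-valued: a colored operad $\mathcal{O}$ has a set of colors, sets of operations $\mathcal{O}\binom{t}{\underline{c}}$ for each color $t$ and each tuple of colors $\underline{c}=(c_1,\dots,c_n)$, $n\ge 0$, maps $\mathcal{O}(\sigma):\mathcal{O}\binom{t}{\underline{c}}\to\mathcal{O}\binom{t}{\underline{c}\sigma}$ for $\sigma\in\Sigma_n$ with $\underline{c}\sigma=(c_{\sigma(1)},\dots,c_{\sigma(n)})$, compositions $\gamma$ and units, subject to the usual axioms. $\mathbf{Op}_{\mathfrak{C}}$ is the category of operads with color set $\mathfrak{C}$ and morphisms that are the identity on colors. Orthogonal category: a pair $\overline{\mathbf{C}}=(\mathbf{C},\perp)$ of a small category $\mathbf{C}$ and a set $\perp$ of pairs $(f_1,f_2)$ of $\mathbf{C}$-morphisms with common target (written $f_1\perp f_2$) that is symmetric and stable under post-composition ($f_1\perp f_2\Rightarrow gf_1\perp gf_2$) and pre-composition ($f_1\perp f_2\Rightarrow f_1h_1\perp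 f_2h_2$). The operad $\mathcal{O}_{\mathbf{C}}$: the colors are the objects $\mathbf{C}_0$ of $\mathbf{C}$; $\mathcal{O}_{\mathbf{C}}\binom{t}{\underline{c}}=\Sigma_n\times\prod_{i=1}^n\mathbf{C}(c_i,t)$ with elements $(\sigma,\underline{f})$; permutations act by $(\sigma,\underline{f})\mapsto(\sigma\sigma',\underline{f}\sigma')$ with $\underline{f}\sigma'=(f_{\sigma'(1)},\dots,f_{\sigma'(n)})$; composition is $\gamma\big((\sigma,\underline{f}),((\sigma_1,\underline{g}_1),\dots,(\sigma_m,\underline{g}_m))\big)=\big(\sigma(\sigma_1,\dots,\sigma_m),(f_1g_{11},\dots,f_1g_{1k_1},\dots,f_mg_{m1},\dots,f_mg_{mk_m})\big)$, where $\sigma(\sigma_1,\dots,\sigma_m)\in\Sigma_{k_1+\cdots+k_m}$ is the composition of the associative operad, i.e. the sum permutation $\sigma_1\oplus\cdots\oplus\sigma_m$ followed by the block permutation moving the $i$-th block (of length $k_i$) to the $\sigma(i)$-th block position; the units are $(e,\mathrm{id}_t)$. The operad $\mathcal{O}_{\overline{\mathbf{C}}}$: the coequalizer in $\mathbf{Op}_{\mathbf{C}_0}$ that universally identifies the operations $(e,(f_1,f_2))$ and $(\tau,(f_1,f_2))$ of $\mathcal{O}_{\mathbf{C}}$ for all $f_1\perp f_2$, where $e,\tau\in\Sigma_2$ are the identity and the transposition. Algebras: an $\mathcal{O}$-algebra $A$ in $\mathbf{M}$ consists of objects $A_t\in\mathbf{M}$ for all colors $t$ and morphisms $\alpha(o):A_{c_1}\otimes\cdots\otimes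 A_{c_n}\to A_t$ for all $o\in\mathcal{O}\binom{t}{\underline{c}}$, subject to the usual equivariance, associativity and unitality axioms; morphisms are families $A_t\to B_t$ compatible with the actions. $\mathbf{Alg}(\mathbf{M})$ is the category of associative and unital algebras (monoids) in $\mathbf{M}$. A functor $\mathfrak{A}:\mathbf{C}\to\mathbf{Alg}(\mathbf{M})$ is $\perp$-commutative if $\mu_c\circ(\mathfrak{A}(f_1)\otimes\mathfrak{A}(f_2))=\mu_c^{\mathrm{op}}\circ(\mathfrak{A}(f_1)\otimes\mathfrak{A}(f_2))$ for every orthogonal pair $(f_1:c_1\to c)\perp(f_2:c_2\to c)$, where $\mu_c$ is the multiplication of $\mathfrak{A}(c)$ and $\mu_c^{\mathrm{op}}$ its composite with the symmetric braiding. $\mathbf{Alg}(\mathbf{M})^{\overline{\mathbf{C}}}$ is the full subcategory of the functor category $\mathbf{Alg}(\mathbf{M})^{\mathbf{C}}$ on the $\perp$-commutative functors. The canonical identification sends $(A,\alpha)$ to the functor $c\mapsto A_c$ with multiplication $\alpha([e,(\mathrm{id}_c,\mathrm{id}_c)])$, unit given by the operation of arity $0$, and action on morphisms $f\mapsto\alpha([e,f])$. *)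

theory Defs
  imports "HOL-Library.FuncSet" "HOL-Combinatorics.Permutations"
begin

section \<open>Categories\<close>

record ('o, 'a) cat =
  Ob :: "'o set"
  Ar :: "'a set"
  Dom :: "'a \<Rightarrow> 'o"
  Cod :: "'a \<Rightarrow> 'o"
  Ident :: "'o \<Rightarrow> 'a"
  Comp :: "'a \<Rightarrow> 'a \<Rightarrow> 'a"  (infixl "\<cdot>\<index>" 70)

definition Hom :: "('o, 'a, 'z) cat_scheme \<Rightarrow> 'o \<Rightarrow> 'o \<Rightarrow> 'a set" where
  "Hom C x y = {f \<in> Ar C. Dom C f = x \<and> Cod C f = y}"

locale category =
  fixes C :: "('o, 'a, 'z) cat_scheme" (structure)
  assumes dom_ob: "f \<in> Ar C \<Longrightarrow> Dom C f \<in> Ob C"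
    and cod_ob: "f \<in> Ar C \<Longrightarrow> Cod C f \<in> Ob C"
    and id_hom: "x \<in> Ob C \<Longrightarrow> Ident C x \<in> Hom C x x"
    and comp_hom: "\<lbrakk>f \<in> Hom C x y; g \<in> Hom C y z\<rbrakk> \<Longrightarrow> g \<cdot> f \<in> Hom C x z"
    and comp_id: "f \<in> Hom C x y \<Longrightarrow> f \<cdot> Ident C x = f"
    and id_comp: "f \<in> Hom C x y \<Longrightarrow> Ident C y \<cdot> f = f"
    and comp_assoc: "\<lbrakk>f \<in> Hom C w x; g \<in> Hom C x y; h \<in> Hom C y z\<rbrakk>
      \<Longrightarrow> (h \<cdot> g) \<cdot> f = h \<cdot> (g \<cdot> f)"

definition iso_arrow :: "('o, 'a, 'z) cat_scheme \<Rightarrow> 'a \<Rightarrow> bool" where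
  "iso_arrow C f \<longleftrightarrow> f \<in> Ar C \<and>
     (\<exists>g \<in> Hom C (Cod C f) (Dom C f).
        g \<cdot>\<^bsub>C\<^esub> f = Ident C (Dom C f) \<and> f \<cdot>\<^bsub>C\<^esub> g = Ident C (Cod C f))"

definition inverse_arrow :: "('o, 'a, 'z) cat_scheme \<Rightarrow> 'a \<Rightarrow> 'a" where
  "inverse_arrow C f =
     (THE g. g \<in> Hom C (Cod C f) (Dom C f) \<and>
        g \<cdot>\<^bsub>C\<^esub> f = Ident C (Dom C f) \<and> f \<cdot>\<^bsub>C\<^esub> g = Ident C (Cod C f))"

type_synonym ('o, 'a, 'p, 'b) ftor = "('o \<Rightarrow> 'p) \<times> ('a \<Rightarrow> 'b)"

definition is_functor ::
  "('o, 'a, 'z) cat_scheme \<Rightarrow> ('p, 'b, 'y) cat_scheme \<Rightarrow> ('o, 'a, 'p, 'b) ftor \<Rightarrow> bool" where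
  "is_functor C D F \<longleftrightarrow> category C \<and> category D \<and>
     (\<forall>x \<in> Ob C. fst F x \<in> Ob D) \<and>
     (\<forall>f \<in> Ar C. snd F f \<in> Hom D (fst F (Dom C f)) (fst F (Cod C f))) \<and>
     (\<forall>x \<in> Ob C. snd F (Ident C x) = Ident D (fst F x)) \<and>
     (\<forall>f \<in> Ar C. \<forall>g \<in> Ar C. Dom C g = Cod C f \<longrightarrow>
        snd F (g \<cdot>\<^bsub>C\<^esub> f) = snd F g \<cdot>\<^bsub>D\<^esub> snd F f)"

definition is_category_isomorphism ::
  "('o, 'a, 'z) cat_scheme \<Rightarrow> ('p, 'b, 'y) cat_scheme \<Rightarrow> ('o, 'a, 'p, 'b) ftor \<Rightarrow> bool" where
  "is_category_isomorphism C D F \<longleftrightarrow> is_functor C D F \<and>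
     (\<exists>G. is_functor D C G \<and>
        (\<forall>x \<in> Ob C. fst G (fst F x) = x) \<and> (\<forall>f \<in> Ar C. snd G (snd F f) = f) \<and>
        (\<forall>y \<in> Ob D. fst F (fst G y) = y) \<and> (\<forall>g \<in> Ar D. snd F (snd G g) = g))"

definition is_natural ::
  "('o, 'a, 'z) cat_scheme \<Rightarrow> ('p, 'b, 'y) cat_scheme \<Rightarrow>
   ('o, 'a, 'p, 'b) ftor \<Rightarrow> ('o, 'a, 'p, 'b) ftor \<Rightarrow> ('o \<Rightarrow> 'b) \<Rightarrow> bool" where
  "is_natural C D F G \<eta> \<longleftrightarrow>
     (\<forall>x \<in> Ob C. \<eta> x \<in> Hom D (fst F x) (fst G x)) \<and>
     (\<forall>f \<in> Ar C. \<eta> (Cod C f) \<cdot>\<^bsub>D\<^esub> snd F f = snd G f \<cdot>\<^bsub>D\<^esub> \<eta> (Dom C f))"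

text \<open>
  Objects and components of the functor category are \<^const>\<open>extensional\<close>, so that HOL
  equality is equality of functors and of natural transformations. Arrows carry their
  source and target.
\<close>

definition functor_cat ::
  "('o, 'a, 'z) cat_scheme \<Rightarrow> ('p, 'b, 'y) cat_scheme \<Rightarrow>
   (('o, 'a, 'p, 'b) ftor, ('o, 'a, 'p, 'b) ftor \<times> ('o, 'a, 'p, 'b) ftor \<times> ('o \<Rightarrow> 'b)) cat" where
  "functor_cat C D =
     (let obs = {F. is_functor C D F \<and> fst F \<in> extensional (Ob C) \<and> snd F \<in> extensional (Ar C)}
      in \<lparr>Ob = obs,
          Ar = {(F, G, \<eta>). F \<in> obs \<and> G \<in> obs \<and> \<eta> \<in> extensional (Ob C) \<and> is_natural C D F G \<eta>},
          Dom = (\<lambda>(F, G, \<eta>). F),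
          Cod = (\<lambda>(F, G, \<eta>). G),
          Ident = (\<lambda>F. (F, F, \<lambda>x \<in> Ob C. Ident D (fst F x))),
          Comp = (\<lambda>(F', G', \<theta>) (F, G, \<eta>). (F, G', \<lambda>x \<in> Ob C. \<theta> x \<cdot>\<^bsub>D\<^esub> \<eta> x))\<rparr>)"

definition full_subcat :: "('o, 'a) cat \<Rightarrow> 'o set \<Rightarrow> ('o, 'a) cat" where
  "full_subcat C S = C\<lparr>Ob := Ob C \<inter> S, Ar := {f \<in> Ar C. Dom C f \<in> S \<and> Cod C f \<in> S}\<rparr>"


subsection \<open>Limits and colimits\<close>

definition is_cone ::
  "('o, 'a, 'z) cat_scheme \<Rightarrow> ('p, 'b, 'y) cat_scheme \<Rightarrow> ('o, 'a, 'p, 'b) ftor \<Rightarrow>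
   'p \<Rightarrow> ('o \<Rightarrow> 'b) \<Rightarrow> bool" where
  "is_cone J M D x l \<longleftrightarrow> x \<in> Ob M \<and> (\<forall>j \<in> Ob J. l j \<in> Hom M x (fst D j)) \<and>
     (\<forall>u \<in> Ar J. snd D u \<cdot>\<^bsub>M\<^esub> l (Dom J u) = l (Cod J u))"

definition has_limit ::
  "('o, 'a, 'z) cat_scheme \<Rightarrow> ('p, 'b, 'y) cat_scheme \<Rightarrow> ('o, 'a, 'p, 'b) ftor \<Rightarrow> bool" where
  "has_limit J M D \<longleftrightarrow> (\<exists>x l. is_cone J M D x l \<and>
     (\<forall>y m. is_cone J M D y m \<longrightarrow>
        (\<exists>!h. h \<in> Hom M y x \<and> (\<forall>j \<in> Ob J. l j \<cdot>\<^bsub>M\<^esub> h = m j))))"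

definition is_cocone ::
  "('o, 'a, 'z) cat_scheme \<Rightarrow> ('p, 'b, 'y) cat_scheme \<Rightarrow> ('o, 'a, 'p, 'b) ftor \<Rightarrow>
   'p \<Rightarrow> ('o \<Rightarrow> 'b) \<Rightarrow> bool" where
  "is_cocone J M D x l \<longleftrightarrow> x \<in> Ob M \<and> (\<forall>j \<in> Ob J. l j \<in> Hom M (fst D j) x) \<and>
     (\<forall>u \<in> Ar J. l (Cod J u) \<cdot>\<^bsub>M\<^esub> snd D u = l (Dom J u))"

definition has_colimit ::
  "('o, 'a, 'z) cat_scheme \<Rightarrow> ('p, 'b, 'y) cat_scheme \<Rightarrow> ('o, 'a, 'p, 'b) ftor \<Rightarrow> bool" where
  "has_colimit J M D \<longleftrightarrow> (\<exists>x l. is_cocone J M D x l \<and>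
     (\<forall>y m. is_cocone J M D y m \<longrightarrow>
        (\<exists>!h. h \<in> Hom M x y \<and> (\<forall>j \<in> Ob J. h \<cdot>\<^bsub>M\<^esub> l j = m j))))"

text \<open>
  Smallness is relative to a universe, given here by a type \<open>'i\<close>: a diagram shape is small
  if its objects and arrows are elements of \<open>'i\<close>.
\<close>

definition bicomplete :: "'i itself \<Rightarrow> ('o, 'a, 'z) cat_scheme \<Rightarrow> bool" where
  "bicomplete U M \<longleftrightarrow>
     (\<forall>(J :: ('i, 'i) cat) D. is_functor J M D \<longrightarrow> has_limit J M D \<and> has_colimit J M D)"


section \<open>Symmetric monoidal categories\<close>

record ('o, 'a) smc = "('o, 'a) cat" +
  Tens :: "'o \<Rightarrow> 'o \<Rightarrow> 'o"  (infixr "\<otimes>\<^sub>0\<index>" 75)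
  TensA :: "'a \<Rightarrow> 'a \<Rightarrow> 'a"  (infixr "\<otimes>\<^sub>1\<index>" 75)
  Unt :: "'o"
  assoc :: "'o \<Rightarrow> 'o \<Rightarrow> 'o \<Rightarrow> 'a"
  lunit :: "'o \<Rightarrow> 'a"
  runit :: "'o \<Rightarrow> 'a"
  braid :: "'o \<Rightarrow> 'o \<Rightarrow> 'a"

locale symmetric_monoidal_category = category M
  for M :: "('o, 'a, 'z) smc_scheme" (structure) +
  assumes unit_ob: "Unt M \<in> Ob M"
    and tens_ob: "\<lbrakk>x \<in> Ob M; y \<in> Ob M\<rbrakk> \<Longrightarrow> x \<otimes>\<^sub>0 y \<in> Ob M"
    and tens_hom: "\<lbrakk>f \<in> Hom M x x'; g \<in> Hom M y y'\<rbrakk>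
      \<Longrightarrow> f \<otimes>\<^sub>1 g \<in> Hom M (x \<otimes>\<^sub>0 y) (x' \<otimes>\<^sub>0 y')"
    and tens_id: "\<lbrakk>x \<in> Ob M; y \<in> Ob M\<rbrakk> \<Longrightarrow> Ident M x \<otimes>\<^sub>1 Ident M y = Ident M (x \<otimes>\<^sub>0 y)"
    and tens_comp: "\<lbrakk>f \<in> Hom M x x'; f' \<in> Hom M x' x''; g \<in> Hom M y y'; g' \<in> Hom M y' y''\<rbrakk>
      \<Longrightarrow> (f' \<cdot> f) \<otimes>\<^sub>1 (g' \<cdot> g) = (f' \<otimes>\<^sub>1 g') \<cdot> (f \<otimes>\<^sub>1 g)"
    and assoc_hom: "\<lbrakk>x \<in> Ob M; y \<in> Ob M; z \<in> Ob M\<rbrakk>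
      \<Longrightarrow> assoc M x y z \<in> Hom M ((x \<otimes>\<^sub>0 y) \<otimes>\<^sub>0 z) (x \<otimes>\<^sub>0 (y \<otimes>\<^sub>0 z))"
    and assoc_iso: "\<lbrakk>x \<in> Ob M; y \<in> Ob M; z \<in> Ob M\<rbrakk> \<Longrightarrow> iso_arrow M (assoc M x y z)"
    and assoc_nat: "\<lbrakk>f \<in> Hom M x x'; g \<in> Hom M y y'; h \<in> Hom M z z'\<rbrakk>
      \<Longrightarrow> assoc M x' y' z' \<cdot> ((f \<otimes>\<^sub>1 g) \<otimes>\<^sub>1 h) = (f \<otimes>\<^sub>1 (g \<otimes>\<^sub>1 h)) \<cdot> assoc M x y z"
    and lunit_hom: "x \<in> Ob M \<Longrightarrow> lunit M x \<in> Hom M (Unt M \<otimes>\<^sub>0 x) x"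
    and lunit_iso: "x \<in> Ob M \<Longrightarrow> iso_arrow M (lunit M x)"
    and lunit_nat: "f \<in> Hom M x y \<Longrightarrow> lunit M y \<cdot> (Ident M (Unt M) \<otimes>\<^sub>1 f) = f \<cdot> lunit M x"
    and runit_hom: "x \<in> Ob M \<Longrightarrow> runit M x \<in> Hom M (x \<otimes>\<^sub>0 Unt M) x"
    and runit_iso: "x \<in> Ob M \<Longrightarrow> iso_arrow M (runit M x)"
    and runit_nat: "f \<in> Hom M x y \<Longrightarrow> runit M y \<cdot> (f \<otimes>\<^sub>1 Ident M (Unt M)) = f \<cdot> runit M x"
    and braid_hom: "\<lbrakk>x \<in> Ob M; y \<in> Ob M\<rbrakk> \<Longrightarrow> braid M x y \<in> Hom M (x \<otimes>\<^sub>0 y) (y \<otimes>\<^sub>0 x)"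
    and braid_nat: "\<lbrakk>f \<in> Hom M x x'; g \<in> Hom M y y'\<rbrakk>
      \<Longrightarrow> braid M x' y' \<cdot> (f \<otimes>\<^sub>1 g) = (g \<otimes>\<^sub>1 f) \<cdot> braid M x y"
    and braid_sym: "\<lbrakk>x \<in> Ob M; y \<in> Ob M\<rbrakk>
      \<Longrightarrow> braid M y x \<cdot> braid M x y = Ident M (x \<otimes>\<^sub>0 y)"
    and pentagon: "\<lbrakk>w \<in> Ob M; x \<in> Ob M; y \<in> Ob M; z \<in> Ob M\<rbrakk>
      \<Longrightarrow> (Ident M w \<otimes>\<^sub>1 assoc M x y z) \<cdot> assoc M w (x \<otimes>\<^sub>0 y) z \<cdot> (assoc M w x y \<otimes>\<^sub>1 Ident M z)
          = assoc M w x (y \<otimes>\<^sub>0 z) \<cdot> assoc M (w \<otimes>\<^sub>0 x) y z"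
    and triangle: "\<lbrakk>x \<in> Ob M; y \<in> Ob M\<rbrakk>
      \<Longrightarrow> (Ident M x \<otimes>\<^sub>1 lunit M y) \<cdot> assoc M x (Unt M) y = runit M x \<otimes>\<^sub>1 Ident M y"
    and hexagon: "\<lbrakk>x \<in> Ob M; y \<in> Ob M; z \<in> Ob M\<rbrakk>
      \<Longrightarrow> assoc M y z x \<cdot> braid M x (y \<otimes>\<^sub>0 z) \<cdot> assoc M x y z
          = (Ident M y \<otimes>\<^sub>1 braid M x z) \<cdot> assoc M y x z \<cdot> (braid M x y \<otimes>\<^sub>1 Ident M z)"

text \<open>Closedness: every \<open>- \<otimes> x\<close> has a right adjoint, given by universal arrows.\<close>

locale closed_symmetric_monoidal_category = symmetric_monoidal_category M
  for M :: "('o, 'a, 'z) smc_scheme" (structure) +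
  assumes closed: "\<lbrakk>x \<in> Ob M; y \<in> Ob M\<rbrakk> \<Longrightarrow>
      \<exists>h \<in> Ob M. \<exists>ev \<in> Hom M (h \<otimes>\<^sub>0 x) y. \<forall>z \<in> Ob M. \<forall>f \<in> Hom M (z \<otimes>\<^sub>0 x) y.
        \<exists>!g. g \<in> Hom M z h \<and> ev \<cdot> (g \<otimes>\<^sub>1 Ident M x) = f"


subsection \<open>Finite tensor products\<close>

text \<open>
  The tensor product of a list is bracketed to the right; a one-element list has its entry
  as tensor product, and the empty list the monoidal unit.
\<close>

fun tens :: "('o, 'a, 'z) smc_scheme \<Rightarrow> 'o list \<Rightarrow> 'o" where
  "tens M [] = Unt M"
| "tens M [x] = x"
| "tens M (x # y # zs) = x \<otimes>\<^sub>0\<^bsub>M\<^esub> tens M (y # zs)"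

fun tensA :: "('o, 'a, 'z) smc_scheme \<Rightarrow> 'a list \<Rightarrow> 'a" where
  "tensA M [] = Ident M (Unt M)"
| "tensA M [f] = f"
| "tensA M (f # g # hs) = f \<otimes>\<^sub>1\<^bsub>M\<^esub> tensA M (g # hs)"

text \<open>
  \<open>append_iso M xs ys : tens xs \<otimes> tens ys \<rightarrow> tens (xs @ ys)\<close> and
  \<open>concat_iso M [xs\<^sub>1, \<dots>, xs\<^sub>m] : tens [tens xs\<^sub>1, \<dots>, tens xs\<^sub>m] \<rightarrow> tens (xs\<^sub>1 @ \<dots> @ xs\<^sub>m)\<close>
  are the coherence isomorphisms that remove inner brackets.
\<close>

fun append_iso :: "('o, 'a, 'z) smc_scheme \<Rightarrow> 'o list \<Rightarrow> 'o list \<Rightarrow> 'a" where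
  "append_iso M [] ys = lunit M (tens M ys)"
| "append_iso M [x] ys = (if ys = [] then runit M x else Ident M (x \<otimes>\<^sub>0\<^bsub>M\<^esub> tens M ys))"
| "append_iso M (x # x' # xs) ys =
     (Ident M x \<otimes>\<^sub>1\<^bsub>M\<^esub> append_iso M (x' # xs) ys)
       \<cdot>\<^bsub>M\<^esub> assoc M x (tens M (x' # xs)) (tens M ys)"

fun concat_iso :: "('o, 'a, 'z) smc_scheme \<Rightarrow> 'o list list \<Rightarrow> 'a" where
  "concat_iso M [] = Ident M (Unt M)"
| "concat_iso M [xs] = Ident M (tens M xs)"
| "concat_iso M (xs # ys # yss) =
     append_iso M xs (concat (ys # yss))
       \<cdot>\<^bsub>M\<^esub> (Ident M (tens M xs) \<otimes>\<^sub>1\<^bsub>M\<^esub> concat_iso M (ys # yss))"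

text \<open>
  The symmetry isomorphism of a permutation is obtained by insertion sort of the positions,
  using the braiding on adjacent factors; by coherence every other way of composing
  braidings to the same permutation gives the same arrow.
  With \<open>X k\<close> the object labelled by the position \<open>k\<close>,
  \<^item> \<open>swap_iso M x y zs : tens (x # y # zs) \<rightarrow> tens (y # x # zs)\<close>,
  \<^item> \<open>insort_iso M X k ks : tens (map X (k # ks)) \<rightarrow> tens (map X (insort k ks))\<close>,
  \<^item> \<open>sort_iso M X ks : tens (map X ks) \<rightarrow> tens (map X (sort ks))\<close>,
  \<^item> \<open>perm_iso M xs \<sigma> : tens (permute_list \<sigma> xs) \<rightarrow> tens xs\<close>, that is
    \<open>x\<^bsub>\<sigma>(1)\<^esub> \<otimes> \<dots> \<otimes> x\<^bsub>\<sigma>(n)\<^esub> \<rightarrow> x\<^bsub>1\<^esub> \<otimes> \<dots> \<otimes> x\<^bsub>n\<^esub>\<close>.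
\<close>

definition swap_iso :: "('o, 'a, 'z) smc_scheme \<Rightarrow> 'o \<Rightarrow> 'o \<Rightarrow> 'o list \<Rightarrow> 'a" where
  "swap_iso M x y zs =
     (if zs = [] then braid M x y
      else assoc M y x (tens M zs) \<cdot>\<^bsub>M\<^esub> (braid M x y \<otimes>\<^sub>1\<^bsub>M\<^esub> Ident M (tens M zs))
             \<cdot>\<^bsub>M\<^esub> inverse_arrow M (assoc M x y (tens M zs)))"

text \<open>\<open>id \<otimes> f : tens (x # xs) \<rightarrow> tens (x # ys)\<close> for an arrow \<open>f : tens xs \<rightarrow> tens ys\<close>, where
  \<open>xs\<close> and \<open>ys\<close> have the same length.\<close>

definition whisker :: "('o, 'a, 'z) smc_scheme \<Rightarrow> 'o \<Rightarrow> 'o list \<Rightarrow> 'a \<Rightarrow> 'a" where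
  "whisker M x xs f = (if xs = [] then Ident M x else Ident M x \<otimes>\<^sub>1\<^bsub>M\<^esub> f)"

fun insort_iso :: "('o, 'a, 'z) smc_scheme \<Rightarrow> (nat \<Rightarrow> 'o) \<Rightarrow> nat \<Rightarrow> nat list \<Rightarrow> 'a" where
  "insort_iso M X k [] = Ident M (X k)"
| "insort_iso M X k (j # js) =
     (if k \<le> j then Ident M (tens M (map X (k # j # js)))
      else whisker M (X j) (map X (k # js)) (insort_iso M X k js)
             \<cdot>\<^bsub>M\<^esub> swap_iso M (X k) (X j) (map X js))"

fun sort_iso :: "('o, 'a, 'z) smc_scheme \<Rightarrow> (nat \<Rightarrow> 'o) \<Rightarrow> nat list \<Rightarrow> 'a" where
  "sort_iso M X [] = Ident M (Unt M)"
| "sort_iso M X (k # ks) =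
     insort_iso M X k (sort ks) \<cdot>\<^bsub>M\<^esub> whisker M (X k) (map X ks) (sort_iso M X ks)"

definition perm_iso :: "('o, 'a, 'z) smc_scheme \<Rightarrow> 'o list \<Rightarrow> (nat \<Rightarrow> nat) \<Rightarrow> 'a" where
  "perm_iso M xs \<sigma> = sort_iso M (\<lambda>i. xs ! i) (map \<sigma> [0..<length xs])"


section \<open>Monoids in a monoidal category\<close>

definition is_monoid :: "('o, 'a, 'z) smc_scheme \<Rightarrow> 'o \<times> 'a \<times> 'a \<Rightarrow> bool" where
  "is_monoid M = (\<lambda>(a, mu, eta).
     a \<in> Ob M \<and> mu \<in> Hom M (a \<otimes>\<^sub>0\<^bsub>M\<^esub> a) a \<and> eta \<in> Hom M (Unt M) a \<and>
     mu \<cdot>\<^bsub>M\<^esub> (mu \<otimes>\<^sub>1\<^bsub>M\<^esub> Ident M a) = mu \<cdot>\<^bsub>M\<^esub> (Ident M a \<otimes>\<^sub>1\<^bsub>M\<^esub> mu) \<cdot>\<^bsub>M\<^esub> assoc M a a a \<and>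
     mu \<cdot>\<^bsub>M\<^esub> (eta \<otimes>\<^sub>1\<^bsub>M\<^esub> Ident M a) = lunit M a \<and>
     mu \<cdot>\<^bsub>M\<^esub> (Ident M a \<otimes>\<^sub>1\<^bsub>M\<^esub> eta) = runit M a)"

definition is_monoid_hom ::
  "('o, 'a, 'z) smc_scheme \<Rightarrow> 'o \<times> 'a \<times> 'a \<Rightarrow> 'o \<times> 'a \<times> 'a \<Rightarrow> 'a \<Rightarrow> bool" where
  "is_monoid_hom M = (\<lambda>(a, mu, eta) (a', mu', eta') f.
     f \<in> Hom M a a' \<and> f \<cdot>\<^bsub>M\<^esub> mu = mu' \<cdot>\<^bsub>M\<^esub> (f \<otimes>\<^sub>1\<^bsub>M\<^esub> f) \<and> f \<cdot>\<^bsub>M\<^esub> eta = eta')"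

type_synonym ('o, 'a) monoid_ob = "'o \<times> 'a \<times> 'a"
type_synonym ('o, 'a) monoid_ar = "('o, 'a) monoid_ob \<times> ('o, 'a) monoid_ob \<times> 'a"

text \<open>The category \<open>Alg(M)\<close>; an arrow is a triple of source, target and underlying arrow.\<close>

definition monoid_cat ::
  "('o, 'a, 'z) smc_scheme \<Rightarrow> (('o, 'a) monoid_ob, ('o, 'a) monoid_ar) cat" where
  "monoid_cat M =
     \<lparr>Ob = {X. is_monoid M X},
      Ar = {(X, Y, f). is_monoid M X \<and> is_monoid M Y \<and> is_monoid_hom M X Y f},
      Dom = (\<lambda>(X, Y, f). X),
      Cod = (\<lambda>(X, Y, f). Y),
      Ident = (\<lambda>X. (X, X, Ident M (fst X))),
      Comp = (\<lambda>(Y, Z, g) (X, Y', f). (X, Z, g \<cdot>\<^bsub>M\<^esub> f))\<rparr>"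


section \<open>Colored operads\<close>

text \<open>
  \<open>Ops P t c\<close> is the set of operations from the tuple \<open>c\<close> to \<open>t\<close>, and
  \<open>Act P t c \<sigma> : Ops P t c \<rightarrow> Ops P t (permute_list \<sigma> c)\<close>.
  \<open>Gamma P t c bs x xs\<close> is the composition of \<open>x \<in> Ops P t c\<close> with the list \<open>xs\<close> of operations
  \<open>xs ! i \<in> Ops P (c ! i) (bs ! i)\<close>. The sets \<open>Ops P t c\<close> need not be disjoint, whence the
  color arguments of the structure maps.
\<close>

record ('c, 'x) operad =
  Colors :: "'c set"
  Ops :: "'c \<Rightarrow> 'c list \<Rightarrow> 'x set"
  Act :: "'c \<Rightarrow> 'c list \<Rightarrow> (nat \<Rightarrow> nat) \<Rightarrow> 'x \<Rightarrow> 'x"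
  Gamma :: "'c \<Rightarrow> 'c list \<Rightarrow> 'c list list \<Rightarrow> 'x \<Rightarrow> 'x list \<Rightarrow> 'x"
  OUnit :: "'c \<Rightarrow> 'x"

definition operations :: "('c, 'x) operad \<Rightarrow> ('c \<times> 'c list \<times> 'x) set" where
  "operations P = {(t, c, x). t \<in> Colors P \<and> set c \<subseteq> Colors P \<and> x \<in> Ops P t c}"

definition composable ::
  "('c, 'x) operad \<Rightarrow> 'c list \<Rightarrow> 'c list list \<Rightarrow> 'x list \<Rightarrow> bool" where
  "composable P c bs xs \<longleftrightarrow> length bs = length c \<and> length xs = length c \<and>
     (\<forall>i < length c. (c ! i, bs ! i, xs ! i) \<in> operations P)"

text \<open>
  Permutations of \<open>k\<^bsub>1\<^esub> + \<dots> + k\<^bsub>m\<^esub>\<close> letters, where \<open>ks = [k\<^bsub>1\<^esub>, \<dots>, k\<^bsub>m\<^esub>]\<close>. The value \<open>(i, r)\<close> of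
  \<open>block_of ks j\<close> says that \<open>j\<close> is the letter \<open>r\<close> of block \<open>i\<close> (counting from 0).
  The sum permutation acts by the \<open>i\<close>-th of the given permutations inside block \<open>i\<close>;
  the block permutation moves block \<open>i\<close> to the \<open>\<sigma> i\<close>-th block position, so that it comes
  after exactly the blocks \<open>i'\<close> with \<open>\<sigma> i' < \<sigma> i\<close>.
\<close>

fun block_of :: "nat list \<Rightarrow> nat \<Rightarrow> nat \<times> nat" where
  "block_of [] j = (0, j)"
| "block_of (k # ks) j =
     (if j < k then (0, j) else (let (i, r) = block_of ks (j - k) in (Suc i, r)))"

definition sum_perm :: "nat list \<Rightarrow> (nat \<Rightarrow> nat) list \<Rightarrow> nat \<Rightarrow> nat" where
  "sum_perm ks \<sigma>s j =
     (if j < sum_list ks then (let (i, r) = block_of ks j in sum_list (take i ks) + (\<sigma>s ! i) r)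
      else j)"

definition block_perm :: "nat list \<Rightarrow> (nat \<Rightarrow> nat) \<Rightarrow> nat \<Rightarrow> nat" where
  "block_perm ks \<sigma> j =
     (if j < sum_list ks
      then (let (i, r) = block_of ks j in (\<Sum>i' | i' < length ks \<and> \<sigma> i' < \<sigma> i. ks ! i') + r)
      else j)"

locale colored_operad =
  fixes P :: "('c, 'x) operad"
  assumes act_closed: "\<lbrakk>(t, c, x) \<in> operations P; \<sigma> permutes {..<length c}\<rbrakk>
      \<Longrightarrow> Act P t c \<sigma> x \<in> Ops P t (permute_list \<sigma> c)"
    and act_id: "(t, c, x) \<in> operations P \<Longrightarrow> Act P t c id x = x"
    and act_comp: "\<lbrakk>(t, c, x) \<in> operations P; \<sigma> permutes {..<length c}; \<tau> permutes {..<length c}\<rbrakk>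
      \<Longrightarrow> Act P t (permute_list \<sigma> c) \<tau> (Act P t c \<sigma> x) = Act P t c (\<sigma> \<circ> \<tau>) x"
    and unit_closed: "t \<in> Colors P \<Longrightarrow> OUnit P t \<in> Ops P t [t]"
    and gamma_closed: "\<lbrakk>(t, c, x) \<in> operations P; composable P c bs xs\<rbrakk>
      \<Longrightarrow> Gamma P t c bs x xs \<in> Ops P t (concat bs)"
    and gamma_unit_left: "(t, c, x) \<in> operations P \<Longrightarrow> Gamma P t [t] [c] (OUnit P t) [x] = x"
    and gamma_unit_right: "(t, c, x) \<in> operations P
      \<Longrightarrow> Gamma P t c (map (\<lambda>a. [a]) c) x (map (OUnit P) c) = x"
    and gamma_assoc: "\<lbrakk>(t, c, x) \<in> operations P; composable P c bs xs;
        length ass = length c; length yss = length c;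
        \<And>i. i < length c \<Longrightarrow> composable P (bs ! i) (ass ! i) (yss ! i)\<rbrakk>
      \<Longrightarrow> Gamma P t (concat bs) (concat ass) (Gamma P t c bs x xs) (concat yss) =
          Gamma P t c (map concat ass) x
            (map (\<lambda>i. Gamma P (c ! i) (bs ! i) (ass ! i) (xs ! i) (yss ! i)) [0..<length c])"
    and gamma_act_outer: "\<lbrakk>(t, c, x) \<in> operations P; composable P c bs xs;
        \<sigma> permutes {..<length c}\<rbrakk>
      \<Longrightarrow> Gamma P t (permute_list \<sigma> c) (permute_list \<sigma> bs) (Act P t c \<sigma> x) (permute_list \<sigma> xs) =
          Act P t (concat bs) (block_perm (map length (permute_list \<sigma> bs)) \<sigma>)
            (Gamma P t c bs x xs)"
    and gamma_act_inner: "\<lbrakk>(t, c, x) \<in> operations P; composable P c bs xs;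
        length \<sigma>s = length c; \<And>i. i < length c \<Longrightarrow> (\<sigma>s ! i) permutes {..<length (bs ! i)}\<rbrakk>
      \<Longrightarrow> Gamma P t c (map (\<lambda>i. permute_list (\<sigma>s ! i) (bs ! i)) [0..<length c]) x
            (map (\<lambda>i. Act P (c ! i) (bs ! i) (\<sigma>s ! i) (xs ! i)) [0..<length c]) =
          Act P t (concat bs) (sum_perm (map length bs) \<sigma>s) (Gamma P t c bs x xs)"

definition operad_morphism ::
  "('c, 'x) operad \<Rightarrow> ('c, 'y) operad \<Rightarrow> ('c \<Rightarrow> 'c list \<Rightarrow> 'x \<Rightarrow> 'y) \<Rightarrow> bool" where
  "operad_morphism P Q \<phi> \<longleftrightarrow> colored_operad P \<and> colored_operad Q \<and> Colors P = Colors Q \<and>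
     (\<forall>(t, c, x) \<in> operations P. \<phi> t c x \<in> Ops Q t c) \<and>
     (\<forall>(t, c, x) \<in> operations P. \<forall>\<sigma>. \<sigma> permutes {..<length c} \<longrightarrow>
        \<phi> t (permute_list \<sigma> c) (Act P t c \<sigma> x) = Act Q t c \<sigma> (\<phi> t c x)) \<and>
     (\<forall>(t, c, x) \<in> operations P. \<forall>bs xs. composable P c bs xs \<longrightarrow>
        \<phi> t (concat bs) (Gamma P t c bs x xs) =
        Gamma Q t c bs (\<phi> t c x) (map (\<lambda>i. \<phi> (c ! i) (bs ! i) (xs ! i)) [0..<length c])) \<and>
     (\<forall>t \<in> Colors P. \<phi> t [t] (OUnit P t) = OUnit Q t)"

text \<open>
  \<open>q : P \<rightarrow> Q\<close> is the universal morphism under \<open>P\<close>, among operads with the same colors and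
  morphisms that are the identity on colors, that identifies \<open>x\<close> and \<open>y\<close> in \<open>Ops P t c\<close> for
  all \<open>(t, c, x, y) \<in> R\<close>; equivalently, the coequalizer of the two morphisms into \<open>P\<close> from the
  free operad on \<open>R\<close>. The competing operads \<open>Q'\<close> range over all operads whose operations
  are elements of the type \<open>'y\<close> of the operations of \<open>Q\<close>. For \<open>'y = 'x set\<close> such a \<open>Q\<close>
  exists, and it is universal also among operads with operations of any other type
  (\<open>quot_operad_coequalizer\<close> and \<open>quot_operad_universal\<close> below).
\<close>

definition identifies ::
  "('c \<times> 'c list \<times> 'x \<times> 'x) set \<Rightarrow> ('c \<Rightarrow> 'c list \<Rightarrow> 'x \<Rightarrow> 'y) \<Rightarrow> bool" where
  "identifies R \<phi> \<longleftrightarrow> (\<forall>(t, c, x, y) \<in> R. \<phi> t c x = \<phi> t c y)"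

definition is_operad_coequalizer ::
  "('c, 'x) operad \<Rightarrow> ('c \<times> 'c list \<times> 'x \<times> 'x) set \<Rightarrow>
   ('c, 'y) operad \<Rightarrow> ('c \<Rightarrow> 'c list \<Rightarrow> 'x \<Rightarrow> 'y) \<Rightarrow> bool" where
  "is_operad_coequalizer P R Q q \<longleftrightarrow> operad_morphism P Q q \<and> identifies R q \<and>
     (\<forall>(Q' :: ('c, 'y) operad) \<phi>. operad_morphism P Q' \<phi> \<and> identifies R \<phi> \<longrightarrow>
        (\<exists>\<psi>. operad_morphism Q Q' \<psi> \<and> (\<forall>(t, c, x) \<in> operations P. \<psi> t c (q t c x) = \<phi> t c x)) \<and>
        (\<forall>\<psi> \<psi>'. operad_morphism Q Q' \<psi> \<and> operad_morphism Q Q' \<psi>' \<and>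
           (\<forall>(t, c, x) \<in> operations P. \<psi> t c (q t c x) = \<phi> t c x) \<and>
           (\<forall>(t, c, x) \<in> operations P. \<psi>' t c (q t c x) = \<phi> t c x) \<longrightarrow>
           (\<forall>(t, c, y) \<in> operations Q. \<psi> t c y = \<psi>' t c y)))"


section \<open>Algebras over a colored operad\<close>

type_synonym ('c, 'x, 'o, 'a) alg_ob = "('c \<Rightarrow> 'o) \<times> ('c \<times> 'c list \<times> 'x \<Rightarrow> 'a)"
type_synonym ('c, 'x, 'o, 'a) alg_ar =
  "('c, 'x, 'o, 'a) alg_ob \<times> ('c, 'x, 'o, 'a) alg_ob \<times> ('c \<Rightarrow> 'a)"

definition is_operad_algebra ::
  "('c, 'x) operad \<Rightarrow> ('o, 'a, 'z) smc_scheme \<Rightarrow> ('c, 'x, 'o, 'a) alg_ob \<Rightarrow> bool" where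
  "is_operad_algebra P M = (\<lambda>(A, \<alpha>).
     (\<forall>t \<in> Colors P. A t \<in> Ob M) \<and>
     (\<forall>(t, c, x) \<in> operations P. \<alpha> (t, c, x) \<in> Hom M (tens M (map A c)) (A t)) \<and>
     (\<forall>(t, c, x) \<in> operations P. \<forall>\<sigma>. \<sigma> permutes {..<length c} \<longrightarrow>
        \<alpha> (t, permute_list \<sigma> c, Act P t c \<sigma> x) = \<alpha> (t, c, x) \<cdot>\<^bsub>M\<^esub> perm_iso M (map A c) \<sigma>) \<and>
     (\<forall>(t, c, x) \<in> operations P. \<forall>bs xs. composable P c bs xs \<longrightarrow>
        \<alpha> (t, concat bs, Gamma P t c bs x xs) \<cdot>\<^bsub>M\<^esub> concat_iso M (map (map A) bs) =
        \<alpha> (t, c, x) \<cdot>\<^bsub>M\<^esub> tensA M (map (\<lambda>i. \<alpha> (c ! i, bs ! i, xs ! i)) [0..<length c])) \<and>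
     (\<forall>t \<in> Colors P. \<alpha> (t, [t], OUnit P t) = Ident M (A t)))"

definition is_algebra_hom ::
  "('c, 'x) operad \<Rightarrow> ('o, 'a, 'z) smc_scheme \<Rightarrow>
   ('c, 'x, 'o, 'a) alg_ob \<Rightarrow> ('c, 'x, 'o, 'a) alg_ob \<Rightarrow> ('c \<Rightarrow> 'a) \<Rightarrow> bool" where
  "is_algebra_hom P M = (\<lambda>(A, \<alpha>) (B, \<beta>) \<phi>.
     (\<forall>t \<in> Colors P. \<phi> t \<in> Hom M (A t) (B t)) \<and>
     (\<forall>(t, c, x) \<in> operations P.
        \<phi> t \<cdot>\<^bsub>M\<^esub> \<alpha> (t, c, x) = \<beta> (t, c, x) \<cdot>\<^bsub>M\<^esub> tensA M (map \<phi> c)))"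

definition operad_alg_cat ::
  "('c, 'x) operad \<Rightarrow> ('o, 'a, 'z) smc_scheme \<Rightarrow>
   (('c, 'x, 'o, 'a) alg_ob, ('c, 'x, 'o, 'a) alg_ar) cat" where
  "operad_alg_cat P M =
     (let obs = {(A, \<alpha>). is_operad_algebra P M (A, \<alpha>) \<and>
                   A \<in> extensional (Colors P) \<and> \<alpha> \<in> extensional (operations P)}
      in \<lparr>Ob = obs,
          Ar = {(X, Y, \<phi>). X \<in> obs \<and> Y \<in> obs \<and> \<phi> \<in> extensional (Colors P) \<and>
                  is_algebra_hom P M X Y \<phi>},
          Dom = (\<lambda>(X, Y, \<phi>). X),
          Cod = (\<lambda>(X, Y, \<phi>). Y),
          Ident = (\<lambda>X. (X, X, \<lambda>t \<in> Colors P. Ident M (fst X t))),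
          Comp = (\<lambda>(Y, Z, \<psi>) (X, Y', \<phi>). (X, Z, \<lambda>t \<in> Colors P. \<psi> t \<cdot>\<^bsub>M\<^esub> \<phi> t))\<rparr>)"


section \<open>Orthogonal categories\<close>

record ('o, 'a) orth_cat = "('o, 'a) cat" +
  Perp :: "('a \<times> 'a) set"

locale orthogonal_category = category C
  for C :: "('o, 'a, 'z) orth_cat_scheme" (structure) +
  assumes perp_ar: "(f1, f2) \<in> Perp C \<Longrightarrow> f1 \<in> Ar C \<and> f2 \<in> Ar C \<and> Cod C f1 = Cod C f2"
    and perp_sym: "(f1, f2) \<in> Perp C \<Longrightarrow> (f2, f1) \<in> Perp C"
    and perp_post: "\<lbrakk>(f1, f2) \<in> Perp C; g \<in> Ar C; Dom C g = Cod C f1\<rbrakk>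
      \<Longrightarrow> (g \<cdot> f1, g \<cdot> f2) \<in> Perp C"
    and perp_pre: "\<lbrakk>(f1, f2) \<in> Perp C; h1 \<in> Ar C; Cod C h1 = Dom C f1; h2 \<in> Ar C; Cod C h2 = Dom C f2\<rbrakk>
      \<Longrightarrow> (f1 \<cdot> h1, f2 \<cdot> h2) \<in> Perp C"

definition perp_commutative_functors ::
  "('c, 'd, 'y) orth_cat_scheme \<Rightarrow> ('o, 'a, 'z) smc_scheme \<Rightarrow>
   ('c, 'd, ('o, 'a) monoid_ob, ('o, 'a) monoid_ar) ftor set" where
  "perp_commutative_functors C M =
     {F. \<forall>(f1, f2) \<in> Perp C.
        (case (fst F (Cod C f1), snd F f1, snd F f2) of
           ((a, mu, eta), (_, _, g1), (_, _, g2)) \<Rightarrow>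
             mu \<cdot>\<^bsub>M\<^esub> (g1 \<otimes>\<^sub>1\<^bsub>M\<^esub> g2) = (mu \<cdot>\<^bsub>M\<^esub> braid M a a) \<cdot>\<^bsub>M\<^esub> (g1 \<otimes>\<^sub>1\<^bsub>M\<^esub> g2))}"

definition perp_commutative_cat ::
  "('c, 'd, 'y) orth_cat_scheme \<Rightarrow> ('o, 'a, 'z) smc_scheme \<Rightarrow>
   (('c, 'd, ('o, 'a) monoid_ob, ('o, 'a) monoid_ar) ftor,
    ('c, 'd, ('o, 'a) monoid_ob, ('o, 'a) monoid_ar) ftor \<times>
    ('c, 'd, ('o, 'a) monoid_ob, ('o, 'a) monoid_ar) ftor \<times> ('c \<Rightarrow> ('o, 'a) monoid_ar)) cat" where
  "perp_commutative_cat C M =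
     full_subcat (functor_cat C (monoid_cat M)) (perp_commutative_functors C M)"

text \<open>Operations \<open>(\<sigma>, [f\<^bsub>1\<^esub>, \<dots>, f\<^bsub>n\<^esub>])\<close>; positions are counted from 0.\<close>

type_synonym 'd perm_op = "(nat \<Rightarrow> nat) \<times> 'd list"

definition cat_operad :: "('c, 'd, 'y) cat_scheme \<Rightarrow> ('c, 'd perm_op) operad" where
  "cat_operad C =
     \<lparr>Colors = Ob C,
      Ops = (\<lambda>t c. {(\<sigma>, fs). \<sigma> permutes {..<length c} \<and> length fs = length c \<and>
                      (\<forall>i < length c. fs ! i \<in> Hom C (c ! i) t)}),
      Act = (\<lambda>t c \<sigma>' (\<sigma>, fs). (\<sigma> \<circ> \<sigma>', permute_list \<sigma>' fs)),
      Gamma = (\<lambda>t c bs (\<sigma>, fs) xs.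
        (block_perm (map length bs) \<sigma> \<circ> sum_perm (map length bs) (map fst xs),
         concat (map (\<lambda>i. map (\<lambda>g. fs ! i \<cdot>\<^bsub>C\<^esub> g) (snd (xs ! i))) [0..<length c]))),
      OUnit = (\<lambda>t. (id, [Ident C t]))\<rparr>"

definition perp_relations ::
  "('c, 'd, 'y) orth_cat_scheme \<Rightarrow> ('c \<times> 'c list \<times> 'd perm_op \<times> 'd perm_op) set" where
  "perp_relations C =
     {(Cod C f1, [Dom C f1, Dom C f2], (id, [f1, f2]), (transpose 0 1, [f1, f2])) | f1 f2.
        (f1, f2) \<in> Perp C}"

text \<open>
  The canonical functor, for an operad \<open>P\<close> under \<open>cat_operad C\<close> via \<open>q\<close>: writing
  \<open>[\<sigma>, fs]\<close> for the image of \<open>(\<sigma>, fs)\<close> under \<open>q\<close>, the algebra \<open>(A, \<alpha>)\<close> is sent to the functor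
  with \<open>c \<mapsto> (A c, \<alpha> [id, (id\<^bsub>c\<^esub>, id\<^bsub>c\<^esub>)], \<alpha> [id, ()])\<close> and \<open>f \<mapsto> \<alpha> [id, f]\<close>.
\<close>

definition canonical_monoid ::
  "('c, 'd, 'y) cat_scheme \<Rightarrow> ('c \<Rightarrow> 'c list \<Rightarrow> 'd perm_op \<Rightarrow> 'x) \<Rightarrow>
   ('c, 'x, 'o, 'a) alg_ob \<Rightarrow> 'c \<Rightarrow> ('o, 'a) monoid_ob" where
  "canonical_monoid C q = (\<lambda>(A, \<alpha>) c.
     (A c,
      \<alpha> (c, [c, c], q c [c, c] (id, [Ident C c, Ident C c])),
      \<alpha> (c, [], q c [] (id, []))))"

definition canonical_ob ::
  "('c, 'd, 'y) cat_scheme \<Rightarrow> ('c \<Rightarrow> 'c list \<Rightarrow> 'd perm_op \<Rightarrow> 'x) \<Rightarrow>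
   ('c, 'x, 'o, 'a) alg_ob \<Rightarrow> ('c, 'd, ('o, 'a) monoid_ob, ('o, 'a) monoid_ar) ftor" where
  "canonical_ob C q = (\<lambda>(A, \<alpha>).
     (\<lambda>c \<in> Ob C. canonical_monoid C q (A, \<alpha>) c,
      \<lambda>f \<in> Ar C. (canonical_monoid C q (A, \<alpha>) (Dom C f), canonical_monoid C q (A, \<alpha>) (Cod C f),
         \<alpha> (Cod C f, [Dom C f], q (Cod C f) [Dom C f] (id, [f])))))"

definition canonical_functor ::
  "('c, 'd, 'y) cat_scheme \<Rightarrow> ('c \<Rightarrow> 'c list \<Rightarrow> 'd perm_op \<Rightarrow> 'x) \<Rightarrow>
   (('c, 'x, 'o, 'a) alg_ob, ('c, 'x, 'o, 'a) alg_ar,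
    ('c, 'd, ('o, 'a) monoid_ob, ('o, 'a) monoid_ar) ftor,
    ('c, 'd, ('o, 'a) monoid_ob, ('o, 'a) monoid_ar) ftor \<times>
    ('c, 'd, ('o, 'a) monoid_ob, ('o, 'a) monoid_ar) ftor \<times> ('c \<Rightarrow> ('o, 'a) monoid_ar)) ftor" where
  "canonical_functor C q =
     (canonical_ob C q,
      \<lambda>(X, Y, \<phi>). (canonical_ob C q X, canonical_ob C q Y,
         \<lambda>c \<in> Ob C. (canonical_monoid C q X c, canonical_monoid C q Y c, \<phi> c)))"


section \<open>Well-definedness\<close>

subsection \<open>Sum and block permutations\<close>

lemma block_of_index:
  "\<lbrakk>i < length ks; r < ks ! i\<rbrakk> \<Longrightarrow> block_of ks (sum_list (take i ks) + r) = (i, r)"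
proof (induction ks arbitrary: i)
  case Nil
  then show ?case by simp
next
  case (Cons k ks)
  show ?case
  proof (cases i)
    case 0
    then show ?thesis using Cons.prems by simp
  next
    case (Suc i')
    then show ?thesis using Cons.IH[of i'] Cons.prems by simp
  qed
qed

lemma index_less:
  "\<lbrakk>i < length ks; r < ks ! i\<rbrakk> \<Longrightarrow> sum_list (take i ks) + r < sum_list (ks :: nat list)"
proof (induction ks arbitrary: i)
  case Nil
  then show ?case by simp
next
  case (Cons k ks)
  then show ?case by (cases i) (auto simp: add.assoc)
qed

lemma index_cases:
  fixes ks :: "nat list"
  assumes "j < sum_list ks"
  obtains i r where "i < length ks" "r < ks ! i" "j = sum_list (take i ks) + r"
  using assms
proof (induction ks arbitrary: j thesis)
  case Nil
  then show ?case by simp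
next
  case (Cons k ks)
  show ?case
  proof (cases "j < k")
    case True
    then show ?thesis using Cons.prems(1)[of 0 j] by simp
  next
    case False
    then have "j - k < sum_list ks" using Cons.prems(2) by auto
    then obtain i r where "i < length ks" "r < ks ! i" "j - k = sum_list (take i ks) + r"
      using Cons.IH by blast
    then show ?thesis using Cons.prems(1)[of "Suc i" r] False by auto
  qed
qed

lemma index_ex:
  fixes ks :: "nat list"
  assumes "j < sum_list ks"
  shows "\<exists>i r. i < length ks \<and> r < ks ! i \<and> j = sum_list (take i ks) + r"
  by (rule index_cases[OF assms]) blast

lemma sum_index:
  fixes ks :: "nat list" and F :: "nat \<Rightarrow> nat"
  shows "(\<Sum>j<sum_list ks. F j) = (\<Sum>i<length ks. \<Sum>r<ks ! i. F (sum_list (take i ks) + r))"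
proof (induction ks arbitrary: F)
  case Nil
  then show ?case by simp
next
  case (Cons k ks)
  have split: "(\<Sum>j<k + n. F j) = (\<Sum>j<k. F j) + (\<Sum>j<n. F (k + j))" for k n :: nat
    by (induction n) auto
  have "(\<Sum>j<k + sum_list ks. F j) = (\<Sum>j<k. F j) + (\<Sum>j<sum_list ks. F (k + j))"
    using split[of k "sum_list ks"] .
  then show ?case
    by (simp add: sum.lessThan_Suc_shift Cons.IH[of "\<lambda>j. F (k + j)"] add.assoc del: sum.lessThan_Suc)
qed

lemma nth_concat_index:
  assumes "i < length xss" "r < length (xss ! i)"
  shows "concat xss ! (sum_list (take i (map length xss)) + r) = xss ! i ! r"
  using assms
proof (induction xss arbitrary: i)
  case Nil
  then show ?case by simp
next
  case (Cons xs xss)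
  then show ?case by (cases i) (auto simp: nth_append add.assoc)
qed

lemma sum_perm_index:
  "\<lbrakk>i < length ks; r < ks ! i\<rbrakk> \<Longrightarrow>
    sum_perm ks \<sigma>s (sum_list (take i ks) + r) = sum_list (take i ks) + (\<sigma>s ! i) r"
  by (simp add: sum_perm_def block_of_index index_less)

lemma block_perm_index:
  assumes "i < length ks" "r < ks ! i"
  shows "block_perm ks \<sigma> (sum_list (take i ks) + r) =
      (\<Sum>i'<length ks. if \<sigma> i' < \<sigma> i then ks ! i' else 0) + r"
proof -
  have "(\<Sum>i' | i' < length ks \<and> \<sigma> i' < \<sigma> i. ks ! i') =
      (\<Sum>i' \<in> {i' \<in> {..<length ks}. \<sigma> i' < \<sigma> i}. ks ! i')"
    by (rule sum.cong) auto
  also have "\<dots> = (\<Sum>i'<length ks. if \<sigma> i' < \<sigma> i then ks ! i' else 0)"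
    by (rule sum.inter_filter) simp
  finally show ?thesis
    using assms by (simp only: block_perm_def block_of_index index_less if_True Let_def prod.case)
qed

lemma permutesI_lessThan:
  fixes n :: nat
  assumes "\<And>j. j < n \<Longrightarrow> p j < n" "inj_on p {..<n}" "\<And>j. \<not> j < n \<Longrightarrow> p j = j"
  shows "p permutes {..<n}"
proof (rule bij_imp_permutes)
  have "p ` {..<n} \<subseteq> {..<n}" using assms(1) by auto
  then show "bij_betw p {..<n} {..<n}"
    using assms(2) by (simp add: bij_betw_def endo_inj_surj)
qed (use assms(3) in auto)

lemma index_inj:
  fixes ks :: "nat list"
  assumes "i < length ks" "r < ks ! i" "i' < length ks" "r' < ks ! i'"
    "sum_list (take i ks) + r = sum_list (take i' ks) + r'"
  shows "i = i' \<and> r = r'"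
  using block_of_index[OF assms(1,2)] block_of_index[OF assms(3,4)]
  unfolding assms(5) by simp

lemma sum_perm_permutes:
  assumes "length \<sigma>s = length ks" "\<And>i. i < length ks \<Longrightarrow> (\<sigma>s ! i) permutes {..<ks ! i}"
  shows "sum_perm ks \<sigma>s permutes {..<sum_list ks}"
proof (rule permutesI_lessThan)
  have lt: "(\<sigma>s ! i) r < ks ! i" if "i < length ks" "r < ks ! i" for i r
    using permutes_in_image[OF assms(2)[OF that(1)], of r] that by simp
  show "sum_perm ks \<sigma>s j < sum_list ks" if "j < sum_list ks" for j
    using index_ex[OF that] by (force simp: sum_perm_index intro: index_less lt)
  show "inj_on (sum_perm ks \<sigma>s) {..<sum_list ks}"
  proof (rule inj_onI)
    fix j j' assume jj: "j \<in> {..<sum_list ks}" "j' \<in> {..<sum_list ks}"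
      "sum_perm ks \<sigma>s j = sum_perm ks \<sigma>s j'"
    obtain i r where ir: "i < length ks" "r < ks ! i" "j = sum_list (take i ks) + r"
      using index_ex[of j ks] jj(1) by auto
    obtain i' r' where ir': "i' < length ks" "r' < ks ! i'" "j' = sum_list (take i' ks) + r'"
      using index_ex[of j' ks] jj(2) by auto
    have "i = i' \<and> (\<sigma>s ! i) r = (\<sigma>s ! i') r'"
      using jj(3) index_inj[OF ir(1) lt[OF ir(1,2)] ir'(1) lt[OF ir'(1,2)]]
      unfolding ir(3) ir'(3) sum_perm_index[OF ir(1,2)] sum_perm_index[OF ir'(1,2)] by blast
    then show "j = j'"
      using ir(3) ir'(3) inj_eq[OF permutes_inj[OF assms(2)[OF ir(1)]], of r r'] by auto
  qed
qed (auto simp: sum_perm_def)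

lemma block_pos_less:
  fixes ks :: "nat list" and \<sigma> :: "nat \<Rightarrow> nat"
  assumes "i < length ks" "r < ks ! i" "\<sigma> i < p"
  shows "(\<Sum>i'<length ks. if \<sigma> i' < \<sigma> i then ks ! i' else 0) + r <
    (\<Sum>i'<length ks. if \<sigma> i' < p then ks ! i' else 0)"
proof -
  have "(\<Sum>i'<length ks. if \<sigma> i' < \<sigma> i then ks ! i' else 0) + ks ! i
      = (\<Sum>i'<length ks. (if \<sigma> i' < \<sigma> i then ks ! i' else 0) + (if i' = i then ks ! i else 0))"
    using assms(1) by (simp add: sum.distrib)
  also have "\<dots> \<le> (\<Sum>i'<length ks. if \<sigma> i' < p then ks ! i' else 0)"
    using assms(3) by (intro sum_mono) auto
  finally show ?thesis using assms(2) by linarith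
qed

lemma sum_list_nth_lessThan: "sum_list (ks :: nat list) = (\<Sum>i<length ks. ks ! i)"
  by (simp add: sum_list_sum_nth atLeast0LessThan)

lemma block_perm_permutes:
  assumes "\<sigma> permutes {..<length ks}"
  shows "block_perm ks \<sigma> permutes {..<sum_list ks}"
proof (rule permutesI_lessThan)
  have inj: "\<sigma> i = \<sigma> i' \<Longrightarrow> i = i'" for i i'
    by (rule injD[OF permutes_inj[OF assms]])
  have lt: "\<sigma> i < length ks" if "i < length ks" for i
    using permutes_in_image[OF assms, of i] that by simp
  show "block_perm ks \<sigma> j < sum_list ks" if jl: "j < sum_list ks" for j
  proof -
    obtain i r where ir: "i < length ks" "r < ks ! i" "j = sum_list (take i ks) + r"
      using index_ex[OF jl] by auto
    have "sum_list ks = (\<Sum>i'<length ks. if \<sigma> i' < length ks then ks ! i' else 0)"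
      unfolding sum_list_nth_lessThan by (rule sum.cong) (use lt in auto)
    then show ?thesis
      using block_pos_less[where \<sigma> = \<sigma>, OF ir(1,2) lt[OF ir(1)]]
      unfolding ir(3) block_perm_index[OF ir(1,2)] by (rule ssubst)
  qed
  show "inj_on (block_perm ks \<sigma>) {..<sum_list ks}"
  proof (rule inj_onI)
    fix j j' assume jj: "j \<in> {..<sum_list ks}" "j' \<in> {..<sum_list ks}"
      "block_perm ks \<sigma> j = block_perm ks \<sigma> j'"
    obtain i r where ir: "i < length ks" "r < ks ! i" "j = sum_list (take i ks) + r"
      using index_ex[of j ks] jj(1) by auto
    obtain i' r' where ir': "i' < length ks" "r' < ks ! i'" "j' = sum_list (take i' ks) + r'"
      using index_ex[of j' ks] jj(2) by auto
    have eq: "(\<Sum>l<length ks. if \<sigma> l < \<sigma> i then ks ! l else 0) + r =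
        (\<Sum>l<length ks. if \<sigma> l < \<sigma> i' then ks ! l else 0) + r'"
      using jj(3) unfolding ir(3) ir'(3) block_perm_index[OF ir(1,2)] block_perm_index[OF ir'(1,2)] .
    have "\<not> \<sigma> i < \<sigma> i'" using block_pos_less[where \<sigma> = \<sigma> and p = "\<sigma> i'", OF ir(1,2)] eq by linarith
    moreover have "\<not> \<sigma> i' < \<sigma> i" using block_pos_less[where \<sigma> = \<sigma> and p = "\<sigma> i", OF ir'(1,2)] eq by linarith
    ultimately have "i = i'" using inj[of i i'] by linarith
    then show "j = j'" using eq ir(3) ir'(3) by simp
  qed
qed (auto simp: block_perm_def)

definition gam_perm :: "nat list \<Rightarrow> (nat \<Rightarrow> nat) \<Rightarrow> (nat \<Rightarrow> nat) list \<Rightarrow> nat \<Rightarrow> nat" where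
  "gam_perm ks \<sigma> \<sigma>s = block_perm ks \<sigma> \<circ> sum_perm ks \<sigma>s"

lemma gam_perm_permutes:
  assumes "\<sigma> permutes {..<length ks}" "length \<sigma>s = length ks"
    "\<And>i. i < length ks \<Longrightarrow> (\<sigma>s ! i) permutes {..<ks ! i}"
  shows "gam_perm ks \<sigma> \<sigma>s permutes {..<sum_list ks}"
  unfolding gam_perm_def
  by (intro permutes_compose sum_perm_permutes block_perm_permutes assms)

lemma perm_less: "\<lbrakk>p permutes {..<n}; i < n\<rbrakk> \<Longrightarrow> p i < (n :: nat)"
  using permutes_in_image[of p "{..<n}" i] by simp

lemma gam_perm_index:
  assumes "i < length ks" "r < ks ! i" "(\<sigma>s ! i) permutes {..<ks ! i}"
  shows "gam_perm ks \<sigma> \<sigma>s (sum_list (take i ks) + r) =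
    (\<Sum>i'<length ks. if \<sigma> i' < \<sigma> i then ks ! i' else 0) + (\<sigma>s ! i) r"
  using block_perm_index[OF assms(1) perm_less[OF assms(3,2)]] sum_perm_index[OF assms(1,2)]
  by (simp add: gam_perm_def)

lemma perm_eqI:
  fixes ks :: "nat list"
  assumes "p permutes {..<sum_list ks}" "p' permutes {..<sum_list ks}"
    "\<And>i r. \<lbrakk>i < length ks; r < ks ! i\<rbrakk> \<Longrightarrow>
      p (sum_list (take i ks) + r) = p' (sum_list (take i ks) + r)"
  shows "p = p'"
proof
  fix j
  show "p j = p' j"
  proof (cases "j < sum_list ks")
    case True
    then show ?thesis using index_ex[OF True] assms(3) by blast
  next
    case False
    then show ?thesis using permutes_not_in[OF assms(1), of j] permutes_not_in[OF assms(2), of j] by simp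
  qed
qed

lemma sum_list_concat: "sum_list (concat ls) = sum_list (map sum_list (ls :: nat list list))"
  by (induction ls) auto

lemma take_concat_index:
  "\<lbrakk>i < length xss; r \<le> length (xss ! i)\<rbrakk> \<Longrightarrow>
    take (sum_list (take i (map length xss)) + r) (concat xss) = concat (take i xss) @ take r (xss ! i)"
proof (induction xss arbitrary: i)
  case Nil
  then show ?case by simp
next
  case (Cons xs xss)
  then show ?case by (cases i) (auto simp: add.assoc)
qed

lemma sum_list_take_concat:
  "\<lbrakk>i < length ls; j < length (ls ! i)\<rbrakk> \<Longrightarrow>
    sum_list (take (sum_list (take i (map length ls)) + j) (concat ls)) =
    sum_list (take i (map sum_list ls)) + sum_list (take j (ls ! i :: nat list))"
  by (subst take_concat_index) (simp_all add: sum_list_concat flip: take_map)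

lemma gam_perm_assoc:
  assumes \<sigma>: "\<sigma> permutes {..<length ls}"
    and len: "length \<sigma>s = length ls" "length \<tau>ss = length ls"
      "\<And>i. i < length ls \<Longrightarrow> length (\<tau>ss ! i) = length (ls ! i)"
    and \<sigma>s: "\<And>i. i < length ls \<Longrightarrow> (\<sigma>s ! i) permutes {..<length (ls ! i)}"
    and \<tau>ss: "\<And>i j. \<lbrakk>i < length ls; j < length (ls ! i)\<rbrakk> \<Longrightarrow> (\<tau>ss ! i ! j) permutes {..<ls ! i ! j}"
  shows "gam_perm (concat ls) (gam_perm (map length ls) \<sigma> \<sigma>s) (concat \<tau>ss) =
    gam_perm (map sum_list ls) \<sigma> (map (\<lambda>i. gam_perm (ls ! i) (\<sigma>s ! i) (\<tau>ss ! i)) [0..<length ls])"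
    (is "?L = ?R")
proof (rule perm_eqI)
  let ?G = "gam_perm (map length ls) \<sigma> \<sigma>s"
  let ?m = "map length ls"
  let ?s = "map sum_list ls"
  let ?rho = "map (\<lambda>i. gam_perm (ls ! i) (\<sigma>s ! i) (\<tau>ss ! i)) [0..<length ls]"
  have lenc: "length (concat ls) = sum_list ?m" by (simp add: length_concat)
  have lent: "map length \<tau>ss = ?m"
    using len by (intro nth_equalityI) auto
  have G: "?G permutes {..<length (concat ls)}"
    unfolding lenc using \<sigma> \<sigma>s len by (intro gam_perm_permutes) auto
  have \<tau>nth: "concat \<tau>ss ! (sum_list (take i ?m) + j) = \<tau>ss ! i ! j"
    if "i < length ls" "j < length (ls ! i)" for i j
    using nth_concat_index[of i \<tau>ss j] that len lent by simp
  have lnth: "concat ls ! (sum_list (take i ?m) + j) = ls ! i ! j"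
    if "i < length ls" "j < length (ls ! i)" for i j
    using nth_concat_index[of i ls j] that by simp
  have ilt: "sum_list (take i ?m) + j < length (concat ls)"
    if "i < length ls" "j < length (ls ! i)" for i j
    unfolding lenc using index_less[of i ?m j] that by simp
  have sc: "sum_list (concat ls) = sum_list ?s" by (simp add: sum_list_concat)
  have tlen: "length (concat \<tau>ss) = length (concat ls)"
    by (simp add: length_concat lent)
  show "?L permutes {..<sum_list ?s}"
    unfolding sc[symmetric]
  proof (rule gam_perm_permutes[OF G tlen])
    fix x assume "x < length (concat ls)"
    then obtain i j where "i < length ?m" "j < ?m ! i" "x = sum_list (take i ?m) + j"
      using index_ex[of x ?m] lenc by auto
    then show "(concat \<tau>ss ! x) permutes {..<concat ls ! x}"
      using \<tau>nth[of i j] lnth[of i j] \<tau>ss[of i j] by simp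
  qed
  have rho: "gam_perm (ls ! i) (\<sigma>s ! i) (\<tau>ss ! i) permutes {..<sum_list (ls ! i)}"
    if "i < length ls" for i
    using that by (intro gam_perm_permutes \<sigma>s len \<tau>ss)
  show "?R permutes {..<sum_list ?s}"
    using \<sigma> rho by (intro gam_perm_permutes) auto
  fix i s assume "i < length ?s" "s < ?s ! i"
  then have i: "i < length ls" and s: "s < sum_list (ls ! i)" by auto
  obtain j r where j: "j < length (ls ! i)" and r: "r < ls ! i ! j"
    and seq: "s = sum_list (take j (ls ! i)) + r"
    using index_ex[OF s] by blast
  have Gval: "?G (sum_list (take i' ?m) + j') =
      (\<Sum>l<length ?m. if \<sigma> l < \<sigma> i' then ?m ! l else 0) + (\<sigma>s ! i') j'"
    if "i' < length ls" "j' < length (ls ! i')" for i' j'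
    using gam_perm_index[of i' ?m j' \<sigma>s \<sigma>] that \<sigma>s by simp
  have sig: "(\<sigma>s ! i') j' < length (ls ! i')" if "i' < length ls" "j' < length (ls ! i')" for i' j'
    using perm_less[OF \<sigma>s] that by blast
  have cmp: "?G (sum_list (take i' ?m) + j') < ?G (sum_list (take i ?m) + j) \<longleftrightarrow>
      \<sigma> i' < \<sigma> i \<or> i' = i \<and> (\<sigma>s ! i) j' < (\<sigma>s ! i) j"
    if i': "i' < length ls" "j' < length (ls ! i')" for i' j'
  proof -
    consider "i' = i" | "\<sigma> i' < \<sigma> i" | "\<sigma> i < \<sigma> i'"
      using inj_eq[OF permutes_inj[OF \<sigma>], of i i'] by linarith
    then show ?thesis
    proof cases
      case 1
      then show ?thesis using Gval[OF i j] Gval[OF i'] by simp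
    next
      case 2
      then show ?thesis
        using Gval[OF i j] Gval[OF i'] sig[OF i'] i'
          block_pos_less[of i' ?m "(\<sigma>s ! i') j'" \<sigma> "\<sigma> i"] by simp
    next
      case 3
      then show ?thesis
        using Gval[OF i j] Gval[OF i'] sig[OF i j] i
          block_pos_less[of i ?m "(\<sigma>s ! i) j" \<sigma> "\<sigma> i'"] by auto
    qed
  qed
  have "(\<Sum>x<length (concat ls). if ?G x < ?G (sum_list (take i ?m) + j) then concat ls ! x else 0)
      = (\<Sum>i'<length ls. \<Sum>j'<length (ls ! i').
          if ?G (sum_list (take i' ?m) + j') < ?G (sum_list (take i ?m) + j)
          then concat ls ! (sum_list (take i' ?m) + j') else 0)"
    unfolding lenc sum_index by simp
  also have "\<dots> = (\<Sum>i'<length ls. \<Sum>j'<length (ls ! i').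
          if \<sigma> i' < \<sigma> i \<or> i' = i \<and> (\<sigma>s ! i) j' < (\<sigma>s ! i) j then ls ! i' ! j' else 0)"
    by (intro sum.cong refl) (simp add: cmp lnth)
  also have "\<dots> = (\<Sum>i'<length ls. (if \<sigma> i' < \<sigma> i then sum_list (ls ! i') else 0) +
      (if i' = i then (\<Sum>j'<length (ls ! i). if (\<sigma>s ! i) j' < (\<sigma>s ! i) j then ls ! i ! j' else 0) else 0))"
    by (intro sum.cong refl) (auto simp: sum_list_nth_lessThan)
  also have "\<dots> = (\<Sum>i'<length ls. if \<sigma> i' < \<sigma> i then sum_list (ls ! i') else 0) +
      (\<Sum>j'<length (ls ! i). if (\<sigma>s ! i) j' < (\<sigma>s ! i) j then ls ! i ! j' else 0)"
    using i by (simp add: sum.distrib)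
  finally have main: "(\<Sum>x<length (concat ls). if ?G x < ?G (sum_list (take i ?m) + j)
      then concat ls ! x else 0) = \<dots>" .
  have "?L (sum_list (take i ?s) + s) = ?L (sum_list (take (sum_list (take i ?m) + j) (concat ls)) + r)"
    by (simp add: sum_list_take_concat[OF i j] seq add.assoc)
  also have "\<dots> = (\<Sum>x<length (concat ls). if ?G x < ?G (sum_list (take i ?m) + j)
      then concat ls ! x else 0) + (\<tau>ss ! i ! j) r"
    using gam_perm_index[OF ilt[OF i j], of r "concat \<tau>ss" ?G] r \<tau>ss[OF i j]
    by (simp add: lnth[OF i j] \<tau>nth[OF i j])
  also have "\<dots> = (\<Sum>i'<length ls. if \<sigma> i' < \<sigma> i then sum_list (ls ! i') else 0) +
      gam_perm (ls ! i) (\<sigma>s ! i) (\<tau>ss ! i) s"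
    unfolding main seq gam_perm_index[OF j r \<tau>ss[OF i j], of "\<sigma>s ! i"] by simp
  also have "\<dots> = ?R (sum_list (take i ?s) + s)"
    using gam_perm_index[of i ?s s ?rho \<sigma>] i s rho[OF i]
    by (simp cong: if_cong sum.cong_simp)
  finally show "?L (sum_list (take i ?s) + s) = ?R (sum_list (take i ?s) + s)" .
qed

lemma block_perm_permute_list:
  assumes \<sigma>: "\<sigma> permutes {..<length ks}" and i: "i < length ks" "r < ks ! \<sigma> i"
  shows "block_perm (permute_list \<sigma> ks) \<sigma> (sum_list (take i (permute_list \<sigma> ks)) + r) =
    sum_list (take (\<sigma> i) ks) + r"
proof -
  have \<sigma>i: "\<sigma> i < length ks" using perm_less[OF \<sigma> i(1)] .
  have "(\<Sum>i'<length ks. if \<sigma> i' < \<sigma> i then permute_list \<sigma> ks ! i' else 0)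
      = (\<Sum>i'<length ks. ((\<lambda>x. if x < \<sigma> i then ks ! x else 0) \<circ> \<sigma>) i')"
    using \<sigma> by (intro sum.cong refl) (simp add: permute_list_nth)
  also have "\<dots> = (\<Sum>x<length ks. if x < \<sigma> i then ks ! x else 0)"
    by (rule sum.permute[OF \<sigma>, symmetric])
  also have "\<dots> = (\<Sum>x\<in>{x \<in> {..<length ks}. x < \<sigma> i}. ks ! x)"
    by (rule sum.inter_filter[symmetric]) simp
  also have "{x \<in> {..<length ks}. x < \<sigma> i} = {..<\<sigma> i}" using \<sigma>i by auto
  also have "(\<Sum>x<\<sigma> i. ks ! x) = sum_list (take (\<sigma> i) ks)"
    using \<sigma>i by (simp add: sum_list_nth_lessThan min_def)
  finally show ?thesis
    using block_perm_index[of i "permute_list \<sigma> ks" r \<sigma>] i \<sigma> by (simp add: permute_list_nth)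
qed

lemma gam_perm_outer:
  assumes \<sigma>: "\<sigma> permutes {..<length ks}" and \<sigma>': "\<sigma>' permutes {..<length ks}"
    and len: "length \<tau>s = length ks"
    and \<tau>s: "\<And>i. i < length ks \<Longrightarrow> (\<tau>s ! i) permutes {..<ks ! i}"
  shows "gam_perm (permute_list \<sigma>' ks) (\<sigma> \<circ> \<sigma>') (permute_list \<sigma>' \<tau>s) =
    gam_perm ks \<sigma> \<tau>s \<circ> block_perm (permute_list \<sigma>' ks) \<sigma>'"
proof (rule perm_eqI)
  let ?k = "permute_list \<sigma>' ks"
  have sl: "sum_list ?k = sum_list ks"
    using \<sigma>' by (metis mset_permute_list sum_mset_sum_list)
  have lt: "i < length ks \<Longrightarrow> \<sigma>' i < length ks" for i using perm_less[OF \<sigma>'] .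
  have \<tau>s': "(permute_list \<sigma>' \<tau>s ! i) permutes {..<?k ! i}" if "i < length ks" for i
    using that \<sigma>' \<tau>s[OF lt[OF that]] len by (simp add: permute_list_nth)
  show "gam_perm ?k (\<sigma> \<circ> \<sigma>') (permute_list \<sigma>' \<tau>s) permutes {..<sum_list ?k}"
    using \<tau>s' len \<sigma> \<sigma>' by (intro gam_perm_permutes permutes_compose) auto
  show "gam_perm ks \<sigma> \<tau>s \<circ> block_perm ?k \<sigma>' permutes {..<sum_list ?k}"
    using block_perm_permutes[of \<sigma>' ?k] gam_perm_permutes[OF \<sigma> len \<tau>s] \<sigma>'
    by (intro permutes_compose) (auto simp: sl)
  fix i r assume "i < length ?k" "r < ?k ! i"
  then have i: "i < length ks" and r: "r < ks ! \<sigma>' i" using \<sigma>' by (auto simp: permute_list_nth)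
  have "gam_perm ?k (\<sigma> \<circ> \<sigma>') (permute_list \<sigma>' \<tau>s) (sum_list (take i ?k) + r) =
      (\<Sum>i'<length ks. ((\<lambda>x. if \<sigma> x < \<sigma> (\<sigma>' i) then ks ! x else 0) \<circ> \<sigma>') i') + (\<tau>s ! \<sigma>' i) r"
    using gam_perm_index[of i ?k r "permute_list \<sigma>' \<tau>s" "\<sigma> \<circ> \<sigma>'"] \<tau>s'[OF i] i r \<sigma>' len
    by (simp add: permute_list_nth cong: sum.cong_simp if_cong)
  also have "\<dots> = (\<Sum>x<length ks. if \<sigma> x < \<sigma> (\<sigma>' i) then ks ! x else 0) + (\<tau>s ! \<sigma>' i) r"
    by (subst sum.permute[OF \<sigma>', symmetric]) simp
  also have "\<dots> = (gam_perm ks \<sigma> \<tau>s \<circ> block_perm ?k \<sigma>') (sum_list (take i ?k) + r)"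
    using block_perm_permute_list[OF \<sigma>' i r] gam_perm_index[OF lt[OF i] r \<tau>s[OF lt[OF i]]] by simp
  finally show "gam_perm ?k (\<sigma> \<circ> \<sigma>') (permute_list \<sigma>' \<tau>s) (sum_list (take i ?k) + r) = \<dots>" .
qed

lemma gam_perm_inner:
  assumes \<sigma>: "\<sigma> permutes {..<length ks}"
    and len: "length \<tau>s = length ks" "length \<rho>s = length ks"
    and \<tau>s: "\<And>i. i < length ks \<Longrightarrow> (\<tau>s ! i) permutes {..<ks ! i}"
    and \<rho>s: "\<And>i. i < length ks \<Longrightarrow> (\<rho>s ! i) permutes {..<ks ! i}"
  shows "gam_perm ks \<sigma> (map (\<lambda>i. \<tau>s ! i \<circ> \<rho>s ! i) [0..<length ks]) =
    gam_perm ks \<sigma> \<tau>s \<circ> sum_perm ks \<rho>s"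
proof (rule perm_eqI)
  let ?c = "map (\<lambda>i. \<tau>s ! i \<circ> \<rho>s ! i) [0..<length ks]"
  have c: "(?c ! i) permutes {..<ks ! i}" if "i < length ks" for i
    using that \<tau>s \<rho>s by (simp add: permutes_compose)
  show "gam_perm ks \<sigma> ?c permutes {..<sum_list ks}"
    using c \<sigma> by (intro gam_perm_permutes) auto
  show "gam_perm ks \<sigma> \<tau>s \<circ> sum_perm ks \<rho>s permutes {..<sum_list ks}"
    using assms by (intro permutes_compose gam_perm_permutes sum_perm_permutes)
  fix i r assume i: "i < length ks" and r: "r < ks ! i"
  show "gam_perm ks \<sigma> ?c (sum_list (take i ks) + r) =
      (gam_perm ks \<sigma> \<tau>s \<circ> sum_perm ks \<rho>s) (sum_list (take i ks) + r)"
    using gam_perm_index[OF i r c[OF i], of \<sigma>] sum_perm_index[OF i r, of \<rho>s]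
      gam_perm_index[OF i perm_less[OF \<rho>s[OF i] r] \<tau>s[OF i], of \<sigma>] i by simp
qed

lemma list_eq_index:
  assumes "map length xss = ks" "length ys = sum_list ks"
    "\<And>i r. \<lbrakk>i < length xss; r < length (xss ! i)\<rbrakk> \<Longrightarrow> ys ! (sum_list (take i ks) + r) = xss ! i ! r"
  shows "ys = concat xss"
proof (rule nth_equalityI)
  show "length ys = length (concat xss)" using assms(1,2) by (simp add: length_concat)
  fix j assume "j < length ys"
  then obtain i r where "i < length ks" "r < ks ! i" "j = sum_list (take i ks) + r"
    using index_ex[of j ks] assms(2) by auto
  then show "ys ! j = concat xss ! j"
    using assms(1,3) nth_concat_index[of i xss r] by auto
qed

lemma permute_list_block_perm:
  assumes \<sigma>: "\<sigma> permutes {..<length xss}"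
  shows "permute_list (block_perm (map length (permute_list \<sigma> xss)) \<sigma>) (concat xss) =
    concat (permute_list \<sigma> xss)"
proof -
  let ?p = "permute_list \<sigma> xss"
  have ml: "map length ?p = permute_list \<sigma> (map length xss)"
    using \<sigma> by (simp add: permute_list_map)
  have sl: "sum_list (map length ?p) = length (concat xss)"
    using \<sigma> unfolding ml by (metis length_concat length_map mset_permute_list sum_mset_sum_list)
  have bp: "block_perm (map length ?p) \<sigma> permutes {..<length (concat xss)}"
    using block_perm_permutes[of \<sigma> "map length ?p"] \<sigma> sl by simp
  show ?thesis
  proof (rule list_eq_index[OF refl])
    fix i r assume "i < length ?p" and r': "r < length (?p ! i)"
    then have i: "i < length xss" and r: "r < length (xss ! \<sigma> i)"
      using \<sigma> by (auto simp: permute_list_nth)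
    have lt: "\<sigma> i < length xss" using perm_less[OF \<sigma> i] .
    have idx: "sum_list (take i (map length ?p)) + r < length (concat xss)"
      using index_less[of i "map length ?p" r] i r' sl by simp
    have "block_perm (map length ?p) \<sigma> (sum_list (take i (map length ?p)) + r) =
        sum_list (take (\<sigma> i) (map length xss)) + r"
      using block_perm_permute_list[of \<sigma> "map length xss" i r] \<sigma> i r lt unfolding ml by simp
    then show "permute_list (block_perm (map length ?p) \<sigma>) (concat xss) !
        (sum_list (take i (map length ?p)) + r) = ?p ! i ! r"
      using permute_list_nth[OF bp idx] nth_concat_index[OF lt r] permute_list_nth[OF \<sigma> i] by simp
  qed (simp add: sl)
qed

lemma permute_list_sum_perm:
  assumes len: "length \<sigma>s = length xss"
    and \<sigma>s: "\<And>i. i < length xss \<Longrightarrow> (\<sigma>s ! i) permutes {..<length (xss ! i)}"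
  shows "permute_list (sum_perm (map length xss) \<sigma>s) (concat xss) =
    concat (map (\<lambda>i. permute_list (\<sigma>s ! i) (xss ! i)) [0..<length xss])"
proof (rule list_eq_index)
  let ?ks = "map length xss"
  have sp: "sum_perm ?ks \<sigma>s permutes {..<length (concat xss)}"
    using sum_perm_permutes[of \<sigma>s ?ks] len \<sigma>s by (simp add: length_concat)
  show "map length (map (\<lambda>i. permute_list (\<sigma>s ! i) (xss ! i)) [0..<length xss]) = ?ks"
    by (intro nth_equalityI) auto
  show "length (permute_list (sum_perm ?ks \<sigma>s) (concat xss)) = sum_list ?ks"
    by (simp add: length_concat)
  fix i r assume "i < length (map (\<lambda>i. permute_list (\<sigma>s ! i) (xss ! i)) [0..<length xss])"
    "r < length (map (\<lambda>i. permute_list (\<sigma>s ! i) (xss ! i)) [0..<length xss] ! i)"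
  then have i: "i < length xss" and r: "r < length (xss ! i)" by auto
  have idx: "sum_list (take i ?ks) + r < length (concat xss)"
    using index_less[of i ?ks r] i r by (simp add: length_concat)
  show "permute_list (sum_perm ?ks \<sigma>s) (concat xss) ! (sum_list (take i ?ks) + r) =
      map (\<lambda>i. permute_list (\<sigma>s ! i) (xss ! i)) [0..<length xss] ! i ! r"
    using permute_list_nth[OF sp idx] sum_perm_index[of i ?ks r \<sigma>s] i r
      nth_concat_index[OF i perm_less[OF \<sigma>s[OF i] r]] permute_list_nth[OF \<sigma>s[OF i] r] by simp
qed

lemma upt_index:
  "[0..<sum_list ks] = concat (map (\<lambda>i. map (\<lambda>r. sum_list (take i ks) + r) [0..<ks ! i]) [0..<length ks])"
  by (rule list_eq_index[where ks = ks])
    (auto intro!: nth_equalityI simp: index_less)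


subsection \<open>Sources and targets of the coherence arrows\<close>

context category
begin

lemma inverse_arrow_hom:
  assumes "iso_arrow C f" "f \<in> Hom C x y"
  shows "inverse_arrow C f \<in> Hom C y x"
proof -
  have d: "Dom C f = x" "Cod C f = y" using assms(2) by (auto simp: Hom_def)
  obtain g where g: "g \<in> Hom C y x" "g \<cdot> f = Ident C x" "f \<cdot> g = Ident C y"
    using assms(1) unfolding iso_arrow_def d by blast
  have "h = g" if "h \<in> Hom C y x" "h \<cdot> f = Ident C x" for h
    using comp_assoc[OF g(1) assms(2) that(1)] that(2) g id_comp[OF g(1)] comp_id[OF that(1)] by simp
  then have "inverse_arrow C f = g"
    unfolding inverse_arrow_def d using g by (intro the_equality) blast+
  then show ?thesis using g by simp
qed

end

context symmetric_monoidal_category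
begin

lemma tens_list_ob: "set xs \<subseteq> Ob M \<Longrightarrow> tens M xs \<in> Ob M"
  by (induction xs rule: induct_list012) (auto intro: unit_ob tens_ob)

lemma append_iso_hom:
  "\<lbrakk>set xs \<subseteq> Ob M; set ys \<subseteq> Ob M\<rbrakk>
    \<Longrightarrow> append_iso M xs ys \<in> Hom M (tens M xs \<otimes>\<^sub>0 tens M ys) (tens M (xs @ ys))"
proof (induction xs)
  case Nil
  then show ?case using lunit_hom[OF tens_list_ob] by simp
next
  case (Cons x xs)
  show ?case
  proof (cases xs)
    case Nil
    then show ?thesis using Cons.prems runit_hom[of x] id_hom[of "x \<otimes>\<^sub>0 tens M ys"] tens_list_ob[of ys] tens_ob
      by (cases ys) auto
  next
    case (Cons x' xs')
    have o: "x \<in> Ob M" "tens M xs \<in> Ob M" "tens M ys \<in> Ob M"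
      using Cons.prems tens_list_ob[of xs] tens_list_ob[of ys] by auto
    have "append_iso M xs ys \<in> Hom M (tens M xs \<otimes>\<^sub>0 tens M ys) (tens M (xs @ ys))"
      using Cons.IH Cons.prems by simp
    from comp_hom[OF assoc_hom[OF o] tens_hom[OF id_hom[OF o(1)] this]]
    show ?thesis by (simp add: Cons)
  qed
qed

lemma concat_iso_hom:
  "(\<And>xs. xs \<in> set xss \<Longrightarrow> set xs \<subseteq> Ob M)
    \<Longrightarrow> concat_iso M xss \<in> Hom M (tens M (map (tens M) xss)) (tens M (concat xss))"
proof (induction xss)
  case Nil
  then show ?case using id_hom[OF unit_ob] by simp
next
  case (Cons xs xss)
  have o: "tens M xs \<in> Ob M" using Cons.prems tens_list_ob by simp
  show ?case
  proof (cases xss)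
    case Nil
    then show ?thesis using id_hom[OF o] by simp
  next
    case (Cons ys yss)
    have "concat_iso M xss \<in> Hom M (tens M (map (tens M) xss)) (tens M (concat xss))"
      using Cons.IH Cons.prems by simp
    moreover have "append_iso M xs (concat xss) \<in>
        Hom M (tens M xs \<otimes>\<^sub>0 tens M (concat xss)) (tens M (xs @ concat xss))"
      by (intro append_iso_hom) (use Cons.prems in auto)
    ultimately show ?thesis
      using comp_hom[OF tens_hom[OF id_hom[OF o]]] by (simp add: Cons)
  qed
qed

lemma swap_iso_hom:
  assumes "x \<in> Ob M" "y \<in> Ob M" "set zs \<subseteq> Ob M"
  shows "swap_iso M x y zs \<in> Hom M (tens M (x # y # zs)) (tens M (y # x # zs))"
proof (cases zs)
  case Nil
  then show ?thesis using braid_hom[OF assms(1,2)] by (simp add: swap_iso_def)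
next
  case (Cons z zs')
  have o: "tens M zs \<in> Ob M" using assms tens_list_ob by simp
  show ?thesis
    using comp_hom[OF inverse_arrow_hom[OF assoc_iso[OF assms(1,2) o] assoc_hom[OF assms(1,2) o]]
        comp_hom[OF tens_hom[OF braid_hom[OF assms(1,2)] id_hom[OF o]] assoc_hom[OF assms(2,1) o]]]
      comp_assoc[OF inverse_arrow_hom[OF assoc_iso[OF assms(1,2) o] assoc_hom[OF assms(1,2) o]]
        tens_hom[OF braid_hom[OF assms(1,2)] id_hom[OF o]] assoc_hom[OF assms(2,1) o]]
    by (simp add: swap_iso_def Cons)
qed

lemma whisker_hom:
  assumes "x \<in> Ob M" "f \<in> Hom M (tens M xs) (tens M ys)" "length xs = length ys"
  shows "whisker M x xs f \<in> Hom M (tens M (x # xs)) (tens M (x # ys))"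
  using assms tens_hom[OF id_hom[OF assms(1)] assms(2)] id_hom[OF assms(1)]
  by (cases xs; cases ys) (auto simp: whisker_def)

lemma insort_iso_hom:
  "\<lbrakk>X k \<in> Ob M; X ` set ks \<subseteq> Ob M\<rbrakk>
    \<Longrightarrow> insort_iso M X k ks \<in> Hom M (tens M (map X (k # ks))) (tens M (map X (insort k ks)))"
proof (induction ks)
  case Nil
  then show ?case using id_hom by simp
next
  case (Cons j js)
  show ?case
  proof (cases "k \<le> j")
    case True
    then show ?thesis using id_hom[OF tens_list_ob[of "map X (k # j # js)"]] Cons.prems by auto
  next
    case False
    have "insort_iso M X k js \<in> Hom M (tens M (map X (k # js))) (tens M (map X (insort k js)))"
      using Cons by simp
    then have "whisker M (X j) (map X (k # js)) (insort_iso M X k js) \<in>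
        Hom M (tens M (X j # map X (k # js))) (tens M (X j # map X (insort k js)))"
      using Cons.prems by (intro whisker_hom) auto
    moreover have "swap_iso M (X k) (X j) (map X js) \<in>
        Hom M (tens M (X k # X j # map X js)) (tens M (X j # X k # map X js))"
      using Cons.prems by (intro swap_iso_hom) auto
    ultimately show ?thesis using comp_hom False by fastforce
  qed
qed

lemma sort_iso_hom:
  "X ` set ks \<subseteq> Ob M
    \<Longrightarrow> sort_iso M X ks \<in> Hom M (tens M (map X ks)) (tens M (map X (sort ks)))"
proof (induction ks)
  case Nil
  then show ?case using id_hom[OF unit_ob] by simp
next
  case (Cons k ks)
  have "whisker M (X k) (map X ks) (sort_iso M X ks) \<in>
      Hom M (tens M (X k # map X ks)) (tens M (X k # map X (sort ks)))"
    using Cons by (intro whisker_hom) auto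
  moreover have "insort_iso M X k (sort ks) \<in>
      Hom M (tens M (map X (k # sort ks))) (tens M (map X (insort k (sort ks))))"
    using Cons.prems by (intro insort_iso_hom) auto
  ultimately show ?case using comp_hom by fastforce
qed

lemma perm_iso_hom:
  assumes "set xs \<subseteq> Ob M" "\<sigma> permutes {..<length xs}"
  shows "perm_iso M xs \<sigma> \<in> Hom M (tens M (permute_list \<sigma> xs)) (tens M xs)"
proof -
  have "map \<sigma> [0..<length xs] = permute_list \<sigma> [0..<length xs]"
    using perm_less[OF assms(2)] by (auto simp: permute_list_def)
  then have "sort (map \<sigma> [0..<length xs]) = [0..<length xs]"
    using assms(2) by (intro properties_for_sort) simp_all
  moreover have "(\<lambda>i. xs ! i) ` set (map \<sigma> [0..<length xs]) \<subseteq> Ob M"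
    using assms perm_less[OF assms(2)] by (auto simp: subset_iff)
  ultimately show ?thesis
    using sort_iso_hom[of "\<lambda>i. xs ! i" "map \<sigma> [0..<length xs]"]
    by (simp add: perm_iso_def permute_list_def map_nth o_def)
qed

end


subsection \<open>Quotients of operads\<close>

inductive operad_cong ::
  "('c, 'x) operad \<Rightarrow> ('c \<times> 'c list \<times> 'x \<times> 'x) set \<Rightarrow> 'c \<Rightarrow> 'c list \<Rightarrow> 'x \<Rightarrow> 'x \<Rightarrow> bool"
  for P R where
  cong_base: "\<lbrakk>(t, c, x, y) \<in> R; (t, c, x) \<in> operations P; (t, c, y) \<in> operations P\<rbrakk>
    \<Longrightarrow> operad_cong P R t c x y"
| cong_refl: "(t, c, x) \<in> operations P \<Longrightarrow> operad_cong P R t c x x"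
| cong_sym: "operad_cong P R t c x y \<Longrightarrow> operad_cong P R t c y x"
| cong_trans: "\<lbrakk>operad_cong P R t c x y; operad_cong P R t c y z\<rbrakk> \<Longrightarrow> operad_cong P R t c x z"
| cong_act: "\<lbrakk>operad_cong P R t c x y; \<sigma> permutes {..<length c}\<rbrakk>
    \<Longrightarrow> operad_cong P R t (permute_list \<sigma> c) (Act P t c \<sigma> x) (Act P t c \<sigma> y)"
| cong_gamma: "\<lbrakk>operad_cong P R t c x y; length bs = length c; length xs = length c; length ys = length c;
    \<And>i. i < length c \<Longrightarrow> operad_cong P R (c ! i) (bs ! i) (xs ! i) (ys ! i)\<rbrakk>
    \<Longrightarrow> operad_cong P R t (concat bs) (Gamma P t c bs x xs) (Gamma P t c bs y ys)"

definition cong_class ::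
  "('c, 'x) operad \<Rightarrow> ('c \<times> 'c list \<times> 'x \<times> 'x) set \<Rightarrow> 'c \<Rightarrow> 'c list \<Rightarrow> 'x \<Rightarrow> 'x set" where
  "cong_class P R t c x = {y. operad_cong P R t c x y}"

definition quot_operad ::
  "('c, 'x) operad \<Rightarrow> ('c \<times> 'c list \<times> 'x \<times> 'x) set \<Rightarrow> ('c, 'x set) operad" where
  "quot_operad P R =
     \<lparr>Colors = Colors P,
      Ops = (\<lambda>t c. cong_class P R t c ` Ops P t c),
      Act = (\<lambda>t c \<sigma> X. cong_class P R t (permute_list \<sigma> c) (Act P t c \<sigma> (SOME x. x \<in> X))),
      Gamma = (\<lambda>t c bs X Xs. cong_class P R t (concat bs)
        (Gamma P t c bs (SOME x. x \<in> X) (map (\<lambda>X. SOME x. x \<in> X) Xs))),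
      OUnit = (\<lambda>t. cong_class P R t [t] (OUnit P t))\<rparr>"

lemma concat_concat_map: "concat (concat xss) = concat (map concat xss)"
  by (induction xss) auto

lemma composable_colors: "composable P c bs xs \<Longrightarrow> set (concat bs) \<subseteq> Colors P"
  by (auto simp: composable_def operations_def set_conv_nth[of bs])

lemma set_permute_list_le: "\<sigma> permutes {..<length c} \<Longrightarrow> set (permute_list \<sigma> c) \<subseteq> set c"
  by simp

context colored_operad
begin

lemma act_operations:
  "\<lbrakk>(t, c, x) \<in> operations P; \<sigma> permutes {..<length c}\<rbrakk>
    \<Longrightarrow> (t, permute_list \<sigma> c, Act P t c \<sigma> x) \<in> operations P"
  using act_closed[of t c x \<sigma>] by (auto simp: operations_def)

lemma gamma_operations:
  "\<lbrakk>(t, c, x) \<in> operations P; composable P c bs xs\<rbrakk>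
    \<Longrightarrow> (t, concat bs, Gamma P t c bs x xs) \<in> operations P"
  using gamma_closed[of t c x bs xs] composable_colors[of P c bs xs]
  by (simp only: operations_def mem_Collect_eq prod.case)

lemma cong_operations:
  "operad_cong P R t c x y \<Longrightarrow> (t, c, x) \<in> operations P \<and> (t, c, y) \<in> operations P"
proof (induction rule: operad_cong.induct)
  case (cong_act t c x y \<sigma>)
  then show ?case using act_operations by blast
next
  case (cong_gamma t c x y bs xs ys)
  then show ?case by (auto intro!: gamma_operations simp: composable_def)
qed auto

lemma class_eq: 
  assumes "(t, c, x) \<in> operations P"
  shows "cong_class P R t c x = cong_class P R t c y \<longleftrightarrow> operad_cong P R t c x y"
proof
  assume "cong_class P R t c x = cong_class P R t c y"
  then have "x \<in> cong_class P R t c y" using cong_refl[OF assms] by (auto simp: cong_class_def)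
  then show "operad_cong P R t c x y" by (auto simp: cong_class_def intro: cong_sym)
next
  assume "operad_cong P R t c x y"
  then show "cong_class P R t c x = cong_class P R t c y"
    unfolding cong_class_def by (blast intro: cong_sym cong_trans)
qed

lemma class_rep:
  assumes "(t, c, x) \<in> operations P"
  shows "operad_cong P R t c x (SOME y. y \<in> cong_class P R t c x)"
proof -
  have "x \<in> cong_class P R t c x" using cong_refl[OF assms] by (simp add: cong_class_def)
  then have "(SOME y. y \<in> cong_class P R t c x) \<in> cong_class P R t c x" by (rule someI)
  then show ?thesis by (simp only: cong_class_def mem_Collect_eq)
qed

lemma quot_operations:
  "(t, c, X) \<in> operations (quot_operad P R) \<longleftrightarrow>
    (\<exists>x. (t, c, x) \<in> operations P \<and> X = cong_class P R t c x)"
  by (auto simp: operations_def quot_operad_def)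

lemma quot_composable:
  assumes "composable (quot_operad P R) c bs Xs"
  obtains xs where "composable P c bs xs"
    "Xs = map (\<lambda>i. cong_class P R (c ! i) (bs ! i) (xs ! i)) [0..<length c]"
proof -
  have len: "length bs = length c" "length Xs = length c"
    using assms by (auto simp: composable_def)
  have "\<forall>i\<in>{..<length c}. \<exists>x. (c ! i, bs ! i, x) \<in> operations P \<and> Xs ! i = cong_class P R (c ! i) (bs ! i) x"
    using assms by (auto simp: composable_def quot_operations)
  then obtain f where f: "\<And>i. i < length c \<Longrightarrow> (c ! i, bs ! i, f i) \<in> operations P \<and>
      Xs ! i = cong_class P R (c ! i) (bs ! i) (f i)"
    unfolding bchoice_iff by auto
  show ?thesis
    by (rule that[of "map f [0..<length c]"])
      (use f len in \<open>auto simp: composable_def intro!: nth_equalityI\<close>)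
qed

lemma quot_act:
  assumes "(t, c, x) \<in> operations P" "\<sigma> permutes {..<length c}"
  shows "Act (quot_operad P R) t c \<sigma> (cong_class P R t c x) =
    cong_class P R t (permute_list \<sigma> c) (Act P t c \<sigma> x)"
  using iffD2[OF class_eq[OF act_operations[OF assms]] cong_act[OF class_rep[OF assms(1)] assms(2)]]
  unfolding quot_operad_def operad.simps by (rule sym)

lemma quot_gamma:
  assumes "(t, c, x) \<in> operations P" "composable P c bs xs"
  shows "Gamma (quot_operad P R) t c bs (cong_class P R t c x)
      (map (\<lambda>i. cong_class P R (c ! i) (bs ! i) (xs ! i)) [0..<length c]) =
    cong_class P R t (concat bs) (Gamma P t c bs x xs)"
proof -
  have "operad_cong P R t (concat bs) (Gamma P t c bs x xs)
      (Gamma P t c bs (SOME y. y \<in> cong_class P R t c x)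
        (map (\<lambda>X. SOME y. y \<in> X) (map (\<lambda>i. cong_class P R (c ! i) (bs ! i) (xs ! i)) [0..<length c])))"
    by (rule cong_gamma[OF class_rep[OF assms(1)]])
      (use assms(2) class_rep in \<open>auto simp: composable_def\<close>)
  from iffD2[OF class_eq[OF gamma_operations[OF assms]] this] show ?thesis
    unfolding quot_operad_def operad.simps by (rule sym)
qed

lemma quot_unit: "OUnit (quot_operad P R) t = cong_class P R t [t] (OUnit P t)"
  by (simp add: quot_operad_def)

lemma unit_operations: "t \<in> Colors P \<Longrightarrow> (t, [t], OUnit P t) \<in> operations P"
  using unit_closed by (simp add: operations_def)

lemma quot_colors [simp]: "Colors (quot_operad P R) = Colors P"
  by (simp add: quot_operad_def)

lemma permute_map_nth:
  "\<lbrakk>\<sigma> permutes {..<n}\<rbrakk> \<Longrightarrow> permute_list \<sigma> (map f [0..<n]) = map (\<lambda>i. f (\<sigma> i)) [0..<n]"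
  using perm_less[of \<sigma> n] by (auto intro!: nth_equalityI simp: permute_list_nth)

lemma quot_colored_operad: "colored_operad (quot_operad P R)"
proof
  fix t c X \<sigma>
  assume X: "(t, c, X) \<in> operations (quot_operad P R)" and \<sigma>: "\<sigma> permutes {..<length c}"
  obtain x where x: "(t, c, x) \<in> operations P" "X = cong_class P R t c x"
    using X unfolding quot_operations by blast
  show "Act (quot_operad P R) t c \<sigma> X \<in> Ops (quot_operad P R) t (permute_list \<sigma> c)"
    unfolding x(2) quot_act[OF x(1) \<sigma>] using act_closed[OF x(1) \<sigma>] by (simp add: quot_operad_def)
  show "Act (quot_operad P R) t (permute_list \<sigma> c) \<tau> (Act (quot_operad P R) t c \<sigma> X) =
      Act (quot_operad P R) t c (\<sigma> \<circ> \<tau>) X" if \<tau>: "\<tau> permutes {..<length c}" for \<tau>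
  proof -
    have \<tau>': "\<tau> permutes {..<length (permute_list \<sigma> c)}" using \<tau> by simp
    show ?thesis
      unfolding x(2) quot_act[OF x(1) \<sigma>] quot_act[OF act_operations[OF x(1) \<sigma>] \<tau>']
        quot_act[OF x(1) permutes_compose[OF \<tau> \<sigma>]] act_comp[OF x(1) \<sigma> \<tau>]
        permute_list_compose[OF \<tau>] ..
  qed
next
  fix t c X
  assume X: "(t, c, X) \<in> operations (quot_operad P R)"
  obtain x where x: "(t, c, x) \<in> operations P" "X = cong_class P R t c x"
    using X unfolding quot_operations by blast
  show "Act (quot_operad P R) t c id X = X"
    unfolding x(2) quot_act[OF x(1) permutes_id] act_id[OF x(1)] by simp
  have t: "t \<in> Colors P" and c: "set c \<subseteq> Colors P" using x(1) by (auto simp: operations_def)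
  have c1: "composable P [t] [c] [x]" using x(1) by (simp add: composable_def)
  show "Gamma (quot_operad P R) t [t] [c] (OUnit (quot_operad P R) t) [X] = X"
    using quot_gamma[OF unit_operations[OF t] c1, of R] gamma_unit_left[OF x(1)]
    by (simp add: x(2) quot_unit)
  have c2: "composable P c (map (\<lambda>a. [a]) c) (map (OUnit P) c)"
    using unit_operations subsetD[OF c nth_mem] by (simp add: composable_def)
  have "map (\<lambda>i. cong_class P R (c ! i) (map (\<lambda>a. [a]) c ! i) (map (OUnit P) c ! i)) [0..<length c] =
      map (OUnit (quot_operad P R)) c"
    by (auto intro!: nth_equalityI simp: quot_unit)
  then show "Gamma (quot_operad P R) t c (map (\<lambda>a. [a]) c) X (map (OUnit (quot_operad P R)) c) = X"
    using quot_gamma[OF x(1) c2, of R] gamma_unit_right[OF x(1)] by (simp add: x(2))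
next
  fix t assume "t \<in> Colors (quot_operad P R)"
  then show "OUnit (quot_operad P R) t \<in> Ops (quot_operad P R) t [t]"
    using unit_closed by (simp add: quot_operad_def)
next
  fix t c X bs Xs
  assume X: "(t, c, X) \<in> operations (quot_operad P R)"
    and Xs: "composable (quot_operad P R) c bs Xs"
  obtain x where x: "(t, c, x) \<in> operations P" "X = cong_class P R t c x"
    using X unfolding quot_operations by blast
  obtain xs where xs: "composable P c bs xs"
    "Xs = map (\<lambda>i. cong_class P R (c ! i) (bs ! i) (xs ! i)) [0..<length c]"
    using quot_composable[OF Xs] .
  have len: "length bs = length c" "length xs = length c" using xs(1) by (auto simp: composable_def)
  have xsi: "(c ! i, bs ! i, xs ! i) \<in> operations P" if "i < length c" for i
    using xs(1) that by (simp add: composable_def)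
  note G = quot_gamma[OF x(1) xs(1), of R, folded x(2) xs(2)]
  show "Gamma (quot_operad P R) t c bs X Xs \<in> Ops (quot_operad P R) t (concat bs)"
    unfolding G using gamma_closed[OF x(1) xs(1)] by (simp add: quot_operad_def)
  show "Gamma (quot_operad P R) t (permute_list \<sigma> c) (permute_list \<sigma> bs)
        (Act (quot_operad P R) t c \<sigma> X) (permute_list \<sigma> Xs) =
      Act (quot_operad P R) t (concat bs) (block_perm (map length (permute_list \<sigma> bs)) \<sigma>)
        (Gamma (quot_operad P R) t c bs X Xs)" if \<sigma>: "\<sigma> permutes {..<length c}" for \<sigma>
  proof -
    have comp: "composable P (permute_list \<sigma> c) (permute_list \<sigma> bs) (permute_list \<sigma> xs)"
      using \<sigma> len xsi perm_less[OF \<sigma>] by (auto simp: composable_def permute_list_nth)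
    have b: "block_perm (map length (permute_list \<sigma> bs)) \<sigma> permutes {..<length (concat bs)}"
    proof -
      have "mset (map length (permute_list \<sigma> bs)) = mset (map length bs)" using \<sigma> len by simp
      then have "sum_list (map length (permute_list \<sigma> bs)) = length (concat bs)"
        unfolding length_concat by (metis sum_mset_sum_list)
      then show ?thesis
        using block_perm_permutes[of \<sigma> "map length (permute_list \<sigma> bs)"] \<sigma> len by simp
    qed
    have "map (\<lambda>i. cong_class P R (permute_list \<sigma> c ! i) (permute_list \<sigma> bs ! i) (permute_list \<sigma> xs ! i))
        [0..<length (permute_list \<sigma> c)] = permute_list \<sigma> Xs"
      unfolding xs(2) permute_map_nth[OF \<sigma>] using \<sigma> len by (auto simp: permute_list_nth)
    then have "Gamma (quot_operad P R) t (permute_list \<sigma> c) (permute_list \<sigma> bs)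
        (Act (quot_operad P R) t c \<sigma> X) (permute_list \<sigma> Xs) =
        cong_class P R t (concat (permute_list \<sigma> bs))
          (Gamma P t (permute_list \<sigma> c) (permute_list \<sigma> bs) (Act P t c \<sigma> x) (permute_list \<sigma> xs))"
      using quot_gamma[OF act_operations[OF x(1) \<sigma>] comp, of R] quot_act[OF x(1) \<sigma>, of R, folded x(2)]
      by simp
    also have "\<dots> = Act (quot_operad P R) t (concat bs) (block_perm (map length (permute_list \<sigma> bs)) \<sigma>)
        (Gamma (quot_operad P R) t c bs X Xs)"
      unfolding gamma_act_outer[OF x(1) xs(1) \<sigma>] G
        quot_act[OF gamma_operations[OF x(1) xs(1)] b]
      using permute_list_block_perm[of \<sigma> bs] \<sigma> len by simp
    finally show ?thesis .
  qed
  show "Gamma (quot_operad P R) t c (map (\<lambda>i. permute_list (\<sigma>s ! i) (bs ! i)) [0..<length c]) X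
        (map (\<lambda>i. Act (quot_operad P R) (c ! i) (bs ! i) (\<sigma>s ! i) (Xs ! i)) [0..<length c]) =
      Act (quot_operad P R) t (concat bs) (sum_perm (map length bs) \<sigma>s)
        (Gamma (quot_operad P R) t c bs X Xs)"
    if \<sigma>s: "length \<sigma>s = length c" "\<And>i. i < length c \<Longrightarrow> (\<sigma>s ! i) permutes {..<length (bs ! i)}" for \<sigma>s
  proof -
    let ?b = "map (\<lambda>i. permute_list (\<sigma>s ! i) (bs ! i)) [0..<length c]"
    let ?y = "map (\<lambda>i. Act P (c ! i) (bs ! i) (\<sigma>s ! i) (xs ! i)) [0..<length c]"
    have comp: "composable P c ?b ?y"
      using len act_operations[OF xsi \<sigma>s(2)] by (simp add: composable_def)
    have eq: "Gamma P t c ?b x ?y =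
        Act P t (concat bs) (sum_perm (map length bs) \<sigma>s) (Gamma P t c bs x xs)"
      by (rule gamma_act_inner[OF x(1) xs(1) \<sigma>s])
    have b: "sum_perm (map length bs) \<sigma>s permutes {..<length (concat bs)}"
      using sum_perm_permutes[of \<sigma>s "map length bs"] \<sigma>s len by (simp add: length_concat)
    have "map (\<lambda>i. cong_class P R (c ! i) (?b ! i) (?y ! i)) [0..<length c] =
        map (\<lambda>i. Act (quot_operad P R) (c ! i) (bs ! i) (\<sigma>s ! i) (Xs ! i)) [0..<length c]"
      using quot_act[OF xsi \<sigma>s(2)] by (simp add: xs(2))
    then have "Gamma (quot_operad P R) t c ?b X
        (map (\<lambda>i. Act (quot_operad P R) (c ! i) (bs ! i) (\<sigma>s ! i) (Xs ! i)) [0..<length c]) =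
        cong_class P R t (concat ?b) (Gamma P t c ?b x ?y)"
      using quot_gamma[OF x(1) comp, of R] by (simp only: x(2))
    also have "\<dots> = Act (quot_operad P R) t (concat bs) (sum_perm (map length bs) \<sigma>s)
        (Gamma (quot_operad P R) t c bs X Xs)"
      unfolding eq G
        quot_act[OF gamma_operations[OF x(1) xs(1)] b]
      using permute_list_sum_perm[of \<sigma>s bs] \<sigma>s len by simp
    finally show ?thesis .
  qed
  show "Gamma (quot_operad P R) t (concat bs) (concat ass) (Gamma (quot_operad P R) t c bs X Xs) (concat Yss) =
      Gamma (quot_operad P R) t c (map concat ass) X
        (map (\<lambda>i. Gamma (quot_operad P R) (c ! i) (bs ! i) (ass ! i) (Xs ! i) (Yss ! i)) [0..<length c])"
    if Y: "length ass = length c" "length Yss = length c"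
      "\<And>i. i < length c \<Longrightarrow> composable (quot_operad P R) (bs ! i) (ass ! i) (Yss ! i)" for ass Yss
  proof -
    have "\<forall>i\<in>{..<length c}. \<exists>ys. composable P (bs ! i) (ass ! i) ys \<and>
        Yss ! i = map (\<lambda>j. cong_class P R (bs ! i ! j) (ass ! i ! j) (ys ! j)) [0..<length (bs ! i)]"
      using quot_composable[OF Y(3)] by (metis lessThan_iff)
    then obtain f where f: "\<And>i. i < length c \<Longrightarrow> composable P (bs ! i) (ass ! i) (f i)"
        "\<And>i. i < length c \<Longrightarrow>
        Yss ! i = map (\<lambda>j. cong_class P R (bs ! i ! j) (ass ! i ! j) (f i ! j)) [0..<length (bs ! i)]"
      unfolding bchoice_iff by auto
    let ?yss = "map f [0..<length c]"
    have fi: "composable P (bs ! i) (ass ! i) (?yss ! i)" if "i < length c" for i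
      using f(1)[OF that] that by simp
    have la: "length (ass ! i) = length (bs ! i)" "length (f i) = length (bs ! i)" if "i < length c" for i
      using f(1)[OF that] by (auto simp: composable_def)
    have ma: "map length ass = map length bs" "map length ?yss = map length bs"
      using len Y la by (auto intro!: nth_equalityI)
    have lY: "map length Yss = map length bs"
      using len Y f(2) by (auto intro!: nth_equalityI)
    have inner: "(c ! i, map concat ass ! i, Gamma P (c ! i) (bs ! i) (ass ! i) (xs ! i) (?yss ! i))
        \<in> operations P" if "i < length c" for i
      using gamma_operations[OF xsi[OF that] fi[OF that]] that Y(1) by simp
    have compR: "composable P c (map concat ass)
        (map (\<lambda>i. Gamma P (c ! i) (bs ! i) (ass ! i) (xs ! i) (?yss ! i)) [0..<length c])"
      using inner Y(1) by (simp add: composable_def)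
    have nths: "concat bs ! x = bs ! i ! j \<and> concat ass ! x = ass ! i ! j \<and>
        concat ?yss ! x = f i ! j \<and> concat Yss ! x = Yss ! i ! j"
      if "i < length c" "j < length (bs ! i)" "x = sum_list (take i (map length bs)) + j" for x i j
      using nth_concat_index[of i bs j] nth_concat_index[of i ass j]
        nth_concat_index[of i ?yss j] nth_concat_index[of i Yss j] that len Y la f(2) ma lY by simp
    have ex: "\<exists>i j. i < length c \<and> j < length (bs ! i) \<and> x = sum_list (take i (map length bs)) + j"
      if "x < length (concat bs)" for x
      using index_ex[of x "map length bs"] that len by (auto simp: length_concat)
    have lens: "length (concat ass) = length (concat bs)" "length (concat ?yss) = length (concat bs)"
      "length (concat Yss) = length (concat bs)"
      unfolding length_concat ma lY by simp_all
    have fij: "(bs ! i ! j, ass ! i ! j, f i ! j) \<in> operations P"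
      if "i < length c" "j < length (bs ! i)" for i j
      using f(1)[OF that(1)] that by (simp add: composable_def)
    have compL: "composable P (concat bs) (concat ass) (concat ?yss)"
      unfolding composable_def using lens ex nths fij by metis
    have YL: "map (\<lambda>x. cong_class P R (concat bs ! x) (concat ass ! x) (concat ?yss ! x))
        [0..<length (concat bs)] = concat Yss"
    proof (rule nth_equalityI)
      fix x assume "x < length (map (\<lambda>x. cong_class P R (concat bs ! x) (concat ass ! x) (concat ?yss ! x))
        [0..<length (concat bs)])"
      then have xl: "x < length (concat bs)" by simp
      then obtain i j where ij: "i < length c" "j < length (bs ! i)"
        "x = sum_list (take i (map length bs)) + j" using ex by blast
      show "map (\<lambda>x. cong_class P R (concat bs ! x) (concat ass ! x) (concat ?yss ! x))
        [0..<length (concat bs)] ! x = concat Yss ! x"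
        using nths[OF ij] f(2)[OF ij(1)] ij(2) xl by simp
    qed (simp add: lens)
    have YR: "map (\<lambda>i. cong_class P R (c ! i) (map concat ass ! i)
          (map (\<lambda>i. Gamma P (c ! i) (bs ! i) (ass ! i) (xs ! i) (?yss ! i)) [0..<length c] ! i)) [0..<length c] =
        map (\<lambda>i. Gamma (quot_operad P R) (c ! i) (bs ! i) (ass ! i) (Xs ! i) (Yss ! i)) [0..<length c]"
    proof (rule map_cong[OF refl])
      fix i assume "i \<in> set [0..<length c]"
      then have i: "i < length c" by simp
      show "cong_class P R (c ! i) (map concat ass ! i)
          (map (\<lambda>i. Gamma P (c ! i) (bs ! i) (ass ! i) (xs ! i) (?yss ! i)) [0..<length c] ! i) =
        Gamma (quot_operad P R) (c ! i) (bs ! i) (ass ! i) (Xs ! i) (Yss ! i)"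
        using quot_gamma[OF xsi[OF i] f(1)[OF i], of R] i Y(1) by (simp add: xs(2) f(2))
    qed
    show ?thesis
      unfolding G
      using quot_gamma[OF gamma_operations[OF x(1) xs(1)] compL, of R, unfolded YL]
        quot_gamma[OF x(1) compR, of R, unfolded YR, folded x(2)]
        gamma_assoc[OF x(1) xs(1) Y(1) _ fi] by (simp add: concat_concat_map)
  qed
qed

text \<open>
  The quotient is universal with respect to operads with operations of any type \<open>'y\<close>.
  Uniqueness of the induced morphism is clear, as \<open>cong_class P R\<close> is onto.
\<close>

lemma quot_operad_universal:
  fixes Q' :: "('c, 'y) operad"
  assumes \<phi>: "operad_morphism P Q' \<phi>" "identifies R \<phi>"
  shows "\<exists>\<psi>. operad_morphism (quot_operad P R) Q' \<psi> \<and>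
    (\<forall>(t, c, x) \<in> operations P. \<psi> t c (cong_class P R t c x) = \<phi> t c x)"
proof -
  note m = \<phi>(1)[unfolded operad_morphism_def]
  have ma: "\<phi> t (permute_list \<sigma> c) (Act P t c \<sigma> x) = Act Q' t c \<sigma> (\<phi> t c x)"
    if "(t, c, x) \<in> operations P" "\<sigma> permutes {..<length c}" for t c x \<sigma>
    using m that by blast
  have mg: "\<phi> t (concat bs) (Gamma P t c bs x xs) =
      Gamma Q' t c bs (\<phi> t c x) (map (\<lambda>i. \<phi> (c ! i) (bs ! i) (xs ! i)) [0..<length c])"
    if "(t, c, x) \<in> operations P" "composable P c bs xs" for t c x bs xs
    using m that by blast
  have ker: "\<phi> t c x = \<phi> t c y" if "operad_cong P R t c x y" for t c x y
    using that
  proof (induction rule: operad_cong.induct)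
    case (cong_base t c x y)
    then show ?case using \<phi>(2) by (auto simp: identifies_def)
  next
    case (cong_act t c x y \<sigma>)
    then show ?case using ma cong_operations by metis
  next
    case (cong_gamma t c x y bs xs ys)
    have co: "composable P c bs xs" "composable P c bs ys"
      using cong_gamma(2-4) cong_operations[OF cong_gamma(5)] by (simp_all add: composable_def)
    have eq: "map (\<lambda>i. \<phi> (c ! i) (bs ! i) (xs ! i)) [0..<length c] =
        map (\<lambda>i. \<phi> (c ! i) (bs ! i) (ys ! i)) [0..<length c]"
      using cong_gamma by simp
    have op: "(t, c, x) \<in> operations P" "(t, c, y) \<in> operations P"
      using cong_operations[OF cong_gamma(1)] by auto
    show ?case unfolding mg[OF op(1) co(1)] mg[OF op(2) co(2)] eq cong_gamma.IH(1) ..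
  qed auto
  define \<psi> where "\<psi> t c X = \<phi> t c (SOME x. x \<in> X)" for t c X
  have \<psi>: "\<psi> t c (cong_class P R t c x) = \<phi> t c x" if "(t, c, x) \<in> operations P" for t c x
    using ker[OF class_rep[OF that]] by (simp add: \<psi>_def)
  have "operad_morphism (quot_operad P R) Q' \<psi>"
    unfolding operad_morphism_def
  proof (intro conjI ballI allI impI; clarify?)
    show "colored_operad (quot_operad P R)" by (rule quot_colored_operad)
    show "colored_operad Q'" using m by blast
    show "Colors (quot_operad P R) = Colors Q'" using m by simp
  next
    fix t c X assume "(t, c, X) \<in> operations (quot_operad P R)"
    then obtain x where x: "(t, c, x) \<in> operations P" "X = cong_class P R t c x"
      unfolding quot_operations by blast
    show "\<psi> t c X \<in> Ops Q' t c" using m x \<psi> by auto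
    show "\<psi> t (permute_list \<sigma> c) (Act (quot_operad P R) t c \<sigma> X) = Act Q' t c \<sigma> (\<psi> t c X)"
      if \<sigma>: "\<sigma> permutes {..<length c}" for \<sigma>
      unfolding x(2) quot_act[OF x(1) \<sigma>] \<psi>[OF x(1)] \<psi>[OF act_operations[OF x(1) \<sigma>]]
      by (rule ma[OF x(1) \<sigma>])
    show "\<psi> t (concat bs) (Gamma (quot_operad P R) t c bs X Xs) =
        Gamma Q' t c bs (\<psi> t c X) (map (\<lambda>i. \<psi> (c ! i) (bs ! i) (Xs ! i)) [0..<length c])"
      if Xs: "composable (quot_operad P R) c bs Xs" for bs Xs
    proof -
      obtain xs where xs: "composable P c bs xs"
        "Xs = map (\<lambda>i. cong_class P R (c ! i) (bs ! i) (xs ! i)) [0..<length c]"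
        using quot_composable[OF Xs] .
      have eq: "map (\<lambda>i. \<psi> (c ! i) (bs ! i) (Xs ! i)) [0..<length c] =
          map (\<lambda>i. \<phi> (c ! i) (bs ! i) (xs ! i)) [0..<length c]"
        using xs(1) by (auto simp: xs(2) composable_def intro!: \<psi>)
      show ?thesis
        unfolding eq mg[OF x(1) xs(1), folded \<psi>[OF gamma_operations[OF x(1) xs(1)]],
            folded quot_gamma[OF x(1) xs(1), of R] xs(2), folded x(2)] x(2) \<psi>[OF x(1)]
        using mg[OF x(1) xs(1)] \<psi>[OF gamma_operations[OF x(1) xs(1)]]
          quot_gamma[OF x(1) xs(1), of R, folded xs(2)] by (simp only:)
    qed
  next
    fix t assume "t \<in> Colors (quot_operad P R)"
    then show "\<psi> t [t] (OUnit (quot_operad P R) t) = OUnit Q' t"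
      using m \<psi>[OF unit_operations] by (simp add: quot_unit)
  qed
  then show ?thesis using \<psi> by blast
qed

lemma quot_operad_coequalizer:
  assumes R: "\<And>t c x y. (t, c, x, y) \<in> R \<Longrightarrow> (t, c, x) \<in> operations P \<and> (t, c, y) \<in> operations P"
  shows "is_operad_coequalizer P R (quot_operad P R) (cong_class P R)"
proof -
  have q: "operad_morphism P (quot_operad P R) (cong_class P R)"
    unfolding operad_morphism_def
    using colored_operad_axioms quot_colored_operad quot_act quot_gamma quot_unit
    by (auto simp: operations_def quot_operad_def)
  have id: "identifies R (cong_class P R)"
    unfolding identifies_def using R class_eq cong_base by fastforce
  show ?thesis
    unfolding is_operad_coequalizer_def using q id quot_operad_universal by (fastforce simp: quot_operations)
qed

end


subsection \<open>The operad of a category and its coequalizer\<close>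

definition gam_list :: "('c, 'd, 'y) cat_scheme \<Rightarrow> 'd list \<Rightarrow> 'd list list \<Rightarrow> 'd list" where
  "gam_list C fs gss = concat (map (\<lambda>i. map (\<lambda>g. fs ! i \<cdot>\<^bsub>C\<^esub> g) (gss ! i)) [0..<length gss])"

lemma cat_operad_simps:
  "Colors (cat_operad C) = Ob C"
  "(\<sigma>, fs) \<in> Ops (cat_operad C) t c \<longleftrightarrow> \<sigma> permutes {..<length c} \<and> length fs = length c \<and>
     (\<forall>i < length c. fs ! i \<in> Hom C (c ! i) t)"
  "Act (cat_operad C) t c \<sigma>' (\<sigma>, fs) = (\<sigma> \<circ> \<sigma>', permute_list \<sigma>' fs)"
  "length xs = length c \<Longrightarrow> Gamma (cat_operad C) t c bs (\<sigma>, fs) xs =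
     (gam_perm (map length bs) \<sigma> (map fst xs), gam_list C fs (map snd xs))"
  "OUnit (cat_operad C) t = (id, [Ident C t])"
  by (auto simp: cat_operad_def gam_perm_def gam_list_def intro!: arg_cong[where f = concat])

lemma cat_operad_operations:
  "(t, c, (\<sigma>, fs)) \<in> operations (cat_operad C) \<longleftrightarrow>
    t \<in> Ob C \<and> set c \<subseteq> Ob C \<and> \<sigma> permutes {..<length c} \<and> length fs = length c \<and>
     (\<forall>i < length c. fs ! i \<in> Hom C (c ! i) t)"
  by (auto simp: operations_def cat_operad_simps)

lemma cat_operad_composable:
  "composable (cat_operad C) c bs xs \<longleftrightarrow> length bs = length c \<and> length xs = length c \<and>
    (\<forall>i < length c. c ! i \<in> Ob C \<and> set (bs ! i) \<subseteq> Ob C \<and>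
       fst (xs ! i) permutes {..<length (bs ! i)} \<and> length (snd (xs ! i)) = length (bs ! i) \<and>
       (\<forall>j < length (bs ! i). snd (xs ! i) ! j \<in> Hom C (bs ! i ! j) (c ! i)))"
  unfolding composable_def
  by (subst (2) prod.collapse[symmetric], simp only: cat_operad_operations)

lemma set_concat_subset:
  "(\<And>i. i < length bs \<Longrightarrow> set (bs ! i) \<subseteq> A) \<Longrightarrow> set (concat bs) \<subseteq> A"
  by (auto simp: set_conv_nth[of bs])

lemma gam_list_lengths:
  "map length (map (\<lambda>i. map (\<lambda>g. fs ! i \<cdot>\<^bsub>C\<^esub> g) (gss ! i)) [0..<length gss]) = map length gss"
  by (intro nth_equalityI) auto

lemma length_gam_list: "length (gam_list C fs gss) = sum_list (map length gss)"
  unfolding gam_list_def length_concat gam_list_lengths ..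

lemma gam_list_index:
  assumes "i < length gss" "r < length (gss ! i)"
  shows "gam_list C fs gss ! (sum_list (take i (map length gss)) + r) = fs ! i \<cdot>\<^bsub>C\<^esub> (gss ! i ! r)"
  using nth_concat_index[of i "map (\<lambda>i. map (\<lambda>g. fs ! i \<cdot>\<^bsub>C\<^esub> g) (gss ! i)) [0..<length gss]" r] assms
  unfolding gam_list_def gam_list_lengths by simp

lemma gam_list_hom:
  assumes "category C" "length fs = length gss" "length bs = length gss" "length c = length gss"
    "\<And>i. i < length gss \<Longrightarrow> fs ! i \<in> Hom C (c ! i) t"
    "\<And>i. i < length gss \<Longrightarrow> length (gss ! i) = length (bs ! i)"
    "\<And>i j. \<lbrakk>i < length gss; j < length (gss ! i)\<rbrakk> \<Longrightarrow> gss ! i ! j \<in> Hom C (bs ! i ! j) (c ! i)"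
    "x < length (concat bs)"
  shows "gam_list C fs gss ! x \<in> Hom C (concat bs ! x) t"
proof -
  have ml: "map length gss = map length bs"
    using assms by (intro nth_equalityI) auto
  obtain i r where ir: "i < length bs" "r < length (bs ! i)"
    "x = sum_list (take i (map length bs)) + r"
    using index_ex[of x "map length bs"] assms(8) by (auto simp: length_concat)
  have "gam_list C fs gss ! x = fs ! i \<cdot>\<^bsub>C\<^esub> (gss ! i ! r)"
    using gam_list_index[of i gss r C fs] assms ir ml by simp
  moreover have "concat bs ! x = bs ! i ! r"
    using nth_concat_index[OF ir(1,2)] ir(3) by simp
  ultimately show ?thesis
    using category.comp_hom[OF assms(1) assms(7) assms(5)] ir assms(3,6) by simp
qed

lemma gam_list_assoc:
  assumes C: "category C" and len: "length fs = length gss" "length hsss = length gss"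
    "\<And>i. i < length gss \<Longrightarrow> length (hsss ! i) = length (gss ! i)"
    and hom: "\<And>i. i < length gss \<Longrightarrow> fs ! i \<in> Hom C (c i) t"
    "\<And>i j. \<lbrakk>i < length gss; j < length (gss ! i)\<rbrakk> \<Longrightarrow> gss ! i ! j \<in> Hom C (b i j) (c i)"
    "\<And>i j k. \<lbrakk>i < length gss; j < length (gss ! i); k < length (hsss ! i ! j)\<rbrakk> \<Longrightarrow>
      hsss ! i ! j ! k \<in> Hom C (a i j k) (b i j)"
  shows "gam_list C (gam_list C fs gss) (concat hsss) =
    gam_list C fs (map (\<lambda>i. gam_list C (gss ! i) (hsss ! i)) [0..<length gss])"
proof -
  have ml: "map length hsss = map length gss"
    using len by (intro nth_equalityI) auto
  have lc: "length (concat hsss) = sum_list (map length gss)"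
    by (simp add: length_concat ml)
  have "gam_list C (gam_list C fs gss) (concat hsss) =
      concat (map (\<lambda>x. map (\<lambda>h. gam_list C fs gss ! x \<cdot>\<^bsub>C\<^esub> h) (concat hsss ! x))
        (concat (map (\<lambda>i. map (\<lambda>r. sum_list (take i (map length gss)) + r) [0..<map length gss ! i])
          [0..<length (map length gss)])))"
    unfolding gam_list_def[of C "gam_list C fs gss"] lc upt_index ..
  also have "\<dots> = concat (map (\<lambda>i. concat (map (\<lambda>r.
      map (\<lambda>h. gam_list C fs gss ! (sum_list (take i (map length gss)) + r) \<cdot>\<^bsub>C\<^esub> h)
        (concat hsss ! (sum_list (take i (map length gss)) + r))) [0..<length (gss ! i)])) [0..<length gss])"
    by (auto simp: map_concat concat_concat_map o_def intro!: arg_cong[where f = concat])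
  also have "\<dots> = concat (map (\<lambda>i. map (\<lambda>g. fs ! i \<cdot>\<^bsub>C\<^esub> g) (gam_list C (gss ! i) (hsss ! i))) [0..<length gss])"
  proof (intro arg_cong[where f = concat] map_cong refl)
    fix i assume "i \<in> set [0..<length gss]"
    then have i: "i < length gss" by simp
    have key: "map (\<lambda>h. gam_list C fs gss ! (sum_list (take i (map length gss)) + r) \<cdot>\<^bsub>C\<^esub> h)
        (concat hsss ! (sum_list (take i (map length gss)) + r)) =
        map (\<lambda>h. fs ! i \<cdot>\<^bsub>C\<^esub> (gss ! i ! r \<cdot>\<^bsub>C\<^esub> h)) (hsss ! i ! r)"
      if r: "r < length (gss ! i)" for r
    proof -
      have c: "concat hsss ! (sum_list (take i (map length gss)) + r) = hsss ! i ! r"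
        using nth_concat_index[of i hsss r] i r len ml by simp
      show ?thesis
        unfolding c gam_list_index[OF i r]
      proof (intro map_cong refl)
        fix h assume "h \<in> set (hsss ! i ! r)"
        then obtain k where "k < length (hsss ! i ! r)" "h = hsss ! i ! r ! k"
          by (auto simp: in_set_conv_nth)
        then show "fs ! i \<cdot>\<^bsub>C\<^esub> gss ! i ! r \<cdot>\<^bsub>C\<^esub> h = fs ! i \<cdot>\<^bsub>C\<^esub> (gss ! i ! r \<cdot>\<^bsub>C\<^esub> h)"
          using category.comp_assoc[OF C hom(3)[OF i r] hom(2)[OF i r] hom(1)[OF i]] by simp
      qed
    qed
    show "concat (map (\<lambda>r. map (\<lambda>h. gam_list C fs gss ! (sum_list (take i (map length gss)) + r) \<cdot>\<^bsub>C\<^esub> h)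
        (concat hsss ! (sum_list (take i (map length gss)) + r))) [0..<length (gss ! i)]) =
        map (\<lambda>g. fs ! i \<cdot>\<^bsub>C\<^esub> g) (gam_list C (gss ! i) (hsss ! i))"
      unfolding gam_list_def[of C "gss ! i"] map_concat map_map o_def len(3)[OF i]
      by (rule arg_cong[where f = concat], rule map_cong[OF refl], rule key) simp
  qed
  also have "\<dots> = gam_list C fs (map (\<lambda>i. gam_list C (gss ! i) (hsss ! i)) [0..<length gss])"
    unfolding gam_list_def[of C fs] by (auto intro!: arg_cong[where f = concat])
  finally show ?thesis .
qed

lemma gam_list_outer:
  assumes \<sigma>: "\<sigma> permutes {..<length gss}" and len: "length fs = length gss"
  shows "gam_list C (permute_list \<sigma> fs) (permute_list \<sigma> gss) =
    permute_list (block_perm (map length (permute_list \<sigma> gss)) \<sigma>) (gam_list C fs gss)"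
proof -
  let ?xss = "map (\<lambda>i. map (\<lambda>g. fs ! i \<cdot>\<^bsub>C\<^esub> g) (gss ! i)) [0..<length gss]"
  have px: "permute_list \<sigma> ?xss =
      map (\<lambda>i. map (\<lambda>g. permute_list \<sigma> fs ! i \<cdot>\<^bsub>C\<^esub> g) (permute_list \<sigma> gss ! i)) [0..<length gss]"
    using perm_less[OF \<sigma>] len \<sigma>
    by (intro nth_equalityI) (auto simp: permute_list_nth)
  have "map length (permute_list \<sigma> ?xss) = map length (permute_list \<sigma> gss)"
    using \<sigma> gam_list_lengths[of C fs gss] by (simp flip: permute_list_map)
  then show ?thesis
    using permute_list_block_perm[of \<sigma> ?xss] \<sigma> unfolding gam_list_def px by simp
qed

lemma gam_list_inner:
  assumes len: "length \<sigma>s = length gss"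
    and \<sigma>s: "\<And>i. i < length gss \<Longrightarrow> (\<sigma>s ! i) permutes {..<length (gss ! i)}"
  shows "gam_list C fs (map (\<lambda>i. permute_list (\<sigma>s ! i) (gss ! i)) [0..<length gss]) =
    permute_list (sum_perm (map length gss) \<sigma>s) (gam_list C fs gss)"
proof -
  let ?xss = "map (\<lambda>i. map (\<lambda>g. fs ! i \<cdot>\<^bsub>C\<^esub> g) (gss ! i)) [0..<length gss]"
  have "permute_list (sum_perm (map length gss) \<sigma>s) (gam_list C fs gss) =
      concat (map (\<lambda>i. permute_list (\<sigma>s ! i) (?xss ! i)) [0..<length ?xss])"
    using permute_list_sum_perm[of \<sigma>s ?xss] len \<sigma>s gam_list_lengths[of C fs gss]
    by (simp add: gam_list_def)
  also have "\<dots> = gam_list C fs (map (\<lambda>i. permute_list (\<sigma>s ! i) (gss ! i)) [0..<length gss])"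
    unfolding gam_list_def using \<sigma>s
    by (intro arg_cong[where f = concat] map_cong) (auto simp: permute_list_map)
  finally show ?thesis by simp
qed

lemma gam_perm_unit_left: "gam_perm [k] id [\<sigma>] j = (if j < k then \<sigma> j else j)"
  if "\<sigma> permutes {..<k}"
  using perm_less[OF that, of j]
  by (auto simp: gam_perm_def sum_perm_def block_perm_def)

lemma gam_perm_unit_right:
  assumes \<sigma>: "\<sigma> permutes {..<n}"
  shows "gam_perm (replicate n 1) \<sigma> (replicate n id) = \<sigma>"
proof (rule perm_eqI)
  show "gam_perm (replicate n 1) \<sigma> (replicate n id) permutes {..<sum_list (replicate n (1::nat))}"
    using \<sigma> by (intro gam_perm_permutes) (auto simp: permutes_id)
  show "\<sigma> permutes {..<sum_list (replicate n (1::nat))}" using \<sigma> by (simp add: sum_list_replicate)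
  fix i r assume "i < length (replicate n (1::nat))" "r < replicate n (1::nat) ! i"
  then have i: "i < n" and r: "r = 0" by auto
  have "(\<Sum>i'<n. if \<sigma> i' < \<sigma> i then replicate n (1::nat) ! i' else 0) =
      (\<Sum>i'<n. ((\<lambda>x. if x < \<sigma> i then 1 else 0) \<circ> \<sigma>) i')"
    by (intro sum.cong) auto
  also have "\<dots> = (\<Sum>x<n. if x < \<sigma> i then 1 else 0)"
    by (rule sum.permute[OF \<sigma>, symmetric])
  also have "\<dots> = card {x \<in> {..<n}. x < \<sigma> i}"
    by (subst sum.inter_filter[symmetric]) auto
  also have "{x \<in> {..<n}. x < \<sigma> i} = {..<\<sigma> i}" using perm_less[OF \<sigma> i] by auto
  finally have *: "(\<Sum>i'<n. if \<sigma> i' < \<sigma> i then replicate n (1::nat) ! i' else 0) = \<sigma> i" by simp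
  have "gam_perm (replicate n 1) \<sigma> (replicate n id) (sum_list (take i (replicate n 1)) + r) = \<sigma> i"
    using gam_perm_index[of i "replicate n 1" r "replicate n id" \<sigma>] i r * by (simp add: permutes_id)
  then show "gam_perm (replicate n 1) \<sigma> (replicate n id) (sum_list (take i (replicate n 1)) + r) =
      \<sigma> (sum_list (take i (replicate n 1)) + r)"
    using i r by (simp add: sum_list_replicate min_def)
qed


lemma cat_operad_operad:
  assumes C: "category C"
  shows "colored_operad (cat_operad C)"
proof
  fix t c x \<sigma>
  assume x: "(t, c, x) \<in> operations (cat_operad C)" and \<sigma>: "\<sigma> permutes {..<length c}"
  obtain p fs where xp: "x = (p, fs)" by fastforce
  note op = x[unfolded xp cat_operad_operations]
  show "Act (cat_operad C) t c \<sigma> x \<in> Ops (cat_operad C) t (permute_list \<sigma> c)"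
    using op \<sigma> perm_less[OF \<sigma>]
    by (simp add: xp cat_operad_simps permutes_compose permute_list_nth)
  show "Act (cat_operad C) t (permute_list \<sigma> c) \<tau> (Act (cat_operad C) t c \<sigma> x) =
      Act (cat_operad C) t c (\<sigma> \<circ> \<tau>) x" if \<tau>: "\<tau> permutes {..<length c}" for \<tau>
    using op \<tau> by (simp add: xp cat_operad_simps o_assoc permute_list_compose)
next
  fix t c x
  assume x: "(t, c, x) \<in> operations (cat_operad C)"
  obtain p fs where xp: "x = (p, fs)" by fastforce
  note op = x[unfolded xp cat_operad_operations]
  show "Act (cat_operad C) t c id x = x" by (simp add: xp cat_operad_simps)
  have "gam_perm [length c] id [p] = p"
    using gam_perm_unit_left[of p "length c"] permutes_not_in[of p "{..<length c}"] op by fastforce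
  moreover have "gam_list C [Ident C t] [fs] = fs"
    unfolding gam_list_def using op category.id_comp[OF C] by (auto intro!: nth_equalityI)
  ultimately show "Gamma (cat_operad C) t [t] [c] (OUnit (cat_operad C) t) [x] = x"
    by (simp add: xp cat_operad_simps)
  have "map length (map (\<lambda>a. [a]) c) = replicate (length c) 1"
    "map fst (map (OUnit (cat_operad C)) c) = replicate (length c) id"
    by (auto intro!: nth_equalityI simp: cat_operad_simps)
  moreover have "gam_list C fs (map snd (map (OUnit (cat_operad C)) c)) = fs"
  proof -
    have "map (\<lambda>i. map (\<lambda>g. fs ! i \<cdot>\<^bsub>C\<^esub> g) (map snd (map (OUnit (cat_operad C)) c) ! i)) [0..<length c] =
        map (\<lambda>i. [fs ! i]) [0..<length c]"
      using op category.comp_id[OF C] by (auto simp: cat_operad_simps)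
    moreover have "length fs = length c" using op by blast
    ultimately show ?thesis
      unfolding gam_list_def length_map using map_nth[of fs] by (simp only: concat_map_singleton)
  qed
  ultimately show "Gamma (cat_operad C) t c (map (\<lambda>a. [a]) c) x (map (OUnit (cat_operad C)) c) = x"
    using op gam_perm_unit_right[of p "length c"] by (simp add: xp cat_operad_simps del: map_map)
next
  fix t assume "t \<in> Colors (cat_operad C)"
  then show "OUnit (cat_operad C) t \<in> Ops (cat_operad C) t [t]"
    using category.id_hom[OF C] by (simp add: cat_operad_simps permutes_id)
next
  fix t c x bs xs
  assume x: "(t, c, x) \<in> operations (cat_operad C)" and xs: "composable (cat_operad C) c bs xs"
  obtain p fs where xp: "x = (p, fs)" by fastforce
  note op = x[unfolded xp cat_operad_operations] and co = xs[unfolded cat_operad_composable]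
  have ml: "map length (map snd xs) = map length bs"
    using co by (intro nth_equalityI) auto
  have G: "Gamma (cat_operad C) t c bs x xs =
      (gam_perm (map length bs) p (map fst xs), gam_list C fs (map snd xs))"
    using co by (simp add: xp cat_operad_simps)
  show "Gamma (cat_operad C) t c bs x xs \<in> Ops (cat_operad C) t (concat bs)"
    unfolding G cat_operad_simps
  proof (intro conjI allI impI)
    show "gam_perm (map length bs) p (map fst xs) permutes {..<length (concat bs)}"
      unfolding length_concat using op co by (intro gam_perm_permutes) auto
    show "length (gam_list C fs (map snd xs)) = length (concat bs)"
      unfolding length_gam_list ml length_concat ..
    show "gam_list C fs (map snd xs) ! i \<in> Hom C (concat bs ! i) t" if "i < length (concat bs)" for i
      by (rule gam_list_hom[where c = c, OF C]) (use op co that in auto)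
  qed
  show "Gamma (cat_operad C) t (permute_list \<sigma> c) (permute_list \<sigma> bs)
        (Act (cat_operad C) t c \<sigma> x) (permute_list \<sigma> xs) =
      Act (cat_operad C) t (concat bs) (block_perm (map length (permute_list \<sigma> bs)) \<sigma>)
        (Gamma (cat_operad C) t c bs x xs)" if \<sigma>: "\<sigma> permutes {..<length c}" for \<sigma>
  proof -
    have len: "length bs = length c" "length xs = length c" using co by auto
    have m: "map length (permute_list \<sigma> bs) = permute_list \<sigma> (map length bs)"
      "map fst (permute_list \<sigma> xs) = permute_list \<sigma> (map fst xs)"
      "map snd (permute_list \<sigma> xs) = permute_list \<sigma> (map snd xs)"
      using \<sigma> len by (simp_all add: permute_list_map)
    have mg: "map length (permute_list \<sigma> (map snd xs)) = permute_list \<sigma> (map length bs)"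
      using \<sigma> len unfolding ml[symmetric] by (subst permute_list_map) auto
    have "gam_perm (permute_list \<sigma> (map length bs)) (p \<circ> \<sigma>) (permute_list \<sigma> (map fst xs)) =
        gam_perm (map length bs) p (map fst xs) \<circ> block_perm (permute_list \<sigma> (map length bs)) \<sigma>"
      using op co \<sigma> by (intro gam_perm_outer) auto
    moreover have "gam_list C (permute_list \<sigma> fs) (permute_list \<sigma> (map snd xs)) =
        permute_list (block_perm (permute_list \<sigma> (map length bs)) \<sigma>) (gam_list C fs (map snd xs))"
      using gam_list_outer[of \<sigma> "map snd xs" fs C] op co \<sigma> unfolding mg by simp
    ultimately show ?thesis
      unfolding G by (simp add: xp cat_operad_simps m len)
  qed
  show "Gamma (cat_operad C) t c (map (\<lambda>i. permute_list (\<sigma>s ! i) (bs ! i)) [0..<length c]) x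
        (map (\<lambda>i. Act (cat_operad C) (c ! i) (bs ! i) (\<sigma>s ! i) (xs ! i)) [0..<length c]) =
      Act (cat_operad C) t (concat bs) (sum_perm (map length bs) \<sigma>s)
        (Gamma (cat_operad C) t c bs x xs)"
    if \<sigma>s: "length \<sigma>s = length c" "\<And>i. i < length c \<Longrightarrow> (\<sigma>s ! i) permutes {..<length (bs ! i)}" for \<sigma>s
  proof -
    have len: "length bs = length c" "length xs = length c" using co by auto
    let ?ys = "map (\<lambda>i. Act (cat_operad C) (c ! i) (bs ! i) (\<sigma>s ! i) (xs ! i)) [0..<length c]"
    have act: "Act (cat_operad C) (c ! i) (bs ! i) (\<sigma>s ! i) (xs ! i) =
        (fst (xs ! i) \<circ> \<sigma>s ! i, permute_list (\<sigma>s ! i) (snd (xs ! i)))" for i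
      by (subst prod.collapse[of "xs ! i", symmetric]) (simp only: cat_operad_simps)
    have m: "map length (map (\<lambda>i. permute_list (\<sigma>s ! i) (bs ! i)) [0..<length c]) = map length bs"
      "map fst ?ys = map (\<lambda>i. map fst xs ! i \<circ> \<sigma>s ! i) [0..<length (map length bs)]"
      "map snd ?ys = map (\<lambda>i. permute_list (\<sigma>s ! i) (map snd xs ! i)) [0..<length (map snd xs)]"
      using len by (auto intro!: nth_equalityI simp: act)
    have "gam_perm (map length bs) p (map (\<lambda>i. map fst xs ! i \<circ> \<sigma>s ! i) [0..<length (map length bs)]) =
        gam_perm (map length bs) p (map fst xs) \<circ> sum_perm (map length bs) \<sigma>s"
      using op co \<sigma>s by (intro gam_perm_inner) auto
    moreover have "gam_list C fs (map (\<lambda>i. permute_list (\<sigma>s ! i) (map snd xs ! i)) [0..<length (map snd xs)]) =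
        permute_list (sum_perm (map length bs) \<sigma>s) (gam_list C fs (map snd xs))"
      using gam_list_inner[of \<sigma>s "map snd xs" C fs] co \<sigma>s unfolding ml by simp
    ultimately show ?thesis
      unfolding G unfolding xp by (subst cat_operad_simps(4)) (simp_all only: m cat_operad_simps, simp_all)
  qed
  show "Gamma (cat_operad C) t (concat bs) (concat ass) (Gamma (cat_operad C) t c bs x xs) (concat yss) =
      Gamma (cat_operad C) t c (map concat ass) x
        (map (\<lambda>i. Gamma (cat_operad C) (c ! i) (bs ! i) (ass ! i) (xs ! i) (yss ! i)) [0..<length c])"
    if ys: "length ass = length c" "length yss = length c"
      "\<And>i. i < length c \<Longrightarrow> composable (cat_operad C) (bs ! i) (ass ! i) (yss ! i)" for ass yss
  proof -
    note cy = ys(3)[unfolded cat_operad_composable]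
    have len: "length bs = length c" "length xs = length c" using co by auto
    have la: "length (ass ! i) = length (bs ! i)" "length (yss ! i) = length (bs ! i)"
      "length (snd (xs ! i)) = length (bs ! i)" if "i < length c" for i
      using cy[OF that] co that by auto
    let ?ls = "map (map length) ass"
    have mls: "map length ?ls = map length bs" "map length yss = map length bs"
      using len ys la by (auto intro!: nth_equalityI)
    have lcy: "length (concat yss) = length (concat bs)"
      by (simp only: length_concat mls)
    have inner: "Gamma (cat_operad C) (c ! i) (bs ! i) (ass ! i) (xs ! i) (yss ! i) =
        (gam_perm (?ls ! i) (map fst xs ! i) (map (map fst) yss ! i),
         gam_list C (map snd xs ! i) (map (map snd) yss ! i))" if "i < length c" for i
      using that len ys la[OF that]
      by (subst prod.collapse[of "xs ! i", symmetric]) (simp add: cat_operad_simps del: prod.collapse)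
    let ?zs = "map (\<lambda>i. Gamma (cat_operad C) (c ! i) (bs ! i) (ass ! i) (xs ! i) (yss ! i)) [0..<length c]"
    have m: "map length (concat ass) = concat ?ls" "map fst (concat yss) = concat (map (map fst) yss)"
      "map snd (concat yss) = concat (map (map snd) yss)"
      "map length (map concat ass) = map sum_list ?ls"
      by (auto simp: map_concat length_concat)
    have mz: "map fst ?zs = map (\<lambda>i. gam_perm (?ls ! i) (map fst xs ! i) (map (map fst) yss ! i)) [0..<length ?ls]"
      "map snd ?zs = map (\<lambda>i. gam_list C (map snd xs ! i) (map (map snd) yss ! i)) [0..<length (map snd xs)]"
      using len ys by (auto intro!: nth_equalityI simp: inner)
    have "gam_perm (concat ?ls) (gam_perm (map length ?ls) p (map fst xs)) (concat (map (map fst) yss)) =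
        gam_perm (map sum_list ?ls) p
          (map (\<lambda>i. gam_perm (?ls ! i) (map fst xs ! i) (map (map fst) yss ! i)) [0..<length ?ls])"
      by (rule gam_perm_assoc) (use op co cy ys la len in auto)
    moreover have "gam_list C (gam_list C fs (map snd xs)) (concat (map (map snd) yss)) =
        gam_list C fs (map (\<lambda>i. gam_list C (map snd xs ! i) (map (map snd) yss ! i)) [0..<length (map snd xs)])"
      by (rule gam_list_assoc[where c = "\<lambda>i. c ! i" and b = "\<lambda>i j. bs ! i ! j" and
            a = "\<lambda>i j k. ass ! i ! j ! k" and t = t, OF C])
        (use op co cy ys la len in auto)
    ultimately show ?thesis
      unfolding G unfolding xp mls(1)[symmetric]
      by (simp only: cat_operad_simps lcy length_map length_upt diff_zero m mz)
  qed
qed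

theorem perp_operad_coequalizer:
  assumes "orthogonal_category C"
  shows "is_operad_coequalizer (cat_operad C) (perp_relations C)
    (quot_operad (cat_operad C) (perp_relations C)) (cong_class (cat_operad C) (perp_relations C))"
proof -
  interpret orthogonal_category C by (rule assms)
  interpret colored_operad "cat_operad C" by (rule cat_operad_operad) unfold_locales
  have "transpose 0 (1::nat) permutes {..<2}" by (rule permutes_swap_id) auto
  then show ?thesis
    using perp_ar dom_ob cod_ob
    by (intro quot_operad_coequalizer)
      (auto simp: perp_relations_def cat_operad_operations permutes_id Hom_def nth_Cons'
        numeral_2_eq_2 less_Suc_eq)
qed

end

theory Submission
  imports Defs
begin

text \<open>
  An algebra over \<open>\<O>\<^sub>C\<close> is determined by the operations \<open>(e, (id\<^sub>c, id\<^sub>c))\<close>, \<open>(e, ())\<close> and \<open>(e, f)\<close>,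
  since every \<open>(e, (f\<^sub>1, \<dots>, f\<^sub>n))\<close> is composed from these and equivariance gives the remaining ones;
  they make the objects \<open>A\<^sub>c\<close> monoids and the arrows \<open>\<alpha>(e, f)\<close> monoid morphisms. Conversely a diagram
  of monoids lets \<open>(\<sigma>, (f\<^sub>1, \<dots>, f\<^sub>n))\<close> act by permuting the factors with \<open>\<sigma>\<close>, applying the arrows
  \<open>f\<^sub>i\<close> and multiplying; that this is equivariant and associative is the coherence theorem for
  symmetric monoidal categories. It is proved by replacing the objects \<open>x\<close> by the functors \<open>x \<otimes> -\<close>,
  for which concatenation of words is strictly associative: sorting a word is invariant under
  precomposition with a transposition of adjacent letters (by the Yang-Baxter equation), hence any
  two composites of such transpositions that realize the same permutation agree.

  The operations \<open>(e, (f\<^sub>1, f\<^sub>2))\<close> and \<open>(\<tau>, (f\<^sub>1, f\<^sub>2))\<close> act equally if and only if the diagram is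
  commutative on the pair \<open>(f\<^sub>1, f\<^sub>2)\<close>. As the coequalizer is the quotient by the congruence that
  these pairs generate, its algebras are the \<open>\<perp>\<close>-commutative functors.
\<close>

text \<open>The coherence arrows of the definitions are concrete: \<open>tens\<close> treats lists
  of length 0 and 1 separately, and \<open>perm_iso\<close> is one particular insertion sort.
  Neither fits the block permutations that operadic composition produces. The functors x \<otimes> -
  remove the first difficulty at the price of a tail: statements about \<open>append_iso\<close>,
  \<open>concat_iso\<close> and \<open>perm_iso\<close> are conjugated by the invertible arrow
  \<open>untail\<close> into statements about tails. Labels remove the second: each factor is
  labelled by the position it finally takes, so (\<sigma>, fs) acts by sorting the word \<sigma> 0,
  \<sigma> 1, ... and multiplying. For composition, sorting inside blocks and sorting whole blocks
  must both be refined to transpositions of single letters.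

  The coequalizer is given only by its universal property among operads of its own type. Comparison
  with the explicit quotient yields the two facts needed: q is onto, and it identifies only
  congruent operations. Functors to monoids are unpacked into families of arrows, so that both
  categories are described by the same data.\<close>

declare set_insort_key [simp] and ball_Un [simp]

section \<open>Composition, inverses and cancellation in a category\<close>

section \<open>Calculus of arrows\<close>

context category
begin

lemma Hom_iff: "f \<in> Hom C x y \<longleftrightarrow> f \<in> Ar C \<and> Dom C f = x \<and> Cod C f = y"
  by (auto simp: Hom_def)

lemma comp_ar [simp]:
  assumes "f \<in> Ar C" "g \<in> Ar C" "Dom C g = Cod C f"
  shows "g \<cdot> f \<in> Ar C" "Dom C (g \<cdot> f) = Dom C f" "Cod C (g \<cdot> f) = Cod C g"
  using comp_hom[of f "Dom C f" "Cod C f" g "Cod C g"] assms by (auto simp: Hom_def)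

lemma id_ar [simp]:
  assumes "x \<in> Ob C"
  shows "Ident C x \<in> Ar C" "Dom C (Ident C x) = x" "Cod C (Ident C x) = x"
  using id_hom[OF assms] by (auto simp: Hom_def)

lemma ar_ob [simp]: "f \<in> Ar C \<Longrightarrow> Dom C f \<in> Ob C" "f \<in> Ar C \<Longrightarrow> Cod C f \<in> Ob C"
  by (rule dom_ob cod_ob, assumption)+

lemma comp_id_ar [simp]: "\<lbrakk>f \<in> Ar C; Dom C f = x\<rbrakk> \<Longrightarrow> f \<cdot> Ident C x = f"
  by (rule comp_id[of f x "Cod C f"]) (simp add: Hom_iff)

lemma id_comp_ar [simp]: "\<lbrakk>f \<in> Ar C; Cod C f = x\<rbrakk> \<Longrightarrow> Ident C x \<cdot> f = f"
  by (rule id_comp[of f "Dom C f"]) (simp add: Hom_iff)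

lemma comp_assoc_ar [simp]:
  "\<lbrakk>f \<in> Ar C; g \<in> Ar C; h \<in> Ar C; Dom C g = Cod C f; Dom C h = Cod C g\<rbrakk>
    \<Longrightarrow> (h \<cdot> g) \<cdot> f = h \<cdot> (g \<cdot> f)"
  by (rule comp_assoc[of f "Dom C f" "Cod C f" g "Cod C g" h "Cod C h"]) (simp_all add: Hom_iff)

text \<open>Simplification nests composites to the right, and then \<open>g \<cdot> f\<close> is no
  longer a subterm of \<open>g \<cdot> (f \<cdot> h)\<close>. Applied with THEN, this rule turns an
  equation between composites into its variant for use inside a longer composite.\<close>

lemma comp_reassoc:
  "\<lbrakk>g \<cdot> f = k; f \<in> Ar C; g \<in> Ar C; Dom C g = Cod C f; h \<in> Ar C; Cod C h = Dom C f\<rbrakk>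
    \<Longrightarrow> g \<cdot> (f \<cdot> h) = k \<cdot> h"
  using comp_assoc_ar[of h f g] by simp

lemma iso_arrowI:
  assumes "f \<in> Ar C" "g \<in> Ar C" "Dom C g = Cod C f" "Cod C g = Dom C f"
    "g \<cdot> f = Ident C (Dom C f)" "f \<cdot> g = Ident C (Cod C f)"
  shows "iso_arrow C f"
  unfolding iso_arrow_def using assms by (auto simp: Hom_iff)

lemma iso_ar: "iso_arrow C f \<Longrightarrow> f \<in> Ar C"
  by (simp add: iso_arrow_def)

text \<open>For an arrow known to be invertible a left inverse is already the inverse, so the
  definite description in \<open>inverse_arrow\<close> is evaluated from a single equation.\<close>

lemma inverse_unique:
  assumes "iso_arrow C f" "g \<in> Ar C" "Dom C g = Cod C f" "Cod C g = Dom C f"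
      "g \<cdot> f = Ident C (Dom C f)"
  shows "inverse_arrow C f = g"
proof -
  have f: "f \<in> Ar C" using assms(1) by (rule iso_ar)
  obtain k where k: "k \<in> Ar C" "Dom C k = Cod C f" "Cod C k = Dom C f"
    "k \<cdot> f = Ident C (Dom C f)" "f \<cdot> k = Ident C (Cod C f)"
    using assms(1) by (auto simp: iso_arrow_def Hom_iff)
  have u: "h = k" if "h \<in> Ar C" "Dom C h = Cod C f" "h \<cdot> f = Ident C (Dom C f)" for h
  proof -
    have "h = h \<cdot> (f \<cdot> k)" using k(5) that(1,2) by simp
    also have "\<dots> = (h \<cdot> f) \<cdot> k"
      by (rule comp_assoc_ar[symmetric]) (use f k that in \<open>simp_all only:\<close>)
    also have "\<dots> = k" using k(1,3) that(3) by simp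
    finally show ?thesis .
  qed
  have "inverse_arrow C f = k"
    unfolding inverse_arrow_def by (rule the_equality) (use k in \<open>auto simp: Hom_iff intro: u\<close>)
  also have "\<dots> = g" by (rule u[OF assms(2,3,5), symmetric])
  finally show ?thesis .
qed

lemma inverse_ar [simp]:
  assumes "iso_arrow C f"
  shows "inverse_arrow C f \<in> Ar C" "Dom C (inverse_arrow C f) = Cod C f"
    "Cod C (inverse_arrow C f) = Dom C f" "inverse_arrow C f \<cdot> f = Ident C (Dom C f)"
    "f \<cdot> inverse_arrow C f = Ident C (Cod C f)"
proof -
  obtain k where k: "k \<in> Ar C" "Dom C k = Cod C f" "Cod C k = Dom C f"
    "k \<cdot> f = Ident C (Dom C f)" "f \<cdot> k = Ident C (Cod C f)"
    using assms(1) by (auto simp: iso_arrow_def Hom_iff)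
  with inverse_unique[OF assms, of k]
  show "inverse_arrow C f \<in> Ar C" "Dom C (inverse_arrow C f) = Cod C f"
    "Cod C (inverse_arrow C f) = Dom C f" "inverse_arrow C f \<cdot> f = Ident C (Dom C f)"
    "f \<cdot> inverse_arrow C f = Ident C (Cod C f)"
    by simp_all
qed

lemma inverse_comp_cancel [simp]:
  "\<lbrakk>iso_arrow C f; h \<in> Ar C; Cod C h = Dom C f\<rbrakk> \<Longrightarrow> inverse_arrow C f \<cdot> (f \<cdot> h) = h"
  "\<lbrakk>iso_arrow C f; h \<in> Ar C; Cod C h = Cod C f\<rbrakk> \<Longrightarrow> f \<cdot> (inverse_arrow C f \<cdot> h) = h"
  by (subst comp_reassoc[OF inverse_ar(4)]; simp add: iso_ar)
    (subst comp_reassoc[OF inverse_ar(5)]; simp add: iso_ar)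

lemma iso_inverse: "iso_arrow C f \<Longrightarrow> iso_arrow C (inverse_arrow C f)"
  by (rule iso_arrowI[where g = f]) (simp_all add: iso_ar)

lemma iso_id [simp]: "x \<in> Ob C \<Longrightarrow> iso_arrow C (Ident C x)"
  by (rule iso_arrowI[where g = "Ident C x"]) simp_all

lemma iso_comp [simp]:
  "\<lbrakk>iso_arrow C f; iso_arrow C g; Dom C g = Cod C f\<rbrakk> \<Longrightarrow> iso_arrow C (g \<cdot> f)"
  by (rule iso_arrowI[where g = "inverse_arrow C f \<cdot> inverse_arrow C g"]) (simp_all add: iso_ar)

lemma iso_epi:
  assumes "iso_arrow C f" "g \<in> Ar C" "h \<in> Ar C" "Dom C g = Cod C f" "Dom C h = Cod C f"
    "g \<cdot> f = h \<cdot> f"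
  shows "g = h"
proof -
  have "(g \<cdot> f) \<cdot> inverse_arrow C f = (h \<cdot> f) \<cdot> inverse_arrow C f" using assms(6) by simp
  then show ?thesis using assms(1-5) by (simp add: iso_ar)
qed

lemma iso_mono:
  assumes "iso_arrow C f" "g \<in> Ar C" "h \<in> Ar C" "Cod C g = Dom C f" "Cod C h = Dom C f"
    "f \<cdot> g = f \<cdot> h"
  shows "g = h"
proof -
  have "g = inverse_arrow C f \<cdot> (f \<cdot> g)"
    by (rule inverse_comp_cancel(1)[symmetric, OF assms(1,2,4)])
  also have "\<dots> = h"
    unfolding assms(6) by (rule inverse_comp_cancel(1)[OF assms(1,3,5)])
  finally show ?thesis .
qed

end

section \<open>Unit laws, hexagons and the Yang-Baxter equation for swaps in front of a tail\<close>

section \<open>The braiding in the presence of a tail\<close>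

context symmetric_monoidal_category
begin

abbreviation I where "I \<equiv> Unt M"

abbreviation whisker_left (infixr "\<triangleright>" 75) where
  "x \<triangleright> f \<equiv> Ident M x \<otimes>\<^sub>1 f"

lemma ob_simps [simp]: "I \<in> Ob M" "\<lbrakk>x \<in> Ob M; y \<in> Ob M\<rbrakk> \<Longrightarrow> x \<otimes>\<^sub>0 y \<in> Ob M"
  by (rule unit_ob, rule tens_ob)

lemma tens_ar [simp]:
  assumes "f \<in> Ar M" "g \<in> Ar M"
  shows "f \<otimes>\<^sub>1 g \<in> Ar M" "Dom M (f \<otimes>\<^sub>1 g) = Dom M f \<otimes>\<^sub>0 Dom M g"
    "Cod M (f \<otimes>\<^sub>1 g) = Cod M f \<otimes>\<^sub>0 Cod M g"
  using tens_hom[of f "Dom M f" "Cod M f" g "Dom M g" "Cod M g"] assms by (auto simp: Hom_iff)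

lemma assoc_ar [simp]:
  assumes "x \<in> Ob M" "y \<in> Ob M" "z \<in> Ob M"
  shows "assoc M x y z \<in> Ar M" "Dom M (assoc M x y z) = (x \<otimes>\<^sub>0 y) \<otimes>\<^sub>0 z"
    "Cod M (assoc M x y z) = x \<otimes>\<^sub>0 (y \<otimes>\<^sub>0 z)" "iso_arrow M (assoc M x y z)"
  using assoc_hom[OF assms] assoc_iso[OF assms] by (auto simp: Hom_iff)

lemma lunit_ar [simp]:
  assumes "x \<in> Ob M"
  shows "lunit M x \<in> Ar M" "Dom M (lunit M x) = I \<otimes>\<^sub>0 x" "Cod M (lunit M x) = x"
    "iso_arrow M (lunit M x)"
  using lunit_hom[OF assms] lunit_iso[OF assms] by (auto simp: Hom_iff)

lemma runit_ar [simp]: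
  assumes "x \<in> Ob M"
  shows "runit M x \<in> Ar M" "Dom M (runit M x) = x \<otimes>\<^sub>0 I" "Cod M (runit M x) = x"
    "iso_arrow M (runit M x)"
  using runit_hom[OF assms] runit_iso[OF assms] by (auto simp: Hom_iff)

lemma braid_ar [simp]:
  assumes "x \<in> Ob M" "y \<in> Ob M"
  shows "braid M x y \<in> Ar M" "Dom M (braid M x y) = x \<otimes>\<^sub>0 y" "Cod M (braid M x y) = y \<otimes>\<^sub>0 x"
  using braid_hom[OF assms] by (auto simp: Hom_iff)

lemma braid_iso [simp]: "\<lbrakk>x \<in> Ob M; y \<in> Ob M\<rbrakk> \<Longrightarrow> iso_arrow M (braid M x y)"
  by (rule iso_arrowI[where g = "braid M y x"]) (simp_all add: braid_sym)

lemma tens_id_ar [simp]: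
  "\<lbrakk>x \<in> Ob M; y \<in> Ob M\<rbrakk> \<Longrightarrow> x \<triangleright> Ident M y = Ident M (x \<otimes>\<^sub>0 y)"
  by (rule tens_id)

lemma interchange [simp]:
  "\<lbrakk>f \<in> Ar M; f' \<in> Ar M; g \<in> Ar M; g' \<in> Ar M; Dom M f' = Cod M f; Dom M g' = Cod M g\<rbrakk>
    \<Longrightarrow> (f' \<otimes>\<^sub>1 g') \<cdot> (f \<otimes>\<^sub>1 g) = (f' \<cdot> f) \<otimes>\<^sub>1 (g' \<cdot> g)"
  by (rule tens_comp[symmetric, of f "Dom M f" _ f' "Cod M f'" g "Dom M g" _ g' "Cod M g'"])
    (simp_all add: Hom_iff)

lemma interchange_r [simp]:
  "\<lbrakk>f \<in> Ar M; f' \<in> Ar M; g \<in> Ar M; g' \<in> Ar M; Dom M f' = Cod M f; Dom M g' = Cod M g;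
    h \<in> Ar M; Cod M h = Dom M f \<otimes>\<^sub>0 Dom M g\<rbrakk>
    \<Longrightarrow> (f' \<otimes>\<^sub>1 g') \<cdot> ((f \<otimes>\<^sub>1 g) \<cdot> h) = ((f' \<cdot> f) \<otimes>\<^sub>1 (g' \<cdot> g)) \<cdot> h"
  by (subst comp_reassoc[OF interchange]) simp_all

lemma iso_tens [simp]: "\<lbrakk>iso_arrow M f; iso_arrow M g\<rbrakk> \<Longrightarrow> iso_arrow M (f \<otimes>\<^sub>1 g)"
  by (rule iso_arrowI[where g = "inverse_arrow M f \<otimes>\<^sub>1 inverse_arrow M g"]) (simp_all add: iso_ar)

lemma assoc_natural:
  "\<lbrakk>f \<in> Ar M; g \<in> Ar M; h \<in> Ar M; Cod M f = x; Cod M g = y; Cod M h = z\<rbrakk>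
    \<Longrightarrow> assoc M x y z \<cdot> ((f \<otimes>\<^sub>1 g) \<otimes>\<^sub>1 h) = (f \<otimes>\<^sub>1 (g \<otimes>\<^sub>1 h)) \<cdot> assoc M (Dom M f) (Dom M g) (Dom M h)"
  by (rule assoc_nat) (simp_all add: Hom_iff)

lemma lunit_natural:
  "\<lbrakk>f \<in> Ar M; Cod M f = x\<rbrakk> \<Longrightarrow> lunit M x \<cdot> (I \<triangleright> f) = f \<cdot> lunit M (Dom M f)"
  by (rule lunit_nat) (simp_all add: Hom_iff)

lemma runit_natural:
  "\<lbrakk>f \<in> Ar M; Cod M f = x\<rbrakk> \<Longrightarrow> runit M x \<cdot> (f \<otimes>\<^sub>1 Ident M I) = f \<cdot> runit M (Dom M f)"
  by (rule runit_nat) (simp_all add: Hom_iff)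

lemma braid_natural:
  "\<lbrakk>f \<in> Ar M; g \<in> Ar M; Cod M f = x; Cod M g = y\<rbrakk>
    \<Longrightarrow> braid M x y \<cdot> (f \<otimes>\<^sub>1 g) = (g \<otimes>\<^sub>1 f) \<cdot> braid M (Dom M f) (Dom M g)"
  by (rule braid_nat) (simp_all add: Hom_iff)

lemmas assoc_natural_r = assoc_natural[THEN comp_reassoc]

lemma pentagon_ar:
  "\<lbrakk>w \<in> Ob M; x \<in> Ob M; y \<in> Ob M; z \<in> Ob M\<rbrakk>
    \<Longrightarrow> assoc M w x (y \<otimes>\<^sub>0 z) \<cdot> assoc M (w \<otimes>\<^sub>0 x) y z =
      (w \<triangleright> assoc M x y z) \<cdot> (assoc M w (x \<otimes>\<^sub>0 y) z \<cdot> (assoc M w x y \<otimes>\<^sub>1 Ident M z))"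
  using pentagon[of w x y z] by simp

lemmas pentagon_ar_r = pentagon_ar[THEN comp_reassoc]

text \<open>Naturality of the invertible \<open>lunit\<close> conjugates
  \<open>I \<triangleright> f\<close> into \<open>f\<close>. Equations may therefore be checked
  after tensoring with the unit, where the triangle identity becomes available.\<close>

lemma unit_tens_faithful:
  assumes f: "f \<in> Ar M" and g: "g \<in> Ar M" and d: "Dom M f = Dom M g" and c: "Cod M f = Cod M g"
    and e: "I \<triangleright> f = I \<triangleright> g"
  shows "f = g"
proof (rule iso_epi[OF lunit_ar(4)[OF dom_ob[OF g]] f g])
  show "f \<cdot> lunit M (Dom M g) = g \<cdot> lunit M (Dom M g)"
    using lunit_natural[OF f c] lunit_natural[OF g refl] by (simp only: d e)
qed (simp_all add: d g)

lemma tens_unit_faithful: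
  assumes f: "f \<in> Ar M" and g: "g \<in> Ar M" and d: "Dom M f = Dom M g" and c: "Cod M f = Cod M g"
    and e: "f \<otimes>\<^sub>1 Ident M I = g \<otimes>\<^sub>1 Ident M I"
  shows "f = g"
proof (rule iso_epi[OF runit_ar(4)[OF dom_ob[OF g]] f g])
  show "f \<cdot> runit M (Dom M g) = g \<cdot> runit M (Dom M g)"
    using runit_natural[OF f c] runit_natural[OF g refl] by (simp only: d e)
qed (simp_all add: d g)

lemma triangle_ar:
  "\<lbrakk>x \<in> Ob M; y \<in> Ob M\<rbrakk> \<Longrightarrow> (x \<triangleright> lunit M y) \<cdot> assoc M x I y = runit M x \<otimes>\<^sub>1 Ident M y"
  by (rule triangle)

lemmas triangle_ar_r = triangle_ar[THEN comp_reassoc]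

text \<open>A classical consequence of the axioms, due to Kelly. After tensoring with
  \<open>I\<close> on the right, the triangle expresses both right unitors through
  \<open>lunit M I\<close>, and the pentagon for x, y, I, I compares what remains.\<close>

lemma runit_tens:
  assumes [simp]: "x \<in> Ob M" "y \<in> Ob M"
  shows "runit M (x \<otimes>\<^sub>0 y) = (x \<triangleright> runit M y) \<cdot> assoc M x y I"
proof (rule tens_unit_faithful)
  have "assoc M x y I \<cdot> (runit M (x \<otimes>\<^sub>0 y) \<otimes>\<^sub>1 Ident M I) =
      assoc M x y I \<cdot> (((x \<otimes>\<^sub>0 y) \<triangleright> lunit M I) \<cdot> assoc M (x \<otimes>\<^sub>0 y) I I)"
    by (simp add: triangle_ar)
  also have "\<dots> = (x \<triangleright> (y \<triangleright> lunit M I)) \<cdot> (assoc M x y (I \<otimes>\<^sub>0 I) \<cdot> assoc M (x \<otimes>\<^sub>0 y) I I)"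
    by (simp add: assoc_natural_r del: tens_id_ar flip: tens_id)
  also have "\<dots> = (x \<triangleright> (runit M y \<otimes>\<^sub>1 Ident M I)) \<cdot> (assoc M x (y \<otimes>\<^sub>0 I) I \<cdot>
      (assoc M x y I \<otimes>\<^sub>1 Ident M I))"
    by (simp add: pentagon_ar triangle_ar)
  also have "\<dots> = assoc M x y I \<cdot> (((x \<triangleright> runit M y) \<cdot> assoc M x y I) \<otimes>\<^sub>1 Ident M I)"
  proof -
    have "assoc M x y I \<cdot> (((x \<triangleright> runit M y) \<otimes>\<^sub>1 Ident M I) \<cdot> (assoc M x y I \<otimes>\<^sub>1 Ident M I)) =
      (x \<triangleright> (runit M y \<otimes>\<^sub>1 Ident M I)) \<cdot> (assoc M x (y \<otimes>\<^sub>0 I) I \<cdot> (assoc M x y I \<otimes>\<^sub>1 Ident M I))"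
      by (subst assoc_natural_r) simp_all
    then show ?thesis by simp
  qed
  finally have "assoc M x y I \<cdot> (runit M (x \<otimes>\<^sub>0 y) \<otimes>\<^sub>1 Ident M I) = \<dots>" .
  then show "runit M (x \<otimes>\<^sub>0 y) \<otimes>\<^sub>1 Ident M I = ((x \<triangleright> runit M y) \<cdot> assoc M x y I) \<otimes>\<^sub>1 Ident M I"
    by (rule iso_mono[rotated -1]) simp_all
qed simp_all

text \<open>\<open>sw x y z : x \<otimes> (y \<otimes> z) \<rightarrow> y \<otimes> (x \<otimes> z)\<close>\<close>

definition sw :: "'o \<Rightarrow> 'o \<Rightarrow> 'o \<Rightarrow> 'a" where
  "sw x y z = assoc M y x z \<cdot> ((braid M x y \<otimes>\<^sub>1 Ident M z) \<cdot> inverse_arrow M (assoc M x y z))"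

lemma sw_ar [simp]:
  assumes "x \<in> Ob M" "y \<in> Ob M" "z \<in> Ob M"
  shows "sw x y z \<in> Ar M" "Dom M (sw x y z) = x \<otimes>\<^sub>0 (y \<otimes>\<^sub>0 z)" "Cod M (sw x y z) = y \<otimes>\<^sub>0 (x \<otimes>\<^sub>0 z)"
    "iso_arrow M (sw x y z)"
  using assms by (simp_all add: sw_def iso_inverse)

lemma sw_assoc:
  assumes "x \<in> Ob M" "y \<in> Ob M" "z \<in> Ob M"
  shows "sw x y z \<cdot> assoc M x y z = assoc M y x z \<cdot> (braid M x y \<otimes>\<^sub>1 Ident M z)"
  using assms by (simp add: sw_def)

lemmas sw_assoc_r = sw_assoc[THEN comp_reassoc]

lemma sw_sym:
  assumes [simp]: "x \<in> Ob M" "y \<in> Ob M" "z \<in> Ob M"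
  shows "sw y x z \<cdot> sw x y z = Ident M (x \<otimes>\<^sub>0 (y \<otimes>\<^sub>0 z))"
proof (rule iso_epi[of "assoc M x y z"])
  show "sw y x z \<cdot> sw x y z \<cdot> assoc M x y z = Ident M (x \<otimes>\<^sub>0 (y \<otimes>\<^sub>0 z)) \<cdot> assoc M x y z"
    by (simp add: sw_assoc sw_assoc_r braid_sym)
qed simp_all

lemmas sw_sym_r = sw_sym[THEN comp_reassoc]

lemma sw_natural:
  assumes [simp]: "f \<in> Ar M" "g \<in> Ar M" "h \<in> Ar M" "Cod M f = x" "Cod M g = y" "Cod M h = z"
  shows "sw x y z \<cdot> (f \<otimes>\<^sub>1 (g \<otimes>\<^sub>1 h)) = (g \<otimes>\<^sub>1 (f \<otimes>\<^sub>1 h)) \<cdot> sw (Dom M f) (Dom M g) (Dom M h)"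
proof -
  have [simp]: "x \<in> Ob M" "y \<in> Ob M" "z \<in> Ob M" using assms cod_ob by blast+
  let ?a = "Dom M f" and ?b = "Dom M g" and ?c = "Dom M h"
  show ?thesis
  proof (rule iso_epi[of "assoc M ?a ?b ?c"])
    have "(sw x y z \<cdot> (f \<otimes>\<^sub>1 (g \<otimes>\<^sub>1 h))) \<cdot> assoc M ?a ?b ?c =
        sw x y z \<cdot> (assoc M x y z \<cdot> ((f \<otimes>\<^sub>1 g) \<otimes>\<^sub>1 h))"
      by (simp add: assoc_natural)
    also have "\<dots> = assoc M y x z \<cdot> (((g \<otimes>\<^sub>1 f) \<otimes>\<^sub>1 h) \<cdot> (braid M ?a ?b \<otimes>\<^sub>1 Ident M ?c))"
      by (simp add: sw_assoc_r braid_natural)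
    also have "\<dots> = (g \<otimes>\<^sub>1 (f \<otimes>\<^sub>1 h)) \<cdot> (assoc M ?b ?a ?c \<cdot> (braid M ?a ?b \<otimes>\<^sub>1 Ident M ?c))"
      by (subst assoc_natural_r) simp_all
    also have "\<dots> = ((g \<otimes>\<^sub>1 (f \<otimes>\<^sub>1 h)) \<cdot> sw ?a ?b ?c) \<cdot> assoc M ?a ?b ?c"
      by (simp add: sw_assoc)
    finally show "(sw x y z \<cdot> (f \<otimes>\<^sub>1 (g \<otimes>\<^sub>1 h))) \<cdot> assoc M ?a ?b ?c =
      ((g \<otimes>\<^sub>1 (f \<otimes>\<^sub>1 h)) \<cdot> sw ?a ?b ?c) \<cdot> assoc M ?a ?b ?c" .
  qed simp_all
qed

lemmas sw_natural_r = sw_natural[THEN comp_reassoc]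

text \<open>The hexagon in tailed form: passing y \<otimes> y' means passing y and then y'.
  Precomposition with two associators turns every \<open>sw\<close> into a \<open>braid\<close>;
  pentagons then shift the associators until the hexagon, tensored with z, appears.\<close>

lemma sw_tens_right:
  assumes [simp]: "x \<in> Ob M" "y \<in> Ob M" "y' \<in> Ob M" "z \<in> Ob M"
  shows "assoc M y y' (x \<otimes>\<^sub>0 z) \<cdot> sw x (y \<otimes>\<^sub>0 y') z =
    (y \<triangleright> sw x y' z) \<cdot> (sw x y (y' \<otimes>\<^sub>0 z) \<cdot> (x \<triangleright> assoc M y y' z))"
proof (rule iso_epi[of "assoc M x (y \<otimes>\<^sub>0 y') z \<cdot> (assoc M x y y' \<otimes>\<^sub>1 Ident M z)"])
  let ?e = "assoc M x (y \<otimes>\<^sub>0 y') z \<cdot> (assoc M x y y' \<otimes>\<^sub>1 Ident M z)"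
  have "((y \<triangleright> sw x y' z) \<cdot> (sw x y (y' \<otimes>\<^sub>0 z) \<cdot> (x \<triangleright> assoc M y y' z))) \<cdot> ?e =
      (y \<triangleright> sw x y' z) \<cdot> (sw x y (y' \<otimes>\<^sub>0 z) \<cdot> (assoc M x y (y' \<otimes>\<^sub>0 z) \<cdot> assoc M (x \<otimes>\<^sub>0 y) y' z))"
    by (simp add: pentagon_ar)
  also have "\<dots> = (y \<triangleright> sw x y' z) \<cdot> (assoc M y x (y' \<otimes>\<^sub>0 z) \<cdot>
      ((braid M x y \<otimes>\<^sub>1 (y' \<triangleright> Ident M z)) \<cdot> assoc M (x \<otimes>\<^sub>0 y) y' z))"
    by (simp add: sw_assoc_r)
  also have "\<dots> = (y \<triangleright> sw x y' z) \<cdot> ((assoc M y x (y' \<otimes>\<^sub>0 z) \<cdot> assoc M (y \<otimes>\<^sub>0 x) y' z) \<cdot>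
      ((braid M x y \<otimes>\<^sub>1 Ident M y') \<otimes>\<^sub>1 Ident M z))"
    by (simp add: assoc_natural del: tens_id_ar)
  also have "\<dots> = (y \<triangleright> (sw x y' z \<cdot> assoc M x y' z)) \<cdot> (assoc M y (x \<otimes>\<^sub>0 y') z \<cdot>
      ((assoc M y x y' \<cdot> (braid M x y \<otimes>\<^sub>1 Ident M y')) \<otimes>\<^sub>1 Ident M z))"
    by (simp add: pentagon_ar)
  also have "\<dots> = (y \<triangleright> assoc M y' x z) \<cdot> ((y \<triangleright> (braid M x y' \<otimes>\<^sub>1 Ident M z)) \<cdot> 
      (assoc M y (x \<otimes>\<^sub>0 y') z \<cdot> ((assoc M y x y' \<cdot> (braid M x y \<otimes>\<^sub>1 Ident M y')) \<otimes>\<^sub>1 Ident M z)))"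
    by (simp add: sw_assoc)
  also have "\<dots> = (y \<triangleright> assoc M y' x z) \<cdot> (assoc M y (y' \<otimes>\<^sub>0 x) z \<cdot> 
      (((y \<triangleright> braid M x y') \<cdot> assoc M y x y' \<cdot> (braid M x y \<otimes>\<^sub>1 Ident M y')) \<otimes>\<^sub>1 Ident M z))"
  proof -
    have "(y \<triangleright> (braid M x y' \<otimes>\<^sub>1 Ident M z)) \<cdot> 
      (assoc M y (x \<otimes>\<^sub>0 y') z \<cdot> ((assoc M y x y' \<cdot> (braid M x y \<otimes>\<^sub>1 Ident M y')) \<otimes>\<^sub>1 Ident M z)) =
      assoc M y (y' \<otimes>\<^sub>0 x) z \<cdot> (((y \<triangleright> braid M x y') \<otimes>\<^sub>1 Ident M z) \<cdot>
        ((assoc M y x y' \<cdot> (braid M x y \<otimes>\<^sub>1 Ident M y')) \<otimes>\<^sub>1 Ident M z))"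
      by (subst assoc_natural_r) simp_all
    then show ?thesis by simp
  qed
  \<comment> \<open>The hexagon, read from right to left inside the first tensor factor.\<close>
  also have "\<dots> = (y \<triangleright> assoc M y' x z) \<cdot> (assoc M y (y' \<otimes>\<^sub>0 x) z \<cdot> 
      ((assoc M y y' x \<cdot> braid M x (y \<otimes>\<^sub>0 y') \<cdot> assoc M x y y') \<otimes>\<^sub>1 Ident M z))"
    by (simp only: hexagon assms)
  also have "\<dots> = assoc M y y' (x \<otimes>\<^sub>0 z) \<cdot> (assoc M (y \<otimes>\<^sub>0 y') x z \<cdot> ((braid M x (y \<otimes>\<^sub>0 y') \<cdot>
      assoc M x y y') \<otimes>\<^sub>1 Ident M z))"
    by (simp add: pentagon_ar_r)
  also have "\<dots> = (assoc M y y' (x \<otimes>\<^sub>0 z) \<cdot> sw x (y \<otimes>\<^sub>0 y') z) \<cdot> ?e"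
    by (simp add: sw_assoc_r)
  finally show "(assoc M y y' (x \<otimes>\<^sub>0 z) \<cdot> sw x (y \<otimes>\<^sub>0 y') z) \<cdot> ?e = 
    ((y \<triangleright> sw x y' z) \<cdot> (sw x y (y' \<otimes>\<^sub>0 z) \<cdot> (x \<triangleright> assoc M y y' z))) \<cdot> ?e"
    by (rule sym)
qed simp_all

text \<open>For a symmetric braiding the second hexagon is the inverse of the first: precomposition
  with the opposite swap reduces it to \<open>sw_tens_right\<close>.\<close>

lemma sw_tens_left:
  assumes [simp]: "x \<in> Ob M" "x' \<in> Ob M" "y \<in> Ob M" "z \<in> Ob M"
  shows "(y \<triangleright> assoc M x x' z) \<cdot> sw (x \<otimes>\<^sub>0 x') y z =
    sw x y (x' \<otimes>\<^sub>0 z) \<cdot> ((x \<triangleright> sw x' y z) \<cdot> assoc M x x' (y \<otimes>\<^sub>0 z))"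
proof (rule iso_epi[of "sw y (x \<otimes>\<^sub>0 x') z"])
  have "(sw x y (x' \<otimes>\<^sub>0 z) \<cdot> ((x \<triangleright> sw x' y z) \<cdot> assoc M x x' (y \<otimes>\<^sub>0 z))) \<cdot> sw y (x \<otimes>\<^sub>0 x') z =
      sw x y (x' \<otimes>\<^sub>0 z) \<cdot> ((x \<triangleright> (sw x' y z \<cdot> sw y x' z)) \<cdot> 
       (sw y x (x' \<otimes>\<^sub>0 z) \<cdot> (y \<triangleright> assoc M x x' z)))"
    by (simp add: sw_tens_right)
  also have "\<dots> = y \<triangleright> assoc M x x' z"
    by (simp add: sw_sym sw_sym_r)
  finally show "((y \<triangleright> assoc M x x' z) \<cdot> sw (x \<otimes>\<^sub>0 x') y z) \<cdot> sw y (x \<otimes>\<^sub>0 x') z =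
    (sw x y (x' \<otimes>\<^sub>0 z) \<cdot> ((x \<triangleright> sw x' y z) \<cdot> assoc M x x' (y \<otimes>\<^sub>0 z))) \<cdot> sw y (x \<otimes>\<^sub>0 x') z"
    by (simp add: sw_sym)
qed simp_all

text \<open>Compatibility of the braiding with the unit is not among the axioms. Passing I \<otimes>
  I is passing \<open>I\<close> twice by \<open>sw_tens_right\<close>, and passing it once by
  naturality along \<open>runit M I\<close>. Cancelling the invertible common part leaves the claim
  tensored with \<open>I\<close>.\<close>

lemma sw_unit_right:
  assumes [simp]: "x \<in> Ob M" "z \<in> Ob M"
  shows "lunit M (x \<otimes>\<^sub>0 z) \<cdot> sw x I z = x \<triangleright> lunit M z"
proof (rule unit_tens_faithful)
  let ?e = "sw x I (I \<otimes>\<^sub>0 z) \<cdot> (x \<triangleright> assoc M I I z)"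
  have "(I \<triangleright> (x \<triangleright> lunit M z)) \<cdot> ?e =
      sw x I z \<cdot> (x \<triangleright> ((I \<triangleright> lunit M z) \<cdot> assoc M I I z))"
    using sw_natural_r[of "Ident M x" "Ident M I" "lunit M z" x I z "x \<triangleright> assoc M I I z"]
    by simp
  also have "\<dots> = sw x I z \<cdot> (x \<triangleright> (runit M I \<otimes>\<^sub>1 Ident M z))"
    by (simp add: triangle_ar)
  also have "\<dots> = (runit M I \<otimes>\<^sub>1 (x \<triangleright> Ident M z)) \<cdot> sw x (I \<otimes>\<^sub>0 I) z"
    by (simp add: sw_natural del: tens_id_ar)
  also have "\<dots> = (I \<triangleright> lunit M (x \<otimes>\<^sub>0 z)) \<cdot> (assoc M I I (x \<otimes>\<^sub>0 z) \<cdot> sw x (I \<otimes>\<^sub>0 I) z)"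
    by (simp add: triangle_ar_r)
  also have "\<dots> = (I \<triangleright> (lunit M (x \<otimes>\<^sub>0 z) \<cdot> sw x I z)) \<cdot> ?e"
    by (simp add: sw_tens_right)
  finally have eq: "(I \<triangleright> (x \<triangleright> lunit M z)) \<cdot> ?e = \<dots>" .
  show "I \<triangleright> (lunit M (x \<otimes>\<^sub>0 z) \<cdot> sw x I z) = I \<triangleright> (x \<triangleright> lunit M z)"
    by (rule iso_epi[OF _ _ _ _ _ eq[symmetric]]) simp_all
qed simp_all

lemma sw_unit_left:
  assumes [simp]: "x \<in> Ob M" "z \<in> Ob M"
  shows "(x \<triangleright> lunit M z) \<cdot> sw I x z = lunit M (x \<otimes>\<^sub>0 z)"
  by (simp add: sw_sym flip: sw_unit_right)

text \<open>Relates the swap with tail \<open>I\<close> to the bare braiding: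
  \<open>runit_tens\<close> absorbs the tail into the right unitor of the product, along which the
  braiding is natural.\<close>

lemma sw_runit:
  assumes [simp]: "x \<in> Ob M" "y \<in> Ob M"
  shows "(y \<triangleright> runit M x) \<cdot> sw x y I = braid M x y \<cdot> (x \<triangleright> runit M y)"
proof (rule iso_epi[of "assoc M x y I"])
  show "((y \<triangleright> runit M x) \<cdot> sw x y I) \<cdot> assoc M x y I =
      (braid M x y \<cdot> (x \<triangleright> runit M y)) \<cdot> assoc M x y I"
    by (simp add: sw_assoc runit_natural flip: runit_tens)
       (simp add: runit_tens[symmetric] runit_natural flip: comp_assoc_ar)
qed simp_all

text \<open>Joining a and b into one factor by \<open>sw_tens_left\<close> turns the equation into
  naturality of the exchange with s along the arrow \<open>braid M a b\<close>.\<close>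

lemma yang_baxter:
  assumes [simp]: "a \<in> Ob M" "b \<in> Ob M" "s \<in> Ob M" "z \<in> Ob M"
  shows "(s \<triangleright> sw a b z) \<cdot> (sw a s (b \<otimes>\<^sub>0 z) \<cdot> (a \<triangleright> sw b s z)) =
    sw b s (a \<otimes>\<^sub>0 z) \<cdot> ((b \<triangleright> sw a s z) \<cdot> sw a b (s \<otimes>\<^sub>0 z))"
proof (rule iso_epi[of "assoc M a b (s \<otimes>\<^sub>0 z)"])
  have "((s \<triangleright> sw a b z) \<cdot> (sw a s (b \<otimes>\<^sub>0 z) \<cdot> (a \<triangleright> sw b s z))) \<cdot> assoc M a b (s \<otimes>\<^sub>0 z) =
      (s \<triangleright> (sw a b z \<cdot> assoc M a b z)) \<cdot> sw (a \<otimes>\<^sub>0 b) s z"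
    by (simp flip: sw_tens_left)
  also have "\<dots> = (s \<triangleright> assoc M b a z) \<cdot> ((s \<triangleright> (braid M a b \<otimes>\<^sub>1 Ident M z)) \<cdot> sw (a \<otimes>\<^sub>0 b) s z)"
    by (simp add: sw_assoc)
  also have "\<dots> = (s \<triangleright> assoc M b a z) \<cdot> (sw (b \<otimes>\<^sub>0 a) s z \<cdot> (braid M a b \<otimes>\<^sub>1 (s \<triangleright> Ident M z)))"
    by (subst sw_natural) simp_all
  also have "\<dots> = sw b s (a \<otimes>\<^sub>0 z) \<cdot> ((b \<triangleright> sw a s z) \<cdot> (assoc M b a (s \<otimes>\<^sub>0 z) \<cdot>
      (braid M a b \<otimes>\<^sub>1 Ident M (s \<otimes>\<^sub>0 z))))"
    by (simp add: sw_tens_left[THEN comp_reassoc])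
  also have "\<dots> = (sw b s (a \<otimes>\<^sub>0 z) \<cdot> ((b \<triangleright> sw a s z) \<cdot> sw a b (s \<otimes>\<^sub>0 z))) \<cdot> assoc M a b (s \<otimes>\<^sub>0 z)"
    by (simp add: sw_assoc)
  finally show "((s \<triangleright> sw a b z) \<cdot> (sw a s (b \<otimes>\<^sub>0 z) \<cdot> (a \<triangleright> sw b s z))) \<cdot> assoc M a b (s \<otimes>\<^sub>0 z) =
    (sw b s (a \<otimes>\<^sub>0 z) \<cdot> ((b \<triangleright> sw a s z) \<cdot> sw a b (s \<otimes>\<^sub>0 z))) \<cdot> assoc M a b (s \<otimes>\<^sub>0 z)" .
qed simp_all

end

section \<open>Words acting on a tail, and sorting them by adjacent swaps\<close>

section \<open>Coherence for symmetry isomorphisms\<close>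

context symmetric_monoidal_category
begin

text \<open>
  \<open>actl [x\<^sub>1, \<dots>, x\<^sub>n] z = x\<^sub>1 \<otimes> (\<dots> \<otimes> (x\<^sub>n \<otimes> z))\<close>. In contrast to \<open>tens\<close> this turns concatenation of lists
  into composition on the nose, and it needs no special case for one-element lists. The arrow
  \<open>untail xs : actl xs I \<rightarrow> tens xs\<close> compares the two.
\<close>

primrec actl :: "'o list \<Rightarrow> 'o \<Rightarrow> 'o" where
  "actl [] z = z"
| "actl (x # xs) z = x \<otimes>\<^sub>0 actl xs z"

primrec actA :: "'a list \<Rightarrow> 'a \<Rightarrow> 'a" where
  "actA [] h = h"
| "actA (f # fs) h = f \<otimes>\<^sub>1 actA fs h"

primrec untail :: "'o list \<Rightarrow> 'a" where
  "untail [] = Ident M I"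
| "untail (x # xs) = (if xs = [] then runit M x else x \<triangleright> untail xs)"

lemma actl_ob [simp]: "\<lbrakk>\<forall>x \<in> set xs. x \<in> Ob M; z \<in> Ob M\<rbrakk> \<Longrightarrow> actl xs z \<in> Ob M"
  by (induction xs) auto

lemma actl_append [simp]: "actl (xs @ ys) z = actl xs (actl ys z)"
  by (induction xs) auto

lemma actA_append: "actA (fs @ gs) h = actA fs (actA gs h)"
  by (induction fs) auto

lemma actA_ar [simp]:
  assumes "\<forall>f \<in> set fs. f \<in> Ar M" "h \<in> Ar M"
  shows "actA fs h \<in> Ar M" "Dom M (actA fs h) = actl (map (Dom M) fs) (Dom M h)"
    "Cod M (actA fs h) = actl (map (Cod M) fs) (Cod M h)"
  using assms by (induction fs) auto

lemma actA_comp: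
  assumes "\<forall>i \<in> set ks. f i \<in> Ar M \<and> g i \<in> Ar M \<and> Dom M (g i) = Cod M (f i)"
    "h \<in> Ar M" "k \<in> Ar M" "Dom M k = Cod M h"
  shows "actA (map g ks) k \<cdot> actA (map f ks) h = actA (map (\<lambda>i. g i \<cdot> f i) ks) (k \<cdot> h)"
  using assms(1)
proof (induction ks)
  case Nil
  then show ?case by simp
next
  case (Cons a ks)
  have "actl (map (Dom M \<circ> g) ks) (Dom M k) = actl (map (Cod M \<circ> f) ks) (Cod M h)"
    using Cons.prems assms(4) by (auto intro!: arg_cong2[where f = actl])
  then show ?case using Cons assms by (simp add: o_def)
qed

lemma tens_ob_list: "\<forall>x \<in> set xs. x \<in> Ob M \<Longrightarrow> tens M xs \<in> Ob M"
  by (rule tens_list_ob) auto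

lemma untail_ar [simp]:
  assumes "\<forall>x \<in> set xs. x \<in> Ob M"
  shows "untail xs \<in> Ar M" "Dom M (untail xs) = actl xs I" "Cod M (untail xs) = tens M xs"
    "iso_arrow M (untail xs)"
proof -
  have "untail xs \<in> Ar M \<and> Dom M (untail xs) = actl xs I \<and> Cod M (untail xs) = tens M xs \<and>
      iso_arrow M (untail xs)"
    using assms
  proof (induction xs)
    case Nil
    then show ?case by simp
  next
    case (Cons x xs)
    then show ?case by (cases xs) auto
  qed
  then show "untail xs \<in> Ar M" "Dom M (untail xs) = actl xs I" "Cod M (untail xs) = tens M xs"
    "iso_arrow M (untail xs)" by auto
qed

lemma tensA_ar [simp]:
  assumes "\<forall>f \<in> set fs. f \<in> Ar M"
  shows "tensA M fs \<in> Ar M" "Dom M (tensA M fs) = tens M (map (Dom M) fs)"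
    "Cod M (tensA M fs) = tens M (map (Cod M) fs)"
proof -
  have "tensA M fs \<in> Ar M \<and> Dom M (tensA M fs) = tens M (map (Dom M) fs) \<and>
      Cod M (tensA M fs) = tens M (map (Cod M) fs)"
    using assms
  proof (induction fs)
    case Nil
    then show ?case by simp
  next
    case (Cons f fs)
    then show ?case by (cases fs) auto
  qed
  then show "tensA M fs \<in> Ar M" "Dom M (tensA M fs) = tens M (map (Dom M) fs)"
    "Cod M (tensA M fs) = tens M (map (Cod M) fs)" by auto
qed

lemma tens_Cons: "xs \<noteq> [] \<Longrightarrow> tens M (x # xs) = x \<otimes>\<^sub>0 tens M xs"
  by (cases xs) auto

lemma tensA_Cons: "fs \<noteq> [] \<Longrightarrow> tensA M (f # fs) = f \<otimes>\<^sub>1 tensA M fs"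
  by (cases fs) auto

lemma untail_natural:
  assumes "\<forall>f \<in> set fs. f \<in> Ar M"
  shows "tensA M fs \<cdot> untail (map (Dom M) fs) = untail (map (Cod M) fs) \<cdot> actA fs (Ident M I)"
  using assms
proof (induction fs)
  case Nil
  then show ?case by simp
next
  case (Cons f fs)
  show ?case
  proof (cases "fs = []")
    case True
    then show ?thesis using Cons.prems by (simp add: runit_natural)
  next
    case False
    then show ?thesis using Cons.IH Cons.prems by (simp add: tensA_Cons)
  qed
qed

text \<open>\<open>ins\<close> and \<open>srt\<close> are \<open>insort_iso\<close> and \<open>sort_iso\<close> with a tail \<open>z\<close>.\<close>

primrec ins :: "(nat \<Rightarrow> 'o) \<Rightarrow> nat \<Rightarrow> nat list \<Rightarrow> 'o \<Rightarrow> 'a" where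
  "ins X k [] z = Ident M (X k \<otimes>\<^sub>0 z)"
| "ins X k (j # js) z =
     (if k \<le> j then Ident M (actl (map X (k # j # js)) z)
      else ((X j) \<triangleright> ins X k js z) \<cdot> sw (X k) (X j) (actl (map X js) z))"

primrec srt :: "(nat \<Rightarrow> 'o) \<Rightarrow> nat list \<Rightarrow> 'o \<Rightarrow> 'a" where
  "srt X [] z = Ident M z"
| "srt X (k # ks) z = ins X k (sort ks) z \<cdot> ((X k) \<triangleright> srt X ks z)"

lemma ins_ar [simp]:
  assumes "X k \<in> Ob M" "\<forall>j \<in> set ks. X j \<in> Ob M" "z \<in> Ob M"
  shows "ins X k ks z \<in> Ar M" "Dom M (ins X k ks z) = actl (map X (k # ks)) z"
    "Cod M (ins X k ks z) = actl (map X (insort k ks)) z"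
  using assms by (induction ks) auto

lemma srt_ar [simp]:
  assumes "\<forall>j \<in> set ks. X j \<in> Ob M" "z \<in> Ob M"
  shows "srt X ks z \<in> Ar M" "Dom M (srt X ks z) = actl (map X ks) z"
    "Cod M (srt X ks z) = actl (map X (sort ks)) z"
  using assms by (induction ks) auto

lemma ins_iso [simp]:
  "\<lbrakk>X k \<in> Ob M; \<forall>j \<in> set ks. X j \<in> Ob M; z \<in> Ob M\<rbrakk> \<Longrightarrow> iso_arrow M (ins X k ks z)"
  by (induction ks) auto

lemma srt_iso [simp]:
  "\<lbrakk>\<forall>j \<in> set ks. X j \<in> Ob M; z \<in> Ob M\<rbrakk> \<Longrightarrow> iso_arrow M (srt X ks z)"
  by (induction ks) auto

lemma ins_least:
  "\<lbrakk>X k \<in> Ob M; \<forall>j \<in> set ks. X j \<in> Ob M \<and> k \<le> j; z \<in> Ob M\<rbrakk>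
    \<Longrightarrow> ins X k ks z = Ident M (actl (map X (k # ks)) z)"
  by (cases ks) auto

lemma srt_sorted:
  "\<lbrakk>\<forall>j \<in> set ks. X j \<in> Ob M; z \<in> Ob M; sorted ks\<rbrakk> \<Longrightarrow> srt X ks z = Ident M (actl (map X ks) z)"
  by (induction ks) (auto simp: ins_least sorted_sort_id)

text \<open>Induction on the list. If a stays in front of the head s, the right side exchanges a
  with b and back again, so \<open>sw_sym\<close> suffices. If both letters pass s, the two orders
  of the three exchanges are related by \<open>yang_baxter\<close>.\<close>

lemma ins_exchange_less:
  assumes "a < b" "X a \<in> Ob M" "X b \<in> Ob M" "\<forall>j \<in> set ks. X j \<in> Ob M" "z \<in> Ob M"
  shows "ins X a (insort b ks) z \<cdot> ((X a) \<triangleright> ins X b ks z) =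
    ins X b (insort a ks) z \<cdot> (((X b) \<triangleright> ins X a ks z) \<cdot> sw (X a) (X b) (actl (map X ks) z))"
  using assms(4)
proof (induction ks)
  case Nil
  then show ?case using assms by (simp add: sw_sym)
next
  case (Cons s ks)
  have [simp]: "X a \<in> Ob M" "X b \<in> Ob M" "X s \<in> Ob M" "\<forall>j \<in> set ks. X j \<in> Ob M" "z \<in> Ob M"
    using assms Cons.prems by auto
  let ?A = "X a" and ?B = "X b" and ?S = "X s" and ?Z = "actl (map X ks) z"
  consider "b \<le> s" | "a \<le> s" "s < b" | "s < a" by linarith
  then show ?case
  proof cases
    case 1
    then show ?thesis using assms(1) by (simp add: sw_sym)
  next
    case 2
    then show ?thesis using assms(1) by (simp add: sw_sym)
  next
    case 3
    have "ins X a (insort b (s # ks)) z \<cdot> (?A \<triangleright> ins X b (s # ks) z) =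
        (?S \<triangleright> ins X a (insort b ks) z) \<cdot> (sw ?A ?S (actl (map X (insort b ks)) z) \<cdot>
          ((?A \<triangleright> (?S \<triangleright> ins X b ks z)) \<cdot> (?A \<triangleright> sw ?B ?S ?Z)))"
      using 3 assms(1) by simp
    also have "\<dots> = (?S \<triangleright> (ins X a (insort b ks) z \<cdot> (?A \<triangleright> ins X b ks z))) \<cdot>
        (sw ?A ?S (?B \<otimes>\<^sub>0 ?Z) \<cdot> (?A \<triangleright> sw ?B ?S ?Z))"
      by (subst sw_natural_r) simp_all
    also have "\<dots> = (?S \<triangleright> (ins X b (insort a ks) z \<cdot> (?B \<triangleright> ins X a ks z))) \<cdot>
        ((?S \<triangleright> sw ?A ?B ?Z) \<cdot> (sw ?A ?S (?B \<otimes>\<^sub>0 ?Z) \<cdot> (?A \<triangleright> sw ?B ?S ?Z)))"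
      using Cons.IH by simp
    also have "\<dots> = (?S \<triangleright> (ins X b (insort a ks) z \<cdot> (?B \<triangleright> ins X a ks z))) \<cdot>
        (sw ?B ?S (?A \<otimes>\<^sub>0 ?Z) \<cdot> ((?B \<triangleright> sw ?A ?S ?Z) \<cdot> sw ?A ?B (?S \<otimes>\<^sub>0 ?Z)))"
      by (simp add: yang_baxter)
    also have "\<dots> = (?S \<triangleright> ins X b (insort a ks) z) \<cdot> (sw ?B ?S (actl (map X (insort a ks)) z) \<cdot>
        ((?B \<triangleright> (?S \<triangleright> ins X a ks z)) \<cdot>
          ((?B \<triangleright> sw ?A ?S ?Z) \<cdot> sw ?A ?B (?S \<otimes>\<^sub>0 ?Z))))"
      by (subst sw_natural_r) simp_all
    also have "\<dots> = ins X b (insort a (s # ks)) z \<cdot>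
        ((?B \<triangleright> ins X a (s # ks) z) \<cdot> sw ?A ?B (actl (map X (s # ks)) z))"
      using 3 assms(1) by simp
    finally show ?thesis .
  qed
qed

lemma ins_exchange:
  assumes "a \<noteq> b" and [simp]: "X a \<in> Ob M" "X b \<in> Ob M" "\<forall>j \<in> set ks. X j \<in> Ob M" "z \<in> Ob M"
  shows "ins X b (insort a ks) z \<cdot> (((X b) \<triangleright> ins X a ks z) \<cdot> sw (X a) (X b) (actl (map X ks) z)) =
    ins X a (insort b ks) z \<cdot> ((X a) \<triangleright> ins X b ks z)"
proof (cases "a < b")
  case True
  then show ?thesis using ins_exchange_less[of a b X ks z] by simp
next
  case False
  \<comment> \<open>The previous lemma with a and b interchanged; the two opposite swaps that result
    cancel by \<open>sw_sym\<close>.\<close>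
  then have "b < a" using assms(1) by simp
  then have eq: "ins X b (insort a ks) z \<cdot> ((X b) \<triangleright> ins X a ks z) =
    ins X a (insort b ks) z \<cdot> (((X a) \<triangleright> ins X b ks z) \<cdot> sw (X b) (X a) (actl (map X ks) z))"
    by (intro ins_exchange_less) simp_all
  have "ins X b (insort a ks) z \<cdot> (((X b) \<triangleright> ins X a ks z) \<cdot> sw (X a) (X b) (actl (map X ks) z)) =
      (ins X a (insort b ks) z \<cdot> (((X a) \<triangleright> ins X b ks z) \<cdot> sw (X b) (X a) (actl (map X ks) z))) \<cdot>
        sw (X a) (X b) (actl (map X ks) z)"
    by (subst comp_reassoc[OF eq]) (simp_all add: insort_is_Cons)
  also have "\<dots> = ins X a (insort b ks) z \<cdot> ((X a) \<triangleright> ins X b ks z)"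
    by (simp add: sw_sym)
  finally show ?thesis .
qed

text \<open>Distinct labels are essential: \<open>ins\<close> leaves equal labels in place, and as
  \<open>srt\<close> is invertible, the equation for a = b would force the swap of an object with
  itself to be the identity.\<close>

lemma srt_swap_hd:
  assumes ab: "a \<noteq> b" and [simp]: "X a \<in> Ob M" "X b \<in> Ob M" "\<forall>j \<in> set ks. X j \<in> Ob M" "z \<in> Ob M"
  shows "srt X (b # a # ks) z \<cdot> sw (X a) (X b) (actl (map X ks) z) = srt X (a # b # ks) z"
proof -
  let ?S = "actl (map X (sort ks)) z" and ?Z = "actl (map X ks) z"
  have "srt X (b # a # ks) z \<cdot> sw (X a) (X b) ?Z =
      ins X b (insort a (sort ks)) z \<cdot> (((X b) \<triangleright> ins X a (sort ks) z) \<cdot>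
        (((X b) \<triangleright> ((X a) \<triangleright> srt X ks z)) \<cdot> sw (X a) (X b) ?Z))"
    by simp
  also have "\<dots> = (ins X b (insort a (sort ks)) z \<cdot> (((X b) \<triangleright> ins X a (sort ks) z) \<cdot>
      sw (X a) (X b) ?S)) \<cdot> ((X a) \<triangleright> ((X b) \<triangleright> srt X ks z))"
    by (simp add: sw_natural)
  also have "\<dots> = (ins X a (insort b (sort ks)) z \<cdot> ((X a) \<triangleright> ins X b (sort ks) z)) \<cdot>
      ((X a) \<triangleright> ((X b) \<triangleright> srt X ks z))"
    by (subst ins_exchange[OF ab]) simp_all
  also have "\<dots> = srt X (a # b # ks) z" by simp
  finally show ?thesis .
qed

abbreviation swap_at :: "(nat \<Rightarrow> 'o) \<Rightarrow> nat list \<Rightarrow> nat \<Rightarrow> nat \<Rightarrow> nat list \<Rightarrow> 'o \<Rightarrow> 'a" where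
  "swap_at X us a b vs z \<equiv>
     actA (map (\<lambda>i. Ident M (X i)) us) (sw (X a) (X b) (actl (map X vs) z))"

lemma map_id_simps [simp]:
  "\<forall>i \<in> set us. X i \<in> Ob M \<Longrightarrow> map (Dom M \<circ> (\<lambda>i. Ident M (X i))) us = map X us"
  "\<forall>i \<in> set us. X i \<in> Ob M \<Longrightarrow> map (Cod M \<circ> (\<lambda>i. Ident M (X i))) us = map X us"
  by auto

lemma srt_swap:
  assumes ab: "a \<noteq> b" and ob: "\<forall>j \<in> set (us @ a # b # vs). X j \<in> Ob M" and [simp]: "z \<in> Ob M"
  shows "srt X (us @ b # a # vs) z \<cdot> swap_at X us a b vs z = srt X (us @ a # b # vs) z"
  using ob
proof (induction us)
  case Nil
  then show ?case using srt_swap_hd[OF ab, of X vs z] by simp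
next
  case (Cons u us)
  have [simp]: "sort (us @ b # a # vs) = sort (us @ a # b # vs)"
    by (intro properties_for_sort) simp_all
  show ?case using Cons by simp
qed

section \<open>Composites of adjacent transpositions and their uniqueness\<close>

text \<open>
  \<open>coh X z ks ls f\<close> says that \<open>f : actl (map X ks) z \<rightarrow> actl (map X ls) z\<close> is a composite of
  transpositions of adjacent factors. The factors are told apart by their labels, the entries of
  \<open>ks\<close>, and factors with the same label are never exchanged: this makes \<open>f\<close> unique, see \<open>coh_srt\<close>.
\<close>

inductive coh :: "(nat \<Rightarrow> 'o) \<Rightarrow> 'o \<Rightarrow> nat list \<Rightarrow> nat list \<Rightarrow> 'a \<Rightarrow> bool" for X z ks where
  coh_id: "coh X z ks ks (Ident M (actl (map X ks) z))"
| coh_step: "\<lbrakk>coh X z ks (us @ a # b # vs) f; a \<noteq> b\<rbrakk>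
    \<Longrightarrow> coh X z ks (us @ b # a # vs) (swap_at X us a b vs z \<cdot> f)"

lemma coh_mset: "coh X z ks ls f \<Longrightarrow> mset ls = mset ks"
  by (induction rule: coh.induct) (auto simp: add_mset_commute)

lemma coh_set: "coh X z ks ls f \<Longrightarrow> set ls = set ks"
  by (metis coh_mset set_mset_mset)

lemma coh_ar:
  assumes "coh X z ks ls f" "\<forall>j \<in> set ks. X j \<in> Ob M" "z \<in> Ob M"
  shows "f \<in> Ar M \<and> Dom M f = actl (map X ks) z \<and> Cod M f = actl (map X ls) z"
  using assms(1)
proof (induction rule: coh.induct)
  case coh_id
  then show ?case using assms by simp
next
  case (coh_step us a b vs f)
  then have "set (us @ a # b # vs) = set ks" by (metis coh_set)
  then have "\<forall>j \<in> set (us @ a # b # vs). X j \<in> Ob M" using assms(2) by blast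
  then show ?case using coh_step.IH assms(3) by simp
qed

text \<open>Each transposition in \<open>f\<close> is absorbed by \<open>srt_swap\<close>. As
  \<open>srt X ls z\<close> is invertible, \<open>f\<close> is determined by the words
  \<open>ks\<close> and \<open>ls\<close>: this is the coherence theorem in the form used
  below.\<close>

lemma coh_srt:
  assumes "coh X z ks ls f" "\<forall>j \<in> set ks. X j \<in> Ob M" "z \<in> Ob M"
  shows "srt X ls z \<cdot> f = srt X ks z"
  using assms(1)
proof (induction rule: coh.induct)
  case coh_id
  then show ?case using assms by simp
next
  case (coh_step us a b vs f)
  then have "set (us @ a # b # vs) = set ks" by (metis coh_set)
  then have ob: "\<forall>j \<in> set (us @ a # b # vs). X j \<in> Ob M" using assms(2) by blast
  have "srt X (us @ b # a # vs) z \<cdot> (swap_at X us a b vs z \<cdot> f) = srt X (us @ a # b # vs) z \<cdot> f"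
    using coh_ar[OF coh_step.hyps(1) assms(2,3)] ob assms(3)
    by (subst comp_reassoc[OF srt_swap[OF coh_step.hyps(2)]]) simp_all
  then show ?case using coh_step.IH by simp
qed

lemma coh_trans:
  assumes g: "coh X z ls ms g" and f: "coh X z ks ls f"
    and ob: "\<forall>j \<in> set ks. X j \<in> Ob M" "z \<in> Ob M"
  shows "coh X z ks ms (g \<cdot> f)"
  using g
proof (induction rule: coh.induct)
  case coh_id
  then show ?case using coh_ar[OF f ob] f by simp
next
  case (coh_step us a b vs g)
  have ls: "\<forall>j \<in> set ls. X j \<in> Ob M" using coh_set[OF f] ob by simp
  have "set (us @ a # b # vs) = set ls" using coh_set[OF coh_step.hyps(1)] .
  then have "\<forall>j \<in> set (us @ a # b # vs). X j \<in> Ob M" using ls by blast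
  then have "(swap_at X us a b vs z \<cdot> g) \<cdot> f = swap_at X us a b vs z \<cdot> (g \<cdot> f)"
    using coh_ar[OF f ob] coh_ar[OF coh_step.hyps(1) ls ob(2)] ob(2) by simp
  then show ?case using coh.coh_step[OF coh_step.IH coh_step.hyps(2)] by simp
qed

lemma coh_Cons:
  assumes "coh X z ks ls f" "\<forall>j \<in> set ks. X j \<in> Ob M" "z \<in> Ob M" "X c \<in> Ob M"
  shows "coh X z (c # ks) (c # ls) ((X c) \<triangleright> f)"
  using assms(1)
proof (induction rule: coh.induct)
  case coh_id
  then show ?case using coh.coh_id[of X z "c # ks"] assms by simp
next
  case (coh_step us a b vs f)
  have "set (us @ a # b # vs) = set ks" using coh_set[OF coh_step.hyps(1)] .
  then have "\<forall>j \<in> set (us @ a # b # vs). X j \<in> Ob M" using assms(2) by blast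
  then show ?case
    using coh.coh_step[of X z "c # ks" "c # us" a b vs "(X c) \<triangleright> f"] coh_step.hyps(2) coh_step.IH
      coh_ar[OF coh_step.hyps(1) assms(2,3)] assms(3,4) by simp
qed

text \<open>The arrow is unchanged. The letters \<open>vs\<close> merely pass from the tail into the
  word, which \<open>actl\<close> does not distinguish.\<close>

lemma coh_append:
  assumes "coh X (actl (map X vs) z) ks ls f"
  shows "coh X z (ks @ vs) (ls @ vs) f"
  using assms
proof (induction rule: coh.induct)
  case coh_id
  then show ?case using coh.coh_id[of X z "ks @ vs"] by simp
next
  case (coh_step us a b ws f)
  then show ?case using coh.coh_step[of X z "ks @ vs" us a b "ws @ vs"] by simp
qed

text \<open>Relabelling keeps the arrow; injectivity of \<open>s\<close> keeps the two letters of
  every transposition distinct.\<close>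

lemma coh_map:
  assumes "coh (\<lambda>i. X (s i)) z ks ls f" "inj s"
  shows "coh X z (map s ks) (map s ls) f"
  using assms(1)
proof (induction rule: coh.induct)
  case coh_id
  then show ?case using coh.coh_id[of X z "map s ks"] by (simp add: o_def)
next
  case (coh_step us a b vs f)
  then show ?case using coh.coh_step[of X z "map s ks" "map s us" "s a" "s b" "map s vs" f] assms(2)
    by (simp add: o_def inj_eq)
qed

lemma coh_swap:
  assumes "a \<noteq> b" "\<forall>j \<in> set (a # b # vs). X j \<in> Ob M" "z \<in> Ob M"
  shows "coh X z (a # b # vs) (b # a # vs) (sw (X a) (X b) (actl (map X vs) z))"
  using coh_step[of X z "a # b # vs" "[]" a b vs "Ident M (actl (map X (a # b # vs)) z)"]
    coh_id[of X z "a # b # vs"] assms by simp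

lemma coh_ins:
  assumes "X k \<in> Ob M" "\<forall>j \<in> set ks. X j \<in> Ob M" "z \<in> Ob M"
  shows "coh X z (k # ks) (insort k ks) (ins X k ks z)"
  using assms(2)
proof (induction ks)
  case Nil
  then show ?case using coh_id[of X z "[k]"] by simp
next
  case (Cons j js)
  show ?case
  proof (cases "k \<le> j")
    case True
    then show ?thesis using coh_id[of X z "k # j # js"] by simp
  next
    case False
    have "coh X z (k # j # js) (j # insort k js)
        (((X j) \<triangleright> ins X k js z) \<cdot> sw (X k) (X j) (actl (map X js) z))"
      using False Cons assms by (intro coh_trans[OF coh_Cons coh_swap]) auto
    then show ?thesis using False by simp
  qed
qed

lemma coh_sort:
  assumes "\<forall>j \<in> set ks. X j \<in> Ob M" "z \<in> Ob M"
  shows "coh X z ks (sort ks) (srt X ks z)"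
  using assms(1)
proof (induction ks)
  case Nil
  then show ?case using coh_id[of X z "[]"] by simp
next
  case (Cons k ks)
  then show ?case using assms(2) by (auto intro!: coh_trans[OF coh_ins coh_Cons])
qed

text \<open>\<open>f'\<close> is the same sequence of transpositions performed on the objects Y. It
  is built along the derivation of \<open>f\<close>, hence the existential statement; uniqueness can
  identify it afterwards.\<close>

lemma coh_natural:
  assumes "coh X z ks ls f" and z: "z \<in> Ob M"
    and g: "\<forall>j \<in> set ks. g j \<in> Ar M \<and> Dom M (g j) = X j \<and> Cod M (g j) = Y j"
  shows "\<exists>f'. coh Y z ks ls f' \<and>
    actA (map g ls) (Ident M z) \<cdot> f = f' \<cdot> actA (map g ks) (Ident M z)"
  using assms(1)
proof (induction rule: coh.induct)
  have X: "\<forall>j \<in> set ks. X j \<in> Ob M" and Y: "\<forall>j \<in> set ks. Y j \<in> Ob M" using g ar_ob by metis+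
  have m: "map (Dom M \<circ> g) js = map X js" "map (Cod M \<circ> g) js = map Y js"
    if "set js \<subseteq> set ks" for js
    using g that by auto
  {
    case coh_id
    show ?case
      by (rule exI, rule conjI, rule coh.coh_id) (use z g in \<open>simp add: m\<close>)
  next
    case (coh_step us a b vs f)
    then obtain f' where f': "coh Y z ks (us @ a # b # vs) f'"
      "actA (map g (us @ a # b # vs)) (Ident M z) \<cdot> f = f' \<cdot> actA (map g ks) (Ident M z)"
      by blast
    have s: "set (us @ a # b # vs) = set ks" using coh_set[OF coh_step.hyps(1)] .
    then have m': "map (Dom M \<circ> g) us = map X us" "map (Cod M \<circ> g) us = map Y us"
        "map (Dom M \<circ> g) vs = map X vs" "map (Cod M \<circ> g) vs = map Y vs"
      by (intro m; auto)+
    have S: "\<forall>j \<in> set (us @ a # b # vs). X j \<in> Ob M \<and> Y j \<in> Ob M \<and> g j \<in> Ar M \<and> Dom M (g j) = X j \<and>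
        Cod M (g j) = Y j"
      unfolding s using X Y g by blast
    note fa = coh_ar[OF coh_step.hyps(1) X z] coh_ar[OF f'(1) Y z]
    have idl: "map (\<lambda>i. g i \<cdot> Ident M (X i)) us = map g us"
        "map (\<lambda>i. Ident M (Y i) \<cdot> g i) us = map g us"
      using S by auto
    have sw: "actA (map g (us @ b # a # vs)) (Ident M z) \<cdot> swap_at X us a b vs z =
        swap_at Y us a b vs z \<cdot> actA (map g (us @ a # b # vs)) (Ident M z)"
      using S z by (simp add: actA_append actA_comp m' idl sw_natural)
    have "actA (map g (us @ b # a # vs)) (Ident M z) \<cdot> (swap_at X us a b vs z \<cdot> f) =
        swap_at Y us a b vs z \<cdot> (actA (map g (us @ a # b # vs)) (Ident M z) \<cdot> f)"
      using S z fa by (subst comp_reassoc[OF sw]) (simp_all add: m' actA_append)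
    also have "\<dots> = (swap_at Y us a b vs z \<cdot> f') \<cdot> actA (map g ks) (Ident M z)"
      unfolding f'(2) using S z g fa by (simp add: m)
    finally show ?case using coh.coh_step[OF f'(1) coh_step.hyps(2)] by blast
  }
qed

lemma srt_natural:
  assumes z: "z \<in> Ob M"
    and g: "\<forall>j \<in> set ks. g j \<in> Ar M \<and> Dom M (g j) = X j \<and> Cod M (g j) = Y j"
  shows "actA (map g (sort ks)) (Ident M z) \<cdot> srt X ks z = srt Y ks z \<cdot> actA (map g ks) (Ident M z)"
proof -
  have X: "\<forall>j \<in> set ks. X j \<in> Ob M" and Y: "\<forall>j \<in> set ks. Y j \<in> Ob M" using g ar_ob by metis+
  obtain f' where f': "coh Y z ks (sort ks) f'"
    "actA (map g (sort ks)) (Ident M z) \<cdot> srt X ks z = f' \<cdot> actA (map g ks) (Ident M z)"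
    using coh_natural[OF coh_sort[OF X z] z g] by blast
  \<comment> \<open>Uniqueness identifies \<open>f'\<close>, because sorting the already sorted
    target word is the identity.\<close>
  have "f' = srt Y ks z"
    using coh_srt[OF f'(1) Y z] coh_ar[OF f'(1) Y z] srt_sorted[of "sort ks" Y z] Y z by simp
  then show ?thesis using f'(2) by simp
qed

section \<open>Comparison of sorting on a tail with the symmetry isomorphisms of the
  definitions\<close>

lemma swap_iso_untail:
  assumes "x \<in> Ob M" "y \<in> Ob M" "\<forall>z \<in> set zs. z \<in> Ob M"
  shows "swap_iso M x y zs \<cdot> untail (x # y # zs) = untail (y # x # zs) \<cdot> sw x y (actl zs I)"
proof (cases "zs = []")
  case True
  then show ?thesis using assms by (simp add: swap_iso_def sw_runit)
next
  case False
  then have "swap_iso M x y zs = sw x y (tens M zs)"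
    using assms tens_ob_list[of zs] by (simp add: swap_iso_def sw_def)
  then show ?thesis using False assms tens_ob_list[of zs] by (simp add: sw_natural)
qed

lemma insort_iso_untail:
  assumes "X k \<in> Ob M" "\<forall>j \<in> set ks. X j \<in> Ob M"
  shows "insort_iso M X k ks \<cdot> untail (map X (k # ks)) =
      untail (map X (insort k ks)) \<cdot> ins X k ks I"
  using assms(2)
proof (induction ks)
  case Nil
  then show ?case using assms by simp
next
  case (Cons j js)
  have [simp]: "X j \<in> Ob M" "\<forall>j \<in> set js. X j \<in> Ob M" "X k \<in> Ob M" using Cons.prems assms by auto
  show ?case
  proof (cases "k \<le> j")
    case True
    have "tens M (X k # X j # map X js) \<in> Ob M" by (rule tens_ob_list) simp
    have "untail (map X (k # j # js)) \<in> Ar M"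
        "Cod M (untail (map X (k # j # js))) = tens M (map X (k # j # js))"
      "Dom M (untail (map X (k # j # js))) = actl (map X (k # j # js)) I"
      by (rule untail_ar; simp)+
    then show ?thesis using True by (simp del: untail.simps tens.simps list.map actl.simps)
  next
    case False
    have i: "insort_iso M X k js \<in> Ar M" "Dom M (insort_iso M X k js) = tens M (X k # map X js)"
      "Cod M (insort_iso M X k js) = tens M (map X (insort k js))"
      using insort_iso_hom[of X k js] by (auto simp: Hom_iff image_subset_iff)
    have s: "swap_iso M (X k) (X j) (map X js) \<in> Ar M"
      "Dom M (swap_iso M (X k) (X j) (map X js)) = tens M (X k # X j # map X js)"
      "Cod M (swap_iso M (X k) (X j) (map X js)) = tens M (X j # X k # map X js)"
      using swap_iso_hom[of "X k" "X j" "map X js"] by (auto simp: Hom_iff image_subset_iff)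
    have ne: "map X (insort k js) \<noteq> []" using insort_not_Nil by simp
    have u1: "untail (X j # X k # map X js) = (X j) \<triangleright> untail (X k # map X js)" 
      "untail (X j # map X (insort k js)) = (X j) \<triangleright> untail (map X (insort k js))"
      using ne by simp_all
    have "insort_iso M X k (j # js) \<cdot> untail (map X (k # j # js)) =
        ((X j) \<triangleright> insort_iso M X k js) \<cdot>
          (swap_iso M (X k) (X j) (map X js) \<cdot> untail (X k # X j # map X js))"
      using False i s by (simp add: whisker_def del: untail.simps)
    also have "\<dots> = ((X j) \<triangleright> insort_iso M X k js) \<cdot>
          (((X j) \<triangleright> untail (X k # map X js)) \<cdot> sw (X k) (X j) (actl (map X js) I))"
      unfolding u1(1)[symmetric] by (subst swap_iso_untail) simp_all
    also have "\<dots> = ((X j) \<triangleright> (insort_iso M X k js \<cdot> untail (map X (k # js)))) \<cdot>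
        sw (X k) (X j) (actl (map X js) I)"
      using i by (simp del: untail.simps)
    also have "\<dots> = untail (X j # map X (insort k js)) \<cdot> (((X j) \<triangleright> ins X k js I) \<cdot>
        sw (X k) (X j) (actl (map X js) I))"
      unfolding u1(2) using Cons.IH by (simp del: untail.simps)
    also have "\<dots> = untail (map X (insort k (j # js))) \<cdot> ins X k (j # js) I"
      using False by simp
    finally show ?thesis .
  qed
qed

lemma sort_iso_untail:
  assumes "\<forall>j \<in> set ks. X j \<in> Ob M"
  shows "sort_iso M X ks \<cdot> untail (map X ks) = untail (map X (sort ks)) \<cdot> srt X ks I"
  using assms
proof (induction ks)
  case Nil
  then show ?case by simp
next
  case (Cons k ks)
  have [simp]: "X k \<in> Ob M" "\<forall>j \<in> set ks. X j \<in> Ob M" using Cons.prems by auto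
  have i: "insort_iso M X k (sort ks) \<in> Ar M"
      "Dom M (insort_iso M X k (sort ks)) = tens M (X k # map X (sort ks))"
    "Cod M (insort_iso M X k (sort ks)) = tens M (map X (insort k (sort ks)))"
    using insort_iso_hom[of X k "sort ks"] by (auto simp: Hom_iff image_subset_iff)
  have s: "sort_iso M X ks \<in> Ar M" "Dom M (sort_iso M X ks) = tens M (map X ks)"
    "Cod M (sort_iso M X ks) = tens M (map X (sort ks))"
    using sort_iso_hom[of X ks] by (auto simp: Hom_iff image_subset_iff)
  have w: "whisker M (X k) (map X ks) (sort_iso M X ks) \<cdot> untail (X k # map X ks) =
      untail (X k # map X (sort ks)) \<cdot> ((X k) \<triangleright> srt X ks I)"
  proof (cases "ks = []")
    case True
    then show ?thesis by (simp add: whisker_def)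
  next
    case False
    then have "sort ks \<noteq> []" by (metis set_empty2 set_sort)
    then show ?thesis using False Cons.IH s by (simp add: whisker_def)
  qed
  have wa: "whisker M (X k) (map X ks) (sort_iso M X ks) \<in> Hom M (tens M (X k # map X ks)) (tens M
      (X k # map X (sort ks)))"
    using s by (intro whisker_hom) (auto simp: Hom_iff)
  have "sort_iso M X (k # ks) \<cdot> untail (map X (k # ks)) =
      insort_iso M X k (sort ks) \<cdot> (untail (X k # map X (sort ks)) \<cdot> ((X k) \<triangleright> srt X ks I))"
    using i wa w by (simp add: Hom_iff del: untail.simps)
  also have "\<dots> = (untail (map X (insort k (sort ks))) \<cdot> ins X k (sort ks) I) \<cdot> ((X k) \<triangleright> srt X ks I)"
    using i by (subst comp_reassoc[OF insort_iso_untail[of X k "sort ks", simplified list.map]])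
        (simp_all del: untail.simps)
  also have "\<dots> = untail (map X (sort (k # ks))) \<cdot> srt X (k # ks) I"
    by simp
  finally show ?case .
qed

text \<open>Makes the uniqueness of coherence arrows applicable to \<open>perm_iso\<close>: up to
  the invertible \<open>untail\<close> it sorts the word of positions \<sigma> 0, \<sigma> 1,
  ....\<close>

lemma perm_iso_untail:
  assumes "\<forall>x \<in> set xs. x \<in> Ob M" "\<sigma> permutes {..<length xs}"
  shows "perm_iso M xs \<sigma> \<cdot> untail (permute_list \<sigma> xs) =
    untail xs \<cdot> srt (\<lambda>i. xs ! i) (map \<sigma> [0..<length xs]) I"
proof -
  have "map \<sigma> [0..<length xs] = permute_list \<sigma> [0..<length xs]"
    using perm_less[OF assms(2)] by (auto simp: permute_list_def)
  then have "sort (map \<sigma> [0..<length xs]) = [0..<length xs]"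
    using assms(2) by (intro properties_for_sort) simp_all
  then show ?thesis
    using sort_iso_untail[of "map \<sigma> [0..<length xs]" "\<lambda>i. xs ! i"] assms perm_less[OF assms(2)]
    by (auto simp: perm_iso_def permute_list_def map_nth o_def)
qed

end

section \<open>Coherence of the unit and removal of inner brackets\<close>

section \<open>Blocks\<close>

context symmetric_monoidal_category
begin

lemma lunit_unit_tens:
  assumes [simp]: "x \<in> Ob M"
  shows "lunit M (I \<otimes>\<^sub>0 x) = I \<triangleright> lunit M x"
proof (rule iso_mono[of "lunit M x"])
  show "lunit M x \<cdot> lunit M (I \<otimes>\<^sub>0 x) = lunit M x \<cdot> (I \<triangleright> lunit M x)"
    by (subst lunit_natural) simp_all
qed simp_all

text \<open>The counterpart of \<open>runit_tens\<close>. After tensoring with \<open>I\<close> on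
  the left, the pentagon for I, I, x, y applies, and the triangle turns the left unitors into the
  right unitor of \<open>I\<close>.\<close>

lemma lunit_tens:
  assumes [simp]: "x \<in> Ob M" "y \<in> Ob M"
  shows "lunit M (x \<otimes>\<^sub>0 y) \<cdot> assoc M I x y = lunit M x \<otimes>\<^sub>1 Ident M y"
proof (rule unit_tens_faithful)
  let ?e = "assoc M I (I \<otimes>\<^sub>0 x) y \<cdot> (assoc M I I x \<otimes>\<^sub>1 Ident M y)"
  have "(I \<triangleright> (lunit M (x \<otimes>\<^sub>0 y) \<cdot> assoc M I x y)) \<cdot> ?e =
      (I \<triangleright> lunit M (x \<otimes>\<^sub>0 y)) \<cdot> (assoc M I I (x \<otimes>\<^sub>0 y) \<cdot> assoc M (I \<otimes>\<^sub>0 I) x y)"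
    by (simp add: pentagon_ar)
  also have "\<dots> = (runit M I \<otimes>\<^sub>1 (x \<triangleright> Ident M y)) \<cdot> assoc M (I \<otimes>\<^sub>0 I) x y"
    by (simp add: triangle_ar_r)
  also have "\<dots> = assoc M I x y \<cdot> ((runit M I \<otimes>\<^sub>1 Ident M x) \<otimes>\<^sub>1 Ident M y)"
    by (subst assoc_natural) simp_all
  also have "\<dots> = assoc M I x y \<cdot> (((I \<triangleright> lunit M x) \<otimes>\<^sub>1 Ident M y) \<cdot> (assoc M I I x \<otimes>\<^sub>1 Ident M y))"
    by (simp flip: triangle_ar)
  also have "\<dots> = (I \<triangleright> (lunit M x \<otimes>\<^sub>1 Ident M y)) \<cdot> ?e"
    by (subst assoc_natural_r) simp_all
  finally have eq: "(I \<triangleright> (lunit M (x \<otimes>\<^sub>0 y) \<cdot> assoc M I x y)) \<cdot> ?e = \<dots>" .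
  show "I \<triangleright> (lunit M (x \<otimes>\<^sub>0 y) \<cdot> assoc M I x y) = I \<triangleright> (lunit M x \<otimes>\<^sub>1 Ident M y)"
    by (rule iso_epi[OF _ _ _ _ _ eq]) simp_all
qed simp_all

text \<open>Tensored with \<open>I\<close> on the right, both become
  \<open>(I \<triangleright> lunit M I) \<cdot> assoc M I I I\<close>, one by
  \<open>lunit_tens\<close> and the other by the triangle.\<close>

lemma lunit_eq_runit: "lunit M I = runit M I"
proof (rule tens_unit_faithful)
  show "lunit M I \<otimes>\<^sub>1 Ident M I = runit M I \<otimes>\<^sub>1 Ident M I"
    by (simp add: lunit_unit_tens flip: triangle_ar lunit_tens)
qed simp_all

primrec whl :: "'o list \<Rightarrow> 'a \<Rightarrow> 'a" where
  "whl [] f = f"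
| "whl (x # xs) f = x \<triangleright> whl xs f"

lemma whl_ar [simp]:
  assumes "\<forall>x \<in> set xs. x \<in> Ob M" "f \<in> Ar M"
  shows "whl xs f \<in> Ar M" "Dom M (whl xs f) = actl xs (Dom M f)"
      "Cod M (whl xs f) = actl xs (Cod M f)"
  using assms by (induction xs) auto

lemma whl_append [simp]: "whl (xs @ ys) f = whl xs (whl ys f)"
  by (induction xs) auto

lemma whl_comp [simp]:
  "\<lbrakk>\<forall>x \<in> set xs. x \<in> Ob M; f \<in> Ar M; g \<in> Ar M; Dom M g = Cod M f\<rbrakk>
    \<Longrightarrow> whl xs g \<cdot> whl xs f = whl xs (g \<cdot> f)"
  by (induction xs) auto

lemmas whl_comp_r [simp] = whl_comp[THEN comp_reassoc]

lemma actA_whl: "actA (map (\<lambda>i. Ident M (X i)) ks) f = whl (map X ks) f"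
  by (induction ks) auto

lemma coh_whl:
  assumes "coh X z ks ls f" "\<forall>j \<in> set (us @ ks). X j \<in> Ob M" "z \<in> Ob M"
  shows "coh X z (us @ ks) (us @ ls) (whl (map X us) f)"
  using assms by (induction us) (auto intro!: coh_Cons)

text \<open>\<open>join xs z : actl xs I \<otimes> z \<rightarrow> actl xs z\<close>\<close>

primrec join :: "'o list \<Rightarrow> 'o \<Rightarrow> 'a" where
  "join [] z = lunit M z"
| "join (x # xs) z = (x \<triangleright> join xs z) \<cdot> assoc M x (actl xs I) z"

lemma join_ar [simp]:
  assumes "\<forall>x \<in> set xs. x \<in> Ob M" "z \<in> Ob M"
  shows "join xs z \<in> Ar M" "Dom M (join xs z) = actl xs I \<otimes>\<^sub>0 z" "Cod M (join xs z) = actl xs z"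
    "iso_arrow M (join xs z)"
proof -
  have "join xs z \<in> Ar M \<and> Dom M (join xs z) = actl xs I \<otimes>\<^sub>0 z \<and> Cod M (join xs z) = actl xs z \<and>
      iso_arrow M (join xs z)"
    using assms by (induction xs) auto
  then show "join xs z \<in> Ar M" "Dom M (join xs z) = actl xs I \<otimes>\<^sub>0 z" "Cod M (join xs z) = actl xs z"
    "iso_arrow M (join xs z)" by auto
qed

lemma join_natural:
  assumes "\<forall>x \<in> set xs. x \<in> Ob M" and [simp]: "h \<in> Ar M" "Cod M h = z" "y = actl xs I"
  shows "join xs z \<cdot> (y \<triangleright> h) = whl xs h \<cdot> join xs (Dom M h)"
  using assms(1) unfolding assms(4)
proof (induction xs)
  case Nil
  then show ?case by (simp add: lunit_natural)
next
  case (Cons x xs)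
  have [simp]: "z \<in> Ob M" using assms(2,3) cod_ob by blast
  have "join (x # xs) z \<cdot> ((actl (x # xs) I) \<triangleright> h) =
      (x \<triangleright> join xs z) \<cdot> (assoc M x (actl xs I) z \<cdot> ((x \<triangleright> Ident M (actl xs I)) \<otimes>\<^sub>1 h))"
    using Cons.prems by simp
  also have "\<dots> = (x \<triangleright> (join xs z \<cdot> ((actl xs I) \<triangleright> h))) \<cdot> assoc M x (actl xs I) (Dom M h)"
    using Cons.prems by (subst assoc_natural) simp_all
  also have "\<dots> = whl (x # xs) h \<cdot> join (x # xs) (Dom M h)"
    using Cons by simp
  finally show ?case .
qed

lemma join_unit: "\<forall>x \<in> set xs. x \<in> Ob M \<Longrightarrow> join xs I = runit M (actl xs I)"
  by (induction xs) (auto simp: lunit_eq_runit runit_tens)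

text \<open>\<open>join\<close> is the tailed form of \<open>append_iso\<close>. The one-letter word
  is the delicate case: there \<open>untail\<close> inserts a right unitor, and the triangle
  identity matches it with the left unitor at the end of \<open>join\<close>.\<close>

lemma append_iso_untail:
  assumes "\<forall>x \<in> set (xs @ ys). x \<in> Ob M"
  shows "append_iso M xs ys \<cdot> (untail xs \<otimes>\<^sub>1 untail ys) = untail (xs @ ys) \<cdot> join xs (actl ys I)"
  using assms
proof (induction xs)
  case Nil
  then show ?case by (simp add: lunit_natural)
next
  case (Cons x xs)
  have ob [simp]: "x \<in> Ob M" "\<forall>x \<in> set xs. x \<in> Ob M" "\<forall>x \<in> set ys. x \<in> Ob M"
    using Cons.prems by auto
  show ?case
  proof (cases "xs = []")
    case True
    show ?thesis
    proof (cases "ys = []")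
      case True
      then show ?thesis using \<open>xs = []\<close> by (simp add: triangle_ar)
    next
      case False
      have "untail (x # ys) \<cdot> join [x] (actl ys I) =
          (x \<triangleright> untail ys) \<cdot> ((x \<triangleright> lunit M (actl ys I)) \<cdot> assoc M x I (actl ys I))"
        using False by simp
      also have "\<dots> = runit M x \<otimes>\<^sub>1 untail ys"
        by (simp add: triangle_ar)
      finally show ?thesis using True False tens_ob_list[of ys] by (simp add: tens_Cons)
    qed
  next
    case False
    then obtain x' xs' where xs: "xs = x' # xs'" by (cases xs) auto
    have t [simp]: "tens M xs \<in> Ob M" "tens M ys \<in> Ob M" by (simp_all add: tens_ob_list)
    have a: "append_iso M xs ys \<in> Ar M" "Dom M (append_iso M xs ys) = tens M xs \<otimes>\<^sub>0 tens M ys"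
      "Cod M (append_iso M xs ys) = tens M (xs @ ys)"
      using append_iso_hom[of xs ys] ob(2,3) by (auto simp: Hom_iff subset_iff)
    have ai: "append_iso M (x # xs) ys = (x \<triangleright> append_iso M xs ys) \<cdot>
        assoc M x (tens M xs) (tens M ys)"
      unfolding xs by simp
    have "append_iso M (x # xs) ys \<cdot> (untail (x # xs) \<otimes>\<^sub>1 untail ys) =
        (x \<triangleright> append_iso M xs ys) \<cdot> (assoc M x (tens M xs) (tens M ys) \<cdot>
          ((x \<triangleright> untail xs) \<otimes>\<^sub>1 untail ys))"
      using a False by (simp add: ai)
    also have "\<dots> = (x \<triangleright> (append_iso M xs ys \<cdot> (untail xs \<otimes>\<^sub>1 untail ys))) \<cdot>
        assoc M x (actl xs I) (actl ys I)"
      using a by (subst assoc_natural) simp_all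
    also have "\<dots> = untail ((x # xs) @ ys) \<cdot> join (x # xs) (actl ys I)"
      using Cons.IH False by simp
    finally show ?thesis .
  qed
qed

abbreviation tens0 :: "'o list \<Rightarrow> 'o" where
  "tens0 xs \<equiv> actl xs I"

text \<open>\<open>flat xss z : actl (map tens0 xss) z \<rightarrow> actl (concat xss) z\<close>\<close>

primrec flat :: "'o list list \<Rightarrow> 'o \<Rightarrow> 'a" where
  "flat [] z = Ident M z"
| "flat (xs # xss) z = join xs (actl (concat xss) z) \<cdot> ((tens0 xs) \<triangleright> flat xss z)"

lemma flat_ar [simp]:
  assumes "\<forall>xs \<in> set xss. \<forall>x \<in> set xs. x \<in> Ob M" "z \<in> Ob M"
  shows "flat xss z \<in> Ar M" "Dom M (flat xss z) = actl (map tens0 xss) z"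
    "Cod M (flat xss z) = actl (concat xss) z" "iso_arrow M (flat xss z)"
proof -
  have "flat xss z \<in> Ar M \<and> Dom M (flat xss z) = actl (map tens0 xss) z \<and>
      Cod M (flat xss z) = actl (concat xss) z \<and> iso_arrow M (flat xss z)"
    using assms by (induction xss) auto
  then show "flat xss z \<in> Ar M" "Dom M (flat xss z) = actl (map tens0 xss) z"
    "Cod M (flat xss z) = actl (concat xss) z" "iso_arrow M (flat xss z)" by auto
qed

lemma flat_natural:
  assumes "\<forall>xs \<in> set xss. \<forall>x \<in> set xs. x \<in> Ob M" "h \<in> Ar M" "Cod M h = z"
  shows "flat xss z \<cdot> whl (map tens0 xss) h = whl (concat xss) h \<cdot> flat xss (Dom M h)"
  using assms(1)
proof (induction xss)
  case Nil
  then show ?case using assms by simp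
next
  case (Cons xs xss)
  have [simp]: "z \<in> Ob M" using assms(2,3) cod_ob by blast
  have "flat (xs # xss) z \<cdot> whl (map tens0 (xs # xss)) h =
      join xs (actl (concat xss) z) \<cdot> ((tens0 xs) \<triangleright> (flat xss z \<cdot> whl (map tens0 xss) h))"
    using Cons.prems assms by simp
  also have "\<dots> = (join xs (actl (concat xss) z) \<cdot> ((tens0 xs) \<triangleright> whl (concat xss) h)) \<cdot>
      ((tens0 xs) \<triangleright> flat xss (Dom M h))"
    using Cons assms by simp
  also have "\<dots> = whl (concat (xs # xss)) h \<cdot> flat (xs # xss) (Dom M h)"
    using Cons.prems assms by (subst join_natural) simp_all
  finally show ?case .
qed

lemma flat_append:
  assumes "\<forall>xs \<in> set (xss @ yss). \<forall>x \<in> set xs. x \<in> Ob M" "z \<in> Ob M"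
  shows "flat (xss @ yss) z = flat xss (actl (concat yss) z) \<cdot> whl (map tens0 xss) (flat yss z)"
  using assms(1)
proof (induction xss)
  case Nil
  then show ?case using assms(2) by simp
next
  case (Cons xs xss)
  have [simp]: "\<forall>x \<in> set xs. x \<in> Ob M" "\<forall>xs \<in> set xss. \<forall>x \<in> set xs. x \<in> Ob M"
    "\<forall>xs \<in> set yss. \<forall>x \<in> set xs. x \<in> Ob M" "z \<in> Ob M"
    using Cons.prems assms(2) by auto
  show ?case using Cons by simp
qed

text \<open>The tails are removed in two layers, inside every block and then for the word of blocks.
  For a single block the outer layer is a right unitor, supplied by
  \<open>join_unit\<close>.\<close>

lemma concat_iso_untail:
  assumes "\<forall>xs \<in> set xss. \<forall>x \<in> set xs. x \<in> Ob M"
  shows "concat_iso M xss \<cdot> (tensA M (map untail xss) \<cdot> untail (map tens0 xss)) =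
    untail (concat xss) \<cdot> flat xss I"
  using assms
proof (induction xss)
  case Nil
  then show ?case by simp
next
  case (Cons xs xss)
  have ob [simp]: "\<forall>x \<in> set xs. x \<in> Ob M" "\<forall>xs \<in> set xss. \<forall>x \<in> set xs. x \<in> Ob M"
    using Cons.prems by auto
  show ?case
  proof (cases "xss = []")
    case True
    then show ?thesis using tens_ob_list[of xs] by (simp add: join_unit)
  next
    case False
    then obtain ys yss where xss: "xss = ys # yss" by (cases xss) auto
    have t [simp]: "tens M xs \<in> Ob M" by (simp add: tens_ob_list)
    have c: "concat_iso M xss \<in> Ar M" "Dom M (concat_iso M xss) = tens M (map (tens M) xss)"
      "Cod M (concat_iso M xss) = tens M (concat xss)"
      using concat_iso_hom[of xss] ob(2) by (auto simp: Hom_iff subset_iff)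
    have s: "set xs \<subseteq> Ob M" "set (concat xss) \<subseteq> Ob M" using Cons.prems by auto
    have a: "append_iso M xs (concat xss) \<in> Ar M"
        "Dom M (append_iso M xs (concat xss)) = tens M xs \<otimes>\<^sub>0 tens M (concat xss)"
      "Cod M (append_iso M xs (concat xss)) = tens M (xs @ concat xss)"
      using append_iso_hom[of xs "concat xss"] s by (simp_all add: Hom_iff)
    have tA: "tensA M (map untail xss) \<in> Ar M"
        "Dom M (tensA M (map untail xss)) = tens M (map tens0 xss)"
      "Cod M (tensA M (map untail xss)) = tens M (map (tens M) xss)"
      by (auto intro!: arg_cong[where f = "tens M"])
    have ci: "concat_iso M (xs # xss) = append_iso M xs (concat xss) \<cdot>
        ((tens M xs) \<triangleright> concat_iso M xss)"
      unfolding xss by simp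
    have "concat_iso M (xs # xss) \<cdot> (tensA M (map untail (xs # xss)) \<cdot>
        untail (map tens0 (xs # xss))) =
       append_iso M xs (concat xss) \<cdot> (untail xs \<otimes>\<^sub>1
         (concat_iso M xss \<cdot> (tensA M (map untail xss) \<cdot> untail (map tens0 xss))))"
      using False a c tA by (simp add: ci tensA_Cons)
    also have "\<dots> = (append_iso M xs (concat xss) \<cdot> (untail xs \<otimes>\<^sub>1 untail (concat xss))) \<cdot>
        ((tens0 xs) \<triangleright> flat xss I)"
      using Cons.IH a by simp
    also have "\<dots> = untail (concat (xs # xss)) \<cdot> flat (xs # xss) I"
      by (subst append_iso_untail) (auto simp del: untail.simps)
    finally show ?thesis .
  qed
qed

section \<open>Symmetries of blocks as symmetries of their letters\<close>

lemma block_swap_single: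
  assumes "a \<notin> set bs" "\<forall>j \<in> set (a # bs). X j \<in> Ob M" "z \<in> Ob M"
  shows "\<exists>f. coh X z (a # bs) (bs @ [a]) f \<and>
    join (map X bs) (X a \<otimes>\<^sub>0 z) \<cdot> sw (X a) (tens0 (map X bs)) z =
      f \<cdot> ((X a) \<triangleright> join (map X bs) z)"
  using assms(1,2)
proof (induction bs)
  case Nil
  show ?case
    by (rule exI[of _ "Ident M (X a \<otimes>\<^sub>0 z)"]) (use Nil assms(3) coh_id[of X z
        "[a]"] in \<open>simp add: sw_unit_right\<close>)
next
  case (Cons b bs)
  have ob [simp]: "X a \<in> Ob M" "X b \<in> Ob M" "\<forall>j \<in> set bs. X j \<in> Ob M" "z \<in> Ob M"
    using Cons.prems assms by auto
  let ?T = "tens0 (map X bs)" and ?Z = "actl (map X bs) z"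
  obtain f where f: "coh X z (a # bs) (bs @ [a]) f"
    "join (map X bs) (X a \<otimes>\<^sub>0 z) \<cdot> sw (X a) ?T z = f \<cdot> ((X a) \<triangleright> join (map X bs) z)"
    using Cons by auto
  have fa [simp]: "f \<in> Ar M" "Dom M f = X a \<otimes>\<^sub>0 ?Z" "Cod M f = actl (map X bs) (X a \<otimes>\<^sub>0 z)"
    using coh_ar[OF f(1)] by auto
  let ?f = "((X b) \<triangleright> f) \<cdot> sw (X a) (X b) ?Z"
  have "join (map X (b # bs)) (X a \<otimes>\<^sub>0 z) \<cdot> sw (X a) (tens0 (map X (b # bs))) z =
      ((X b) \<triangleright> join (map X bs) (X a \<otimes>\<^sub>0 z)) \<cdot>
        (assoc M (X b) ?T (X a \<otimes>\<^sub>0 z) \<cdot> sw (X a) (X b \<otimes>\<^sub>0 ?T) z)"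
    by simp
  also have "\<dots> = ((X b) \<triangleright> (join (map X bs) (X a \<otimes>\<^sub>0 z) \<cdot> sw (X a) ?T z)) \<cdot>
      (sw (X a) (X b) (?T \<otimes>\<^sub>0 z) \<cdot> ((X a) \<triangleright> assoc M (X b) ?T z))"
    by (simp add: sw_tens_right)
  also have "\<dots> = ((X b) \<triangleright> f) \<cdot> (((X b) \<triangleright> ((X a) \<triangleright> join (map X bs) z)) \<cdot>
      (sw (X a) (X b) (?T \<otimes>\<^sub>0 z) \<cdot> ((X a) \<triangleright> assoc M (X b) ?T z)))"
    unfolding f(2) by simp
  also have "\<dots> = ((X b) \<triangleright> f) \<cdot> (sw (X a) (X b) ?Z \<cdot>
      (((X a) \<triangleright> ((X b) \<triangleright> join (map X bs) z)) \<cdot> ((X a) \<triangleright> assoc M (X b) ?T z)))"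
    by (subst sw_natural_r) simp_all
  also have "\<dots> = ?f \<cdot> ((X a) \<triangleright> join (map X (b # bs)) z)"
    by simp
  finally have eq: "join (map X (b # bs)) (X a \<otimes>\<^sub>0 z) \<cdot> sw (X a) (tens0 (map X (b # bs))) z = \<dots>" .
  have "coh X z (a # b # bs) ((b # bs) @ [a]) ?f"
    using Cons.prems coh_Cons[OF f(1), of b] coh_swap[of a b bs X z] by (auto intro!: coh_trans)
  with eq show ?case by blast
qed

text \<open>\<open>sw_tens_left\<close> splits the first letter off \<open>as\<close>; that letter
  passes \<open>bs\<close> by \<open>block_swap_single\<close>, where \<open>sw_tens_right\<close>
  splits \<open>bs\<close> in turn. The label sets are disjoint because \<open>coh\<close> exchanges
  only distinct labels.\<close>

lemma block_swap:
  assumes "set as \<inter> set bs = {}" "\<forall>j \<in> set (as @ bs). X j \<in> Ob M" "z \<in> Ob M"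
  shows "\<exists>f. coh X z (as @ bs) (bs @ as) f \<and>
    join (map X bs) (actl (map X as) z) \<cdot>
      (((tens0 (map X bs)) \<triangleright> join (map X as) z) \<cdot> sw (tens0 (map X as)) (tens0 (map X bs)) z) =
    f \<cdot> (join (map X as) (actl (map X bs) z) \<cdot> ((tens0 (map X as)) \<triangleright> join (map X bs) z))"
  using assms(1,2)
proof (induction as)
  case Nil
  have [simp]: "\<forall>j \<in> set bs. X j \<in> Ob M" "z \<in> Ob M" using Nil assms by auto
  show ?case
    by (rule exI[of _ "Ident M (actl (map X bs) z)"])
      (use coh_id[of X z bs] in \<open>simp add: sw_unit_left lunit_natural\<close>)
next
  case (Cons a as)
  have ob [simp]: "X a \<in> Ob M" "\<forall>j \<in> set as. X j \<in> Ob M" "\<forall>j \<in> set bs. X j \<in> Ob M" "z \<in> Ob M"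
    using Cons.prems assms by auto
  let ?T = "tens0 (map X as)" and ?U = "tens0 (map X bs)" and ?A = "X a"
  let ?Z = "actl (map X as) z" and ?W = "actl (map X bs) z"
  obtain f where f: "coh X z (as @ bs) (bs @ as) f"
    "join (map X bs) ?Z \<cdot> ((?U \<triangleright> join (map X as) z) \<cdot> sw ?T ?U z) =
    f \<cdot> (join (map X as) ?W \<cdot> (?T \<triangleright> join (map X bs) z))"
    using Cons by auto
  obtain g where g: "coh X ?Z (a # bs) (bs @ [a]) g"
    "join (map X bs) (?A \<otimes>\<^sub>0 ?Z) \<cdot> sw ?A ?U ?Z = g \<cdot> (?A \<triangleright> join (map X bs) ?Z)"
    using block_swap_single[of a bs X ?Z] Cons.prems by auto
  have fa [simp]: "f \<in> Ar M" "Dom M f = actl (map X as) ?W" "Cod M f = actl (map X bs) ?Z"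
    using coh_ar[OF f(1), OF ballI] by force+
  have ga [simp]: "g \<in> Ar M" "Dom M g = ?A \<otimes>\<^sub>0 actl (map X bs) ?Z"
      "Cod M g = actl (map X bs) (?A \<otimes>\<^sub>0 ?Z)"
    using coh_ar[OF g(1)] by auto
  let ?f = "g \<cdot> (?A \<triangleright> f)"
  have "join (map X bs) (actl (map X (a # as)) z) \<cdot>
      ((?U \<triangleright> join (map X (a # as)) z) \<cdot> sw (tens0 (map X (a # as))) ?U z) =
      join (map X bs) (?A \<otimes>\<^sub>0 ?Z) \<cdot> ((?U \<triangleright> (?A \<triangleright> join (map X as) z)) \<cdot>
        ((?U \<triangleright> assoc M ?A ?T z) \<cdot> sw (?A \<otimes>\<^sub>0 ?T) ?U z))"
    by simp
  also have "\<dots> = join (map X bs) (?A \<otimes>\<^sub>0 ?Z) \<cdot> ((?U \<triangleright> (?A \<triangleright> join (map X as) z)) \<cdot>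
        (sw ?A ?U (?T \<otimes>\<^sub>0 z) \<cdot> ((?A \<triangleright> sw ?T ?U z) \<cdot> assoc M ?A ?T (?U \<otimes>\<^sub>0 z))))"
    by (subst sw_tens_left) simp_all
  also have "\<dots> = join (map X bs) (?A \<otimes>\<^sub>0 ?Z) \<cdot> (sw ?A ?U ?Z \<cdot>
        ((?A \<triangleright> (?U \<triangleright> join (map X as) z)) \<cdot>
          ((?A \<triangleright> sw ?T ?U z) \<cdot> assoc M ?A ?T (?U \<otimes>\<^sub>0 z))))"
    by (subst sw_natural_r) simp_all
  also have "\<dots> = g \<cdot> ((Ident M ?A \<otimes>\<^sub>1
      (join (map X bs) ?Z \<cdot> ((?U \<triangleright> join (map X as) z) \<cdot> sw ?T ?U z))) \<cdot> assoc M ?A ?T (?U \<otimes>\<^sub>0 z))"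
    by (subst comp_reassoc[OF g(2)]) simp_all
  also have "\<dots> = ?f \<cdot> ((?A \<triangleright> join (map X as) ?W) \<cdot>
      ((?A \<triangleright> (?T \<triangleright> join (map X bs) z)) \<cdot> assoc M ?A ?T (?U \<otimes>\<^sub>0 z)))"
    unfolding f(2) by simp
  also have "\<dots> = ?f \<cdot> ((?A \<triangleright> join (map X as) ?W) \<cdot>
      (assoc M ?A ?T ?W \<cdot> ((?A \<triangleright> Ident M ?T) \<otimes>\<^sub>1 join (map X bs) z)))"
    by (subst assoc_natural) simp_all
  also have "\<dots> = ?f \<cdot> (join (map X (a # as)) (actl (map X bs) z) \<cdot> 
      ((tens0 (map X (a # as))) \<triangleright> join (map X bs) z))"
    by simp
  finally have eq: "join (map X bs) (actl (map X (a # as)) z) \<cdot>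
      ((?U \<triangleright> join (map X (a # as)) z) \<cdot> sw (tens0 (map X (a # as))) ?U z) = \<dots>" .
  have "coh X z ((a # bs) @ as) ((bs @ [a]) @ as) g" by (rule coh_append[OF g(1)])
  moreover have "coh X z (a # as @ bs) (a # bs @ as) (?A \<triangleright> f)"
    by (rule coh_Cons[OF f(1)]) auto
  ultimately have "coh X z ((a # as) @ bs) (bs @ a # as) ?f"
    using coh_trans[of X z "a # bs @ as" "bs @ a # as" g "a # as @ bs"] by auto
  with eq show ?case by blast
qed

abbreviation block_obs :: "(nat \<Rightarrow> 'o) \<Rightarrow> (nat \<Rightarrow> nat list) \<Rightarrow> nat list \<Rightarrow> 'o list list" where
  "block_obs X L ks \<equiv> map (\<lambda>k. map X (L k)) ks"

text \<open>Each transposition of two blocks is refined by \<open>block_swap\<close>, with the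
  letters of the later blocks as tail, and is carried past the earlier blocks by
  \<open>flat_natural\<close>. Only distinct block labels are exchanged, so disjointness of distinct
  blocks suffices.\<close>

lemma coh_blocks:
  assumes "coh (\<lambda>k. tens0 (map X (L k))) z ks ls f"
    and z [simp]: "z \<in> Ob M" and ob: "\<forall>k \<in> set ks. \<forall>j \<in> set (L k). X j \<in> Ob M"
    and disj: "\<And>k k'. \<lbrakk>k \<in> set ks; k' \<in> set ks; k \<noteq> k'\<rbrakk> \<Longrightarrow> set (L k) \<inter> set (L k') = {}"
  shows "\<exists>f'. coh X z (concat (map L ks)) (concat (map L ls)) f' \<and>
    flat (block_obs X L ls) z \<cdot> f = f' \<cdot> flat (block_obs X L ks) z"
  using assms(1)
proof (induction rule: coh.induct)
  case coh_id
  have [simp]: "actl (concat (block_obs X L ks)) z = actl (map X (concat (map L ks))) z"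
    by (simp add: map_concat o_def)
  show ?case
    by (rule exI, rule conjI, rule coh.coh_id) (use ob in \<open>simp add: o_def\<close>)
next
  case (coh_step us a b vs f)
  let ?Y = "\<lambda>k. tens0 (map X (L k))"
  obtain f' where f': "coh X z (concat (map L ks)) (concat (map L (us @ a # b # vs))) f'"
    "flat (block_obs X L (us @ a # b # vs)) z \<cdot> f = f' \<cdot> flat (block_obs X L ks) z"
    using coh_step.IH by blast
  have s: "set (us @ a # b # vs) = set ks" using coh_set[OF coh_step.hyps(1)] .
  have "\<forall>k \<in> set (us @ a # b # vs). \<forall>j \<in> set (L k). X j \<in> Ob M" unfolding s by (rule ob)
  then have ob' [simp]: "\<forall>k \<in> set us. \<forall>j \<in> set (L k). X j \<in> Ob M" "\<forall>j \<in> set (L a). X j \<in> Ob M"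
    "\<forall>j \<in> set (L b). X j \<in> Ob M" "\<forall>k \<in> set vs. \<forall>j \<in> set (L k). X j \<in> Ob M"
    by auto
  have "a \<in> set ks" "b \<in> set ks" using s by auto
  then have d: "set (L a) \<inter> set (L b) = {}" by (rule disj) (rule coh_step.hyps(2))
  have cm [simp]: "concat (block_obs X L js) = map X (concat (map L js))" for js
    by (simp add: map_concat o_def)
  have fa [simp]: "f \<in> Ar M" "Dom M f = actl (map ?Y ks) z"
      "Cod M f = actl (map ?Y (us @ a # b # vs)) z"
    using coh_ar[OF coh_step.hyps(1) _ z] ob by auto
  have fa' [simp]: "f' \<in> Ar M" "Dom M f' = actl (map X (concat (map L ks))) z"
    "Cod M f' = actl (map X (concat (map L (us @ a # b # vs)))) z"
    using coh_ar[OF f'(1) _ z] ob by auto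
  let ?Z = "actl (map X (concat (map L vs))) z" and ?V = "block_obs X L vs"
  let ?A = "map X (L a)" and ?B = "map X (L b)"
  obtain g where g: "coh X ?Z (L a @ L b) (L b @ L a) g"
    "join ?B (actl ?A ?Z) \<cdot> (((tens0 ?B) \<triangleright> join ?A ?Z) \<cdot> sw (tens0 ?A) (tens0 ?B) ?Z) =
    g \<cdot> (join ?A (actl ?B ?Z) \<cdot> ((tens0 ?A) \<triangleright> join ?B ?Z))"
    using block_swap[of "L a" "L b" X ?Z, OF d, OF ballI] by force
  have ga [simp]: "g \<in> Ar M" "Dom M g = actl ?A (actl ?B ?Z)" "Cod M g = actl ?B (actl ?A ?Z)"
    using coh_ar[OF g(1), OF ballI] by force+
  have hd: "flat (?B # ?A # ?V) z \<cdot> sw (tens0 ?A) (tens0 ?B) (actl (map tens0 ?V) z) =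
      g \<cdot> flat (?A # ?B # ?V) z"
  proof -
    have "flat (?B # ?A # ?V) z \<cdot> sw (tens0 ?A) (tens0 ?B) (actl (map tens0 ?V) z) =
        join ?B (actl ?A ?Z) \<cdot> (((tens0 ?B) \<triangleright> join ?A ?Z) \<cdot>
        (((tens0 ?B) \<triangleright> ((tens0 ?A) \<triangleright> flat ?V z)) \<cdot>
          sw (tens0 ?A) (tens0 ?B) (actl (map tens0 ?V) z)))"
      by (simp add: o_def)
    also have "\<dots> = (join ?B (actl ?A ?Z) \<cdot> (((tens0 ?B) \<triangleright> join ?A ?Z) \<cdot>
        sw (tens0 ?A) (tens0 ?B) ?Z)) \<cdot> ((tens0 ?A) \<triangleright> ((tens0 ?B) \<triangleright> flat ?V z))"
      by (simp add: sw_natural o_def)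
    also have "\<dots> = g \<cdot> flat (?A # ?B # ?V) z"
      unfolding g(2) by (simp add: o_def)
    finally show ?thesis .
  qed
  let ?U = "block_obs X L us"
  have sweq: "flat (block_obs X L (us @ b # a # vs)) z \<cdot> swap_at ?Y us a b vs z =
      whl (map X (concat (map L us))) g \<cdot> flat (block_obs X L (us @ a # b # vs)) z"
  proof -
    have "flat (block_obs X L (us @ b # a # vs)) z \<cdot> swap_at ?Y us a b vs z =
        flat ?U (actl ?B (actl ?A ?Z)) \<cdot> whl (map tens0 ?U)
          (flat (?B # ?A # ?V) z \<cdot> sw (tens0 ?A) (tens0 ?B) (actl (map tens0 ?V) z))"
      by (simp add: flat_append actA_whl o_def del: flat.simps)
    also have "\<dots> = (flat ?U (actl ?B (actl ?A ?Z)) \<cdot> whl (map tens0 ?U) g) \<cdot>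
        whl (map tens0 ?U) (flat (?A # ?B # ?V) z)"
      unfolding hd by (simp add: o_def del: flat.simps)
    also have "\<dots> = whl (map X (concat (map L us))) g \<cdot> flat (block_obs X L (us @ a # b # vs)) z"
      by (subst flat_natural) (simp_all add: flat_append o_def del: flat.simps)
    finally show ?thesis .
  qed
  let ?f = "whl (map X (concat (map L us))) g \<cdot> f'"
  have "flat (block_obs X L (us @ b # a # vs)) z \<cdot> (swap_at ?Y us a b vs z \<cdot> f) =
      whl (map X (concat (map L us))) g \<cdot> (flat (block_obs X L (us @ a # b # vs)) z \<cdot> f)"
    by (subst comp_reassoc[OF sweq]) (simp_all add: o_def actA_whl del: flat.simps)
  also have "\<dots> = ?f \<cdot> flat (block_obs X L ks) z"
    unfolding f'(2) using ob by (simp add: o_def del: flat.simps)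
  finally have eq: "flat (block_obs X L (us @ b # a # vs)) z \<cdot> (swap_at ?Y us a b vs z \<cdot> f) = \<dots>" .
  have g1: "coh X z (L a @ L b @ concat (map L vs)) (L b @ L a @ concat (map L vs)) g"
    using coh_append[OF g(1)] by simp
  have "coh X z (concat (map L us) @ L a @ L b @ concat (map L vs)) (concat (map L us) @ L b @ L a
      @ concat (map L vs))
      (whl (map X (concat (map L us))) g)"
    by (rule coh_whl[OF g1]) auto
  then have "coh X z (concat (map L ks)) (concat (map L (us @ b # a # vs))) ?f"
    using ob by (intro coh_trans[OF _ f'(1)]) auto
  with eq show ?case by blast
qed

text \<open>The tail may be divided: a swap with tail v \<otimes> w is the swap with tail v,
  tensored with w. Both reduce to the braiding by \<open>sw_assoc\<close>, and pentagons match the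
  associators.\<close>

lemma sw_tail:
  assumes [simp]: "a \<in> Ob M" "b \<in> Ob M" "v \<in> Ob M" "w \<in> Ob M"
  shows "(b \<triangleright> assoc M a v w) \<cdot> (assoc M b (a \<otimes>\<^sub>0 v) w \<cdot> (sw a b v \<otimes>\<^sub>1 Ident M w)) =
    sw a b (v \<otimes>\<^sub>0 w) \<cdot> ((a \<triangleright> assoc M b v w) \<cdot> assoc M a (b \<otimes>\<^sub>0 v) w)"
proof (rule iso_epi[of "assoc M a b v \<otimes>\<^sub>1 Ident M w"])
  have "((b \<triangleright> assoc M a v w) \<cdot> (assoc M b (a \<otimes>\<^sub>0 v) w \<cdot> (sw a b v \<otimes>\<^sub>1 Ident M w))) \<cdot>
      (assoc M a b v \<otimes>\<^sub>1 Ident M w) =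
      (b \<triangleright> assoc M a v w) \<cdot> (assoc M b (a \<otimes>\<^sub>0 v) w \<cdot> ((assoc M b a v \<otimes>\<^sub>1 Ident M w) \<cdot>
        ((braid M a b \<otimes>\<^sub>1 Ident M v) \<otimes>\<^sub>1 Ident M w)))"
    by (simp add: sw_assoc)
  also have "\<dots> = assoc M b a (v \<otimes>\<^sub>0 w) \<cdot> (assoc M (b \<otimes>\<^sub>0 a) v w \<cdot>
      ((braid M a b \<otimes>\<^sub>1 Ident M v) \<otimes>\<^sub>1 Ident M w))"
    by (simp add: pentagon_ar_r)
  also have "\<dots> = assoc M b a (v \<otimes>\<^sub>0 w) \<cdot> ((braid M a b \<otimes>\<^sub>1 (v \<triangleright> Ident M w)) \<cdot>
      assoc M (a \<otimes>\<^sub>0 b) v w)"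
    by (subst assoc_natural) simp_all
  also have "\<dots> = sw a b (v \<otimes>\<^sub>0 w) \<cdot> (assoc M a b (v \<otimes>\<^sub>0 w) \<cdot> assoc M (a \<otimes>\<^sub>0 b) v w)"
    by (simp add: sw_assoc_r)
  also have "\<dots> = (sw a b (v \<otimes>\<^sub>0 w) \<cdot> ((a \<triangleright> assoc M b v w) \<cdot> assoc M a (b \<otimes>\<^sub>0 v) w)) \<cdot>
      (assoc M a b v \<otimes>\<^sub>1 Ident M w)"
    by (simp add: pentagon_ar)
  finally show "((b \<triangleright> assoc M a v w) \<cdot> (assoc M b (a \<otimes>\<^sub>0 v) w \<cdot> (sw a b v \<otimes>\<^sub>1 Ident M w))) \<cdot>
      (assoc M a b v \<otimes>\<^sub>1 Ident M w) = (sw a b (v \<otimes>\<^sub>0 w) \<cdot> ((a \<triangleright> assoc M b v w) \<cdot> assoc M a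
        (b \<otimes>\<^sub>0 v) w)) \<cdot>
      (assoc M a b v \<otimes>\<^sub>1 Ident M w)" .
qed simp_all

lemma swap_at_tail:
  assumes "\<forall>j \<in> set (us @ a # b # vs). X j \<in> Ob M" and [simp]: "w \<in> Ob M"
  shows "join (map X (us @ b # a # vs)) w \<cdot> (swap_at X us a b vs I \<otimes>\<^sub>1 Ident M w) =
    swap_at X us a b vs w \<cdot> join (map X (us @ a # b # vs)) w"
  using assms(1)
proof (induction us)
  case Nil
  then have [simp]: "X a \<in> Ob M" "X b \<in> Ob M" "\<forall>j \<in> set vs. X j \<in> Ob M" by auto
  let ?V = "tens0 (map X vs)"
  have "join (map X (b # a # vs)) w \<cdot> (sw (X a) (X b) ?V \<otimes>\<^sub>1 Ident M w) =
      ((X b) \<triangleright> ((X a) \<triangleright> join (map X vs) w)) \<cdot> (((X b) \<triangleright> assoc M (X a) ?V w) \<cdot>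
        (assoc M (X b) (X a \<otimes>\<^sub>0 ?V) w \<cdot> (sw (X a) (X b) ?V \<otimes>\<^sub>1 Ident M w)))"
    by simp
  also have "\<dots> = (((X b) \<triangleright> ((X a) \<triangleright> join (map X vs) w)) \<cdot> sw (X a) (X b) (?V \<otimes>\<^sub>0 w)) \<cdot>
      (((X a) \<triangleright> assoc M (X b) ?V w) \<cdot> assoc M (X a) (X b \<otimes>\<^sub>0 ?V) w)"
    by (subst sw_tail) simp_all
  also have "((X b) \<triangleright> ((X a) \<triangleright> join (map X vs) w)) \<cdot> sw (X a) (X b) (?V \<otimes>\<^sub>0 w) =
      sw (X a) (X b) (actl (map X vs) w) \<cdot> ((X a) \<triangleright> ((X b) \<triangleright> join (map X vs) w))"
    by (subst sw_natural) simp_all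
  finally show ?case by simp
next
  case (Cons u us)
  then have [simp]: "X u \<in> Ob M" "\<forall>j \<in> set us. X j \<in> Ob M" "X a \<in> Ob M" "X b \<in> Ob M"
      "\<forall>j \<in> set vs. X j \<in> Ob M"
    by auto
  have "join (map X ((u # us) @ b # a # vs)) w \<cdot> (swap_at X (u # us) a b vs I \<otimes>\<^sub>1 Ident M w) =
      ((X u) \<triangleright> join (map X (us @ b # a # vs)) w) \<cdot> (assoc M (X u) (tens0 (map X
        (us @ b # a # vs))) w \<cdot>
        (((X u) \<triangleright> swap_at X us a b vs I) \<otimes>\<^sub>1 Ident M w))"
    by simp
  also have "\<dots> = ((X u) \<triangleright> (join (map X (us @ b # a # vs)) w \<cdot>
      (swap_at X us a b vs I \<otimes>\<^sub>1 Ident M w))) \<cdot>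
      assoc M (X u) (tens0 (map X (us @ a # b # vs))) w"
    by (subst assoc_natural) simp_all
  also have "\<dots> = swap_at X (u # us) a b vs w \<cdot> join (map X ((u # us) @ a # b # vs)) w"
    using Cons by simp
  finally show ?case .
qed

text \<open>A coherence arrow inside one block is given with tail \<open>I\<close>. Here the tail is
  replaced by the word \<open>w\<close> that follows, keeping the same transpositions.\<close>

lemma coh_tail:
  assumes "coh X I ks ls f" and ob: "\<forall>j \<in> set ks. X j \<in> Ob M" and w [simp]: "w \<in> Ob M"
  shows "\<exists>g. coh X w ks ls g \<and>
    join (map X ls) w \<cdot> (f \<otimes>\<^sub>1 Ident M w) = g \<cdot> join (map X ks) w"
  using assms(1)
proof (induction rule: coh.induct)
  case coh_id
  show ?case by (rule exI, rule conjI, rule coh.coh_id) (use ob in simp)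
next
  case (coh_step us a b vs f)
  then obtain g where g: "coh X w ks (us @ a # b # vs) g"
    "join (map X (us @ a # b # vs)) w \<cdot> (f \<otimes>\<^sub>1 Ident M w) = g \<cdot> join (map X ks) w" by blast
  have s: "set (us @ a # b # vs) = set ks" using coh_set[OF coh_step.hyps(1)] .
  have ob': "\<forall>j \<in> set (us @ a # b # vs). X j \<in> Ob M" unfolding s by (rule ob)
  then have [simp]: "X a \<in> Ob M" "X b \<in> Ob M" "\<forall>j \<in> set us. X j \<in> Ob M" "\<forall>j \<in> set vs. X j \<in> Ob M"
    by auto
  note fa [simp] = coh_ar[OF coh_step.hyps(1) ob ob_simps(1)] coh_ar[OF g(1) ob w]
  have "join (map X (us @ b # a # vs)) w \<cdot> ((swap_at X us a b vs I \<cdot> f) \<otimes>\<^sub>1 Ident M w) =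
      join (map X (us @ b # a # vs)) w \<cdot> ((swap_at X us a b vs I \<otimes>\<^sub>1 Ident M w) \<cdot>
          (f \<otimes>\<^sub>1 Ident M w))"
    by simp
  also have "\<dots> = swap_at X us a b vs w \<cdot> (join (map X (us @ a # b # vs)) w \<cdot> (f \<otimes>\<^sub>1 Ident M w))"
    by (subst comp_reassoc[OF swap_at_tail[OF ob' w]]) simp_all
  also have "\<dots> = (swap_at X us a b vs w \<cdot> g) \<cdot> join (map X ks) w"
    unfolding g(2) using ob by simp
  finally show ?case using coh.coh_step[OF g(1) coh_step.hyps(2)] by blast
qed

text \<open>Parallel to \<open>coh_blocks\<close>: the transpositions happen inside the blocks,
  whose order stays fixed. The first block is permuted with the others as its tail
  (\<open>coh_tail\<close>), and afterwards the others behind the first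
  (\<open>coh_whl\<close>).\<close>

lemma coh_concat:
  assumes "\<forall>i \<in> set is. coh X I (K i) (L i) (f i)"
    "\<forall>i \<in> set is. \<forall>j \<in> set (K i). X j \<in> Ob M" and z [simp]: "z \<in> Ob M"
  shows "\<exists>f'. coh X z (concat (map K is)) (concat (map L is)) f' \<and>
    flat (map (\<lambda>i. map X (L i)) is) z \<cdot> actA (map f is) (Ident M z) = f' \<cdot> flat (map (\<lambda>i. map X
        (K i)) is) z"
  using assms(1,2)
proof (induction "is")
  case Nil
  show ?case using coh_id[of X z "[]"] by auto
next
  case (Cons i "is")
  then obtain f' where f': "coh X z (concat (map K is)) (concat (map L is)) f'"
    "flat (map (\<lambda>i. map X (L i)) is) z \<cdot> actA (map f is) (Ident M z) =
      f' \<cdot> flat (map (\<lambda>i. map X (K i)) is) z"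
    by auto
  have K: "\<forall>j \<in> set (K i). X j \<in> Ob M" "\<forall>j \<in> set (concat (map K is)). X j \<in> Ob M" using Cons.prems
      by auto
  have sL: "set (L i') = set (K i')" if "i' \<in> set (i # is)" for i' using coh_set Cons.prems(1) that
      by blast
  have L: "\<forall>j \<in> set (L i). X j \<in> Ob M" "\<forall>j \<in> set (concat (map L is)). X j \<in> Ob M"
    using Cons.prems(2) sL by auto
  have [simp]: "\<forall>j \<in> set (K i). X j \<in> Ob M" "\<forall>j \<in> set (L i). X j \<in> Ob M"
    "\<forall>i \<in> set is. \<forall>j \<in> set (K i). X j \<in> Ob M" "\<forall>i \<in> set is. \<forall>j \<in> set (L i). X j \<in> Ob M"
    using K L by auto
  have cm [simp]: "concat (map (\<lambda>i. map X (J i)) is) = map X (concat (map J is))" for J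
    by (simp add: map_concat o_def)
  let ?u = "actl (map X (concat (map K is))) z" and ?v = "actl (map X (concat (map L is))) z"
  have fi [simp]: "f i' \<in> Ar M" "Dom M (f i') = tens0 (map X (K i'))"
      "Cod M (f i') = tens0 (map X (L i'))"
    if "i' \<in> set (i # is)" for i'
    using coh_ar[of X I "K i'" "L i'" "f i'"] Cons.prems that by auto
  note fa [simp] = coh_ar[OF f'(1) K(2) z]
  obtain g where g: "coh X ?u (K i) (L i) g"
    "join (map X (L i)) ?u \<cdot> (f i \<otimes>\<^sub>1 Ident M ?u) = g \<cdot> join (map X (K i)) ?u"
    using coh_tail[of X "K i" "L i" "f i" ?u] Cons.prems by auto
  have ga [simp]: "g \<in> Ar M" "Dom M g = actl (map X (K i)) ?u" "Cod M g = actl (map X (L i)) ?u"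
    using coh_ar[OF g(1) K(1)] by simp_all
  have mD [simp]: "map (Dom M \<circ> f) is = map (\<lambda>i. tens0 (map X (K i))) is"
    "map (Cod M \<circ> f) is = map (\<lambda>i. tens0 (map X (L i))) is" by auto
  note [simp] = mD[unfolded o_def]
  have "flat (map (\<lambda>i. map X (L i)) (i # is)) z \<cdot> actA (map f (i # is)) (Ident M z) =
      join (map X (L i)) ?v \<cdot> (f i \<otimes>\<^sub>1 (flat (map (\<lambda>i. map X (L i)) is) z \<cdot> actA (map f is)
          (Ident M z)))"
    by (simp add: o_def)
  also have "\<dots> = (join (map X (L i)) ?v \<cdot> ((tens0 (map X (L i))) \<triangleright> f')) \<cdot> ((f i \<otimes>\<^sub>1 Ident M ?u) \<cdot>
       ((tens0 (map X (K i))) \<triangleright> flat (map (\<lambda>i. map X (K i)) is) z))"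
    unfolding f'(2) by (simp add: o_def)
  also have "\<dots> = whl (map X (L i)) f' \<cdot> (join (map X (L i)) ?u \<cdot> ((f i \<otimes>\<^sub>1 Ident M ?u) \<cdot>
       ((tens0 (map X (K i))) \<triangleright> flat (map (\<lambda>i. map X (K i)) is) z)))"
    by (subst join_natural) (simp_all add: o_def)
  also have "\<dots> = (whl (map X (L i)) f' \<cdot> g) \<cdot> flat (map (\<lambda>i. map X (K i)) (i # is)) z"
    by (subst comp_reassoc[OF g(2)]) (simp_all add: o_def)
  finally have eq: "flat (map (\<lambda>i. map X (L i)) (i # is)) z \<cdot> actA (map f (i # is)) (Ident M z) =
      \<dots>" .
  have "coh X z (L i @ concat (map K is)) (L i @ concat (map L is)) (whl (map X (L i)) f')"
    by (rule coh_whl[OF f'(1)]) (use K L in auto)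
  moreover have "coh X z (K i @ concat (map K is)) (L i @ concat (map K is)) g"
    by (rule coh_append) (use g(1) in simp)
  ultimately have "coh X z (concat (map K (i # is))) (concat (map L (i # is))) (whl (map X (L i))
      f' \<cdot> g)"
    by (simp, rule coh_trans) (use K in auto)
  with eq show ?case by blast
qed

section \<open>Products of words in a monoid\<close>

section \<open>Iterated multiplication in a monoid\<close>

text \<open>\<open>evm mu [g\<^sub>1, \<dots>, g\<^sub>n] h\<close> is the product \<open>g\<^sub>1 \<dots> g\<^sub>n h\<close> in the monoid with multiplication \<open>mu\<close>.\<close>

primrec evm :: "'a \<Rightarrow> 'a list \<Rightarrow> 'a \<Rightarrow> 'a" where
  "evm mu [] h = h"
| "evm mu (g # gs) h = mu \<cdot> (g \<otimes>\<^sub>1 evm mu gs h)"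

lemma monoidD:
  assumes "is_monoid M (a, mu, eta)"
  shows "a \<in> Ob M" "mu \<in> Ar M" "Dom M mu = a \<otimes>\<^sub>0 a" "Cod M mu = a"
    "eta \<in> Ar M" "Dom M eta = I" "Cod M eta = a"
    "mu \<cdot> (mu \<otimes>\<^sub>1 Ident M a) = mu \<cdot> ((a \<triangleright> mu) \<cdot> assoc M a a a)"
    "mu \<cdot> (eta \<otimes>\<^sub>1 Ident M a) = lunit M a" "mu \<cdot> (a \<triangleright> eta) = runit M a"
  using assms by (auto simp: is_monoid_def Hom_iff)

lemma evm_append: "evm mu (gs @ gs') h = evm mu gs (evm mu gs' h)"
  by (induction gs) auto

lemma evm_ar [simp]:
  assumes "\<forall>g \<in> set gs. g \<in> Ar M \<and> Cod M g = a" "h \<in> Ar M" "Cod M h = a"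
    "mu \<in> Ar M" "Dom M mu = a \<otimes>\<^sub>0 a" "Cod M mu = a"
  shows "evm mu gs h \<in> Ar M" "Dom M (evm mu gs h) = actl (map (Dom M) gs) (Dom M h)"
    "Cod M (evm mu gs h) = a"
proof -
  have "evm mu gs h \<in> Ar M \<and> Dom M (evm mu gs h) = actl (map (Dom M) gs) (Dom M h) \<and>
      Cod M (evm mu gs h) = a"
    using assms(1) by (induction gs) (use assms(2-) in auto)
  then show "evm mu gs h \<in> Ar M" "Dom M (evm mu gs h) = actl (map (Dom M) gs) (Dom M h)"
    "Cod M (evm mu gs h) = a" by auto
qed

lemma evm_actA:
  assumes "\<forall>i \<in> set ks. f i \<in> Ar M \<and> g i \<in> Ar M \<and> Cod M (g i) = a \<and> Dom M (g i) = Cod M (f i)"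
    "h \<in> Ar M" "Cod M h = a" "k \<in> Ar M" "Dom M h = Cod M k"
    and [simp]: "mu \<in> Ar M" "Dom M mu = a \<otimes>\<^sub>0 a" "Cod M mu = a"
  shows "evm mu (map g ks) h \<cdot> actA (map f ks) k = evm mu (map (\<lambda>i. g i \<cdot> f i) ks) (h \<cdot> k)"
  using assms(1)
proof (induction ks)
  case Nil
  then show ?case using assms by simp
next
  case (Cons i ks)
  have [simp]: "actl (map (Dom M \<circ> g) ks) w = actl (map (Cod M \<circ> f) ks) w" for w
    using Cons.prems by (auto intro!: arg_cong2[where f = actl])
  have [simp]: "\<forall>g' \<in> set (map g ks). g' \<in> Ar M \<and> Cod M g' = a" "\<forall>f' \<in> set (map f ks). f' \<in> Ar M"
    "f i \<in> Ar M" "g i \<in> Ar M" "Cod M (g i) = a" "Dom M (g i) = Cod M (f i)"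
    using Cons.prems by auto
  note [simp] = evm_ar[of "map g ks" a] 
  show ?case using Cons assms by simp
qed

text \<open>Associativity moves the factor \<open>h\<close> inwards letter by letter until it meets
  \<open>eta\<close>, which the left unit law removes.\<close>

lemma evm_join:
  assumes m: "is_monoid M (a, mu, eta)" and g: "\<forall>g \<in> set gs. g \<in> Ar M \<and> Cod M g = a"
    and h: "h \<in> Ar M" "Cod M h = a"
  shows "mu \<cdot> (evm mu gs eta \<otimes>\<^sub>1 h) = evm mu gs h \<cdot> join (map (Dom M) gs) (Dom M h)"
  using g
proof (induction gs)
  case Nil
  note [simp] = monoidD[OF m]
  have "mu \<cdot> (eta \<otimes>\<^sub>1 h) = (mu \<cdot> (eta \<otimes>\<^sub>1 Ident M a)) \<cdot> (I \<triangleright> h)"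
    using h by (simp del: monoidD(9)[OF m])
  then show ?case using h by (simp add: lunit_natural)
next
  case (Cons g gs)
  note [simp] = monoidD(1-7)[OF m]
  let ?e = "evm mu gs eta" and ?t = "tens0 (map (Dom M) gs)"
  have gs: "\<forall>g \<in> set gs. g \<in> Ar M \<and> Cod M g = a" using Cons.prems by simp
  note [simp] = evm_ar[OF gs, of _ mu]
  have o: "\<forall>x \<in> set (map (Dom M) gs). x \<in> Ob M" using gs by simp
  have "mu \<cdot> (evm mu (g # gs) eta \<otimes>\<^sub>1 h) = (mu \<cdot> (mu \<otimes>\<^sub>1 Ident M a)) \<cdot> ((g \<otimes>\<^sub>1 ?e) \<otimes>\<^sub>1 h)"
    using Cons.prems h by simp
  also have "\<dots> = mu \<cdot> ((a \<triangleright> mu) \<cdot> (assoc M a a a \<cdot> ((g \<otimes>\<^sub>1 ?e) \<otimes>\<^sub>1 h)))"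
    unfolding monoidD(8)[OF m] using Cons.prems h by simp
  also have "\<dots> = mu \<cdot> ((g \<otimes>\<^sub>1 (mu \<cdot> (?e \<otimes>\<^sub>1 h))) \<cdot> assoc M (Dom M g) ?t (Dom M h))"
    using Cons.prems h by (subst assoc_natural) simp_all
  also have "\<dots> = mu \<cdot> ((g \<otimes>\<^sub>1 (evm mu gs h \<cdot> join (map (Dom M) gs) (Dom M h))) \<cdot>
      assoc M (Dom M g) ?t (Dom M h))"
    using Cons.IH[OF gs] by simp
  also have "\<dots> = evm mu (g # gs) h \<cdot> join (map (Dom M) (g # gs)) (Dom M h)"
    using Cons.prems h o by simp
  finally show ?case .
qed

text \<open>General associativity: multiplying the products of the blocks is multiplying all
  letters. The brackets removed on the way are recorded by \<open>flat\<close>.\<close>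

lemma evm_flat:
  assumes m: "is_monoid M (a, mu, eta)" and g: "\<forall>gs \<in> set gss. \<forall>g \<in> set gs. g \<in> Ar M \<and> Cod M g = a"
    and h: "h \<in> Ar M" "Cod M h = a"
  shows "evm mu (map (\<lambda>gs. evm mu gs eta) gss) h =
    evm mu (concat gss) h \<cdot> flat (map (map (Dom M)) gss) (Dom M h)"
  using g
proof (induction gss)
  case Nil
  then show ?case using h by simp
next
  case (Cons gs gss)
  note [simp] = monoidD(1-7)[OF m]
  have gs: "\<forall>g \<in> set gs. g \<in> Ar M \<and> Cod M g = a" "\<forall>g \<in> set (concat gss). g \<in> Ar M \<and> Cod M g = a"
    using Cons.prems by auto
  note [simp] = evm_ar[OF gs(1), of _ mu] evm_ar[OF gs(2), of _ mu]
  have o [simp]: "\<forall>x \<in> set gs. Dom M x \<in> Ob M" "\<forall>x \<in> set gss. \<forall>x \<in> set x. Dom M x \<in> Ob M"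
    using Cons.prems by auto
  have [simp]: "concat (map (map (Dom M)) gss) = map (Dom M) (concat gss)" by (simp add: map_concat)
  let ?F = "flat (map (map (Dom M)) gss) (Dom M h)"
  have Fa [simp]: "?F \<in> Ar M" "Cod M ?F = actl (map (Dom M) (concat gss)) (Dom M h)"
    "Dom M ?F = actl (map (tens0 \<circ> map (Dom M)) gss) (Dom M h)"
    using h by simp_all
  have "evm mu (map (\<lambda>gs. evm mu gs eta) (gs # gss)) h =
      mu \<cdot> (evm mu gs eta \<otimes>\<^sub>1 (evm mu (concat gss) h \<cdot> ?F))"
    using Cons by simp
  also have "\<dots> = (mu \<cdot> (evm mu gs eta \<otimes>\<^sub>1 evm mu (concat gss) h)) \<cdot> ((tens0 (map (Dom M) gs)) \<triangleright> ?F)"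
    using h by simp
  also have "\<dots> = evm mu (concat (gs # gss)) h \<cdot> flat (map (map (Dom M)) (gs # gss)) (Dom M h)"
    using h by (subst evm_join[OF m gs(1)]) (simp_all add: evm_append)
  finally show ?case .
qed

lemma evm_hom:
  assumes m: "is_monoid M (a, mu, eta)" "is_monoid M (a', mu', eta')"
    and p: "p \<in> Ar M" "Dom M p = a" "Cod M p = a'" "p \<cdot> mu = mu' \<cdot> (p \<otimes>\<^sub>1 p)"
    and g: "\<forall>g \<in> set gs. g \<in> Ar M \<and> Cod M g = a" and h: "h \<in> Ar M" "Cod M h = a"
  shows "p \<cdot> evm mu gs h = evm mu' (map (\<lambda>g. p \<cdot> g) gs) (p \<cdot> h)"
  using g
proof (induction gs)
  case Nil
  show ?case by simp
next
  case (Cons g gs)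
  note [simp] = monoidD(1-7)[OF m(1)] monoidD(1-7)[OF m(2)]
  have gs: "\<forall>g \<in> set gs. g \<in> Ar M \<and> Cod M g = a" using Cons.prems by auto
  note [simp] = evm_ar[OF gs(1), of _ mu]
  have "p \<cdot> evm mu (g # gs) h = (p \<cdot> mu) \<cdot> (g \<otimes>\<^sub>1 evm mu gs h)"
    using Cons.prems p(1-3) h by simp
  also have "\<dots> = mu' \<cdot> ((p \<cdot> g) \<otimes>\<^sub>1 (p \<cdot> evm mu gs h))"
    unfolding p(4) using Cons.prems p(1-3) h by simp
  also have "\<dots> = evm mu' (map (\<lambda>g. p \<cdot> g) (g # gs)) (p \<cdot> h)"
    using Cons by simp
  finally show ?case .
qed

end

section \<open>Permuting, mapping and multiplying: operations acting on a diagram of monoids\<close>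

section \<open>The algebra of a diagram of monoids\<close>

lemma map_perm_nth: "\<lbrakk>\<sigma> permutes {..<n}; length xs = n\<rbrakk> \<Longrightarrow>
    map (\<lambda>k. h (xs ! inv \<sigma> k)) (map \<sigma> [0..<n]) = map h xs"
  by (rule nth_equalityI) (auto simp: permutes_inverses)

lemma sort_perm: "\<sigma> permutes {..<n} \<Longrightarrow> sort (map \<sigma> [0..<n]) = [0..<n]"
proof -
  assume \<sigma>: "\<sigma> permutes {..<n}"
  have "map \<sigma> [0..<n] = permute_list \<sigma> [0..<n]"
    using perm_less[OF \<sigma>] by (auto simp: permute_list_def)
  then show ?thesis
    using \<sigma> by (intro properties_for_sort) simp_all
qed

lemma concat_intervals:
  fixes off :: "nat \<Rightarrow> nat"
  assumes "\<And>p. p < m \<Longrightarrow> off p \<le> off (Suc p)"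
  shows "concat (map (\<lambda>p. [off p..<off (Suc p)]) [0..<m]) = [off 0..<off m] \<and> off 0 \<le> off m"
  using assms
proof (induction m)
  case 0
  then show ?case by simp
next
  case (Suc m)
  then have "off 0 \<le> off m" "off m \<le> off (Suc m)"
    "concat (map (\<lambda>p. [off p..<off (Suc p)]) [0..<m]) = [off 0..<off m]" by auto
  then show ?case using upt_add_eq_append[of "off 0" "off m" "off (Suc m) - off m"] by auto
qed

context symmetric_monoidal_category
begin

text \<open>Families such as \<open>A (c ! inv \<sigma> k)\<close> are controlled only at labels k
  that occur, so agreement at those labels has to suffice.\<close>

lemma ins_cong: "\<lbrakk>X k = X' k; \<And>j. j \<in> set ks \<Longrightarrow> X j = X' j\<rbrakk> \<Longrightarrow> ins X k ks z = ins X' k ks z"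
proof (induction ks)
  case Nil
  then show ?case by simp
next
  case (Cons j js)
  have m: "map X js = map X' js" using Cons.prems by simp
  show ?case using Cons by (simp add: m)
qed

lemma tensA_iso: "\<forall>f \<in> set fs. iso_arrow M f \<Longrightarrow> iso_arrow M (tensA M fs)"
  by (induction fs rule: induct_list012) auto

lemma srt_cong: "(\<And>j. j \<in> set ks \<Longrightarrow> X j = X' j) \<Longrightarrow> srt X ks z = srt X' ks z"
  by (induction ks) (auto intro!: arg_cong2[where f = "(\<cdot>)"] ins_cong)

end

text \<open>A functor to monoids unpacked into objects, multiplications, units and underlying
  arrows, so that computations take place in \<open>M\<close> without projections from
  tuples.\<close>

locale monoid_diagram = symmetric_monoidal_category M + C: category C
  for M :: "('o, 'a, 'z) smc_scheme" (structure) and C :: "('c, 'd, 'y) cat_scheme" +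
  fixes A :: "'c \<Rightarrow> 'o" and mu eta :: "'c \<Rightarrow> 'a" and fa :: "'d \<Rightarrow> 'a"
  assumes mon: "c \<in> Ob C \<Longrightarrow> is_monoid M (A c, mu c, eta c)"
    and fa_hom: "f \<in> Ar C \<Longrightarrow> is_monoid_hom M (A (Dom C f), mu (Dom C f), eta (Dom C f))
      (A (Cod C f), mu (Cod C f), eta (Cod C f)) (fa f)"
    and fa_id: "c \<in> Ob C \<Longrightarrow> fa (Ident C c) = Ident M (A c)"
    and fa_comp: "\<lbrakk>f \<in> Ar C; g \<in> Ar C; Dom C g = Cod C f\<rbrakk> \<Longrightarrow> fa (g \<cdot>\<^bsub>C\<^esub> f) = fa g \<cdot> fa f"
begin

lemma mon_ar [simp]:
  assumes "c \<in> Ob C"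
  shows "A c \<in> Ob M" "mu c \<in> Ar M" "Dom M (mu c) = A c \<otimes>\<^sub>0 A c" "Cod M (mu c) = A c"
    "eta c \<in> Ar M" "Dom M (eta c) = I" "Cod M (eta c) = A c"
  using monoidD[OF mon[OF assms]] by simp_all

lemma faD:
  assumes "f \<in> Hom C x y"
  shows "fa f \<in> Ar M" "Dom M (fa f) = A x" "Cod M (fa f) = A y"
    "fa f \<cdot> mu x = mu y \<cdot> (fa f \<otimes>\<^sub>1 fa f)" "fa f \<cdot> eta x = eta y" "x \<in> Ob C" "y \<in> Ob C"
  using fa_hom[of f] assms C.ar_ob[of f] by (auto simp: is_monoid_hom_def Hom_iff C.Hom_iff)

text \<open>The product of the \<open>G k\<close> for \<open>k\<close> in \<open>ks\<close>, taken in the order of the labels \<open>k\<close>.\<close>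

definition word :: "(nat \<Rightarrow> 'o) \<Rightarrow> (nat \<Rightarrow> 'a) \<Rightarrow> 'c \<Rightarrow> nat list \<Rightarrow> 'a" where
  "word X G t ks = evm (mu t) (map G (sort ks)) (eta t) \<cdot> srt X ks I"

lemma word_ar:
  assumes "\<forall>k \<in> set ks. G k \<in> Ar M \<and> Dom M (G k) = X k \<and> Cod M (G k) = A t" "t \<in> Ob C"
  shows "word X G t ks \<in> Ar M" "Dom M (word X G t ks) = tens0 (map X ks)"
      "Cod M (word X G t ks) = A t"
proof -
  have X: "\<forall>k \<in> set ks. X k \<in> Ob M" using assms(1) ar_ob by metis
  have e: "\<forall>g \<in> set (map G (sort ks)). g \<in> Ar M \<and> Cod M g = A t" using assms(1) by simp
  have d: "map (Dom M) (map G (sort ks)) = map X (sort ks)" using assms(1) by simp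
  note ea = evm_ar[OF e, of "eta t" "mu t", unfolded d]
  show "word X G t ks \<in> Ar M" "Dom M (word X G t ks) = tens0 (map X ks)"
      "Cod M (word X G t ks) = A t"
    unfolding word_def using ea X assms(2) by simp_all
qed

text \<open>The form in which coherence is used: the product depends only on how the letters are
  labelled, so it absorbs any permutation of them that respects the labels.\<close>

lemma word_coh:
  assumes "coh X I ks ls f" "\<forall>k \<in> set ks. G k \<in> Ar M \<and> Dom M (G k) = X k \<and> Cod M (G k) = A t"
      "t \<in> Ob C"
  shows "word X G t ls \<cdot> f = word X G t ks"
proof -
  have X: "\<forall>k \<in> set ks. X k \<in> Ob M" using assms(2) ar_ob by metis
  have s: "sort ls = sort ks" using coh_mset[OF assms(1)] by (intro properties_for_sort) simp_all
  have sl: "set ls = set ks" using coh_set[OF assms(1)] .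
  have e: "\<forall>g \<in> set (map G (sort ks)). g \<in> Ar M \<and> Cod M g = A t" using assms(2) by simp
  have d: "map (Dom M) (map G (sort ks)) = map X (sort ks)" using assms(2) by simp
  note ea = evm_ar[OF e, of "eta t" "mu t", unfolded d]
  show ?thesis
    unfolding word_def coh_srt[OF assms(1) X ob_simps(1), symmetric] s
    using ea X assms(3) coh_ar[OF assms(1) X ob_simps(1)] sl s
      srt_ar[of ls X I] by simp
qed

lemma word_cong:
  assumes "\<And>j. j \<in> set ks \<Longrightarrow> X j = X' j" "\<And>j. j \<in> set ks \<Longrightarrow> G j = G' j"
  shows "word X G t ks = word X' G' t ks"
proof -
  have m: "map G (sort ks) = map G' (sort ks)" using assms(2) by simp
  show ?thesis unfolding word_def m using srt_cong[of ks X X' I] assms(1) by simp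
qed

text \<open>The action of \<open>(\<sigma>, fs)\<close>, in which the letter \<open>i\<close> has the label \<open>\<sigma> i\<close>.\<close>

definition ev :: "'c \<Rightarrow> 'c list \<Rightarrow> 'd perm_op \<Rightarrow> 'a" where
  "ev t c x = word (\<lambda>k. A (c ! inv (fst x) k)) (\<lambda>k. fa (snd x ! inv (fst x) k)) t (map (fst x)
    [0..<length c]) \<cdot>
     inverse_arrow M (untail (map A c))"

definition is_op :: "'c \<Rightarrow> 'c list \<Rightarrow> (nat \<Rightarrow> nat) \<Rightarrow> 'd list \<Rightarrow> bool" where
  "is_op t c \<sigma> fs \<longleftrightarrow> t \<in> Ob C \<and> set c \<subseteq> Ob C \<and> \<sigma> permutes {..<length c} \<and> length fs = length c \<and>
     (\<forall>i < length c. fs ! i \<in> Hom C (c ! i) t)"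

lemma is_opD:
  assumes "is_op t c \<sigma> fs"
  shows "t \<in> Ob C" "set c \<subseteq> Ob C" "\<sigma> permutes {..<length c}" "length fs = length c"
    "\<And>i. i < length c \<Longrightarrow> fs ! i \<in> Hom C (c ! i) t" "\<forall>x \<in> set (map A c). x \<in> Ob M"
  using assms mon_ar by (auto simp: is_op_def)

lemma op_letters:
  assumes op: "is_op t c \<sigma> fs"
  shows "\<forall>k \<in> set (map \<sigma> [0..<length c]). fa (fs ! inv \<sigma> k) \<in> Ar M \<and>
      Dom M (fa (fs ! inv \<sigma> k)) = A (c ! inv \<sigma> k) \<and> Cod M (fa (fs ! inv \<sigma> k)) = A t"
  using is_opD[OF op] faD[OF is_opD(5)[OF op]] by (auto simp: permutes_inverses)

lemma op_word_ar:
  assumes op: "is_op t c \<sigma> fs"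
  shows "word (\<lambda>k. A (c ! inv \<sigma> k)) (\<lambda>k. fa (fs ! inv \<sigma> k)) t (map \<sigma> [0..<length c]) \<in> Ar M"
    "Dom M (word (\<lambda>k. A (c ! inv \<sigma> k)) (\<lambda>k. fa (fs ! inv \<sigma> k)) t (map \<sigma> [0..<length c])) =
      tens0 (map A c)"
    "Cod M (word (\<lambda>k. A (c ! inv \<sigma> k)) (\<lambda>k. fa (fs ! inv \<sigma> k)) t (map \<sigma> [0..<length c])) = A t"
  using word_ar[OF op_letters[OF op] is_opD(1)[OF op]]
    map_perm_nth[OF is_opD(3)[OF op], of c A] by simp_all

lemma ev_untail:
  assumes "is_op t c \<sigma> fs"
  shows "ev t c (\<sigma>, fs) \<cdot> untail (map A c) =
    word (\<lambda>k. A (c ! inv \<sigma> k)) (\<lambda>k. fa (fs ! inv \<sigma> k)) t (map \<sigma> [0..<length c])"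
  using op_word_ar[OF assms] untail_ar[OF is_opD(6)[OF assms]] by (simp add: ev_def)

lemma ev_ar:
  assumes "is_op t c \<sigma> fs"
  shows "ev t c (\<sigma>, fs) \<in> Ar M" "Dom M (ev t c (\<sigma>, fs)) = tens M (map A c)"
      "Cod M (ev t c (\<sigma>, fs)) = A t"
  using op_word_ar[OF assms] untail_ar[OF is_opD(6)[OF assms]] by (simp_all add: ev_def)

lemma ev_id:
  assumes "is_op t c id fs"
  shows "ev t c (id, fs) \<cdot> untail (map A c) = evm (mu t) (map fa fs) (eta t)"
proof -
  note op = is_opD[OF assms]
  have X: "\<forall>k \<in> set [0..<length c]. A (c ! k) \<in> Ob M" using op(6) by simp
  have m: "map (\<lambda>k. A (c ! k)) [0..<length c] = map A c"
    "map (\<lambda>k. fa (fs ! k)) [0..<length c] = map fa fs"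
    using op(4) by (auto intro!: nth_equalityI)
  have g: "\<forall>g \<in> set (map fa fs). g \<in> Ar M \<and> Cod M g = A t"
    using op(4) faD[OF op(5)] by (auto simp: in_set_conv_nth)
  have d: "map (Dom M) (map fa fs) = map A c"
    using op(4) faD[OF op(5)] by (auto intro!: nth_equalityI)
  have "srt (\<lambda>k. A (c ! k)) [0..<length c] I = Ident M (tens0 (map A c))"
    using srt_sorted[OF X ob_simps(1)] m by simp
  then show ?thesis
    using ev_untail[OF assms] evm_ar[OF g, of "eta t" "mu t", unfolded d] op(1) m
    by (simp add: word_def inv_id)
qed

text \<open>Letter i of the permuted tuple has label \<sigma>(\<tau> i). Relabelled along \<sigma>,
  the arrow \<open>perm_iso\<close> for \<tau> leads from the word of \<sigma> \<circ> \<tau> to the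
  word of \<sigma>, and \<open>word_coh\<close> absorbs it.\<close>

lemma ev_act:
  assumes op: "is_op t c \<sigma> fs" and \<tau>: "\<tau> permutes {..<length c}"
  shows "ev t (permute_list \<tau> c) (\<sigma> \<circ> \<tau>, permute_list \<tau> fs) =
      ev t c (\<sigma>, fs) \<cdot> perm_iso M (map A c) \<tau>"
proof -
  let ?n = "length c" and ?X = "\<lambda>k. A (c ! inv \<sigma> k)" and ?G = "\<lambda>k. fa (fs ! inv \<sigma> k)"
  note o = is_opD[OF op]
  have op': "is_op t (permute_list \<tau> c) (\<sigma> \<circ> \<tau>) (permute_list \<tau> fs)"
    using o \<tau> perm_less[OF \<tau>] unfolding is_op_def
    by (auto simp: permutes_compose permute_list_nth)
  have mA: "map A (permute_list \<tau> c) = permute_list \<tau> (map A c)"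
    using \<tau> by (simp add: permute_list_map)
  have u: "\<forall>x \<in> set (map A (permute_list \<tau> c)). x \<in> Ob M" by (rule is_opD(6)[OF op'])
  \<comment> \<open>\<open>perm_iso\<close> names a factor by its position i, the words name it by
    its label \<sigma> i; the objects are the same.\<close>
  have S: "srt (\<lambda>i. map A c ! i) (map \<tau> [0..<?n]) I = srt (\<lambda>i. ?X (\<sigma> i)) (map \<tau> [0..<?n]) I"
    using perm_less[OF \<tau>] permutes_inverses[OF o(3)] by (intro srt_cong) auto
  have X: "\<forall>j \<in> set (map \<tau> [0..<?n]). ?X (\<sigma> j) \<in> Ob M"
    using perm_less[OF \<tau>] permutes_inverses[OF o(3)] o(6) by auto
  have "coh (\<lambda>i. ?X (\<sigma> i)) I (map \<tau> [0..<?n]) [0..<?n] (srt (\<lambda>i. ?X (\<sigma> i)) (map \<tau> [0..<?n]) I)"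
    using coh_sort[OF X ob_simps(1)] sort_perm[OF \<tau>] by simp
  from coh_map[OF this permutes_inj[OF o(3)]]
  have coh: "coh ?X I (map (\<sigma> \<circ> \<tau>) [0..<?n]) (map \<sigma> [0..<?n]) (srt (\<lambda>i. ?X (\<sigma> i)) (map \<tau> [0..<?n])
      I)"
    by simp
  have st: "set (map (\<sigma> \<circ> \<tau>) [0..<?n]) = set (map \<sigma> [0..<?n])"
    using coh_set[OF coh] by simp
  have p: "perm_iso M (map A c) \<tau> \<in> Ar M" "Cod M (perm_iso M (map A c) \<tau>) = tens M (map A c)"
    "Dom M (perm_iso M (map A c) \<tau>) = tens M (map A (permute_list \<tau> c))"
    using perm_iso_hom[of "map A c" \<tau>] o(6) \<tau> mA by (auto simp: Hom_iff)
  have s: "srt (\<lambda>i. ?X (\<sigma> i)) (map \<tau> [0..<?n]) I \<in> Ar M"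
    "Dom M (srt (\<lambda>i. ?X (\<sigma> i)) (map \<tau> [0..<?n]) I) = tens0 (map A (permute_list \<tau> c))"
    "Cod M (srt (\<lambda>i. ?X (\<sigma> i)) (map \<tau> [0..<?n]) I) = tens0 (map A c)"
  proof -
    have "map (\<lambda>i. ?X (\<sigma> i)) (map \<tau> [0..<?n]) = map A (permute_list \<tau> c)"
      "map (\<lambda>i. ?X (\<sigma> i)) [0..<?n] = map A c"
      using permutes_inverses[OF o(3)] by (auto intro!: nth_equalityI simp: permute_list_def)
    then show "srt (\<lambda>i. ?X (\<sigma> i)) (map \<tau> [0..<?n]) I \<in> Ar M"
      "Dom M (srt (\<lambda>i. ?X (\<sigma> i)) (map \<tau> [0..<?n]) I) = tens0 (map A (permute_list \<tau> c))"
      "Cod M (srt (\<lambda>i. ?X (\<sigma> i)) (map \<tau> [0..<?n]) I) = tens0 (map A c)"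
      using srt_ar[OF X ob_simps(1)] sort_perm[OF \<tau>] by simp_all
  qed
  have "(ev t c (\<sigma>, fs) \<cdot> perm_iso M (map A c) \<tau>) \<cdot> untail (map A (permute_list \<tau> c)) =
      ev t c (\<sigma>, fs) \<cdot> (untail (map A c) \<cdot> srt (\<lambda>i. ?X (\<sigma> i)) (map \<tau> [0..<?n]) I)"
    using perm_iso_untail[OF o(6), of \<tau>] \<tau> ev_ar[OF op] p untail_ar[OF u] S by (simp add: mA)
  also have "\<dots> = word ?X ?G t (map \<sigma> [0..<?n]) \<cdot> srt (\<lambda>i. ?X (\<sigma> i)) (map \<tau> [0..<?n]) I"
    using ev_ar[OF op] untail_ar[OF o(6)] s by (subst comp_reassoc[OF ev_untail[OF op]]) simp_all
  also have "\<dots> = word ?X ?G t (map (\<sigma> \<circ> \<tau>) [0..<?n])"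
    using op_letters[OF op] unfolding st[symmetric] by (rule word_coh[OF coh _ o(1)])
  also have "\<dots> = ev t (permute_list \<tau> c) (\<sigma> \<circ> \<tau>, permute_list \<tau> fs) \<cdot>
      untail (map A (permute_list \<tau> c))"
    unfolding ev_untail[OF op'] unfolding length_permute_list
    using permutes_inverses[OF permutes_compose[OF \<tau> o(3)]] permutes_inverses[OF o(3)] \<tau> o(4)
    by (intro word_cong) (auto simp: permute_list_nth simp del: o_apply, auto)
  finally have eq: "(ev t c (\<sigma>, fs) \<cdot> perm_iso M (map A c) \<tau>) \<cdot> untail (map A (permute_list \<tau> c)) =
      \<dots>" .
  show ?thesis
    using ev_ar[OF op] ev_ar[OF op'] p untail_ar[OF u]
    by (intro iso_epi[OF _ _ _ _ _ eq[symmetric]]) simp_all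
qed

text \<open>
  The letter \<open>r\<close> of block \<open>i\<close> is labelled by its final position \<open>off (\<sigma> i) + s i r\<close>. Both sides then
  permute the letters \<open>K i\<close> of the blocks into \<open>[0..<N]\<close> and multiply: the left side at once, the
  right side by sorting first inside the blocks (\<open>coh_concat\<close>) and then the blocks (\<open>coh_blocks\<close>).
\<close>

lemma ev_gamma:
  assumes op: "is_op t c \<sigma> fs" and len: "length bs = length c" "length xs = length c"
    and ops: "\<And>i. i < length c \<Longrightarrow> is_op (c ! i) (bs ! i) (fst (xs ! i)) (snd (xs ! i))"
  shows "ev t (concat bs) (gam_perm (map length bs) \<sigma> (map fst xs), gam_list C fs (map snd xs)) \<cdot>
      concat_iso M (map (map A) bs) =
    ev t c (\<sigma>, fs) \<cdot> tensA M (map (\<lambda>i. ev (c ! i) (bs ! i) (xs ! i)) [0..<length c])"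
proof -
  define m where "m = length c"
  define k where "k i = length (bs ! i)" for i
  define s where "s i = fst (xs ! i)" for i
  define g where "g i = snd (xs ! i)" for i
  let ?ks = "map length bs"
  define N where "N = sum_list ?ks"
  define base where "base i = sum_list (take i ?ks)" for i
  \<comment> \<open>Where the block standing at block position p begins: the total length of the
    blocks that \<sigma> sends before p.\<close>
  define off where "off p = (\<Sum>i<m. if \<sigma> i < p then k i else 0)" for p
  define \<pi> where "\<pi> = gam_perm ?ks \<sigma> (map fst xs)"
  define gl where "gl = gam_list C fs (map snd xs)"
  note o = is_opD[OF op, folded m_def]
  have oi: "is_op (c ! i) (bs ! i) (s i) (g i)" if "i < m" for i
    using ops[of i] that by (simp add: m_def s_def g_def)
  note oi' = is_opD[OF oi, folded k_def]
  have lc: "length (concat bs) = N" by (simp add: N_def length_concat)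
  have \<sigma>lt: "\<sigma> i < m" "inv \<sigma> i < m" if "i < m" for i
    using perm_less[OF o(3) that] perm_less[OF permutes_inv[OF o(3)] that] by auto
  have \<sigma>inv [simp]: "inv \<sigma> (\<sigma> i) = i" "\<sigma> (inv \<sigma> i) = i" for i
    using permutes_inverses[OF o(3)] by auto
  have \<pi>: "\<pi> permutes {..<N}"
    unfolding \<pi>_def N_def using o(3) oi'(3) len
    by (intro gam_perm_permutes) (auto simp: m_def k_def s_def)
  have \<pi>v: "\<pi> (base i + r) = off (\<sigma> i) + s i r" if "i < m" "r < k i" for i r
  proof -
    have "\<pi> (base i + r) = (\<Sum>i'<length ?ks. if \<sigma> i' < \<sigma> i then ?ks ! i' else 0) + s i r"
      using gam_perm_index[of i ?ks r "map fst xs" \<sigma>] that len oi'(3)[of i]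
      by (simp add: \<pi>_def base_def m_def k_def s_def)
    also have "(\<Sum>i'<length ?ks. if \<sigma> i' < \<sigma> i then ?ks ! i' else 0) = off (\<sigma> i)"
      unfolding off_def using len by (intro sum.cong) (auto simp: m_def k_def)
    finally show ?thesis .
  qed
  have glv: "gl ! (base i + r) = fs ! i \<cdot>\<^bsub>C\<^esub> (g i ! r)" if "i < m" "r < k i" for i r
  proof -
    have "map length (map snd xs) = ?ks"
      using len oi'(4) by (intro nth_equalityI) (auto simp: m_def k_def g_def)
    then show ?thesis
      using gam_list_index[of i "map snd xs" r C fs] that len oi'(4)[of i]
      by (simp add: gl_def base_def m_def k_def g_def)
  qed
  have cv: "concat bs ! (base i + r) = bs ! i ! r" if "i < m" "r < k i" for i r
    using nth_concat_index[of i bs r] that len by (simp add: base_def m_def k_def)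
  have opG: "is_op t (concat bs) \<pi> gl"
    unfolding is_op_def lc
  proof (intro conjI allI impI)
    show "set (concat bs) \<subseteq> Ob C" using oi'(2) len by (intro set_concat_subset) (auto simp: m_def)
    have "map length (map snd xs) = ?ks"
      using len oi'(4) by (intro nth_equalityI) (auto simp: m_def k_def g_def)
    then show "length gl = N" by (simp only: gl_def length_gam_list N_def)
    show "gl ! j \<in> Hom C (concat bs ! j) t" if jN: "j < N" for j
    proof -
      obtain i r where "i < length ?ks" "r < ?ks ! i" and j: "j = base i + r"
        using index_ex[of j ?ks] jN unfolding N_def base_def by blast
      then have "i < m" "r < k i" using len by (auto simp: m_def k_def)
      then show ?thesis unfolding j
        using glv cv C.comp_hom[OF oi'(5) o(5)] by simp
    qed
  qed (use o \<pi> in auto)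
  define X where "X j = A (concat bs ! inv \<pi> j)" for j
  define G where "G j = fa (gl ! inv \<pi> j)" for j
  define Xi where "Xi i r = A (bs ! i ! inv (s i) r)" for i r
  define Gi where "Gi i r = fa (g i ! inv (s i) r)" for i r
  \<comment> \<open>\<open>ii p\<close> is the block that \<sigma> puts at block position p.
    Families indexed by final block positions are obtained from those indexed by blocks through
    \<open>ii\<close>.\<close>
  define ii where "ii = inv \<sigma>"
  have ii: "ii p < m" "\<sigma> (ii p) = p" if "p < m" for p using \<sigma>lt that by (auto simp: ii_def)
  have iis [simp]: "ii (\<sigma> i) = i" for i by (simp add: ii_def)
  have sv: "s i r < k i" "inv (s i) r < k i" "s i (inv (s i) r) = r" if "i < m" "r < k i" for i r
    using perm_less[OF oi'(3)] perm_less[OF permutes_inv[OF oi'(3)]] permutes_inverses[OF oi'(3)]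
        that by auto
  have XG: "X (off (\<sigma> i) + r) = Xi i r" "G (off (\<sigma> i) + r) = fa (fs ! i) \<cdot> Gi i r" if "i < m"
      "r < k i" for i r
  proof -
    have "inv \<pi> (off (\<sigma> i) + r) = base i + inv (s i) r"
      using \<pi>v[OF that(1) sv(2)[OF that]] sv(3)[OF that] permutes_inverses(2)[OF \<pi>] by metis
    moreover have "fa (fs ! i \<cdot>\<^bsub>C\<^esub> (g i ! inv (s i) r)) = fa (fs ! i) \<cdot> Gi i r"
      using o(5)[OF that(1)] oi'(5)[OF that(1) sv(2)[OF that]] unfolding Gi_def
      by (intro fa_comp) (auto simp: C.Hom_iff)
    ultimately show "X (off (\<sigma> i) + r) = Xi i r" "G (off (\<sigma> i) + r) = fa (fs ! i) \<cdot> Gi i r"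
      using that sv(2)[OF that] cv glv by (simp_all add: X_def G_def Xi_def)
  qed
  have Gia: "Gi i r \<in> Ar M" "Dom M (Gi i r) = Xi i r" "Cod M (Gi i r) = A (c ! i)" if "i < m"
      "r < k i" for i r
    using faD[OF oi'(5)[OF that(1) sv(2)[OF that]]] by (simp_all add: Gi_def Xi_def)
  have Xia: "Xi i r \<in> Ob M" if "i < m" "r < k i" for i r
    using Gia[OF that] ar_ob by metis
  note fso = faD[OF o(5)]
  have offS: "off (Suc p) = off p + k (ii p)" if "p < m" for p
  proof -
    have "off (Suc p) = (\<Sum>i<m. (if \<sigma> i < p then k i else 0) + (if i = ii p then k (ii p) else 0))"
      unfolding off_def using ii[OF that] iis by (intro sum.cong) (auto simp: less_Suc_eq)
    then show ?thesis using ii[OF that] by (simp add: sum.distrib off_def)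
  qed
  have offm: "off m = N" "off 0 = 0"
    unfolding off_def N_def using \<sigma>lt len
    by (auto simp: sum_list_nth_lessThan m_def k_def intro!: sum.cong)
  \<comment> \<open>The labels of the block at position p in increasing order. These intervals
    concatenate to \<open>[0..<N]\<close>.\<close>
  define L where "L p = map (\<lambda>r. off p + r) [0..<k (ii p)]" for p
  have Lint: "L p = [off p..<off (Suc p)]" if "p < m" for p
    unfolding L_def offS[OF that] by (rule nth_equalityI) auto
  have cL: "concat (map L [0..<m]) = [0..<N]"
  proof -
    have "concat (map L [0..<m]) = concat (map (\<lambda>p. [off p..<off (Suc p)]) [0..<m])"
      using Lint by (intro arg_cong[where f = concat] map_cong) auto
    then show ?thesis using concat_intervals[of m off] offS offm by simp
  qed
  have off_mono: "off p \<le> off q" if "p \<le> q" for p q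
    unfolding off_def using that by (intro sum_mono) auto
  have Ldisj: "set (L p) \<inter> set (L q) = {}" if "p < m" "q < m" "p \<noteq> q" for p q
  proof -
    have "off (Suc p) \<le> off q \<or> off (Suc q) \<le> off p"
      using that off_mono[of "Suc p" q] off_mono[of "Suc q" p] by linarith
    then show ?thesis using Lint that by auto
  qed
  have XL: "map X (L p) = map (Xi (ii p)) [0..<k (ii p)]"
    "map G (L p) = map (\<lambda>r. fa (fs ! ii p) \<cdot> Gi (ii p) r) [0..<k (ii p)]" if "p < m" for p
    using XG[OF ii(1)[OF that]] ii[OF that] by (auto simp: L_def)
  have Lob: "\<forall>j \<in> set (L p). X j \<in> Ob M" if "p < m" for p
  proof -
    have "\<forall>x \<in> set (map X (L p)). x \<in> Ob M"
      unfolding XL(1)[OF that] using Xia[OF ii(1)[OF that]] by auto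
    then show ?thesis by simp
  qed
  \<comment> \<open>The labels of block i in the order in which its letters are given. These lists
    concatenate to the word of the composite permutation.\<close>
  define K where "K i = map (\<lambda>r. off (\<sigma> i) + s i r) [0..<k i]" for i
  have cK: "concat (map K [0..<m]) = map \<pi> [0..<N]"
  proof -
    have "map \<pi> [0..<N] = concat (map (\<lambda>i. map \<pi> (map (\<lambda>r. base i + r) [0..<k i])) [0..<m])"
      unfolding N_def upt_index[of ?ks] using len
      by (auto simp: map_concat base_def m_def k_def intro!: arg_cong[where f = concat])
    also have "\<dots> = concat (map K [0..<m])"
      using \<pi>v by (intro arg_cong[where f = concat] map_cong) (auto simp: K_def)
    finally show ?thesis by simp
  qed
  have XK: "map X (K i) = map A (bs ! i)" if "i < m" for i
    using XG(1)[OF that] sv[OF that] permutes_inverses[OF oi'(3)[OF that]]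
    by (auto simp: K_def Xi_def k_def intro!: nth_equalityI)
  have Kob: "\<forall>j \<in> set (K i). X j \<in> Ob M" if "i < m" for i
    using XG(1)[OF that] sv[OF that] Xia[OF that] by (auto simp: K_def)
  define W where "W i = word (Xi i) (Gi i) (c ! i) (map (s i) [0..<k i])" for i
  define S where "S i = srt (Xi i) (map (s i) [0..<k i]) I" for i
  have lab: "\<forall>r \<in> set (map (s i) [0..<k i]). Gi i r \<in> Ar M \<and> Dom M (Gi i r) = Xi i r \<and>
      Cod M (Gi i r) = A (c ! i)"
    if "i < m" for i
    using Gia[OF that] sv[OF that] by auto
  have Xmap: "map (Xi i) (map (s i) [0..<k i]) = map A (bs ! i)" if "i < m" for i
    unfolding Xi_def by (rule map_perm_nth[OF oi'(3)[OF that]]) (simp add: k_def)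
  have Xs: "\<forall>r \<in> set (map (s i) [0..<k i]). Xi i r \<in> Ob M" if "i < m" for i
    using Xia[OF that] sv[OF that] by auto
  note srti = sort_perm[OF oi'(3)]
  define T where "T i = tens0 (map A (bs ! i))" for i
  define U where "U i = untail (map A (bs ! i))" for i
  define e where "e i = ev (c ! i) (bs ! i) (xs ! i)" for i
  have Wa: "W i \<in> Ar M" "Dom M (W i) = T i" "Cod M (W i) = A (c ! i)" if "i < m" for i
    using word_ar[OF lab[OF that] oi'(1)[OF that]] Xmap[OF that] by (simp_all add: W_def T_def)
  have Sa: "S i \<in> Ar M" "Dom M (S i) = T i" "Cod M (S i) = tens0 (map (Xi i) [0..<k i])" if "i < m"
      for i
    using srt_ar[of "map (s i) [0..<k i]" "Xi i" I] Xs[OF that] Xmap[OF that] srti[OF that]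
    by (simp_all add: S_def T_def)
  have Ua: "U i \<in> Ar M" "Dom M (U i) = T i" "Cod M (U i) = tens M (map A (bs ! i))"
      "iso_arrow M (U i)" if "i < m" for i
    using untail_ar[OF oi'(6)[OF that]] by (simp_all add: U_def T_def)
  have xsi: "xs ! i = (s i, g i)" for i by (simp add: s_def g_def)
  have ea: "e i \<in> Ar M" "Dom M (e i) = tens M (map A (bs ! i))" "Cod M (e i) = A (c ! i)" if
      "i < m" for i
    using ev_ar[OF oi[OF that]] by (simp_all add: e_def xsi)
  have eU: "e i \<cdot> U i = W i" if "i < m" for i
  proof -
    have "Xi i = (\<lambda>r. A (bs ! i ! inv (s i) r))" "Gi i = (\<lambda>r. fa (g i ! inv (s i) r))"
      by (simp_all add: fun_eq_iff Xi_def Gi_def)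
    then show ?thesis
      using ev_untail[OF oi[OF that]] by (simp add: e_def U_def W_def xsi k_def)
  qed
  have Ac: "map (\<lambda>i. A (c ! i)) [0..<m] = map A c"
    by (auto simp: m_def intro!: nth_equalityI)
  let ?is = "[0..<m]"
  \<comment> \<open>The invertible comparison that removes tails inside the blocks and for the word
    of blocks. Both sides of the claim are compared after precomposition with it.\<close>
  let ?Q = "tensA M (map U ?is) \<cdot> untail (map T ?is)"
  have ls: "\<forall>f \<in> set (map U ?is). f \<in> Ar M" "\<forall>f \<in> set (map e ?is). f \<in> Ar M"
      "\<forall>f \<in> set (map W ?is). f \<in> Ar M"
    using Ua ea Wa by auto
  have lU: "map (Dom M) (map U ?is) = map T ?is"
      "map (Cod M) (map U ?is) = map (\<lambda>i. tens M (map A (bs ! i))) ?is"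
    and le: "map (Dom M) (map e ?is) = map (\<lambda>i. tens M (map A (bs ! i))) ?is"
        "map (Cod M) (map e ?is) = map A c"
    and lW: "map (Dom M) (map W ?is) = map T ?is" "map (Cod M) (map W ?is) = map A c"
    using Ua ea Wa Ac[symmetric] by (auto simp del: list.map_comp)
  have Tob: "\<forall>x \<in> set (map T ?is). x \<in> Ob M" using Ua(1,2) ar_ob by (metis
      (no_types, lifting) atLeastLessThan_iff imageE set_map set_upt)
  have tob: "\<forall>x \<in> set (map (\<lambda>i. tens M (map A (bs ! i))) ?is). x \<in> Ob M"
    using Ua(1,3) ar_ob by (metis (no_types, lifting) atLeastLessThan_iff imageE set_map set_upt)
  note u1 = untail_ar[OF Tob] and u2 = untail_ar[OF tob] and u3 = untail_ar[OF o(6)]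
  note tU = tensA_ar[OF ls(1), unfolded lU] and te = tensA_ar[OF ls(2), unfolded le]
  note aU = actA_ar[OF ls(1) id_ar(1)[OF ob_simps(1)], unfolded lU]
      and ae = actA_ar[OF ls(2) id_ar(1)[OF ob_simps(1)], unfolded le]
    and aW = actA_ar[OF ls(3) id_ar(1)[OF ob_simps(1)], unfolded lW]
  have Qiso: "iso_arrow M ?Q" "?Q \<in> Ar M"
      "Cod M ?Q = tens M (map (\<lambda>i. tens M (map A (bs ! i))) ?is)"
    "Dom M ?Q = actl (map T ?is) I"
    using tensA_iso[of "map U ?is"] Ua u1 tU by auto
  \<comment> \<open>Naturality of \<open>untail\<close>, applied to the inner actions and to the
    comparisons of the blocks, replaces the inner actions by their tailed words
    \<open>W i\<close>.\<close>
  have R1: "tensA M (map e ?is) \<cdot> ?Q = untail (map A c) \<cdot> actA (map W ?is) (Ident M I)"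
  proof -
    have "tensA M (map e ?is) \<cdot> ?Q = tensA M (map e ?is) \<cdot>
        (untail (map (\<lambda>i. tens M (map A (bs ! i))) ?is) \<cdot> actA (map U ?is) (Ident M I))"
      using untail_natural[OF ls(1), unfolded lU] by simp
    also have "\<dots> = (untail (map A c) \<cdot> actA (map e ?is) (Ident M I)) \<cdot> actA (map U ?is) (Ident M I)"
      using te u2 aU by (subst comp_reassoc[OF untail_natural[OF ls(2), unfolded le]]) simp_all
    also have "\<dots> = untail (map A c) \<cdot> (actA (map e ?is) (Ident M I) \<cdot> actA (map U ?is) (Ident M I))"
      using u3 aU ae by simp
    also have "actA (map e ?is) (Ident M I) \<cdot> actA (map U ?is) (Ident M I) =
        actA (map (\<lambda>i. e i \<cdot> U i) ?is) (Ident M I \<cdot> Ident M I)"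
      using ea Ua by (intro actA_comp) auto
    also have "map (\<lambda>i. e i \<cdot> U i) ?is = map W ?is" using eU by simp
    finally show ?thesis by simp
  qed
  \<comment> \<open>\<open>H p\<close> is the outer arrow applied to the block at position p;
    \<open>E p\<close> is the product of the letters of that block after they have been mapped to A
    t.\<close>
  define H where "H p = fa (fs ! ii p)" for p
  define E where "E p = evm (mu t) (map G (L p)) (eta t)" for p
  let ?\<sigma>s = "map \<sigma> ?is"
  let ?Y = "\<lambda>p. T (ii p)" and ?B = "\<lambda>p. A (c ! ii p)" and ?Z = "\<lambda>p. tens0 (map X (L p))"
  have srts: "sort ?\<sigma>s = ?is" by (rule sort_perm[OF o(3)])
  have \<sigma>set: "p < m" if "p \<in> set ?\<sigma>s" for p using that \<sigma>lt by auto
  have mW: "map (\<lambda>p. W (ii p)) ?\<sigma>s = map W ?is" and mS: "map (\<lambda>p. S (ii p)) ?\<sigma>s = map S ?is"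
      by simp_all
  have Y0: "\<forall>p \<in> set ?\<sigma>s. ?B p \<in> Ob M" and Y: "\<forall>p \<in> set ?\<sigma>s. ?Y p \<in> Ob M"
    using \<sigma>set ii oi'(1) Tob by auto
  have Z: "\<forall>p \<in> set ?\<sigma>s. ?Z p \<in> Ob M"
  proof
    fix p assume "p \<in> set ?\<sigma>s"
    from Lob[OF \<sigma>set[OF this]] show "?Z p \<in> Ob M" by simp
  qed
  have Ha: "H p \<in> Ar M" "Dom M (H p) = ?B p" "Cod M (H p) = A t" if "p < m" for p
    using fso[OF ii(1)[OF that]] by (simp_all add: H_def)
  have Ga: "G j \<in> Ar M" "Dom M (G j) = X j" "Cod M (G j) = A t" if "j < N" for j
    using op_letters[OF opG, unfolded lc] that permutes_inverses(1)[OF \<pi>, of j] perm_less[OF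
        permutes_inv[OF \<pi>] that]
    by (force simp: G_def X_def image_iff)+
  have LN: "\<forall>j \<in> set (L p). j < N" if "p < m" for p
    using Lint[OF that] off_mono[of "Suc p" m] that offm by auto
  have GL: "\<forall>h \<in> set (map G (L p)). h \<in> Ar M \<and> Cod M h = A t"
      "map (Dom M) (map G (L p)) = map X (L p)" if "p < m" for p
    using LN[OF that] Ga by auto
  have Ea: "E p \<in> Ar M" "Dom M (E p) = ?Z p" "Cod M (E p) = A t" if "p < m" for p
    using evm_ar[OF GL(1)[OF that], of "eta t" "mu t", unfolded GL(2)[OF that]] o(1) by
        (simp_all add: E_def)
  \<comment> \<open>The outer arrow is a monoid morphism, so it may be applied to each letter of the
    block before multiplying.\<close>
  have HW: "H p \<cdot> W (ii p) = E p \<cdot> S (ii p)" if "p < m" for p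
  proof -
    let ?i = "ii p"
    note i = ii(1)[OF that]
    have gi: "\<forall>h \<in> set (map (Gi ?i) [0..<k ?i]). h \<in> Ar M \<and> Cod M h = A (c ! ?i)"
      "map (Dom M) (map (Gi ?i) [0..<k ?i]) = map (Xi ?i) [0..<k ?i]"
      using Gia[OF i] by auto
    note em = evm_ar[OF gi(1), of "eta (c ! ?i)" "mu (c ! ?i)", unfolded gi(2)]
    have "H p \<cdot> W ?i = (H p \<cdot> evm (mu (c ! ?i)) (map (Gi ?i) [0..<k ?i]) (eta (c ! ?i))) \<cdot> S ?i"
      using Ha[OF that] Sa[OF i] em oi'(1)[OF i] by (simp add: W_def word_def srti[OF i] S_def)
    also have "H p \<cdot> evm (mu (c ! ?i)) (map (Gi ?i) [0..<k ?i]) (eta (c ! ?i)) =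
        evm (mu t) (map (\<lambda>h. H p \<cdot> h) (map (Gi ?i) [0..<k ?i])) (H p \<cdot> eta (c ! ?i))"
      using fso[OF i] oi'(1)[OF i] o(1) gi unfolding H_def
      by (intro evm_hom[OF mon mon]) auto
    also have "\<dots> = E p"
      using XL(2)[OF that] fso(5)[OF i] by (simp add: E_def H_def o_def)
    finally show ?thesis .
  qed
  have step1: "ev t c (\<sigma>, fs) \<cdot> untail (map A c) \<cdot> actA (map W ?is) (Ident M I) =
      evm (mu t) (map H ?is) (eta t) \<cdot> (srt ?B ?\<sigma>s I \<cdot> actA (map (\<lambda>p. W (ii p)) ?\<sigma>s) (Ident M I))"
  proof -
    have h: "\<forall>h \<in> set (map H ?is). h \<in> Ar M \<and> Cod M h = A t" "map (Dom M) (map H ?is) = map ?B ?is"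
      using Ha by auto
    have y: "map ?B ?\<sigma>s = map A c" using Ac by (simp add: o_def)
    have w: "word ?B H t ?\<sigma>s = evm (mu t) (map H ?is) (eta t) \<cdot> srt ?B ?\<sigma>s I"
      by (simp only: word_def srts)
    have "ev t c (\<sigma>, fs) \<cdot> untail (map A c) = word ?B H t ?\<sigma>s"
      using ev_untail[OF op, folded m_def] unfolding H_def ii_def .
    then show ?thesis
      unfolding w mW
      using evm_ar[OF h(1), of "eta t" "mu t", unfolded h(2)] srt_ar[OF Y0 ob_simps(1), unfolded y
          srts] aW o(1) by simp
  qed
  \<comment> \<open>Sorting the blocks is natural, so the blocks may be sorted before each of them
    is multiplied out.\<close>
  have step2: "srt ?B ?\<sigma>s I \<cdot> actA (map (\<lambda>p. W (ii p)) ?\<sigma>s) (Ident M I) =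
      actA (map (\<lambda>p. W (ii p)) ?is) (Ident M I) \<cdot> srt ?Y ?\<sigma>s I"
    using srt_natural[of I ?\<sigma>s "\<lambda>p. W (ii p)" ?Y ?B] Wa[OF ii(1)] \<sigma>set srts by auto
  have step3: "evm (mu t) (map H ?is) (eta t) \<cdot> actA (map (\<lambda>p. W (ii p)) ?is) (Ident M I) =
      evm (mu t) (map E ?is) (eta t) \<cdot> actA (map (\<lambda>p. S (ii p)) ?is) (Ident M I)"
  proof -
    have "evm (mu t) (map H ?is) (eta t) \<cdot> actA (map (\<lambda>p. W (ii p)) ?is) (Ident M I) =
        evm (mu t) (map (\<lambda>p. H p \<cdot> W (ii p)) ?is) (eta t \<cdot> Ident M I)"
      using Ha Wa ii o(1) by (intro evm_actA) auto
    also have "map (\<lambda>p. H p \<cdot> W (ii p)) ?is = map (\<lambda>p. E p \<cdot> S (ii p)) ?is" using HW by simp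
    also have "evm (mu t) (map (\<lambda>p. E p \<cdot> S (ii p)) ?is) (eta t \<cdot> Ident M I) =
        evm (mu t) (map E ?is) (eta t) \<cdot> actA (map (\<lambda>p. S (ii p)) ?is) (Ident M I)"
      using Ea Sa ii XL(1) o(1) by (intro evm_actA[symmetric]) auto
    finally show ?thesis .
  qed
  \<comment> \<open>Naturality once more, now along the sorting inside blocks: this sorting comes
    first and the blocks are sorted afterwards.\<close>
  have step4: "actA (map (\<lambda>p. S (ii p)) ?is) (Ident M I) \<cdot> srt ?Y ?\<sigma>s I =
      srt ?Z ?\<sigma>s I \<cdot> actA (map S ?is) (Ident M I)"
    unfolding mS[symmetric]
    using srt_natural[of I ?\<sigma>s "\<lambda>p. S (ii p)" ?Y ?Z] Sa[OF ii(1)] XL(1) \<sigma>set srts by auto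
  have step5: "evm (mu t) (map E ?is) (eta t) =
      evm (mu t) (map G [0..<N]) (eta t) \<cdot> flat (block_obs X L ?is) I"
  proof -
    have "evm (mu t) (map (\<lambda>gs. evm (mu t) gs (eta t)) (map (\<lambda>p. map G (L p)) ?is)) (eta t) =
        evm (mu t) (concat (map (\<lambda>p. map G (L p)) ?is)) (eta t) \<cdot>
        flat (map (map (Dom M)) (map (\<lambda>p. map G (L p)) ?is)) (Dom M (eta t))"
      using GL(1) o(1) by (intro evm_flat[OF mon]) auto
    moreover have "concat (map (\<lambda>p. map G (L p)) ?is) = map G [0..<N]"
      unfolding cL[symmetric] by (simp add: map_concat o_def)
    moreover have "map (map (Dom M)) (map (\<lambda>p. map G (L p)) ?is) = block_obs X L ?is"
      using GL(2) by simp
    moreover have "map (\<lambda>gs. evm (mu t) gs (eta t)) (map (\<lambda>p. map G (L p)) ?is) = map E ?is"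
      by (simp add: E_def)
    ultimately show ?thesis using mon_ar(6)[OF o(1)] by (simp only:)
  qed
  have L\<sigma>: "\<forall>p \<in> set ?\<sigma>s. \<forall>j \<in> set (L p). X j \<in> Ob M" by (rule ballI, rule Lob[OF \<sigma>set])
  have "coh ?Z I ?\<sigma>s ?is (srt ?Z ?\<sigma>s I)" using coh_sort[OF Z ob_simps(1)] srts by simp
  \<comment> \<open>\<open>f'\<close> sorts the blocks as composites of transpositions of letters,
    \<open>f''\<close> below sorts the letters within each block.\<close>
  from coh_blocks[OF this ob_simps(1) L\<sigma> Ldisj[OF \<sigma>set \<sigma>set]]
  obtain f' where f': "coh X I (concat (map L ?\<sigma>s)) (concat (map L ?is)) f'"
    "flat (block_obs X L ?is) I \<cdot> srt ?Z ?\<sigma>s I = f' \<cdot> flat (block_obs X L ?\<sigma>s) I"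
    by blast
  have "coh X I (K i) (L (\<sigma> i)) (S i)" if "i < m" for i
  proof -
    have "S i = srt (\<lambda>r. X (off (\<sigma> i) + r)) (map (s i) [0..<k i]) I"
      unfolding S_def using XG(1)[OF that] sv[OF that] by (intro srt_cong) auto
    moreover have "coh (\<lambda>r. X (off (\<sigma> i) + r)) I (map (s i) [0..<k i]) [0..<k i] (srt (\<lambda>r. X (off
        (\<sigma> i) + r)) (map (s i) [0..<k i]) I)"
      using coh_sort[of "map (s i) [0..<k i]"
          "\<lambda>r. X (off (\<sigma> i) + r)" I] srti[OF that] XG(1)[OF that] Xs[OF that] sv[OF that] by simp
    ultimately show ?thesis
      using coh_map[of X "\<lambda>r. off (\<sigma> i) + r" I "map (s i) [0..<k i]" "[0..<k i]" "S i"] by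
          (simp add: K_def L_def o_def)
  qed
  then obtain f'' where f'': "coh X I (concat (map K ?is)) (concat (map (\<lambda>i. L (\<sigma> i)) ?is)) f''"
    "flat (map (\<lambda>i. map X (L (\<sigma> i))) ?is) I \<cdot> actA (map S ?is) (Ident M I) =
      f'' \<cdot> flat (map (\<lambda>i. map X (K i)) ?is) I"
    using coh_concat[of ?is X K "\<lambda>i. L (\<sigma> i)" S I] Kob by auto
  let ?eG = "evm (mu t) (map G [0..<N]) (eta t)" and ?F = "flat (map (map A) bs) I"
  have FK: "flat (map (\<lambda>i. map X (K i)) ?is) I = ?F"
  proof -
    have "map (\<lambda>i. map X (K i)) ?is = map (map A) bs"
      using XK len by (intro nth_equalityI) (auto simp: m_def)
    then show ?thesis by simp
  qed
  have bA: "\<forall>ys \<in> set (map (map A) bs). \<forall>x \<in> set ys. x \<in> Ob M"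
    using oi'(6) len by (fastforce simp: m_def in_set_conv_nth)
  have Kob': "\<forall>j \<in> set (concat (map K ?is)). X j \<in> Ob M" using Kob by auto
  have Lob': "\<forall>j \<in> set (concat (map L ?\<sigma>s)). X j \<in> Ob M" using L\<sigma> by auto
  have cLs: "concat (map (\<lambda>i. L (\<sigma> i)) ?is) = concat (map L ?\<sigma>s)" by (simp add: o_def)
  have fa': "f' \<in> Ar M" "Dom M f' = tens0 (map X (concat (map L ?\<sigma>s)))"
      "Cod M f' = tens0 (map X [0..<N])"
    using coh_ar[OF f'(1) Lob' ob_simps(1)] cL by auto
  have fa'': "f'' \<in> Ar M" "Dom M f'' = tens0 (map X (concat (map K ?is)))"
      "Cod M f'' = tens0 (map X (concat (map L ?\<sigma>s)))"
    using coh_ar[OF f''(1) Kob' ob_simps(1)] cLs by auto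
  have gg: "\<forall>j \<in> set [0..<N]. G j \<in> Ar M \<and> Dom M (G j) = X j \<and> Cod M (G j) = A t"
    "\<forall>h \<in> set (map G [0..<N]). h \<in> Ar M \<and> Cod M h = A t"
      "map (Dom M) (map G [0..<N]) = map X [0..<N]"
    using Ga by auto
  note eG = evm_ar[OF gg(2), of "eta t" "mu t", unfolded gg(3)]
  have pset: "set (map \<pi> [0..<N]) = set [0..<N]"
    using permutes_image[OF \<pi>] by (simp add: atLeast0LessThan)
  have "\<forall>j \<in> set [0..<N]. X j \<in> Ob M"
    using Ga dom_ob by (metis atLeastLessThan_iff set_upt)
  then have "srt X [0..<N] I = Ident M (tens0 (map X [0..<N]))"
    by (rule srt_sorted) simp_all
  then have wN: "word X G t [0..<N] = ?eG"
    using eG o(1) by (simp add: word_def)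
  have "coh X I (map \<pi> [0..<N]) [0..<N] (f' \<cdot> f'')"
    using f'(1) f''(1) cL cK coh_trans[of X I _ "[0..<N]" f' "map \<pi> [0..<N]" f''] Kob' by
        (simp add: cLs)
  \<comment> \<open>The decisive use of coherence: \<open>f' \<cdot> f''\<close> is one of many ways
    to sort the word of \<pi>, and the product does not depend on the choice.\<close>
  then have wf: "?eG \<cdot> (f' \<cdot> f'') = word X G t (map \<pi> [0..<N])"
    unfolding wN[symmetric] by (rule word_coh) (use gg(1) pset o(1) in auto)
  have Fa: "?F \<in> Ar M" "Dom M ?F = actl (map T ?is) I"
      "Cod M ?F = tens0 (map X (concat (map K ?is)))"
  proof -
    have "map tens0 (map (map A) bs) = map T ?is"
      using len by (auto intro!: nth_equalityI simp: T_def m_def)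
    moreover have "concat (map (map A) bs) = map X (concat (map K ?is))"
      using XK len by (auto simp: map_concat m_def intro!: arg_cong[where f = concat] nth_equalityI)
    ultimately show "?F \<in> Ar M" "Dom M ?F = actl (map T ?is) I"
        "Cod M ?F = tens0 (map X (concat (map K ?is)))"
      using flat_ar[OF bA ob_simps(1)] by simp_all
  qed
  have main: "(ev t c (\<sigma>, fs) \<cdot> untail (map A c)) \<cdot> actA (map W ?is) (Ident M I) =
      word X G t (map \<pi> [0..<N]) \<cdot> ?F"
  proof -
    have h: "\<forall>h \<in> set (map H ?is). h \<in> Ar M \<and> Cod M h = A t" "map (Dom M) (map H ?is) = map ?B ?is"
      and h': "\<forall>h \<in> set (map E ?is). h \<in> Ar M \<and> Cod M h = A t"
          "map (Dom M) (map E ?is) = map ?Z ?is"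
      using Ha Ea by auto
    note eH = evm_ar[OF h(1), of "eta t" "mu t", unfolded h(2)] and eE = evm_ar[OF h'(1), of
        "eta t" "mu t", unfolded h'(2)]
    have w: "\<forall>h \<in> set (map (\<lambda>p. W (ii p)) ?is). h \<in> Ar M"
        "map (Dom M) (map (\<lambda>p. W (ii p)) ?is) = map ?Y ?is"
      "map (Cod M) (map (\<lambda>p. W (ii p)) ?is) = map ?B ?is"
      and w': "\<forall>h \<in> set (map (\<lambda>p. S (ii p)) ?is). h \<in> Ar M"
          "map (Dom M) (map (\<lambda>p. S (ii p)) ?is) = map ?Y ?is"
      "map (Cod M) (map (\<lambda>p. S (ii p)) ?is) = map ?Z ?is"
      and w'': "\<forall>h \<in> set (map S ?is). h \<in> Ar M" "map (Dom M) (map S ?is) = map T ?is"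
      "map (Cod M) (map S ?is) = map ?Z ?\<sigma>s"
      using Wa Sa ii XL(1) \<sigma>lt by (auto simp: o_def)
    note aW = actA_ar[OF w(1) id_ar(1)[OF ob_simps(1)], unfolded w]
        and aS = actA_ar[OF w'(1) id_ar(1)[OF ob_simps(1)], unfolded w']
      and aS0 = actA_ar[OF w''(1) id_ar(1)[OF ob_simps(1)], unfolded w'']
    have yy: "map ?Y ?\<sigma>s = map T ?is" by simp
    note sY = srt_ar[OF Y ob_simps(1), unfolded srts yy]
        and sZ = srt_ar[OF Z ob_simps(1), unfolded srts]
    have bl: "\<forall>xs \<in> set (block_obs X L ?is). \<forall>x \<in> set xs. x \<in> Ob M"
        "\<forall>xs \<in> set (block_obs X L ?\<sigma>s). \<forall>x \<in> set xs. x \<in> Ob M"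
      using Lob L\<sigma> by auto
    have bm: "map tens0 (block_obs X L ps) = map ?Z ps"
        "concat (block_obs X L ps) = map X (concat (map L ps))" for ps
      by (simp_all add: map_concat o_def)
    note fl = flat_ar[OF bl(1) ob_simps(1), unfolded bm cL]
        and fl' = flat_ar[OF bl(2) ob_simps(1), unfolded bm]
    note idI = id_ar[OF ob_simps(1)]
    have "(ev t c (\<sigma>, fs) \<cdot> untail (map A c)) \<cdot> actA (map W ?is) (Ident M I) =
        evm (mu t) (map H ?is) (eta t) \<cdot> (actA (map (\<lambda>p. W (ii p)) ?is) (Ident M I) \<cdot> srt ?Y ?\<sigma>s I)"
      unfolding step1 step2 ..
    also have "\<dots> = (evm (mu t) (map E ?is) (eta t) \<cdot> actA (map (\<lambda>p. S (ii p)) ?is) (Ident M I)) \<cdot>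
        srt ?Y ?\<sigma>s I"
      by (rule comp_reassoc[OF step3]) (use eH aW sY idI o(1) in simp_all)
    also have "\<dots> = evm (mu t) (map E ?is) (eta t) \<cdot> (actA (map (\<lambda>p. S (ii p)) ?is) (Ident M I) \<cdot>
        srt ?Y ?\<sigma>s I)"
      by (rule comp_assoc_ar) (use eE aS sY idI o(1) in simp_all)
    also have "\<dots> = (?eG \<cdot> flat (block_obs X L ?is) I) \<cdot> (srt ?Z ?\<sigma>s I \<cdot>
        actA (map S ?is) (Ident M I))"
      unfolding step4 step5 ..
    also have "\<dots> = ?eG \<cdot> (flat (block_obs X L ?is) I \<cdot> (srt ?Z ?\<sigma>s I \<cdot>
        actA (map S ?is) (Ident M I)))"
      by (rule comp_assoc_ar) (use eG fl sZ aS0 idI o(1) in simp_all)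
    also have "flat (block_obs X L ?is) I \<cdot> (srt ?Z ?\<sigma>s I \<cdot> actA (map S ?is) (Ident M I)) =
        (f' \<cdot> flat (block_obs X L ?\<sigma>s) I) \<cdot> actA (map S ?is) (Ident M I)"
      by (rule comp_reassoc[OF f'(2)]) (use fl sZ aS0 idI in simp_all)
    also have "\<dots> = f' \<cdot> (flat (block_obs X L ?\<sigma>s) I \<cdot> actA (map S ?is) (Ident M I))"
      by (rule comp_assoc_ar) (use fl' fa' aS0 idI in simp_all)
    also have "flat (block_obs X L ?\<sigma>s) I \<cdot> actA (map S ?is) (Ident M I) = f'' \<cdot> ?F"
      using f''(2) FK by (simp add: o_def)
    also have "f' \<cdot> (f'' \<cdot> ?F) = (f' \<cdot> f'') \<cdot> ?F"
      by (rule comp_assoc_ar[symmetric]) (use fa' fa'' Fa in simp_all)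
    also have "?eG \<cdot> ((f' \<cdot> f'') \<cdot> ?F) = word X G t (map \<pi> [0..<N]) \<cdot> ?F"
      by (rule comp_reassoc[OF wf]) (use eG fa' fa'' Fa o(1) in simp_all)
    finally show ?thesis .
  qed
  let ?ci = "concat_iso M (map (map A) bs)" and ?\<Gamma> = "ev t (concat bs) (\<pi>, gl)"
  have tm: "map (\<lambda>i. tens M (map A (bs ! i))) ?is = map (tens M) (map (map A) bs)"
    "map U ?is = map untail (map (map A) bs)" "map T ?is = map tens0 (map (map A) bs)"
    using len by (auto intro!: nth_equalityI simp: U_def T_def m_def)
  have cc: "concat (map (map A) bs) = map A (concat bs)" by (simp add: map_concat)
  have cia: "?ci \<in> Ar M" "Dom M ?ci = tens M (map (\<lambda>i. tens M (map A (bs ! i))) ?is)"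
      "Cod M ?ci = tens M (map A (concat bs))"
    using concat_iso_hom[of "map (map A) bs"] bA unfolding tm(1) cc by
        (auto simp: Hom_iff subset_iff)
  have ciQ: "?ci \<cdot> ?Q = untail (map A (concat bs)) \<cdot> ?F"
    using concat_iso_untail[OF bA] unfolding tm cc by simp
  note \<Gamma>a = ev_ar[OF opG] and ea0 = ev_ar[OF op] and u4 = untail_ar[OF is_opD(6)[OF opG]]
  have "(?\<Gamma> \<cdot> ?ci) \<cdot> ?Q = ?\<Gamma> \<cdot> (untail (map A (concat bs)) \<cdot> ?F)"
    unfolding ciQ[symmetric] by (rule comp_assoc_ar) (use \<Gamma>a cia Qiso in simp_all)
  also have "\<dots> = word X G t (map \<pi> [0..<N]) \<cdot> ?F"
  proof (rule comp_reassoc)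
    have "?\<Gamma> \<cdot> untail (map A (concat bs)) =
        word (\<lambda>j. A (concat bs ! inv \<pi> j)) (\<lambda>j. fa (gl ! inv \<pi> j)) t (map \<pi> [0..<N])"
      using ev_untail[OF opG] unfolding lc .
    also have "\<dots> = word X G t (map \<pi> [0..<N])"
      by (rule word_cong) (simp_all add: X_def G_def)
    finally show "?\<Gamma> \<cdot> untail (map A (concat bs)) = word X G t (map \<pi> [0..<N])" .
    have "map A (concat bs) = map X (concat (map K ?is))"
      using XK len unfolding cc[symmetric] by
          (auto simp: map_concat m_def intro!: arg_cong[where f = concat] nth_equalityI)
    then show "Cod M ?F = Dom M (untail (map A (concat bs)))" using Fa u4 by simp
  qed (use \<Gamma>a u4 Fa in simp_all)
  also have "\<dots> = ev t c (\<sigma>, fs) \<cdot> (untail (map A c) \<cdot> actA (map W ?is) (Ident M I))"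
    unfolding main[symmetric] by (rule comp_assoc_ar)
        (use ea0 u3 aW id_ar[OF ob_simps(1)] in simp_all)
  also have "\<dots> = (ev t c (\<sigma>, fs) \<cdot> tensA M (map e ?is)) \<cdot> ?Q"
    unfolding R1[symmetric] by (rule comp_assoc_ar[symmetric]) (use ea0 te Qiso in simp_all)
  finally have eq: "(?\<Gamma> \<cdot> ?ci) \<cdot> ?Q = (ev t c (\<sigma>, fs) \<cdot> tensA M (map e ?is)) \<cdot> ?Q" .
  have "?\<Gamma> \<cdot> ?ci = ev t c (\<sigma>, fs) \<cdot> tensA M (map e ?is)"
    by (rule iso_epi[OF Qiso(1) _ _ _ _ eq]) (use \<Gamma>a cia ea0 te Qiso in simp_all)
  then show ?thesis unfolding \<pi>_def gl_def e_def m_def .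
qed

end

section \<open>Values on binary operations and the transposition\<close>

section \<open>Algebras over the operad of a category\<close>

lemma gam_perm_id:
  assumes "length \<sigma>s = length ks" "\<And>i. i < length ks \<Longrightarrow> \<sigma>s ! i = id"
  shows "gam_perm ks id \<sigma>s = id"
proof (rule perm_eqI)
  show "gam_perm ks id \<sigma>s permutes {..<sum_list ks}"
    using assms by (intro gam_perm_permutes) (auto simp: permutes_id)
  show "id permutes {..<sum_list ks}" by (rule permutes_id)
  fix i r assume ir: "i < length ks" "r < ks ! i"
  have "permute_list id ks = ks" by (simp add: permute_list_def map_nth)
  then have "block_perm ks id (sum_list (take i ks) + r) = sum_list (take i ks) + r"
    using block_perm_permute_list[of id ks i r] ir by (simp add: permutes_id)
  then show "gam_perm ks id \<sigma>s (sum_list (take i ks) + r) = id (sum_list (take i ks) + r)"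
    using ir assms by (simp add: gam_perm_def sum_perm_index)
qed

context symmetric_monoidal_category
begin

lemma perm_iso_transpose:
  assumes "x \<in> Ob M" "y \<in> Ob M"
  shows "perm_iso M [y, x] (transpose 0 1) = braid M x y"
  using assms by (simp add: perm_iso_def swap_iso_def whisker_def upt_rec transpose_def)

end

context monoid_diagram
begin

lemma is_op_operations: "is_op t c \<sigma> fs \<longleftrightarrow> (t, c, (\<sigma>, fs)) \<in> operations (cat_operad C)"
  by (auto simp: is_op_def cat_operad_operations)

lemma ev_unit:
  assumes "t \<in> Ob C"
  shows "ev t [t] (id, [Ident C t]) = Ident M (A t)"
proof -
  have op: "is_op t [t] id [Ident C t]"
    using assms C.id_hom[OF assms] by (simp add: is_op_def permutes_id)
  have eq: "ev t [t] (id, [Ident C t]) \<cdot> runit M (A t) = Ident M (A t) \<cdot> runit M (A t)"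
    using ev_id[OF op] assms monoidD(10)[OF mon[OF assms]] by (simp add: fa_id)
  show ?thesis
    using ev_ar[OF op] assms by (intro iso_epi[OF _ _ _ _ _ eq]) simp_all
qed

lemma ev_algebra: "is_operad_algebra (cat_operad C) M (A, \<lambda>(t, c, x). ev t c x)"
  unfolding is_operad_algebra_def prod.case
proof (intro conjI ballI, goal_cases)
  case (1 t)
  then show ?case by (simp add: cat_operad_simps)
next
  case (2 tcx)
  obtain t c \<sigma> fs where "tcx = (t, c, (\<sigma>, fs))" by (metis prod.collapse)
  then show ?case using 2 ev_ar[of t c \<sigma> fs] by (simp add: is_op_operations[symmetric] Hom_iff)
next
  case (3 tcx)
  obtain t c \<sigma> fs where eq: "tcx = (t, c, (\<sigma>, fs))" by (metis prod.collapse)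
  then show ?case
    using 3 ev_act[of t c \<sigma> fs] by (auto simp: is_op_operations[symmetric] cat_operad_simps)
next
  case (4 tcx)
  obtain t c \<sigma> fs where eq: "tcx = (t, c, (\<sigma>, fs))" by (metis prod.collapse)
  then have op: "is_op t c \<sigma> fs" using 4 by (simp add: is_op_operations)
  show ?case
    unfolding eq prod.case
  proof (intro allI impI)
    fix bs xs assume co: "composable (cat_operad C) c bs xs"
    then have len: "length bs = length c" "length xs = length c" by (auto simp: composable_def)
    have "is_op (c ! i) (bs ! i) (fst (xs ! i)) (snd (xs ! i))" if "i < length c" for i
      using co that by (simp add: composable_def is_op_operations)
    from ev_gamma[OF op len this]
    show "ev t (concat bs) (Gamma (cat_operad C) t c bs (\<sigma>, fs) xs) \<cdot>
        concat_iso M (map (map A) bs) =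
        ev t c (\<sigma>, fs) \<cdot> tensA M (map (\<lambda>i. ev (c ! i) (bs ! i) (xs ! i)) [0..<length c])"
      using len by (simp add: cat_operad_simps)
  qed
next
  case (5 t)
  then show ?case using ev_unit[of t] by (simp add: cat_operad_simps)
qed

text \<open>\<open>evm\<close> closes every product with \<open>eta t\<close>. The right unit law
  turns this last factor into a right unitor, which is cancelled.\<close>

lemma ev_binary:
  assumes "f1 \<in> Hom C c1 t" "f2 \<in> Hom C c2 t"
  shows "ev t [c1, c2] (id, [f1, f2]) = mu t \<cdot> (fa f1 \<otimes>\<^sub>1 fa f2)"
proof -
  note f = faD[OF assms(1)] faD[OF assms(2)]
  have op: "is_op t [c1, c2] id [f1, f2]"
    using assms f by (auto simp: is_op_def permutes_id less_Suc_eq)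
  have eq: "ev t [c1, c2] (id, [f1, f2]) \<cdot> ((A c1) \<triangleright> runit M (A c2)) =
      (mu t \<cdot> (fa f1 \<otimes>\<^sub>1 fa f2)) \<cdot> ((A c1) \<triangleright> runit M (A c2))"
  proof -
    have "mu t \<cdot> (fa f2 \<otimes>\<^sub>1 eta t) = (mu t \<cdot> ((A t) \<triangleright> eta t)) \<cdot> (fa f2 \<otimes>\<^sub>1 Ident M I)"
      using f by simp
    also have "\<dots> = fa f2 \<cdot> runit M (A c2)"
      unfolding monoidD(10)[OF mon[OF f(7)]] using f by (simp add: runit_natural)
    finally show ?thesis using ev_id[OF op] f by simp
  qed
  show ?thesis
    using ev_ar[OF op] f by (intro iso_epi[OF _ _ _ _ _ eq]) simp_all
qed

text \<open>The transposition acting on \<open>(id, [f2, f1])\<close> gives this operation, so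
  equivariance reduces it to \<open>ev_binary\<close> with the arguments exchanged.\<close>

lemma ev_binary_transpose:
  assumes "f1 \<in> Hom C c1 t" "f2 \<in> Hom C c2 t"
  shows "ev t [c1, c2] (transpose 0 1, [f1, f2]) =
      (mu t \<cdot> (fa f2 \<otimes>\<^sub>1 fa f1)) \<cdot> braid M (A c1) (A c2)"
proof -
  note f = faD[OF assms(1)] faD[OF assms(2)]
  have op: "is_op t [c2, c1] id [f2, f1]"
    using assms f by (auto simp: is_op_def permutes_id less_Suc_eq)
  have "transpose 0 (1::nat) permutes {..<length [c2, c1]}" by (rule permutes_swap_id) auto
  from ev_act[OF op this] show ?thesis
    using f perm_iso_transpose[of "A c1" "A c2"]
    by (simp add: permute_list_def transpose_def upt_rec ev_binary[OF assms(2,1)])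
qed

lemma ev_transpose_eq_iff:
  assumes "f1 \<in> Hom C c1 t" "f2 \<in> Hom C c2 t"
  shows "ev t [c1, c2] (id, [f1, f2]) = ev t [c1, c2] (transpose 0 1, [f1, f2]) \<longleftrightarrow>
    mu t \<cdot> (fa f1 \<otimes>\<^sub>1 fa f2) = (mu t \<cdot> braid M (A t) (A t)) \<cdot> (fa f1 \<otimes>\<^sub>1 fa f2)"
  using faD[OF assms(1)] faD[OF assms(2)]
  by (simp add: ev_binary[OF assms] ev_binary_transpose[OF assms, unfolded One_nat_def]
      braid_natural)

end

section \<open>Recovering a diagram of monoids from an algebra\<close>

locale cat_operad_algebra = symmetric_monoidal_category M + C: category C
  for M :: "('o, 'a, 'z) smc_scheme" (structure) and C :: "('c, 'd, 'y) cat_scheme" +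
  fixes A :: "'c \<Rightarrow> 'o" and \<alpha> :: "'c \<times> 'c list \<times> 'd perm_op \<Rightarrow> 'a"
  assumes alg: "is_operad_algebra (cat_operad C) M (A, \<alpha>)"
begin

definition amu :: "'c \<Rightarrow> 'a" where
  "amu c = \<alpha> (c, [c, c], (id, [Ident C c, Ident C c]))"

definition aeta :: "'c \<Rightarrow> 'a" where
  "aeta c = \<alpha> (c, [], (id, []))"

definition afa :: "'d \<Rightarrow> 'a" where
  "afa f = \<alpha> (Cod C f, [Dom C f], (id, [f]))"

text \<open>The operations with trivial permutation. They are closed under composition, and
  equivariance yields all others from them.\<close>

abbreviation plain :: "'c \<Rightarrow> 'c list \<Rightarrow> 'd list \<Rightarrow> bool" where
  "plain t c fs \<equiv> t \<in> Ob C \<and> set c \<subseteq> Ob C \<and> list_all2 (\<lambda>f x. f \<in> Hom C x t) fs c"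

lemma plain_operations: "plain t c fs \<Longrightarrow> (t, c, (id, fs)) \<in> operations (cat_operad C)"
  by (auto simp: cat_operad_operations permutes_id list_all2_conv_all_nth)

lemma A_ob [simp]: "c \<in> Ob C \<Longrightarrow> A c \<in> Ob M"
  using alg by (auto simp: is_operad_algebra_def cat_operad_simps)

lemma alpha_ar:
  assumes "(t, c, x) \<in> operations (cat_operad C)"
  shows "\<alpha> (t, c, x) \<in> Ar M" "Dom M (\<alpha> (t, c, x)) = tens M (map A c)" "Cod M (\<alpha> (t, c, x)) = A t"
  using alg assms by (auto simp: is_operad_algebra_def Hom_iff)

lemma alpha_act:
  assumes "(t, c, (\<sigma>, fs)) \<in> operations (cat_operad C)" "\<tau> permutes {..<length c}"
  shows "\<alpha> (t, permute_list \<tau> c, (\<sigma> \<circ> \<tau>, permute_list \<tau> fs)) =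
      \<alpha> (t, c, (\<sigma>, fs)) \<cdot> perm_iso M (map A c) \<tau>"
proof -
  have "\<forall>(t, c, x) \<in> operations (cat_operad C). \<forall>\<sigma>. \<sigma> permutes {..<length c} \<longrightarrow>
        \<alpha> (t, permute_list \<sigma> c, Act (cat_operad C) t c \<sigma> x) = \<alpha> (t, c, x) \<cdot> perm_iso M (map A c) \<sigma>"
    using alg by (simp add: is_operad_algebra_def)
  from bspec[OF this assms(1)] show ?thesis using assms(2) by (simp add: cat_operad_simps)
qed

lemma alpha_gamma:
  assumes t: "plain t c fs" and len: "length bs = length c" "length gss = length c"
    and p: "\<And>i. i < length c \<Longrightarrow> plain (c ! i) (bs ! i) (gss ! i)"
  shows "\<alpha> (t, concat bs, (id, gam_list C fs gss)) \<cdot> concat_iso M (map (map A) bs) =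
    \<alpha> (t, c, (id, fs)) \<cdot> tensA M (map (\<lambda>i. \<alpha> (c ! i, bs ! i, (id, gss ! i))) [0..<length c])"
proof -
  let ?xs = "map (\<lambda>gs. (id, gs)) gss"
  have co: "composable (cat_operad C) c bs ?xs"
    unfolding composable_def using len plain_operations[OF p] by simp
  have "\<forall>(t, c, x) \<in> operations (cat_operad C). \<forall>bs xs. composable (cat_operad C) c bs xs \<longrightarrow>
        \<alpha> (t, concat bs, Gamma (cat_operad C) t c bs x xs) \<cdot> concat_iso M (map (map A) bs) =
        \<alpha> (t, c, x) \<cdot> tensA M (map (\<lambda>i. \<alpha> (c ! i, bs ! i, xs ! i)) [0..<length c])"
    using alg by (simp add: is_operad_algebra_def)
  from bspec[OF this plain_operations[OF t]] co
  have "\<alpha> (t, concat bs, Gamma (cat_operad C) t c bs (id, fs) ?xs) \<cdot> concat_iso M (map (map A) bs) =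
        \<alpha> (t, c, (id, fs)) \<cdot> tensA M (map (\<lambda>i. \<alpha> (c ! i, bs ! i, ?xs ! i)) [0..<length c])"
    by simp
  moreover have "Gamma (cat_operad C) t c bs (id, fs) ?xs = (id, gam_list C fs gss)"
    using len gam_perm_id[of "map fst ?xs" "map length bs"] by (simp add: cat_operad_simps o_def)
  moreover have "map (\<lambda>i. \<alpha> (c ! i, bs ! i, ?xs ! i)) [0..<length c] =
      map (\<lambda>i. \<alpha> (c ! i, bs ! i, (id, gss ! i))) [0..<length c]"
    using len by simp
  ultimately show ?thesis by (simp only:)
qed

lemma alpha_unit: "c \<in> Ob C \<Longrightarrow> \<alpha> (c, [c], (id, [Ident C c])) = Ident M (A c)"
  using alg by (auto simp: is_operad_algebra_def cat_operad_simps)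

lemma alpha_gamma1:
  assumes "f \<in> Hom C x t" "plain x b gs"
  shows "\<alpha> (t, b, (id, map (\<lambda>g. f \<cdot>\<^bsub>C\<^esub> g) gs)) = afa f \<cdot> \<alpha> (x, b, (id, gs))"
proof -
  have t: "plain t [x] [f]" using assms C.ar_ob[of f] by (auto simp: C.Hom_iff)
  have ga: "gam_list C [f] [gs] = map (\<lambda>g. f \<cdot>\<^bsub>C\<^esub> g) gs" by (simp add: gam_list_def)
  have "plain t b (map (\<lambda>g. f \<cdot>\<^bsub>C\<^esub> g) gs)"
    using assms t C.comp_hom[OF _ assms(1)] by (auto simp: list_all2_conv_all_nth)
  from alpha_ar[OF plain_operations[OF this]] show ?thesis
    using alpha_gamma[OF t, of "[b]" "[gs]"] assms by (simp add: ga afa_def C.Hom_iff)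
qed

text \<open>\<open>fs @ gs\<close> arises by composing the multiplication
  \<open>(id, [Ident C t, Ident C t])\<close> with two shorter operations. This gives the monoid
  laws as well as the induction by which words decompose.\<close>

lemma alpha_gamma2:
  assumes t: "t \<in> Ob C" and p: "plain t b fs" "plain t b' gs"
  shows "\<alpha> (t, b @ b', (id, fs @ gs)) \<cdot> append_iso M (map A b) (map A b') =
    amu t \<cdot> (\<alpha> (t, b, (id, fs)) \<otimes>\<^sub>1 \<alpha> (t, b', (id, gs)))"
proof -
  have q: "plain t [t, t] [Ident C t, Ident C t]" using t C.id_hom[OF t] by auto
  have i: "map (\<lambda>g. Ident C t \<cdot>\<^bsub>C\<^esub> g) hs = hs" if "plain t d hs" for d hs
    using that C.id_comp by (auto simp: list_all2_conv_all_nth intro!: nth_equalityI)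
  have ga: "gam_list C [Ident C t, Ident C t] [fs, gs] = fs @ gs"
    using i[OF p(1)] i[OF p(2)] by (simp add: gam_list_def upt_rec)
  have ob: "\<forall>x \<in> set (map A b). x \<in> Ob M" "\<forall>x \<in> set (map A b'). x \<in> Ob M" using p by auto
  have to: "tens M (map A b) \<in> Ob M" "tens M (map A b') \<in> Ob M"
      using tens_ob_list[OF ob(1)] tens_ob_list[OF ob(2)] by auto
  have a: "append_iso M (map A b) (map A b') \<in> Ar M"
    "Dom M (append_iso M (map A b) (map A b')) = tens M (map A b) \<otimes>\<^sub>0 tens M (map A b')"
    using append_iso_hom[of "map A b" "map A b'"] ob by (auto simp: Hom_iff subset_iff)
  have "plain ([t, t] ! i) ([b, b'] ! i) ([fs, gs] ! i)" if "i < length [t, t]" for i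
    using that p by (auto simp: less_Suc_eq)
  from alpha_gamma[OF q _ _ this] show ?thesis
    using to a by (simp add: ga amu_def upt_rec)
qed

lemma amu_eta_ar:
  assumes "c \<in> Ob C"
  shows "amu c \<in> Ar M" "Dom M (amu c) = A c \<otimes>\<^sub>0 A c" "Cod M (amu c) = A c"
    "aeta c \<in> Ar M" "Dom M (aeta c) = I" "Cod M (aeta c) = A c"
  using alpha_ar[OF plain_operations[of c "[c, c]" "[Ident C c, Ident C c]"]]
    alpha_ar[OF plain_operations[of c "[]" "[]"]] assms C.id_hom[OF assms]
  by (simp_all add: amu_def aeta_def)

lemma afa_ar:
  assumes "f \<in> Ar C"
  shows "afa f \<in> Ar M" "Dom M (afa f) = A (Dom C f)" "Cod M (afa f) = A (Cod C f)"
  using alpha_ar[OF plain_operations[of "Cod C f" "[Dom C f]" "[f]"]] assms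
  by (simp_all add: afa_def C.Hom_iff)

text \<open>Each law compares two decompositions of one operation: associativity those of the
  ternary \<open>(id, [id, id, id])\<close>, the unit laws those of \<open>(id, [id])\<close> with
  an empty part on either side, and compatibility of \<open>afa f\<close> with multiplication those
  of \<open>(id, [f, f])\<close>.\<close>

sublocale D: monoid_diagram M C A amu aeta afa
proof
  fix c assume c: "c \<in> Ob C"
  let ?i = "Ident C c"
  have i: "?i \<in> Hom C c c" by (rule C.id_hom[OF c])
  note [simp] = amu_eta_ar[OF c] alpha_unit[OF c] A_ob[OF c]
  have p: "plain c [c] [?i]" "plain c [] []" "plain c [c, c] [?i, ?i]" using c i by auto
  have "\<alpha> (c, [c, c, c], id, [?i, ?i, ?i]) \<in> Ar M"
      "Dom M (\<alpha> (c, [c, c, c], id, [?i, ?i, ?i])) = A c \<otimes>\<^sub>0 A c \<otimes>\<^sub>0 A c"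
    using alpha_ar[OF plain_operations[of c "[c, c, c]" "[?i, ?i, ?i]"]] c i by simp_all
  then have assoc: "amu c \<cdot> (amu c \<otimes>\<^sub>1 Ident M (A c)) =
      amu c \<cdot> ((A c) \<triangleright> amu c) \<cdot> assoc M (A c) (A c) (A c)"
    using alpha_gamma2[OF c p(3,1)] alpha_gamma2[OF c p(1,3)] by (simp add: amu_def[symmetric])
  have "amu c \<cdot> (aeta c \<otimes>\<^sub>1 Ident M (A c)) = lunit M (A c)"
      "amu c \<cdot> ((A c) \<triangleright> aeta c) = runit M (A c)"
    using alpha_gamma2[OF c p(2,1)] alpha_gamma2[OF c p(1,2)] by (simp_all add: aeta_def[symmetric])
  with assoc show "is_monoid M (A c, amu c, aeta c)"
    by (simp add: is_monoid_def Hom_iff)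
  show "afa ?i = Ident M (A c)" using c by (simp add: afa_def)
next
  fix f assume f: "f \<in> Ar C"
  let ?x = "Dom C f" and ?y = "Cod C f"
  have o: "?x \<in> Ob C" "?y \<in> Ob C" using f by auto
  have fh: "f \<in> Hom C ?x ?y" using f by (simp add: C.Hom_iff)
  note [simp] = amu_eta_ar[OF o(1)] amu_eta_ar[OF o(2)] afa_ar[OF f] A_ob[OF o(1)] A_ob[OF o(2)]
  have "afa f \<cdot> amu ?x = \<alpha> (?y, [?x, ?x], id, [f, f])"
    using alpha_gamma1[OF fh, of "[?x, ?x]" "[Ident C ?x, Ident C ?x]"] o C.id_hom[OF o(1)] f by
        (simp add: amu_def)
  also have "\<dots> = amu ?y \<cdot> (afa f \<otimes>\<^sub>1 afa f)"
    using alpha_gamma2[OF o(2), of "[?x]" "[f]" "[?x]" "[f]"] o fh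
      alpha_ar[OF plain_operations[of ?y "[?x, ?x]" "[f, f]"]] by (simp add: afa_def)
  finally have m: "afa f \<cdot> amu ?x = amu ?y \<cdot> (afa f \<otimes>\<^sub>1 afa f)" .
  have "afa f \<cdot> aeta ?x = aeta ?y"
    using alpha_gamma1[OF fh, of "[]" "[]"] o by (simp add: aeta_def)
  with m show "is_monoid_hom M (A ?x, amu ?x, aeta ?x) (A ?y, amu ?y, aeta ?y) (afa f)"
    by (simp add: is_monoid_hom_def Hom_iff)
  fix g assume g: "g \<in> Ar C" "Dom C g = Cod C f"
  have "g \<in> Hom C ?y (Cod C g)" using g by (simp add: C.Hom_iff)
  from alpha_gamma1[OF this, of "[?x]" "[f]"] show "afa (g \<cdot>\<^bsub>C\<^esub> f) = afa g \<cdot> afa f"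
    using o fh f g by (simp add: afa_def)
qed

text \<open>Splitting off the first letter by \<open>alpha_gamma2\<close> reproduces the recursion
  of \<open>evm\<close>, which ends in the nullary operation.\<close>

lemma alpha_id_untail:
  assumes "plain t c fs"
  shows "\<alpha> (t, c, (id, fs)) \<cdot> untail (map A c) = evm (amu t) (map afa fs) (aeta t)"
  using assms
proof (induction c arbitrary: fs)
  case Nil
  then have "fs = []" by simp
  then show ?case using alpha_ar[OF plain_operations[OF Nil]] by (simp add: aeta_def id_def)
next
  case (Cons x c)
  then obtain f fs' where fs: "fs = f # fs'" "f \<in> Hom C x t" "plain t c fs'"
    by (auto simp: list_all2_Cons2)
  have t: "t \<in> Ob C" and x: "x \<in> Ob C" using Cons.prems by auto
  let ?u = "untail (map A c)" and ?a = "\<alpha> (t, x # c, (id, f # fs'))" and ?b = "\<alpha> (t, c, (id, fs'))"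
  have ob: "\<forall>y \<in> set (map A c). y \<in> Ob M" "\<forall>y \<in> set (map A (x # c)). y \<in> Ob M" using Cons.prems
      by auto
  note u = untail_ar[OF ob(1)] untail_ar[OF ob(2)]
      and a = alpha_ar[OF plain_operations[OF Cons.prems]]
    and b = alpha_ar[OF plain_operations[OF fs(3)]]
  have f: "afa f \<in> Ar M" "Dom M (afa f) = A x" "Cod M (afa f) = A t" "afa f = \<alpha> (t, [x], (id, [f]))"
    using afa_ar[of f] fs(2) by (auto simp: C.Hom_iff afa_def)
  have ta: "tens0 (map A c) \<in> Ob M" using ob(1) by simp
  have e: "evm (amu t) (map afa fs') (aeta t) = ?b \<cdot> ?u" using Cons.IH[OF fs(3)] by
      (simp add: id_def)
  \<comment> \<open>For a one-letter word \<open>join\<close> is a right unitor by the triangle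
    identity. It is invertible and is cancelled at the end.\<close>
  have jo: "join [A x] (tens0 (map A c)) = runit M (A x) \<otimes>\<^sub>1 Ident M (tens0 (map A c))"
    using x ta by (simp add: triangle_ar)
  have ai: "append_iso M [A x] (map A c) \<in> Ar M"
    "Dom M (append_iso M [A x] (map A c)) = A x \<otimes>\<^sub>0 tens M (map A c)"
    "Cod M (append_iso M [A x] (map A c)) = tens M (A x # map A c)"
    using append_iso_hom[of "[A x]" "map A c"] ob x by (auto simp: Hom_iff subset_iff)
  have eq: "(?a \<cdot> untail (map A (x # c))) \<cdot> (runit M (A x) \<otimes>\<^sub>1 Ident M (tens0 (map A c))) =
      (amu t \<cdot> (afa f \<otimes>\<^sub>1 (?b \<cdot> ?u))) \<cdot> (runit M (A x) \<otimes>\<^sub>1 Ident M (tens0 (map A c)))"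
  proof -
    have "(?a \<cdot> untail (map A (x # c))) \<cdot> (runit M (A x) \<otimes>\<^sub>1 Ident M (tens0 (map A c))) =
        ?a \<cdot> (untail ([A x] @ map A c) \<cdot> join [A x] (tens0 (map A c)))"
      unfolding jo using a u x ta fs(1) by (simp del: untail.simps)
    also have "\<dots> = ?a \<cdot> (append_iso M [A x] (map A c) \<cdot> (runit M (A x) \<otimes>\<^sub>1 ?u))"
      using append_iso_untail[of "[A x]" "map A c"] ob x by (simp del: join.simps)
    also have "\<dots> = (?a \<cdot> append_iso M [A x] (map A c)) \<cdot> (runit M (A x) \<otimes>\<^sub>1 ?u)"
      using a ai u x fs(1) by simp
    also have "?a \<cdot> append_iso M [A x] (map A c) = amu t \<cdot> (afa f \<otimes>\<^sub>1 ?b)"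
      using alpha_gamma2[OF t, of "[x]" "[f]" c fs'] fs x t f(4) by simp
    also have "(amu t \<cdot> (afa f \<otimes>\<^sub>1 ?b)) \<cdot> (runit M (A x) \<otimes>\<^sub>1 ?u) =
        (amu t \<cdot> (afa f \<otimes>\<^sub>1 (?b \<cdot> ?u))) \<cdot> (runit M (A x) \<otimes>\<^sub>1 Ident M (tens0 (map A c)))"
      using f(1-3) b u x t amu_eta_ar[OF t] ta by simp
    finally show ?thesis .
  qed
  have "?a \<cdot> untail (map A (x # c)) = amu t \<cdot> (afa f \<otimes>\<^sub>1 (?b \<cdot> ?u))"
    by (rule iso_epi[OF _ _ _ _ _ eq]) (use a b u x t f(1-3) amu_eta_ar[OF t] ta fs(1) in \<open>simp_all
        del: untail.simps\<close>)
  then show ?case by (simp add: fs(1) e id_def del: untail.simps)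
qed

text \<open>Any operation is obtained by letting \<sigma> act on one with trivial permutation, whose
  tuple is permuted by the inverse. There both actions are iterated products, and both are
  equivariant.\<close>

lemma alpha_ev:
  assumes "(t, c, (\<sigma>, fs)) \<in> operations (cat_operad C)"
  shows "\<alpha> (t, c, (\<sigma>, fs)) = D.ev t c (\<sigma>, fs)"
proof -
  note op = assms[unfolded cat_operad_operations]
  let ?c = "permute_list (inv \<sigma>) c" and ?fs = "permute_list (inv \<sigma>) fs"
  have \<sigma>: "\<sigma> permutes {..<length c}" and \<sigma>i: "inv \<sigma> permutes {..<length c}"
    using op permutes_inv by auto
  have pl: "plain t ?c ?fs"
    using op \<sigma>i perm_less[OF \<sigma>i] by (auto simp: list_all2_conv_all_nth permute_list_nth)
  note po = plain_operations[OF pl]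
  have dop: "D.is_op t ?c id ?fs" using po by (simp add: D.is_op_operations)
  have ob: "\<forall>y \<in> set (map A ?c). y \<in> Ob M" using pl by auto
  have eq: "\<alpha> (t, ?c, (id, ?fs)) \<cdot> untail (map A ?c) = D.ev t ?c (id, ?fs) \<cdot> untail (map A ?c)"
    using alpha_id_untail[OF pl] D.ev_id[OF dop] by simp
  have e: "\<alpha> (t, ?c, (id, ?fs)) = D.ev t ?c (id, ?fs)"
    by (rule iso_epi[OF _ _ _ _ _ eq]) (use untail_ar[OF ob] alpha_ar[OF po] D.ev_ar[OF dop] in
        simp_all)
  have p: "permute_list \<sigma> ?c = c" "permute_list \<sigma> ?fs = fs"
    using \<sigma> \<sigma>i op permutes_inv_o(2)[OF \<sigma>] permutes_inv_o(1)[OF \<sigma>]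
    by (simp_all flip: permute_list_compose)
  show ?thesis
    using alpha_act[OF po, of \<sigma>] D.ev_act[OF dop, of \<sigma>] \<sigma> e p by simp
qed

end

section \<open>Universal quotients of operads and transport of algebras along them\<close>

section \<open>Algebras over a coequalizer\<close>

lemma operad_morphismD:
  assumes "operad_morphism P Q \<phi>"
  shows "colored_operad P" "colored_operad Q" "Colors P = Colors Q"
    "(t, c, x) \<in> operations P \<Longrightarrow> (t, c, \<phi> t c x) \<in> operations Q"
    "\<lbrakk>(t, c, x) \<in> operations P; \<sigma> permutes {..<length c}\<rbrakk>
      \<Longrightarrow> \<phi> t (permute_list \<sigma> c) (Act P t c \<sigma> x) = Act Q t c \<sigma> (\<phi> t c x)"
    "\<lbrakk>(t, c, x) \<in> operations P; composable P c bs xs\<rbrakk>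
      \<Longrightarrow> \<phi> t (concat bs) (Gamma P t c bs x xs) =
        Gamma Q t c bs (\<phi> t c x) (map (\<lambda>i. \<phi> (c ! i) (bs ! i) (xs ! i)) [0..<length c])"
    "t \<in> Colors P \<Longrightarrow> \<phi> t [t] (OUnit P t) = OUnit Q t"
    "composable P c bs xs \<Longrightarrow> composable Q c bs (map (\<lambda>i. \<phi> (c ! i) (bs ! i) (xs ! i)) [0..<length
      c])"
proof -
  note m = assms[unfolded operad_morphism_def]
  show "colored_operad P" "colored_operad Q" "Colors P = Colors Q" using m by auto
  show op: "(t, c, \<phi> t c x) \<in> operations Q" if "(t, c, x) \<in> operations P" for t c x
    using m that by (fastforce simp: operations_def)
  show "\<phi> t (permute_list \<sigma> c) (Act P t c \<sigma> x) = Act Q t c \<sigma> (\<phi> t c x)"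
    if "(t, c, x) \<in> operations P" "\<sigma> permutes {..<length c}" using m that by blast
  show "\<phi> t (concat bs) (Gamma P t c bs x xs) =
        Gamma Q t c bs (\<phi> t c x) (map (\<lambda>i. \<phi> (c ! i) (bs ! i) (xs ! i)) [0..<length c])"
    if "(t, c, x) \<in> operations P" "composable P c bs xs" using m that by blast
  show "\<phi> t [t] (OUnit P t) = OUnit Q t" if "t \<in> Colors P" using m that by blast
  show "composable Q c bs (map (\<lambda>i. \<phi> (c ! i) (bs ! i) (xs ! i)) [0..<length c])"
    if "composable P c bs xs" using that op by (auto simp: composable_def)
qed

lemma operad_morphismI:
  assumes "colored_operad P" "colored_operad Q" "Colors P = Colors Q"
    "\<And>t c x. (t, c, x) \<in> operations P \<Longrightarrow> \<phi> t c x \<in> Ops Q t c"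
    "\<And>t c x \<sigma>. \<lbrakk>(t, c, x) \<in> operations P; \<sigma> permutes {..<length c}\<rbrakk>
      \<Longrightarrow> \<phi> t (permute_list \<sigma> c) (Act P t c \<sigma> x) = Act Q t c \<sigma> (\<phi> t c x)"
    "\<And>t c x bs xs. \<lbrakk>(t, c, x) \<in> operations P; composable P c bs xs\<rbrakk>
      \<Longrightarrow> \<phi> t (concat bs) (Gamma P t c bs x xs) =
        Gamma Q t c bs (\<phi> t c x) (map (\<lambda>i. \<phi> (c ! i) (bs ! i) (xs ! i)) [0..<length c])"
    "\<And>t. t \<in> Colors P \<Longrightarrow> \<phi> t [t] (OUnit P t) = OUnit Q t"
  shows "operad_morphism P Q \<phi>"
  unfolding operad_morphism_def using assms by blast

lemma operad_morphism_id:
  assumes "colored_operad P"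
  shows "operad_morphism P P (\<lambda>t c x. x)"
proof (rule operad_morphismI[OF assms assms])
  show "Gamma P t c bs x xs = Gamma P t c bs x (map (\<lambda>i. xs ! i) [0..<length c])"
    if "composable P c bs xs" for t c bs x xs
    using that map_nth[of xs] by (simp add: composable_def)
qed (auto simp: operations_def)

lemma operad_morphism_comp:
  assumes \<phi>: "operad_morphism P Q \<phi>" and \<psi>: "operad_morphism Q S \<psi>"
  shows "operad_morphism P S (\<lambda>t c x. \<psi> t c (\<phi> t c x))"
proof (rule operad_morphismI)
  note f = operad_morphismD[OF \<phi>] and g = operad_morphismD[OF \<psi>]
  show "colored_operad P" "colored_operad S" "Colors P = Colors S" using f(1,3) g(2,3) by auto
  show "\<psi> t c (\<phi> t c x) \<in> Ops S t c" if "(t, c, x) \<in> operations P" for t c x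
    using g(4)[OF f(4)[OF that]] by (simp add: operations_def)
  show "\<psi> t (permute_list \<sigma> c) (\<phi> t (permute_list \<sigma> c) (Act P t c \<sigma> x)) =
      Act S t c \<sigma> (\<psi> t c (\<phi> t c x))"
    if "(t, c, x) \<in> operations P" "\<sigma> permutes {..<length c}" for t c x \<sigma>
    using f(5)[OF that] g(5)[OF f(4)[OF that(1)] that(2)] by simp
  show "\<psi> t (concat bs) (\<phi> t (concat bs) (Gamma P t c bs x xs)) =
        Gamma S t c bs (\<psi> t c (\<phi> t c x)) (map (\<lambda>i. \<psi> (c ! i) (bs ! i) (\<phi> (c ! i) (bs ! i)
            (xs ! i))) [0..<length c])"
    if "(t, c, x) \<in> operations P" "composable P c bs xs" for t c x bs xs
    unfolding f(6)[OF that] g(6)[OF f(4)[OF that(1)] f(8)[OF that(2)]]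
    by (intro arg_cong[where f = "Gamma S t c bs (\<psi> t c (\<phi> t c x))"] map_cong) auto
  show "\<psi> t [t] (\<phi> t [t] (OUnit P t)) = OUnit S t" if "t \<in> Colors P" for t
    using f(3) f(7)[OF that] g(7)[of t] that by simp
qed

text \<open>
  A coequalizer is isomorphic under \<open>P\<close> to the quotient operad, since both have the universal
  property with respect to operads of the type of the quotient.
\<close>

lemma
  fixes P :: "('c, 'x) operad" and Q :: "('c, 'x set) operad"
  assumes co: "is_operad_coequalizer P R Q q"
    and R: "\<And>t c x y. (t, c, x, y) \<in> R \<Longrightarrow> (t, c, x) \<in> operations P \<and> (t, c, y) \<in> operations P"
  shows coequalizer_surj: "(t, c, y) \<in> operations Q \<Longrightarrow> \<exists>x. (t, c, x) \<in> operations P \<and> q t c x = y"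
    and coequalizer_cong: "\<lbrakk>(t, c, x) \<in> operations P; (t, c, x') \<in> operations P; q t c x = q t c x'\<rbrakk>
      \<Longrightarrow> operad_cong P R t c x x'"
proof -
  have q: "operad_morphism P Q q" "identifies R q"
    and univ: "\<And>Q' \<phi>. operad_morphism P (Q' :: ('c, 'x set) operad) \<phi> \<and> identifies R \<phi> \<Longrightarrow>
        (\<exists>\<psi>. operad_morphism Q Q' \<psi> \<and> (\<forall>(t, c, x) \<in> operations P. \<psi> t c (q t c x) = \<phi> t c x)) \<and>
        (\<forall>\<psi> \<psi>'. operad_morphism Q Q' \<psi> \<and> operad_morphism Q Q' \<psi>' \<and>
           (\<forall>(t, c, x) \<in> operations P. \<psi> t c (q t c x) = \<phi> t c x) \<and>
           (\<forall>(t, c, x) \<in> operations P. \<psi>' t c (q t c x) = \<phi> t c x) \<longrightarrow>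
           (\<forall>(t, c, y) \<in> operations Q. \<psi> t c y = \<psi>' t c y))"
    using co unfolding is_operad_coequalizer_def by blast+
  interpret colored_operad P by (rule operad_morphismD(1)[OF q(1)])
  have cq: "operad_morphism P (quot_operad P R) (cong_class P R)" "identifies R (cong_class P R)"
    using quot_operad_coequalizer[OF R] unfolding is_operad_coequalizer_def by blast+
  \<comment> \<open>The quotient operad has operations of the same type as Q and therefore is among
    the competitors in the universal property of Q.\<close>
  obtain \<psi> where \<psi>: "operad_morphism Q (quot_operad P R) \<psi>"
    "\<And>t c x. (t, c, x) \<in> operations P \<Longrightarrow> \<psi> t c (q t c x) = cong_class P R t c x"
    using univ[of "quot_operad P R" "cong_class P R"] cq by fast
  obtain \<chi> where \<chi>: "operad_morphism (quot_operad P R) Q \<chi>"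
    "\<And>t c x. (t, c, x) \<in> operations P \<Longrightarrow> \<chi> t c (cong_class P R t c x) = q t c x"
    using quot_operad_universal[OF q] by fast
  \<comment> \<open>Uniqueness in the universal property of Q, with Q itself as the target: the
    composite and the identity both factor q through q.\<close>
  have \<chi>\<psi>: "\<chi> t c (\<psi> t c y) = y" if "(t, c, y) \<in> operations Q" for t c y
    using univ[of Q q] q operad_morphism_comp[OF \<psi>(1) \<chi>(1)] operad_morphism_id[OF
        operad_morphismD(2)[OF q(1)]]
      \<psi>(2) \<chi>(2) that by (smt (verit, del_insts) case_prodD case_prodI2)
  show "\<exists>x. (t, c, x) \<in> operations P \<and> q t c x = y" if y: "(t, c, y) \<in> operations Q"
  proof -
    obtain x where x: "(t, c, x) \<in> operations P" "\<psi> t c y = cong_class P R t c x"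
      using operad_morphismD(4)[OF \<psi>(1) y] by (auto simp: quot_operations)
    then show ?thesis using \<chi>\<psi>[OF y] \<chi>(2)[OF x(1)] by auto
  qed
  \<comment> \<open>\<psi> sends the classes under q to congruence classes, so q identifies no more
    than the congruence does.\<close>
  show "operad_cong P R t c x x'"
    if "(t, c, x) \<in> operations P" "(t, c, x') \<in> operations P" "q t c x = q t c x'"
    using \<psi>(2)[OF that(1)] \<psi>(2)[OF that(2)] that(3) class_eq[OF that(1)] by metis
qed

lemma is_operad_algebraD:
  assumes "is_operad_algebra P M (A, \<alpha>)"
  shows "t \<in> Colors P \<Longrightarrow> A t \<in> Ob M"
    "(t, c, x) \<in> operations P \<Longrightarrow> \<alpha> (t, c, x) \<in> Hom M (tens M (map A c)) (A t)"
    "\<lbrakk>(t, c, x) \<in> operations P; \<sigma> permutes {..<length c}\<rbrakk>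
      \<Longrightarrow> \<alpha> (t, permute_list \<sigma> c, Act P t c \<sigma> x) = \<alpha> (t, c, x) \<cdot>\<^bsub>M\<^esub> perm_iso M (map A c) \<sigma>"
    "\<lbrakk>(t, c, x) \<in> operations P; composable P c bs xs\<rbrakk>
      \<Longrightarrow> \<alpha> (t, concat bs, Gamma P t c bs x xs) \<cdot>\<^bsub>M\<^esub> concat_iso M (map (map A) bs) =
        \<alpha> (t, c, x) \<cdot>\<^bsub>M\<^esub> tensA M (map (\<lambda>i. \<alpha> (c ! i, bs ! i, xs ! i)) [0..<length c])"
    "t \<in> Colors P \<Longrightarrow> \<alpha> (t, [t], OUnit P t) = Ident M (A t)"
  using assms unfolding is_operad_algebra_def by blast+

lemma is_operad_algebraI:
  assumes "\<And>t. t \<in> Colors P \<Longrightarrow> A t \<in> Ob M"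
    "\<And>t c x. (t, c, x) \<in> operations P \<Longrightarrow> \<alpha> (t, c, x) \<in> Hom M (tens M (map A c)) (A t)"
    "\<And>t c x \<sigma>. \<lbrakk>(t, c, x) \<in> operations P; \<sigma> permutes {..<length c}\<rbrakk>
      \<Longrightarrow> \<alpha> (t, permute_list \<sigma> c, Act P t c \<sigma> x) = \<alpha> (t, c, x) \<cdot>\<^bsub>M\<^esub> perm_iso M (map A c) \<sigma>"
    "\<And>t c x bs xs. \<lbrakk>(t, c, x) \<in> operations P; composable P c bs xs\<rbrakk>
      \<Longrightarrow> \<alpha> (t, concat bs, Gamma P t c bs x xs) \<cdot>\<^bsub>M\<^esub> concat_iso M (map (map A) bs) =
        \<alpha> (t, c, x) \<cdot>\<^bsub>M\<^esub> tensA M (map (\<lambda>i. \<alpha> (c ! i, bs ! i, xs ! i)) [0..<length c])"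
    "\<And>t. t \<in> Colors P \<Longrightarrow> \<alpha> (t, [t], OUnit P t) = Ident M (A t)"
  shows "is_operad_algebra P M (A, \<alpha>)"
  unfolding is_operad_algebra_def using assms by blast

text \<open>Values outside the colors and operations do not affect the axioms. This permits the
  passage to extensional representatives.\<close>

lemma is_operad_algebra_cong:
  assumes P: "colored_operad P" and a: "is_operad_algebra P M (A, \<alpha>)"
    and A: "\<And>t. t \<in> Colors P \<Longrightarrow> A' t = A t"
    and \<alpha>: "\<And>t c x. (t, c, x) \<in> operations P \<Longrightarrow> \<alpha>' (t, c, x) = \<alpha> (t, c, x)"
  shows "is_operad_algebra P M (A', \<alpha>')"
proof (rule is_operad_algebraI)
  interpret colored_operad P by (rule P)
  note d = is_operad_algebraD[OF a]
  have m: "map A' c = map A c" if "(t, c, x) \<in> operations P" for t c x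
    using that A by (auto simp: operations_def)
  have t: "t \<in> Colors P" if "(t, c, x) \<in> operations P" for t c x using that by
      (auto simp: operations_def)
  show "A' t \<in> Ob M" if "t \<in> Colors P" for t using A d(1) that by simp
  show "\<alpha>' (t, c, x) \<in> Hom M (tens M (map A' c)) (A' t)" if "(t, c, x) \<in> operations P" for t c x
    using d(2)[OF that] by (simp only: \<alpha>[OF that] A[OF t[OF that]] m[OF that])
  show "\<alpha>' (t, permute_list \<sigma> c, Act P t c \<sigma> x) = \<alpha>' (t, c, x) \<cdot>\<^bsub>M\<^esub> perm_iso M (map A' c) \<sigma>"
    if "(t, c, x) \<in> operations P" "\<sigma> permutes {..<length c}" for t c x \<sigma>
    using d(3)[OF that] by (simp only: \<alpha>[OF that(1)] \<alpha>[OF act_operations[OF that]] m[OF that(1)])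
  show "\<alpha>' (t, concat bs, Gamma P t c bs x xs) \<cdot>\<^bsub>M\<^esub> concat_iso M (map (map A') bs) =
        \<alpha>' (t, c, x) \<cdot>\<^bsub>M\<^esub> tensA M (map (\<lambda>i. \<alpha>' (c ! i, bs ! i, xs ! i)) [0..<length c])"
    if "(t, c, x) \<in> operations P" "composable P c bs xs" for t c x bs xs
  proof -
    have i: "(c ! i, bs ! i, xs ! i) \<in> operations P" if "i < length c" for i
      using \<open>composable P c bs xs\<close> that by (simp add: composable_def)
    have "map (map A') bs = map (map A) bs"
      using that(2) m[OF i] by (intro nth_equalityI) (auto simp: composable_def)
    moreover have "map (\<lambda>i. \<alpha>' (c ! i, bs ! i, xs ! i)) [0..<length c] =
        map (\<lambda>i. \<alpha> (c ! i, bs ! i, xs ! i)) [0..<length c]"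
      using \<alpha>[OF i] by simp
    ultimately show ?thesis
      using d(4)[OF that] \<alpha>[OF that(1)] \<alpha>[OF gamma_operations[OF that]] by (simp only:)
  qed
  show "\<alpha>' (t, [t], OUnit P t) = Ident M (A' t)" if "t \<in> Colors P" for t
    using d(5)[OF that] \<alpha>[OF unit_operations[OF that]] A[OF that] by simp
qed

lemma pullback_algebra:
  assumes q: "operad_morphism P Q q" and a: "is_operad_algebra Q M (A, \<alpha>)"
  shows "is_operad_algebra P M (A, \<lambda>(t, c, x). \<alpha> (t, c, q t c x))"
proof (rule is_operad_algebraI, goal_cases)
  note m = operad_morphismD[OF q] and d = is_operad_algebraD[OF a]
  case (1 t) then show ?case using d(1) m(3) by simp
next
  note m = operad_morphismD[OF q] and d = is_operad_algebraD[OF a]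
  case (2 t c x) then show ?case using d(2)[OF m(4)] by simp
next
  note m = operad_morphismD[OF q] and d = is_operad_algebraD[OF a]
  case (3 t c x \<sigma>) then show ?case using d(3)[OF m(4)] m(5) by simp
next
  note m = operad_morphismD[OF q] and d = is_operad_algebraD[OF a]
  case (4 t c x bs xs)
  have "map (\<lambda>i. \<alpha> (c ! i, bs ! i, map (\<lambda>i. q (c ! i) (bs ! i) (xs ! i)) [0..<length c] ! i))
      [0..<length c] =
      map (\<lambda>i. \<alpha> (c ! i, bs ! i, q (c ! i) (bs ! i) (xs ! i))) [0..<length c]"
    by simp
  then show ?case using d(4)[OF m(4)[OF 4(1)] m(8)[OF 4(2)]] m(6)[OF 4] by (simp del: map_eq_conv)
next
  note m = operad_morphismD[OF q] and d = is_operad_algebraD[OF a]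
  case (5 t) then show ?case using d(5)[of t] m(3) m(7) by simp
qed

text \<open>As q is onto, an operation of Q and every list composable with it lift to P, where the
  axioms are known.\<close>

lemma pushforward_algebra:
  assumes q: "operad_morphism P Q q"
    and surj: "\<And>t c y. (t, c, y) \<in> operations Q \<Longrightarrow> \<exists>x. (t, c, x) \<in> operations P \<and> q t c x = y"
    and a: "is_operad_algebra P M (A, \<alpha>)"
    and \<beta>: "\<And>t c x. (t, c, x) \<in> operations P \<Longrightarrow> \<beta> (t, c, q t c x) = \<alpha> (t, c, x)"
  shows "is_operad_algebra Q M (A, \<beta>)"
proof (rule is_operad_algebraI)
  interpret P: colored_operad P by (rule operad_morphismD(1)[OF q])
  note m = operad_morphismD[OF q] and d = is_operad_algebraD[OF a]
  show "A t \<in> Ob M" if "t \<in> Colors Q" for t using d(1) m(3) that by simp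
  show "\<beta> (t, [t], OUnit Q t) = Ident M (A t)" if "t \<in> Colors Q" for t
    using m(3) m(7)[of t] d(5)[of t] \<beta>[OF P.unit_operations, of t] that by simp
  fix t c y assume "(t, c, y) \<in> operations Q"
  then obtain x where x: "(t, c, x) \<in> operations P" "y = q t c x" using surj by blast
  show "\<beta> (t, c, y) \<in> Hom M (tens M (map A c)) (A t)" using d(2)[OF x(1)] \<beta> x by simp
  show "\<beta> (t, permute_list \<sigma> c, Act Q t c \<sigma> y) = \<beta> (t, c, y) \<cdot>\<^bsub>M\<^esub> perm_iso M (map A c) \<sigma>"
    if "\<sigma> permutes {..<length c}" for \<sigma>
    using m(5)[OF x(1) that] d(3)[OF x(1) that] \<beta>[OF x(1)] \<beta>[OF P.act_operations[OF x(1) that]]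
        x(2) by simp
  fix bs ys assume ys: "composable Q c bs ys"
  then have "\<forall>i. \<exists>x. i < length c \<longrightarrow> (c ! i, bs ! i, x) \<in> operations P \<and> q (c ! i) (bs ! i) x =
      ys ! i"
    using surj by (auto simp: composable_def)
  then obtain f where f: "\<And>i. i < length c \<Longrightarrow> (c ! i, bs ! i, f i) \<in> operations P \<and>
      q (c ! i) (bs ! i) (f i) = ys ! i"
    by metis
  define xs where "xs = map f [0..<length c]"
  have co: "composable P c bs xs" using ys f by (auto simp: composable_def xs_def)
  have yx: "ys = map (\<lambda>i. q (c ! i) (bs ! i) (xs ! i)) [0..<length c]"
    using ys f by (auto simp: composable_def xs_def intro!: nth_equalityI)
  have "map (\<lambda>i. \<beta> (c ! i, bs ! i, ys ! i)) [0..<length c] =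
      map (\<lambda>i. \<alpha> (c ! i, bs ! i, xs ! i)) [0..<length c]"
    using f \<beta> by (auto simp: yx xs_def)
  then show "\<beta> (t, concat bs, Gamma Q t c bs y ys) \<cdot>\<^bsub>M\<^esub> concat_iso M (map (map A) bs) =
        \<beta> (t, c, y) \<cdot>\<^bsub>M\<^esub> tensA M (map (\<lambda>i. \<beta> (c ! i, bs ! i, ys ! i)) [0..<length c])"
    using d(4)[OF x(1) co] m(6)[OF x(1) co] \<beta>[OF x(1)] \<beta>[OF P.gamma_operations[OF x(1) co]]
    by (simp add: x(2) yx[symmetric] del: map_eq_conv)
qed

context symmetric_monoidal_category
begin

text \<open>In the square of \<open>concat_iso_untail\<close> the other arrows are invertible, hence
  so is this one. It is needed to cancel \<open>concat_iso\<close> from the associativity axiom of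
  an algebra.\<close>

lemma concat_iso_iso:
  assumes "\<forall>xs \<in> set xss. \<forall>x \<in> set xs. x \<in> Ob M"
  shows "iso_arrow M (concat_iso M xss)" "Dom M (concat_iso M xss) = tens M (map (tens M) xss)"
    "Cod M (concat_iso M xss) = tens M (concat xss)"
proof -
  let ?Q = "tensA M (map untail xss) \<cdot> untail (map tens0 xss)"
  have c: "concat_iso M xss \<in> Ar M" "Dom M (concat_iso M xss) = tens M (map (tens M) xss)"
    "Cod M (concat_iso M xss) = tens M (concat xss)"
    using concat_iso_hom[of xss] assms by (auto simp: Hom_iff subset_iff)
  have tA: "tensA M (map untail xss) \<in> Ar M"
      "Dom M (tensA M (map untail xss)) = tens M (map tens0 xss)"
    "Cod M (tensA M (map untail xss)) = tens M (map (tens M) xss)"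
      "iso_arrow M (tensA M (map untail xss))"
    using assms by (auto intro!: arg_cong[where f = "tens M"] tensA_iso)
  have Q: "iso_arrow M ?Q" "Dom M ?Q = actl (map tens0 xss) I"
      "Cod M ?Q = tens M (map (tens M) xss)" "?Q \<in> Ar M"
    using tA assms by simp_all
  have u: "iso_arrow M (untail (concat xss) \<cdot> flat xss I)"
    "Dom M (untail (concat xss) \<cdot> flat xss I) = actl (map tens0 xss) I"
    using assms by simp_all
  have "concat_iso M xss = (concat_iso M xss \<cdot> ?Q) \<cdot> inverse_arrow M ?Q"
    using c Q by simp
  also have "\<dots> = (untail (concat xss) \<cdot> flat xss I) \<cdot> inverse_arrow M ?Q"
    by (simp only: concat_iso_untail[OF assms])
  finally have e: "concat_iso M xss = \<dots>" .
  show "iso_arrow M (concat_iso M xss)"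
    unfolding e by (rule iso_comp) (use Q u iso_inverse[OF Q(1)] in simp_all)
  show "Dom M (concat_iso M xss) = tens M (map (tens M) xss)"
    "Cod M (concat_iso M xss) = tens M (concat xss)" using c by auto
qed

text \<open>Having equal actions is itself a congruence. Closure under composition uses that
  \<open>concat_iso\<close> is epi, because the axiom determines the action of a composite only
  after it.\<close>

lemma algebra_cong:
  assumes P: "colored_operad P" and a: "is_operad_algebra P M (A, \<alpha>)"
    and R: "\<And>t c x y. (t, c, x, y) \<in> R \<Longrightarrow> \<alpha> (t, c, x) = \<alpha> (t, c, y)"
    and "operad_cong P R t c x y"
  shows "\<alpha> (t, c, x) = \<alpha> (t, c, y)"
  using assms(4)
proof (induction rule: operad_cong.induct)
  case (cong_base t c x y)
  then show ?case using R by blast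
next
  case (cong_act t c x y \<sigma>)
  then show ?case
    using is_operad_algebraD(3)[OF a] colored_operad.cong_operations[OF P cong_act.hyps(1)] by metis
next
  case (cong_gamma t c x y bs xs ys)
  interpret colored_operad P by (rule P)
  note xy = cong_operations[OF cong_gamma.hyps(1)] and xys = cong_operations[OF cong_gamma.hyps(5)]
  have co: "composable P c bs xs" "composable P c bs ys"
    using xys cong_gamma.hyps(2-4) by (auto simp: composable_def)
  have "map (\<lambda>i. \<alpha> (c ! i, bs ! i, xs ! i)) [0..<length c] =
      map (\<lambda>i. \<alpha> (c ! i, bs ! i, ys ! i)) [0..<length c]"
    using cong_gamma.IH(2) by simp
  then have eq: "\<alpha> (t, concat bs, Gamma P t c bs x xs) \<cdot> concat_iso M (map (map A) bs) =
      \<alpha> (t, concat bs, Gamma P t c bs y ys) \<cdot> concat_iso M (map (map A) bs)"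
    using is_operad_algebraD(4)[OF a _ co(1), of t x] is_operad_algebraD(4)[OF a _ co(2), of t y]
        xy cong_gamma.IH(1)
    by (simp del: map_eq_conv)
  have ob: "\<forall>xs \<in> set (map (map A) bs). \<forall>x \<in> set xs. x \<in> Ob M"
    using composable_colors[OF co(1)] is_operad_algebraD(1)[OF a] by auto
  have "concat (map (map A) bs) = map A (concat bs)" by (simp add: map_concat)
  then show ?case
    using iso_epi[OF concat_iso_iso(1)[OF ob] _ _ _ _ eq] concat_iso_iso(3)[OF ob]
      is_operad_algebraD(2)[OF a gamma_operations[OF _ co(1)], of t x]
      is_operad_algebraD(2)[OF a gamma_operations[OF _ co(2)], of t y] xy
    by (auto simp: Hom_iff)
qed auto

lemma tensA_comp:
  assumes "\<forall>i \<in> set ks. f i \<in> Ar M \<and> g i \<in> Ar M \<and> Dom M (g i) = Cod M (f i)"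
  shows "tensA M (map g ks) \<cdot> tensA M (map f ks) = tensA M (map (\<lambda>i. g i \<cdot> f i) ks)"
  using assms
proof (induction ks)
  case Nil
  then show ?case by simp
next
  case (Cons k ks)
  show ?case
  proof (cases "ks = []")
    case False
    have [simp]: "map (Dom M \<circ> g) ks = map (Cod M \<circ> f) ks" using Cons.prems by simp
    show ?thesis using Cons False by (simp add: tensA_Cons)
  qed simp
qed

lemma tensA_id:
  "\<forall>i \<in> set ks. A i \<in> Ob M \<Longrightarrow> tensA M (map (\<lambda>i. Ident M (A i)) ks) = Ident M (tens M (map A ks))"
proof (induction ks)
  case Nil
  then show ?case by simp
next
  case (Cons k ks)
  show ?case
  proof (cases "ks = []")
    case False
    have "tens M (map A ks) \<in> Ob M" using Cons.prems by (intro tens_ob_list) simp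
    then show ?thesis using Cons False by (simp add: tensA_Cons tens_Cons)
  qed simp
qed

end

lemma (in monoid_diagram) ev_unary:
  assumes "f \<in> Hom C x t"
  shows "ev t [x] (id, [f]) = fa f"
proof -
  note f = faD[OF assms]
  have op: "is_op t [x] id [f]" using assms f by (auto simp: is_op_def permutes_id)
  have "mu t \<cdot> (fa f \<otimes>\<^sub>1 eta t) = (mu t \<cdot> ((A t) \<triangleright> eta t)) \<cdot> (fa f \<otimes>\<^sub>1 Ident M I)"
    using f by simp
  also have "\<dots> = fa f \<cdot> runit M (A x)"
    unfolding monoidD(10)[OF mon[OF f(7)]] using f by (simp add: runit_natural)
  finally have eq: "ev t [x] (id, [f]) \<cdot> runit M (A x) = fa f \<cdot> runit M (A x)"
    using ev_id[OF op] by simp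
  show ?thesis
    using ev_ar[OF op] f by (intro iso_epi[OF _ _ _ _ _ eq]) simp_all
qed

lemma (in monoid_diagram) ev_nullary:
  assumes "t \<in> Ob C"
  shows "ev t [] (id, []) = eta t"
proof -
  have op: "is_op t [] id []" using assms by (auto simp: is_op_def permutes_id)
  show ?thesis using ev_id[OF op] ev_ar[OF op] by simp
qed

text \<open>The morphism \<phi> moves from the outside to the inputs: through the product because it
  is a morphism of monoids (\<open>evm_hom\<close>), past the arrows of the diagram by naturality,
  and past the permutation by \<open>srt_natural\<close>.\<close>

lemma (in symmetric_monoidal_category) ev_natural:
  assumes D: "monoid_diagram M C A mu eta fa" and E: "monoid_diagram M C B nu eps fb"
    and \<phi>: "\<And>c. c \<in> Ob C \<Longrightarrow> is_monoid_hom M (A c, mu c, eta c) (B c, nu c, eps c) (\<phi> c)"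
    and nat: "\<And>f. f \<in> Ar C \<Longrightarrow> \<phi> (Cod C f) \<cdot> fa f = fb f \<cdot> \<phi> (Dom C f)"
    and op: "(t, c, x) \<in> operations (cat_operad C)"
  shows "\<phi> t \<cdot> monoid_diagram.ev M A mu eta fa t c x =
      monoid_diagram.ev M B nu eps fb t c x \<cdot> tensA M (map \<phi> c)"
proof -
  interpret D: monoid_diagram M C A mu eta fa by (rule D)
  interpret E: monoid_diagram M C B nu eps fb by (rule E)
  obtain \<sigma> fs where x: "x = (\<sigma>, fs)" by (metis prod.collapse)
  have dop: "D.is_op t c \<sigma> fs" and eop: "E.is_op t c \<sigma> fs"
    using op unfolding x by (simp_all add: D.is_op_operations E.is_op_operations)
  note o = D.is_opD[OF dop]
  let ?n = "length c" and ?ks = "map \<sigma> [0..<length c]"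
  have \<phi>a: "\<phi> c \<in> Ar M" "Dom M (\<phi> c) = A c" "Cod M (\<phi> c) = B c" "\<phi> c \<cdot> mu c = nu c \<cdot> (\<phi> c \<otimes>\<^sub>1 \<phi> c)"
      "\<phi> c \<cdot> eta c = eps c"
    if "c \<in> Ob C" for c
    using \<phi>[OF that] by (simp_all add: is_monoid_hom_def Hom_iff)
  let ?X = "\<lambda>k. A (c ! inv \<sigma> k)" and ?Y = "\<lambda>k. B (c ! inv \<sigma> k)" and ?p = "\<lambda>k. \<phi> (c ! inv \<sigma> k)"
  let ?G = "\<lambda>k. fa (fs ! inv \<sigma> k)" and ?H = "\<lambda>k. fb (fs ! inv \<sigma> k)"
  have ks: "set ?ks = {..<?n}" using permutes_image[OF o(3)] by (simp add: atLeast0LessThan)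
  have srt: "sort ?ks = [0..<?n]" by (rule sort_perm[OF o(3)])
  have il: "inv \<sigma> k < ?n" if "k < ?n" for k using perm_less[OF permutes_inv[OF o(3)] that] .
  have co: "c ! i \<in> Ob C" if "i < ?n" for i using o(2) that by auto
  have pk: "?p k \<in> Ar M" "Dom M (?p k) = ?X k" "Cod M (?p k) = ?Y k" if "k < ?n" for k
    using \<phi>a[OF co[OF il[OF that]]] by simp_all
  have Gk: "?G k \<in> Ar M" "Dom M (?G k) = ?X k" "Cod M (?G k) = A t"
    "?H k \<in> Ar M" "Dom M (?H k) = ?Y k" "Cod M (?H k) = B t" if "k < ?n" for k
    using D.faD[OF o(5)[OF il[OF that]]] E.faD[OF o(5)[OF il[OF that]]] by simp_all
  have nk: "\<phi> t \<cdot> ?G k = ?H k \<cdot> ?p k" if "k < ?n" for k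
    using nat[of "fs ! inv \<sigma> k"] o(5)[OF il[OF that]] by (simp add: D.C.Hom_iff)
  have g: "\<forall>g \<in> set (map ?G [0..<?n]). g \<in> Ar M \<and> Cod M g = A t"
      "map (Dom M) (map ?G [0..<?n]) = map ?X [0..<?n]"
    and h: "\<forall>g \<in> set (map ?H [0..<?n]). g \<in> Ar M \<and> Cod M g = B t"
        "map (Dom M) (map ?H [0..<?n]) = map ?Y [0..<?n]"
    using Gk by auto
  have p: "\<forall>f \<in> set (map ?p [0..<?n]). f \<in> Ar M" "map (Dom M) (map ?p [0..<?n]) = map ?X [0..<?n]"
    "map (Cod M) (map ?p [0..<?n]) = map ?Y [0..<?n]"
    and pc: "\<forall>f \<in> set (map \<phi> c). f \<in> Ar M" "map (Dom M) (map \<phi> c) = map A c"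
        "map (Cod M) (map \<phi> c) = map B c"
    using pk \<phi>a o(2) by auto
  have Xo: "\<forall>k \<in> set ?ks. ?X k \<in> Ob M" and Yo: "\<forall>k \<in> set ?ks. ?Y k \<in> Ob M"
    unfolding ks using D.mon_ar(1)[OF co[OF il]] E.mon_ar(1)[OF co[OF il]] by auto
  have m: "map ?X ?ks = map A c" "map ?Y ?ks = map B c" "map ?p ?ks = map \<phi> c"
    using map_perm_nth[OF o(3), of c] by simp_all
  note eg = evm_ar[OF g(1), of "eta t" "mu t", unfolded g(2)] and eh = evm_ar[OF h(1), of "eps t"
      "nu t", unfolded h(2)]
  note sX = srt_ar[OF Xo ob_simps(1), unfolded m srt]
      and sY = srt_ar[OF Yo ob_simps(1), unfolded m srt]
  note ap = actA_ar[OF p(1) id_ar(1)[OF ob_simps(1)], unfolded p]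
      and apc = actA_ar[OF pc(1) id_ar(1)[OF ob_simps(1)], unfolded pc]
  note tp = tensA_ar[OF pc(1), unfolded pc]
  note idI = id_ar[OF ob_simps(1)]
  note uA = untail_ar[OF D.is_opD(6)[OF dop]] and uB = untail_ar[OF E.is_opD(6)[OF eop]]
  note eA = D.ev_ar[OF dop] and eB = E.ev_ar[OF eop]
  have wD: "D.word ?X ?G t ?ks = evm (mu t) (map ?G [0..<?n]) (eta t) \<cdot> srt ?X ?ks I"
    and wE: "E.word ?Y ?H t ?ks = evm (nu t) (map ?H [0..<?n]) (eps t) \<cdot> srt ?Y ?ks I"
    unfolding D.word_def E.word_def srt by simp_all
  have "(\<phi> t \<cdot> D.ev t c (\<sigma>, fs)) \<cdot> untail (map A c) = \<phi> t \<cdot> (D.ev t c (\<sigma>, fs) \<cdot> untail (map A c))"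
    by (rule comp_assoc_ar) (use eA uA \<phi>a[OF o(1)] in simp_all)
  also have "\<dots> = (\<phi> t \<cdot> evm (mu t) (map ?G [0..<?n]) (eta t)) \<cdot> srt ?X ?ks I"
    unfolding D.ev_untail[OF dop] wD
    by (rule comp_assoc_ar[symmetric]) (use eg sX \<phi>a[OF o(1)] o(1) in simp_all)
  also have "\<phi> t \<cdot> evm (mu t) (map ?G [0..<?n]) (eta t) =
      evm (nu t) (map (\<lambda>g. \<phi> t \<cdot> g) (map ?G [0..<?n])) (\<phi> t \<cdot> eta t)"
    by (rule evm_hom[OF D.mon[OF o(1)] E.mon[OF o(1)] \<phi>a(1-4)[OF o(1)] g(1)]) (use o(1) in simp_all)
  also have "\<dots> = evm (nu t) (map (\<lambda>k. ?H k \<cdot> ?p k) [0..<?n]) (eps t \<cdot> Ident M I)"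
  proof -
    have "map (\<lambda>g. \<phi> t \<cdot> g) (map ?G [0..<?n]) = map (\<lambda>k. ?H k \<cdot> ?p k) [0..<?n]" using nk by simp
    then show ?thesis using \<phi>a(5)[OF o(1)] o(1) by (simp del: map_eq_conv list.map_comp map_map)
  qed
  also have "\<dots> = evm (nu t) (map ?H [0..<?n]) (eps t) \<cdot> actA (map ?p [0..<?n]) (Ident M I)"
    using pk Gk o(1) by (intro evm_actA[symmetric]) auto
  also have "\<dots> \<cdot> srt ?X ?ks I = evm (nu t) (map ?H [0..<?n]) (eps t) \<cdot>
      (actA (map ?p [0..<?n]) (Ident M I) \<cdot> srt ?X ?ks I)"
    by (rule comp_assoc_ar) (use eh ap sX idI o(1) in simp_all)
  also have "actA (map ?p [0..<?n]) (Ident M I) \<cdot> srt ?X ?ks I =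
      srt ?Y ?ks I \<cdot> actA (map \<phi> c) (Ident M I)"
  proof -
    have "\<forall>j \<in> set ?ks. ?p j \<in> Ar M \<and> Dom M (?p j) = ?X j \<and> Cod M (?p j) = ?Y j"
      unfolding ks using pk by simp
    from srt_natural[OF ob_simps(1) this] show ?thesis unfolding srt m(3) .
  qed
  also have "evm (nu t) (map ?H [0..<?n]) (eps t) \<cdot> (srt ?Y ?ks I \<cdot> actA (map \<phi> c) (Ident M I)) =
      (E.ev t c (\<sigma>, fs) \<cdot> untail (map B c)) \<cdot> actA (map \<phi> c) (Ident M I)"
    unfolding E.ev_untail[OF eop] wE
    by (rule comp_assoc_ar[symmetric]) (use eh sY apc idI o(1) in simp_all)
  also have "\<dots> = E.ev t c (\<sigma>, fs) \<cdot> (untail (map B c) \<cdot> actA (map \<phi> c) (Ident M I))"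
    by (rule comp_assoc_ar) (use eB uB apc idI in simp_all)
  also have "\<dots> = (E.ev t c (\<sigma>, fs) \<cdot> tensA M (map \<phi> c)) \<cdot> untail (map A c)"
    unfolding untail_natural[OF pc(1), unfolded pc, symmetric]
    by (rule comp_assoc_ar[symmetric]) (use eB uA tp in simp_all)
  finally have eq: "(\<phi> t \<cdot> D.ev t c (\<sigma>, fs)) \<cdot> untail (map A c) = \<dots>" .
  show ?thesis
    unfolding x by (rule iso_epi[OF _ _ _ _ _ eq]) (use eA eB tp uA \<phi>a[OF o(1)] in simp_all)
qed

section \<open>Functors, monoids and algebras as categories\<close>

section \<open>The categories of algebras and of functors\<close>

text \<open>The inverse functions are functorial automatically: F preserves identities, composites,
  sources and targets, and injectivity reflects the resulting equations.\<close>

lemma is_category_isomorphismI: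
  assumes F: "is_functor C D F" and ob: "bij_betw (fst F) (Ob C) (Ob D)" and ar:
      "bij_betw (snd F) (Ar C) (Ar D)"
  shows "is_category_isomorphism C D F"
proof -
  interpret C: category C using F by (simp add: is_functor_def)
  interpret D: category D using F by (simp add: is_functor_def)
  define g h where "g = inv_into (Ob C) (fst F)" and "h = inv_into (Ar C) (snd F)"
  have Fo: "fst F x \<in> Ob D" if "x \<in> Ob C" for x using F that by (simp add: is_functor_def)
  have Fa: "snd F f \<in> Ar D" "Dom D (snd F f) = fst F (Dom C f)" "Cod D (snd F f) = fst F (Cod C f)"
    if "f \<in> Ar C" for f using F that by (auto simp: is_functor_def D.Hom_iff)
  have Fi: "snd F (Ident C x) = Ident D (fst F x)" if "x \<in> Ob C" for x using F that by
      (simp add: is_functor_def)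
  have Fc: "snd F (k \<cdot>\<^bsub>C\<^esub> f) = snd F k \<cdot>\<^bsub>D\<^esub> snd F f" if "f \<in> Ar C" "k \<in> Ar C" "Dom C k = Cod C f"
      for f k
    using F that by (simp add: is_functor_def)
  have g: "g (fst F x) = x" if "x \<in> Ob C" for x
    using ob that by (simp add: g_def bij_betw_inv_into_left)
  have h: "h (snd F f) = f" if "f \<in> Ar C" for f
    using ar that by (simp add: h_def bij_betw_inv_into_left)
  have g': "g y \<in> Ob C" "fst F (g y) = y" if "y \<in> Ob D" for y
    using ob that by (auto simp: g_def bij_betw_inv_into_right bij_betw_def inv_into_into)
  have h': "h k \<in> Ar C" "snd F (h k) = k" if "k \<in> Ar D" for k
    using ar that by (auto simp: h_def bij_betw_inv_into_right bij_betw_def inv_into_into)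
  have hd: "Dom C (h k) = g (Dom D k)" "Cod C (h k) = g (Cod D k)" if "k \<in> Ar D" for k
    using Fa[OF h'(1)[OF that]] h'[OF that] g by auto
  have "is_functor D C (g, h)"
    unfolding is_functor_def fst_conv snd_conv
  proof (intro conjI ballI impI)
    show "h k \<in> Hom C (g (Dom D k)) (g (Cod D k))" if "k \<in> Ar D" for k
      using h' hd that by (simp add: C.Hom_iff)
    show "h (Ident D x) = Ident C (g x)" if "x \<in> Ob D" for x
      using Fi[OF g'(1)[OF that]] h[of "Ident C (g x)"] g'[OF that] by simp
    show "h (k' \<cdot>\<^bsub>D\<^esub> k) = h k' \<cdot>\<^bsub>C\<^esub> h k" if "k \<in> Ar D" "k' \<in> Ar D" "Dom D k' = Cod D k" for k k'
    proof -
      have d: "Dom C (h k') = Cod C (h k)" using hd that by simp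
      have "k' \<cdot>\<^bsub>D\<^esub> k = snd F (h k' \<cdot>\<^bsub>C\<^esub> h k)"
        using Fc[OF h'(1)[OF that(1)] h'(1)[OF that(2)] d] h'(2) that by simp
      then show ?thesis using h[of "h k' \<cdot>\<^bsub>C\<^esub> h k"] h'(1) that d by simp
    qed
  qed (use g' C.category_axioms D.category_axioms in auto)
  then show ?thesis
    unfolding is_category_isomorphism_def using F g h g' h' by (intro conjI exI[of _ "(g, h)"]) auto
qed

lemma functor_cat_simps:
  "Ob (functor_cat C D) = {F. is_functor C D F \<and> fst F \<in> extensional (Ob C) \<and>
    snd F \<in> extensional (Ar C)}"
  "(F, G, \<eta>) \<in> Ar (functor_cat C D) \<longleftrightarrow> F \<in> Ob (functor_cat C D) \<and> G \<in> Ob (functor_cat C D) \<and>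
     \<eta> \<in> extensional (Ob C) \<and> is_natural C D F G \<eta>"
  "Dom (functor_cat C D) (F, G, \<eta>) = F"
  "Cod (functor_cat C D) (F, G, \<eta>) = G"
  "Ident (functor_cat C D) F = (F, F, \<lambda>x \<in> Ob C. Ident D (fst F x))"
  "(F', G', \<theta>) \<cdot>\<^bsub>functor_cat C D\<^esub> (F, G, \<eta>) = (F, G', \<lambda>x \<in> Ob C. \<theta> x \<cdot>\<^bsub>D\<^esub> \<eta> x)"
  by (simp_all add: functor_cat_def Let_def)

lemma is_natural_comp:
  assumes F: "is_functor C D F" "is_functor C D G" "is_functor C D H" and n: "is_natural C D F G \<eta>"
      "is_natural C D G H \<theta>"
  shows "is_natural C D F H (\<lambda>x \<in> Ob C. \<theta> x \<cdot>\<^bsub>D\<^esub> \<eta> x)"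
proof -
  interpret C: category C using F(1) by (simp add: is_functor_def)
  interpret D: category D using F(1) by (simp add: is_functor_def)
  have e: "\<eta> x \<in> Ar D" "Dom D (\<eta> x) = fst F x" "Cod D (\<eta> x) = fst G x"
    "\<theta> x \<in> Ar D" "Dom D (\<theta> x) = fst G x" "Cod D (\<theta> x) = fst H x" if "x \<in> Ob C" for x
    using n that by (auto simp: is_natural_def D.Hom_iff)
  have a: "snd K f \<in> Ar D" "Dom D (snd K f) = fst K (Dom C f)" "Cod D (snd K f) = fst K (Cod C f)"
    if "f \<in> Ar C" "is_functor C D K" for f K
    using that by (auto simp: is_functor_def D.Hom_iff)
  have nat: "\<eta> (Cod C f) \<cdot>\<^bsub>D\<^esub> snd F f = snd G f \<cdot>\<^bsub>D\<^esub> \<eta> (Dom C f)"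
    "\<theta> (Cod C f) \<cdot>\<^bsub>D\<^esub> snd G f = snd H f \<cdot>\<^bsub>D\<^esub> \<theta> (Dom C f)" if "f \<in> Ar C" for f
    using n that by (auto simp: is_natural_def)
  have "(\<theta> (Cod C f) \<cdot>\<^bsub>D\<^esub> \<eta> (Cod C f)) \<cdot>\<^bsub>D\<^esub> snd F f = snd H f \<cdot>\<^bsub>D\<^esub> (\<theta> (Dom C f) \<cdot>\<^bsub>D\<^esub> \<eta> (Dom C f))"
      if f: "f \<in> Ar C" for f
  proof -
    have "(\<theta> (Cod C f) \<cdot>\<^bsub>D\<^esub> \<eta> (Cod C f)) \<cdot>\<^bsub>D\<^esub> snd F f = \<theta> (Cod C f) \<cdot>\<^bsub>D\<^esub> (snd G f \<cdot>\<^bsub>D\<^esub> \<eta> (Dom C f))"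
      using e[of "Cod C f"] a[OF f F(1)] f nat(1)[OF f] by simp
    also have "\<dots> = (snd H f \<cdot>\<^bsub>D\<^esub> \<theta> (Dom C f)) \<cdot>\<^bsub>D\<^esub> \<eta> (Dom C f)"
      by (rule D.comp_reassoc[OF nat(2)[OF f]]) (use e[of "Cod C f"] e[of
          "Dom C f"] a[OF f F(2)] f in simp_all)
    also have "\<dots> = snd H f \<cdot>\<^bsub>D\<^esub> (\<theta> (Dom C f) \<cdot>\<^bsub>D\<^esub> \<eta> (Dom C f))"
      by (rule D.comp_assoc_ar) (use e[of "Dom C f"] a[OF f F(3)] f in simp_all)
    finally show ?thesis .
  qed
  then show ?thesis using e by (auto simp: is_natural_def D.Hom_iff)
qed

lemma functor_cat_category:
  assumes C: "category C" and D: "category D"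
  shows "category (functor_cat C D)"
proof -
  interpret C: category C by (rule C)
  interpret D: category D by (rule D)
  have H: "h \<in> Hom (functor_cat C D) F G \<longleftrightarrow> (\<exists>\<eta>. h = (F, G, \<eta>) \<and> (F, G, \<eta>) \<in> Ar (functor_cat C D))"
      for h F G
    by (cases h) (auto simp: Hom_def functor_cat_simps)
  have e: "\<eta> x \<in> Ar D" "Dom D (\<eta> x) = fst F x" "Cod D (\<eta> x) = fst G x"
    if "(F, G, \<eta>) \<in> Ar (functor_cat C D)" "x \<in> Ob C" for F G \<eta> x
    using that by (auto simp: functor_cat_simps is_natural_def D.Hom_iff)
  have f: "fst F x \<in> Ob D" if "F \<in> Ob (functor_cat C D)" "x \<in> Ob C" for F x
    using that by (simp add: functor_cat_simps is_functor_def)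
  have ext: "\<eta> \<in> extensional (Ob C)" if "(F, G, \<eta>) \<in> Ar (functor_cat C D)" for F G \<eta>
    using that by (simp add: functor_cat_simps)
  show ?thesis
  proof
    show "Dom (functor_cat C D) h \<in> Ob (functor_cat C D)"
        "Cod (functor_cat C D) h \<in> Ob (functor_cat C D)"
      if "h \<in> Ar (functor_cat C D)" for h
      using that by (cases h; simp add: functor_cat_simps)+
    show "Ident (functor_cat C D) F \<in> Hom (functor_cat C D) F F" if F: "F \<in> Ob (functor_cat C D)"
        for F
    proof -
      have "is_functor C D F" using F by (simp add: functor_cat_simps)
      then have "is_natural C D F F (\<lambda>x \<in> Ob C. Ident D (fst F x))"
        by (auto simp: is_natural_def is_functor_def D.Hom_iff)
      then show ?thesis using F unfolding H by (simp add: functor_cat_simps)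
    qed
    show "k \<cdot>\<^bsub>functor_cat C D\<^esub> h \<in> Hom (functor_cat C D) x z"
      if "h \<in> Hom (functor_cat C D) x y" "k \<in> Hom (functor_cat C D) y z" for h k x y z
      using that unfolding H by (auto simp: functor_cat_simps intro: is_natural_comp)
    show "h \<cdot>\<^bsub>functor_cat C D\<^esub> Ident (functor_cat C D) F = h"
        "Ident (functor_cat C D) G \<cdot>\<^bsub>functor_cat C D\<^esub> h = h"
      if h: "h \<in> Hom (functor_cat C D) F G" for h F G
    proof -
      obtain \<eta> where \<eta>: "h = (F, G, \<eta>)" "(F, G, \<eta>) \<in> Ar (functor_cat C D)" using h unfolding H
          by blast
      show "h \<cdot>\<^bsub>functor_cat C D\<^esub> Ident (functor_cat C D) F = h"
          "Ident (functor_cat C D) G \<cdot>\<^bsub>functor_cat C D\<^esub> h = h"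
        using e[OF \<eta>(2)] ext[OF \<eta>(2)]
        by (auto simp: \<eta>(1) functor_cat_simps(3-6) fun_eq_iff restrict_def extensional_def)
    qed
    show "(l \<cdot>\<^bsub>functor_cat C D\<^esub> k) \<cdot>\<^bsub>functor_cat C D\<^esub> h =
        l \<cdot>\<^bsub>functor_cat C D\<^esub> (k \<cdot>\<^bsub>functor_cat C D\<^esub> h)"
      if hkl: "h \<in> Hom (functor_cat C D) w x" "k \<in> Hom (functor_cat C D) x y"
          "l \<in> Hom (functor_cat C D) y z" for h k l w x y z
    proof -
      obtain \<eta> \<theta> \<kappa> where n: "h = (w, x, \<eta>)" "(w, x, \<eta>) \<in> Ar (functor_cat C D)" "k = (x, y, \<theta>)"
        "(x, y, \<theta>) \<in> Ar (functor_cat C D)" "l = (y, z, \<kappa>)" "(y, z, \<kappa>) \<in> Ar (functor_cat C D)"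
        using hkl unfolding H by blast
      show ?thesis
        using e[OF n(2)] e[OF n(4)] e[OF n(6)]
        by (auto simp: n(1,3,5) functor_cat_simps(3-6) fun_eq_iff restrict_def)
    qed
  qed
qed

lemma full_subcat_simps:
  "Ob (full_subcat C S) = Ob C \<inter> S"
  "Ar (full_subcat C S) = {f \<in> Ar C. Dom C f \<in> S \<and> Cod C f \<in> S}"
  "Dom (full_subcat C S) = Dom C" "Cod (full_subcat C S) = Cod C"
  "Ident (full_subcat C S) = Ident C" "Comp (full_subcat C S) = Comp C"
  by (simp_all add: full_subcat_def)

lemma full_subcat_category:
  assumes "category C"
  shows "category (full_subcat C S)"
proof -
  interpret category C by (rule assms)
  show ?thesis
    by unfold_locales (auto simp: full_subcat_simps Hom_def)
qed

lemma operad_alg_cat_simps: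
  "Ob (operad_alg_cat P M) = {(A, \<alpha>). is_operad_algebra P M (A, \<alpha>) \<and>
                   A \<in> extensional (Colors P) \<and> \<alpha> \<in> extensional (operations P)}"
  "(X, Y, \<phi>) \<in> Ar (operad_alg_cat P M) \<longleftrightarrow> X \<in> Ob (operad_alg_cat P M) \<and> Y \<in> Ob (operad_alg_cat P M) \<and>
     \<phi> \<in> extensional (Colors P) \<and> is_algebra_hom P M X Y \<phi>"
  "Dom (operad_alg_cat P M) (X, Y, \<phi>) = X"
  "Cod (operad_alg_cat P M) (X, Y, \<phi>) = Y"
  "Ident (operad_alg_cat P M) X = (X, X, \<lambda>t \<in> Colors P. Ident M (fst X t))"
  "(Y', Z, \<psi>) \<cdot>\<^bsub>operad_alg_cat P M\<^esub> (X, Y, \<phi>) = (X, Z, \<lambda>t \<in> Colors P. \<psi> t \<cdot>\<^bsub>M\<^esub> \<phi> t)"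
  by (auto simp add: operad_alg_cat_def Let_def)

lemma monoid_cat_simps:
  "Ob (monoid_cat M) = {X. is_monoid M X}"
  "(X, Y, f) \<in> Ar (monoid_cat M) \<longleftrightarrow> is_monoid M X \<and> is_monoid M Y \<and> is_monoid_hom M X Y f"
  "Dom (monoid_cat M) (X, Y, f) = X"
  "Cod (monoid_cat M) (X, Y, f) = Y"
  "Ident (monoid_cat M) X = (X, X, Ident M (fst X))"
  "(Y', Z, g) \<cdot>\<^bsub>monoid_cat M\<^esub> (X, Y, f) = (X, Z, g \<cdot>\<^bsub>M\<^esub> f)"
  by (simp_all add: monoid_cat_def)

lemma Hom_monoid_cat:
  "h \<in> Hom (monoid_cat M) X Y \<longleftrightarrow>
    (\<exists>f. h = (X, Y, f) \<and> is_monoid M X \<and> is_monoid M Y \<and> is_monoid_hom M X Y f)"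
  by (cases h) (auto simp: Hom_def monoid_cat_simps)

context symmetric_monoidal_category
begin

lemma monoid_homD:
  assumes "is_monoid_hom M (a, mu, eta) (a', mu', eta') f"
  shows "f \<in> Ar M" "Dom M f = a" "Cod M f = a'" "f \<cdot> mu = mu' \<cdot> (f \<otimes>\<^sub>1 f)" "f \<cdot> eta = eta'"
  using assms by (auto simp: is_monoid_hom_def Hom_iff)

lemma monoid_hom_id:
  assumes "is_monoid M (a, mu, eta)"
  shows "is_monoid_hom M (a, mu, eta) (a, mu, eta) (Ident M a)"
  using monoidD[OF assms] by (simp add: is_monoid_hom_def Hom_iff)

lemma monoid_hom_comp:
  assumes m: "is_monoid M X" "is_monoid M Y" "is_monoid M Z"
    and f: "is_monoid_hom M X Y f" and g: "is_monoid_hom M Y Z g"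
  shows "is_monoid_hom M X Z (g \<cdot> f)"
proof -
  obtain a mu eta b nu eps c xi th where X: "X = (a, mu, eta)" "Y = (b, nu, eps)" "Z = (c, xi, th)"
    by (metis prod.collapse)
  note mx = monoidD[OF m(1)[unfolded X]] and my = monoidD[OF m(2)[unfolded X]]
      and mz = monoidD[OF m(3)[unfolded X]]
  note fd = monoid_homD[OF f[unfolded X]] and gd = monoid_homD[OF g[unfolded X]]
  have "(g \<cdot> f) \<cdot> mu = g \<cdot> (f \<cdot> mu)" using fd(1-3) gd(1-3) mx(1-7) by simp
  also have "\<dots> = (g \<cdot> nu) \<cdot> (f \<otimes>\<^sub>1 f)" unfolding fd(4) using fd(1-3) gd(1-3) my(1-7) by simp
  also have "\<dots> = xi \<cdot> ((g \<cdot> f) \<otimes>\<^sub>1 (g \<cdot> f))" unfolding gd(4) using fd(1-3) gd(1-3) mz(1-7) by simp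
  finally have 1: "(g \<cdot> f) \<cdot> mu = \<dots>" .
  have "(g \<cdot> f) \<cdot> eta = g \<cdot> (f \<cdot> eta)" using fd(1-3) gd(1-3) mx(1-7) by simp
  then have "(g \<cdot> f) \<cdot> eta = th" by (simp add: fd(5) gd(5))
  then show ?thesis using 1 fd(1-3) gd(1-3) by (simp add: X is_monoid_hom_def Hom_iff)
qed

lemma monoid_cat_category: "category (monoid_cat M)"
proof
  show "Dom (monoid_cat M) h \<in> Ob (monoid_cat M)" "Cod (monoid_cat M) h \<in> Ob (monoid_cat M)"
    if "h \<in> Ar (monoid_cat M)" for h
    using that by (cases h; simp add: monoid_cat_simps)+
  show "Ident (monoid_cat M) X \<in> Hom (monoid_cat M) X X" if "X \<in> Ob (monoid_cat M)" for X
    using that monoid_hom_id by (cases X) (simp add: Hom_monoid_cat monoid_cat_simps)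
  show "k \<cdot>\<^bsub>monoid_cat M\<^esub> h \<in> Hom (monoid_cat M) x z"
    if "h \<in> Hom (monoid_cat M) x y" "k \<in> Hom (monoid_cat M) y z" for h k x y z
    using that monoid_hom_comp[of x y z] by (auto simp: Hom_monoid_cat monoid_cat_simps)
  have d: "f \<in> Ar M" "Dom M f = fst X" "Cod M f = fst Y" if "is_monoid_hom M X Y f" for X Y f
    using that by (auto simp: is_monoid_hom_def Hom_iff split: prod.splits)
  show "h \<cdot>\<^bsub>monoid_cat M\<^esub> Ident (monoid_cat M) X = h" "Ident (monoid_cat M) Y \<cdot>\<^bsub>monoid_cat M\<^esub> h = h"
    if h: "h \<in> Hom (monoid_cat M) X Y" for h X Y
  proof -
    obtain f where f: "h = (X, Y, f)" "is_monoid_hom M X Y f" using h unfolding Hom_monoid_cat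
        by blast
    show "h \<cdot>\<^bsub>monoid_cat M\<^esub> Ident (monoid_cat M) X = h"
        "Ident (monoid_cat M) Y \<cdot>\<^bsub>monoid_cat M\<^esub> h = h"
      using d[OF f(2)] by (simp_all add: f(1) monoid_cat_simps)
  qed
  show "(l \<cdot>\<^bsub>monoid_cat M\<^esub> k) \<cdot>\<^bsub>monoid_cat M\<^esub> h = l \<cdot>\<^bsub>monoid_cat M\<^esub> (k \<cdot>\<^bsub>monoid_cat M\<^esub> h)"
    if hkl: "h \<in> Hom (monoid_cat M) w x" "k \<in> Hom (monoid_cat M) x y" "l \<in> Hom (monoid_cat M) y z"
        for h k l w x y z
  proof -
    obtain f g f' where n: "h = (w, x, f)" "is_monoid_hom M w x f" "k = (x, y, g)"
        "is_monoid_hom M x y g"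
      "l = (y, z, f')" "is_monoid_hom M y z f'"
      using hkl unfolding Hom_monoid_cat by blast
    show ?thesis
      using d[OF n(2)] d[OF n(4)] d[OF n(6)] by (simp add: n(1,3,5) monoid_cat_simps)
  qed
qed

lemma algebra_hom_id:
  assumes "is_operad_algebra P M (A, \<alpha>)"
  shows "is_algebra_hom P M (A, \<alpha>) (A, \<alpha>) (\<lambda>t \<in> Colors P. Ident M (A t))"
proof -
  note d = is_operad_algebraD[OF assms]
  have "tensA M (map (\<lambda>t \<in> Colors P. Ident M (A t)) c) = Ident M (tens M (map A c))"
    if "(t, c, x) \<in> operations P" for t c x
  proof -
    have c: "set c \<subseteq> Colors P" using that by (simp add: operations_def)
    then have "map (\<lambda>t \<in> Colors P. Ident M (A t)) c = map (\<lambda>t. Ident M (A t)) c" by auto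
    then show ?thesis using tensA_id[of c A] d(1) c by (auto simp del: map_eq_conv)
  qed
  then show ?thesis
    using d(1,2) by (auto simp: is_algebra_hom_def operations_def Hom_iff)
qed

lemma algebra_hom_comp:
  assumes a: "is_operad_algebra P M (A, \<alpha>)" "is_operad_algebra P M (B, \<beta>)"
      "is_operad_algebra P M (D, \<delta>)"
    and f: "is_algebra_hom P M (A, \<alpha>) (B, \<beta>) \<phi>" and g: "is_algebra_hom P M (B, \<beta>) (D, \<delta>) \<psi>"
  shows "is_algebra_hom P M (A, \<alpha>) (D, \<delta>) (\<lambda>t \<in> Colors P. \<psi> t \<cdot> \<phi> t)"
  unfolding is_algebra_hom_def prod.case
proof (intro conjI ballI)
  have fa: "\<phi> t \<in> Ar M" "Dom M (\<phi> t) = A t" "Cod M (\<phi> t) = B t"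
    "\<psi> t \<in> Ar M" "Dom M (\<psi> t) = B t" "Cod M (\<psi> t) = D t" if "t \<in> Colors P" for t
    using f g that by (auto simp: is_algebra_hom_def Hom_iff)
  show "(\<lambda>t \<in> Colors P. \<psi> t \<cdot> \<phi> t) t \<in> Hom M (A t) (D t)" if "t \<in> Colors P" for t
    using fa[OF that] that by (simp add: Hom_iff)
  fix p assume p: "p \<in> operations P"
  obtain t c x where px: "p = (t, c, x)" by (metis prod.collapse)
  have t: "t \<in> Colors P" "set c \<subseteq> Colors P" using p by (auto simp: px operations_def)
  have al: "\<alpha> p \<in> Ar M" "Dom M (\<alpha> p) = tens M (map A c)" "Cod M (\<alpha> p) = A t"
    "\<beta> p \<in> Ar M" "Dom M (\<beta> p) = tens M (map B c)" "Cod M (\<beta> p) = B t"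
    "\<delta> p \<in> Ar M" "Dom M (\<delta> p) = tens M (map D c)" "Cod M (\<delta> p) = D t"
    using is_operad_algebraD(2)[OF a(1)] is_operad_algebraD(2)[OF a(2)] is_operad_algebraD(2)[OF
        a(3)] p
    by (auto simp: px Hom_iff)
  have e: "\<phi> t \<cdot> \<alpha> p = \<beta> p \<cdot> tensA M (map \<phi> c)" "\<psi> t \<cdot> \<beta> p = \<delta> p \<cdot> tensA M (map \<psi> c)"
    using f g p by (auto simp: px is_algebra_hom_def)
  have l: "\<forall>h \<in> set (map \<phi> c). h \<in> Ar M" "map (Dom M) (map \<phi> c) = map A c"
      "map (Cod M) (map \<phi> c) = map B c"
    "\<forall>h \<in> set (map \<psi> c). h \<in> Ar M" "map (Dom M) (map \<psi> c) = map B c"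
      "map (Cod M) (map \<psi> c) = map D c"
    using fa t(2) by auto
  note t1 = tensA_ar[OF l(1), unfolded l] and t2 = tensA_ar[OF l(4), unfolded l]
  have "(\<psi> t \<cdot> \<phi> t) \<cdot> \<alpha> p = \<psi> t \<cdot> (\<beta> p \<cdot> tensA M (map \<phi> c))"
    unfolding e(1)[symmetric] by (rule comp_assoc_ar) (use fa[OF t(1)] al in simp_all)
  also have "\<dots> = (\<delta> p \<cdot> tensA M (map \<psi> c)) \<cdot> tensA M (map \<phi> c)"
    by (rule comp_reassoc[OF e(2)]) (use fa[OF t(1)] al t1 in simp_all)
  also have "\<dots> = \<delta> p \<cdot> (tensA M (map \<psi> c) \<cdot> tensA M (map \<phi> c))"
    by (rule comp_assoc_ar) (use al t1 t2 in simp_all)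
  also have "tensA M (map \<psi> c) \<cdot> tensA M (map \<phi> c) = tensA M (map (\<lambda>t. \<psi> t \<cdot> \<phi> t) c)"
    using fa t(2) by (intro tensA_comp) auto
  also have "map (\<lambda>t. \<psi> t \<cdot> \<phi> t) c = map (\<lambda>t \<in> Colors P. \<psi> t \<cdot> \<phi> t) c" using t(2) by auto
  finally show "case p of (t, c, x) \<Rightarrow> (\<lambda>t \<in> Colors P. \<psi> t \<cdot> \<phi> t) t \<cdot> \<alpha> (t, c, x) =
      \<delta> (t, c, x) \<cdot> tensA M (map (\<lambda>t \<in> Colors P. \<psi> t \<cdot> \<phi> t) c)"
    using t(1) by (simp add: px)
qed

lemma operad_alg_cat_category: "category (operad_alg_cat P M)"
proof -
  let ?K = "operad_alg_cat P M"
  have H: "h \<in> Hom ?K X Y \<longleftrightarrow> (\<exists>\<phi>. h = (X, Y, \<phi>) \<and> (X, Y, \<phi>) \<in> Ar ?K)" for h X Y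
    by (cases h) (auto simp: Hom_def operad_alg_cat_simps(2-))
  have o: "is_operad_algebra P M X" if "X \<in> Ob ?K" for X
    using that by (cases X) (auto simp: operad_alg_cat_simps)
  have e: "\<phi> t \<in> Ar M" "Dom M (\<phi> t) = fst X t" "Cod M (\<phi> t) = fst Y t"
    if "(X, Y, \<phi>) \<in> Ar ?K" "t \<in> Colors P" for X Y \<phi> t
    using that by (auto simp: operad_alg_cat_simps is_algebra_hom_def Hom_iff split: prod.splits)
  have ext: "\<phi> \<in> extensional (Colors P)" if "(X, Y, \<phi>) \<in> Ar ?K" for X Y \<phi>
    using that by (simp add: operad_alg_cat_simps(2))
  show ?thesis
  proof
    show "Dom ?K h \<in> Ob ?K" "Cod ?K h \<in> Ob ?K" if "h \<in> Ar ?K" for h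
      using that by (cases h; simp add: operad_alg_cat_simps(2-))+
    show "Ident ?K X \<in> Hom ?K X X" if "X \<in> Ob ?K" for X
    proof (cases X)
      case (Pair A \<alpha>)
      then show ?thesis
        using that algebra_hom_id[of P A \<alpha>] o[OF that] unfolding H by
            (simp add: operad_alg_cat_simps(2-))
    qed
    show "k \<cdot>\<^bsub>?K\<^esub> h \<in> Hom ?K x z" if h: "h \<in> Hom ?K x y" "k \<in> Hom ?K y z" for h k x y z
    proof -
      obtain A \<alpha> B \<beta> D \<delta> where x: "x = (A, \<alpha>)" "y = (B, \<beta>)" "z = (D, \<delta>)" by (metis prod.collapse)
      obtain \<phi> \<psi> where hk: "h = (x, y, \<phi>)" "k = (y, z, \<psi>)" "(x, y, \<phi>) \<in> Ar ?K" "(y, z, \<psi>) \<in> Ar ?K"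
        using h unfolding H by blast
      note ob = hk(3,4)[unfolded operad_alg_cat_simps(2)]
      have "is_algebra_hom P M x z (\<lambda>t \<in> Colors P. \<psi> t \<cdot> \<phi> t)"
        unfolding x by (rule algebra_hom_comp[of P A \<alpha> B \<beta>]) (use ob o x in auto)
      then show ?thesis using ob unfolding H by (simp add: hk operad_alg_cat_simps(2-))
    qed
    show "h \<cdot>\<^bsub>?K\<^esub> Ident ?K X = h" "Ident ?K Y \<cdot>\<^bsub>?K\<^esub> h = h" if h: "h \<in> Hom ?K X Y" for h X Y
    proof -
      obtain \<phi> where \<phi>: "h = (X, Y, \<phi>)" "(X, Y, \<phi>) \<in> Ar ?K" using h unfolding H by blast
      show "h \<cdot>\<^bsub>?K\<^esub> Ident ?K X = h" "Ident ?K Y \<cdot>\<^bsub>?K\<^esub> h = h"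
        using e[OF \<phi>(2)] ext[OF \<phi>(2)]
        by (auto simp: \<phi>(1) operad_alg_cat_simps(3-) fun_eq_iff restrict_def extensional_def)
    qed
    show "(l \<cdot>\<^bsub>?K\<^esub> k) \<cdot>\<^bsub>?K\<^esub> h = l \<cdot>\<^bsub>?K\<^esub> (k \<cdot>\<^bsub>?K\<^esub> h)"
      if hkl: "h \<in> Hom ?K w x" "k \<in> Hom ?K x y" "l \<in> Hom ?K y z" for h k l w x y z
    proof -
      obtain \<phi> \<psi> \<chi> where n: "h = (w, x, \<phi>)" "(w, x, \<phi>) \<in> Ar ?K" "k = (x, y, \<psi>)"
        "(x, y, \<psi>) \<in> Ar ?K" "l = (y, z, \<chi>)" "(y, z, \<chi>) \<in> Ar ?K"
        using hkl unfolding H by blast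
      show ?thesis
        using e[OF n(2)] e[OF n(4)] e[OF n(6)]
        by (auto simp: n(1,3,5) operad_alg_cat_simps(3-) fun_eq_iff restrict_def)
    qed
  qed
qed

end

section \<open>Bijectivity of the canonical functor on objects and on arrows\<close>

section \<open>The canonical isomorphism\<close>

context symmetric_monoidal_category
begin

definition diagram_functor ::
  "('c, 'd, 'y) cat_scheme \<Rightarrow> ('c \<Rightarrow> 'o) \<Rightarrow> ('c \<Rightarrow> 'a) \<Rightarrow> ('c \<Rightarrow> 'a) \<Rightarrow> ('d \<Rightarrow> 'a) \<Rightarrow>
   ('c, 'd, ('o, 'a) monoid_ob, ('o, 'a) monoid_ar) ftor" where
  "diagram_functor C A mu eta fa =
     (\<lambda>c \<in> Ob C. (A c, mu c, eta c),
      \<lambda>f \<in> Ar C. ((A (Dom C f), mu (Dom C f), eta (Dom C f)), (A (Cod C f), mu (Cod C f), eta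
          (Cod C f)), fa f))"

lemma diagram_functor_functor:
  assumes "monoid_diagram M C A mu eta fa"
  shows "diagram_functor C A mu eta fa \<in> Ob (functor_cat C (monoid_cat M))"
proof -
  interpret monoid_diagram M C A mu eta fa by (rule assms)
  have "is_functor C (monoid_cat M) (diagram_functor C A mu eta fa)"
    unfolding is_functor_def
    using C.category_axioms monoid_cat_category mon fa_hom fa_id fa_comp
    by (auto simp: diagram_functor_def Hom_monoid_cat monoid_cat_simps)
  then show ?thesis by (simp add: functor_cat_simps diagram_functor_def)
qed

lemma functor_diagram:
  assumes "F \<in> Ob (functor_cat C (monoid_cat M))"
  obtains A mu eta fa where "monoid_diagram M C A mu eta fa" "F = diagram_functor C A mu eta fa"
proof -
  have F: "is_functor C (monoid_cat M) F" and ext: "fst F \<in> extensional (Ob C)"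
      "snd F \<in> extensional (Ar C)"
    using assms by (simp_all add: functor_cat_simps)
  interpret C: category C using F by (simp add: is_functor_def)
  define A mu eta fa where "A c = fst (fst F c)" and "mu c = fst (snd (fst F c))" and
      "eta c = snd (snd (fst F c))"
    and "fa f = snd (snd (snd F f))" for c f
  have m: "(A c, mu c, eta c) = fst F c" for c by (simp add: A_def mu_def eta_def)
  have h: "is_monoid_hom M (fst F (Dom C f)) (fst F (Cod C f)) (fa f)"
    "snd F f = (fst F (Dom C f), fst F (Cod C f), fa f)" if "f \<in> Ar C" for f
  proof -
    have "snd F f \<in> Hom (monoid_cat M) (fst F (Dom C f)) (fst F (Cod C f))"
      using F that by (simp add: is_functor_def)
    then show "is_monoid_hom M (fst F (Dom C f)) (fst F (Cod C f)) (fa f)"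
      "snd F f = (fst F (Dom C f), fst F (Cod C f), fa f)"
      by (auto simp: Hom_monoid_cat fa_def)
  qed
  have "monoid_diagram M C A mu eta fa"
  proof
    show "is_monoid M (A c, mu c, eta c)" if "c \<in> Ob C" for c
      unfolding m using F that by (simp add: is_functor_def monoid_cat_simps)
    show "is_monoid_hom M (A (Dom C f), mu (Dom C f), eta (Dom C f)) (A (Cod C f), mu (Cod C f),
        eta (Cod C f)) (fa f)"
      if "f \<in> Ar C" for f unfolding m by (rule h(1)[OF that])
    show "fa (Ident C c) = Ident M (A c)" if "c \<in> Ob C" for c
    proof -
      have "snd F (Ident C c) = Ident (monoid_cat M) (fst F c)" using F that by
          (simp add: is_functor_def)
      then show ?thesis by (simp add: fa_def A_def monoid_cat_simps)
    qed
    show "fa (g \<cdot>\<^bsub>C\<^esub> f) = fa g \<cdot> fa f" if "f \<in> Ar C" "g \<in> Ar C" "Dom C g = Cod C f" for f g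
    proof -
      have "snd F (g \<cdot>\<^bsub>C\<^esub> f) = snd F g \<cdot>\<^bsub>monoid_cat M\<^esub> snd F f" using F that by
          (simp add: is_functor_def)
      then show ?thesis
        unfolding h(2)[OF that(1)] h(2)[OF that(2)] by (simp add: fa_def monoid_cat_simps)
    qed
  qed
  moreover have "F = diagram_functor C A mu eta fa"
    unfolding diagram_functor_def m using h(2) ext
    by (intro prod_eqI) (auto simp: fun_eq_iff restrict_def extensional_def)
  ultimately show thesis by (rule that)
qed

text \<open>For each orthogonal pair this is \<open>ev_transpose_eq_iff\<close>, since
  \<open>perp_relations\<close> lists exactly the two operations compared there.\<close>

lemma diagram_functor_perp:
  fixes C :: "('c, 'd, 'y) orth_cat_scheme"
  assumes D: "monoid_diagram M C A mu eta fa" and C: "orthogonal_category C"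
  shows "diagram_functor C A mu eta fa \<in> perp_commutative_functors C M \<longleftrightarrow>
    (\<forall>(t, c, x, y) \<in> perp_relations C. monoid_diagram.ev M A mu eta fa t c x = monoid_diagram.ev M
      A mu eta fa t c y)"
proof -
  interpret monoid_diagram M C A mu eta fa by (rule D)
  interpret O: orthogonal_category C by (rule C)
  have "(mu (Cod C f1) \<cdot> (fa f1 \<otimes>\<^sub>1 fa f2) =
      (mu (Cod C f1) \<cdot> braid M (A (Cod C f1)) (A (Cod C f1))) \<cdot> (fa f1 \<otimes>\<^sub>1 fa f2)) \<longleftrightarrow>
      ev (Cod C f1) [Dom C f1, Dom C f2] (id, [f1, f2]) = ev (Cod C f1) [Dom C f1, Dom C f2]
          (transpose 0 1, [f1, f2])"
    if "(f1, f2) \<in> Perp C" for f1 f2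
    by (rule ev_transpose_eq_iff[symmetric]) (use O.perp_ar[OF that] in \<open>auto simp: C.Hom_iff\<close>)
  moreover have "diagram_functor C A mu eta fa \<in> perp_commutative_functors C M \<longleftrightarrow>
      (\<forall>(f1, f2) \<in> Perp C. mu (Cod C f1) \<cdot> (fa f1 \<otimes>\<^sub>1 fa f2) =
        (mu (Cod C f1) \<cdot> braid M (A (Cod C f1)) (A (Cod C f1))) \<cdot> (fa f1 \<otimes>\<^sub>1 fa f2))"
    unfolding perp_commutative_functors_def mem_Collect_eq
    by (rule ball_cong[OF refl]) (use O.perp_ar in \<open>force simp: diagram_functor_def\<close>)
  ultimately show ?thesis
    unfolding perp_relations_def by fastforce
qed

end

locale operad_coequalizer = symmetric_monoidal_category M + C: orthogonal_category C
  for M :: "('o, 'a) smc" (structure) and C :: "('c, 'd) orth_cat" +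
  fixes P :: "('c, 'd perm_op set) operad"
    and q :: "'c \<Rightarrow> 'c list \<Rightarrow> 'd perm_op \<Rightarrow> 'd perm_op set"
  assumes coequalizer: "is_operad_coequalizer (cat_operad C) (perp_relations C) P q"
begin

lemma perp_relations_operations:
  assumes "(t, c, x, y) \<in> perp_relations C"
  shows "(t, c, x) \<in> operations (cat_operad C) \<and> (t, c, y) \<in> operations (cat_operad C)"
proof -
  have "transpose 0 (1::nat) permutes {..<2}" by (rule permutes_swap_id) auto
  then show ?thesis
    using assms C.perp_ar
    by (auto simp: perp_relations_def cat_operad_operations permutes_id Hom_def nth_Cons'
        numeral_2_eq_2 less_Suc_eq)
qed

lemma q_morphism: "operad_morphism (cat_operad C) P q" and q_identifies:
    "identifies (perp_relations C) q"
  using coequalizer by (simp_all add: is_operad_coequalizer_def)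

lemma q_surj: "(t, c, y) \<in> operations P \<Longrightarrow> \<exists>x. (t, c, x) \<in> operations (cat_operad C) \<and> q t c x = y"
  by (rule coequalizer_surj[OF coequalizer perp_relations_operations])

lemma q_cong:
  "\<lbrakk>(t, c, x) \<in> operations (cat_operad C); (t, c, x') \<in> operations (cat_operad C); q t c x =
    q t c x'\<rbrakk>
    \<Longrightarrow> operad_cong (cat_operad C) (perp_relations C) t c x x'"
  by (rule coequalizer_cong[OF coequalizer perp_relations_operations])

lemmas qD = operad_morphismD[OF q_morphism]

lemma colors [simp]: "Colors P = Ob C"
  using qD(3) by (simp add: cat_operad_simps)

abbreviation pull :: "('c \<times> 'c list \<times> 'd perm_op set \<Rightarrow> 'a) \<Rightarrow> 'c \<times> 'c list \<times> 'd perm_op \<Rightarrow> 'a" where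
  "pull \<alpha> \<equiv> \<lambda>(t, c, x). \<alpha> (t, c, q t c x)"

abbreviation "cmu \<alpha> \<equiv> cat_operad_algebra.amu C (pull \<alpha>)"
abbreviation "ceta \<alpha> \<equiv> cat_operad_algebra.aeta (pull \<alpha>)"
abbreviation "cfa \<alpha> \<equiv> cat_operad_algebra.afa C (pull \<alpha>)"

lemma pull_algebra:
  assumes "is_operad_algebra P M (A, \<alpha>)"
  shows "cat_operad_algebra M C A (pull \<alpha>)"
  by unfold_locales (rule pullback_algebra[OF q_morphism assms])

lemma pull_diagram:
  assumes "is_operad_algebra P M (A, \<alpha>)"
  shows "monoid_diagram M C A (cmu \<alpha>) (ceta \<alpha>) (cfa \<alpha>)"
proof -
  interpret cat_operad_algebra M C A "pull \<alpha>" by (rule pull_algebra[OF assms])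
  show ?thesis by (rule D.monoid_diagram_axioms)
qed

lemma pull_ev:
  assumes "is_operad_algebra P M (A, \<alpha>)" "(t, c, x) \<in> operations (cat_operad C)"
  shows "\<alpha> (t, c, q t c x) = monoid_diagram.ev M A (cmu \<alpha>) (ceta \<alpha>) (cfa \<alpha>) t c x"
proof -
  interpret cat_operad_algebra M C A "pull \<alpha>" by (rule pull_algebra[OF assms(1)])
  show ?thesis using alpha_ev[of t c "fst x" "snd x"] assms(2) by simp
qed

lemma canonical_monoid_eq:
  assumes "is_operad_algebra P M (A, \<alpha>)"
  shows "canonical_monoid C q (A, \<alpha>) c = (A c, cmu \<alpha> c, ceta \<alpha> c)"
proof -
  interpret cat_operad_algebra M C A "pull \<alpha>" by (rule pull_algebra[OF assms])
  show ?thesis by (simp add: canonical_monoid_def amu_def aeta_def)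
qed

lemma canonical_ob_eq:
  assumes "is_operad_algebra P M (A, \<alpha>)"
  shows "canonical_ob C q (A, \<alpha>) = diagram_functor C A (cmu \<alpha>) (ceta \<alpha>) (cfa \<alpha>)"
proof -
  interpret cat_operad_algebra M C A "pull \<alpha>" by (rule pull_algebra[OF assms])
  have "canonical_monoid C q (A, \<alpha>) = (\<lambda>c. (A c, cmu \<alpha> c, ceta \<alpha> c))"
    by (rule ext) (rule canonical_monoid_eq[OF assms])
  then show ?thesis
    by (simp add: canonical_ob_def diagram_functor_def afa_def)
qed

lemma canonical_ob_in:
  assumes "is_operad_algebra P M (A, \<alpha>)"
  shows "canonical_ob C q (A, \<alpha>) \<in> Ob (perp_commutative_cat C M)"
proof -
  note D = pull_diagram[OF assms]
  have ev: "monoid_diagram.ev M A (cmu \<alpha>) (ceta \<alpha>) (cfa \<alpha>) t c x =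
      monoid_diagram.ev M A (cmu \<alpha>) (ceta \<alpha>) (cfa \<alpha>) t c y"
    if r: "(t, c, x, y) \<in> perp_relations C" for t c x y
  proof -
    have "q t c x = q t c y" using bspec[OF q_identifies[unfolded identifies_def] r] by simp
    then have "\<alpha> (t, c, q t c x) = \<alpha> (t, c, q t c y)" by (rule arg_cong)
    then show ?thesis
      using perp_relations_operations[OF r] by (simp only: pull_ev[OF assms])
  qed
  have "diagram_functor C A (cmu \<alpha>) (ceta \<alpha>) (cfa \<alpha>) \<in> perp_commutative_functors C M"
    unfolding diagram_functor_perp[OF D C.orthogonal_category_axioms]
    by (rule ballI, clarify, rule ev)
  then show ?thesis
    using diagram_functor_functor[OF D]
    by (simp add: canonical_ob_eq[OF assms] perp_commutative_cat_def full_subcat_simps)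
qed

text \<open>Compatibility with multiplication, unit and arrows is compatibility with three kinds of
  operations. The converse is \<open>ev_natural\<close>, since every operation of P is an image
  under q and acts by \<open>ev\<close>.\<close>

lemma algebra_hom_iff:
  assumes a: "is_operad_algebra P M (A, \<alpha>)" "is_operad_algebra P M (B, \<beta>)"
  shows "is_algebra_hom P M (A, \<alpha>) (B, \<beta>) \<phi> \<longleftrightarrow>
    (\<forall>c \<in> Ob C. is_monoid_hom M (A c, cmu \<alpha> c, ceta \<alpha> c) (B c, cmu \<beta> c, ceta \<beta> c) (\<phi> c)) \<and>
    (\<forall>f \<in> Ar C. \<phi> (Cod C f) \<cdot> cfa \<alpha> f = cfa \<beta> f \<cdot> \<phi> (Dom C f))"
proof -
  interpret X: cat_operad_algebra M C A "pull \<alpha>" by (rule pull_algebra[OF a(1)])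
  interpret Y: cat_operad_algebra M C B "pull \<beta>" by (rule pull_algebra[OF a(2)])
  show ?thesis
  proof (intro iffI conjI ballI)
    assume h: "is_algebra_hom P M (A, \<alpha>) (B, \<beta>) \<phi>"
    have \<phi>: "\<phi> c \<in> Ar M" "Dom M (\<phi> c) = A c" "Cod M (\<phi> c) = B c" if "c \<in> Ob C" for c
      using h that by (auto simp: is_algebra_hom_def Hom_iff)
    have e: "\<phi> t \<cdot> pull \<alpha> (t, c, x) = pull \<beta> (t, c, x) \<cdot> tensA M (map \<phi> c)"
      if "(t, c, x) \<in> operations (cat_operad C)" for t c x
      using h qD(4)[OF that] by (auto simp: is_algebra_hom_def)
    show "is_monoid_hom M (A c, cmu \<alpha> c, ceta \<alpha> c) (B c, cmu \<beta> c, ceta \<beta> c) (\<phi> c)" if c: "c \<in> Ob C"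
        for c
      using e[OF X.plain_operations[of c "[c, c]" "[Ident C c, Ident C c]"]]
        e[OF X.plain_operations[of c "[]" "[]"]] \<phi>[OF c] c C.id_hom[OF c] Y.amu_eta_ar[OF c]
      by (simp add: is_monoid_hom_def Hom_iff X.amu_def X.aeta_def Y.amu_def Y.aeta_def)
    show "\<phi> (Cod C f) \<cdot> cfa \<alpha> f = cfa \<beta> f \<cdot> \<phi> (Dom C f)" if f: "f \<in> Ar C" for f
      using e[OF X.plain_operations[of "Cod C f" "[Dom C f]" "[f]"]] f
      by (simp add: X.afa_def Y.afa_def C.Hom_iff)
  next
    assume h: "(\<forall>c \<in> Ob C. is_monoid_hom M (A c, cmu \<alpha> c, ceta \<alpha> c) (B c, cmu \<beta> c,
        ceta \<beta> c) (\<phi> c)) \<and>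
      (\<forall>f \<in> Ar C. \<phi> (Cod C f) \<cdot> cfa \<alpha> f = cfa \<beta> f \<cdot> \<phi> (Dom C f))"
    have "\<phi> t \<cdot> \<alpha> (t, c, y) = \<beta> (t, c, y) \<cdot> tensA M (map \<phi> c)" if y: "(t, c, y) \<in> operations P"
        for t c y
    proof -
      obtain x where x: "(t, c, x) \<in> operations (cat_operad C)" "q t c x = y" using q_surj[OF y]
          by blast
      show ?thesis
        using ev_natural[OF pull_diagram[OF a(1)] pull_diagram[OF a(2)] _ _ x(1), of \<phi>] h
          pull_ev[OF a(1) x(1)] pull_ev[OF a(2) x(1)] x(2) by simp
    qed
    then show "is_algebra_hom P M (A, \<alpha>) (B, \<beta>) \<phi>"
      using h by (auto simp: is_algebra_hom_def is_monoid_hom_def)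
  qed
qed

text \<open>Equal monoids and arrows make the identities an algebra morphism by
  \<open>algebra_hom_iff\<close>. Hence \<alpha> and \<beta> agree on all operations, and elsewhere
  by extensionality.\<close>

lemma canonical_ob_inj:
  assumes a: "(A, \<alpha>) \<in> Ob (operad_alg_cat P M)" "(B, \<beta>) \<in> Ob (operad_alg_cat P M)"
    and eq: "canonical_ob C q (A, \<alpha>) = canonical_ob C q (B, \<beta>)"
  shows "(A, \<alpha>) = (B, \<beta>)"
proof -
  have al: "is_operad_algebra P M (A, \<alpha>)" "is_operad_algebra P M (B, \<beta>)"
    and ext: "A \<in> extensional (Ob C)" "B \<in> extensional (Ob C)"
      "\<alpha> \<in> extensional (operations P)" "\<beta> \<in> extensional (operations P)"
    using a by (simp_all add: operad_alg_cat_simps(1))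
  note eq' = eq[unfolded canonical_ob_eq[OF al(1)] canonical_ob_eq[OF al(2)] diagram_functor_def]
  have ob: "A c = B c \<and> cmu \<alpha> c = cmu \<beta> c \<and> ceta \<alpha> c = ceta \<beta> c" if "c \<in> Ob C" for c
    using fun_cong[OF arg_cong[OF eq', of fst], of c] that by simp
  have ar: "cfa \<alpha> f = cfa \<beta> f" if "f \<in> Ar C" for f
    using fun_cong[OF arg_cong[OF eq', of snd], of f] that by simp
  have AB: "A = B" by (rule extensionalityI[OF ext(1,2)]) (use ob in blast)
  interpret D: monoid_diagram M C A "cmu \<alpha>" "ceta \<alpha>" "cfa \<alpha>" by (rule pull_diagram[OF al(1)])
  have "is_algebra_hom P M (A, \<alpha>) (B, \<beta>) (\<lambda>c. Ident M (A c))"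
    unfolding algebra_hom_iff[OF al]
  proof (intro conjI ballI)
    show "is_monoid_hom M (A c, cmu \<alpha> c, ceta \<alpha> c) (B c, cmu \<beta> c, ceta \<beta> c) (Ident M (A c))" if
        "c \<in> Ob C" for c
      using monoid_hom_id[OF D.mon[OF that]] ob[OF that] by simp
    show "Ident M (A (Cod C f)) \<cdot> cfa \<alpha> f = cfa \<beta> f \<cdot> Ident M (A (Dom C f))" if "f \<in> Ar C" for f
      using D.faD[of f "Dom C f" "Cod C f"] ar[OF that] that by (simp add: C.Hom_iff)
  qed
  then have h: "Ident M (A t) \<cdot> \<alpha> (t, c, y) = \<beta> (t, c, y) \<cdot> tensA M (map (\<lambda>c. Ident M (A c)) c)"
    if "(t, c, y) \<in> operations P" for t c y
    using that by (auto simp: is_algebra_hom_def)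
  have "\<alpha> p = \<beta> p" if "p \<in> operations P" for p
  proof -
    obtain t c y where p: "p = (t, c, y)" by (metis prod.collapse)
    have c: "\<forall>i \<in> set c. A i \<in> Ob M" using that D.mon_ar(1) by (auto simp: p operations_def)
    have "\<alpha> p \<in> Hom M (tens M (map A c)) (A t)" "\<beta> p \<in> Hom M (tens M (map A c)) (A t)"
      using is_operad_algebraD(2)[OF al(1)] is_operad_algebraD(2)[OF al(2)] that AB by
          (simp_all add: p)
    then show ?thesis using h[of t c y] tensA_id[OF c] that by (simp add: p Hom_iff)
  qed
  then have "\<alpha> = \<beta>" by (intro extensionalityI[OF ext(3,4)])
  then show ?thesis using AB by simp
qed

lemma canonical_ob_surj:
  assumes F: "F \<in> Ob (perp_commutative_cat C M)"
  shows "\<exists>X \<in> Ob (operad_alg_cat P M). canonical_ob C q X = F"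
proof -
  have "F \<in> Ob (functor_cat C (monoid_cat M))" and perp: "F \<in> perp_commutative_functors C M"
    using F by (simp_all add: perp_commutative_cat_def full_subcat_simps)
  then obtain A mu eta fa where D: "monoid_diagram M C A mu eta fa" and Feq:
      "F = diagram_functor C A mu eta fa"
    using functor_diagram by blast
  interpret D: monoid_diagram M C A mu eta fa by (rule D)
  let ?ev = "\<lambda>(t, c, x). D.ev t c x"
  have R: "?ev (t, c, x) = ?ev (t, c, y)" if "(t, c, x, y) \<in> perp_relations C" for t c x y
    using perp that unfolding Feq diagram_functor_perp[OF D C.orthogonal_category_axioms] by auto
  \<comment> \<open>An operation of P acts through an arbitrary preimage under q. The choice is
    immaterial: two preimages are congruent by \<open>q_cong\<close>, and \<perp>-commutativity
    makes \<open>ev\<close> constant on congruence classes.\<close>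
  define \<beta> where "\<beta> = (\<lambda>(t, c, y) \<in> operations P. D.ev t c (SOME x. (t, c,
      x) \<in> operations (cat_operad C) \<and> q t c x = y))"
  have \<beta>: "\<beta> (t, c, q t c x) = D.ev t c x" if x: "(t, c, x) \<in> operations (cat_operad C)" for t c x
  proof -
    let ?x = "SOME x'. (t, c, x') \<in> operations (cat_operad C) \<and> q t c x' = q t c x"
    have "(t, c, ?x) \<in> operations (cat_operad C) \<and> q t c ?x = q t c x"
      by (rule someI[of _ x]) (simp add: x)
    then have "operad_cong (cat_operad C) (perp_relations C) t c ?x x"
      using q_cong[of t c ?x x] x by blast
    from algebra_cong[OF qD(1) D.ev_algebra R this] show ?thesis
      using qD(4)[OF x] by (simp add: \<beta>_def)
  qed
  have "is_operad_algebra P M (A, \<beta>)"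
    by (rule pushforward_algebra[OF q_morphism _ D.ev_algebra]) (use q_surj \<beta> in auto)
  \<comment> \<open>The objects of the algebra category are extensional, so \<open>A\<close> is cut
    down to the colors; \<beta> is restricted already.\<close>
  then have alg: "is_operad_algebra P M (restrict A (Ob C), \<beta>)"
    by (rule is_operad_algebra_cong[OF qD(2)]) auto
  interpret X: cat_operad_algebra M C "restrict A (Ob C)" "pull \<beta>" by (rule pull_algebra[OF alg])
  have ob: "cmu \<beta> c = mu c" "ceta \<beta> c = eta c" if c: "c \<in> Ob C" for c
  proof -
    have i: "Ident C c \<in> Hom C c c" by (rule C.id_hom[OF c])
    show "cmu \<beta> c = mu c"
      using \<beta>[OF X.plain_operations[of c "[c, c]" "[Ident C c, Ident C c]"]] c i D.ev_binary[OF i i]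
      by (simp add: X.amu_def D.fa_id)
    show "ceta \<beta> c = eta c"
      using \<beta>[OF X.plain_operations[of c "[]" "[]"]] c D.ev_nullary[OF c] by (simp add: X.aeta_def)
  qed
  have ar: "cfa \<beta> f = fa f" if f: "f \<in> Ar C" for f
    using \<beta>[OF X.plain_operations[of "Cod C f" "[Dom C f]" "[f]"]] f D.ev_unary[of f "Dom C f"
        "Cod C f"]
    by (simp add: X.afa_def C.Hom_iff)
  have "canonical_ob C q (restrict A (Ob C), \<beta>) = F"
    unfolding canonical_ob_eq[OF alg] Feq diagram_functor_def
    using ob ar by (auto intro!: restrict_ext)
  moreover have "(restrict A (Ob C), \<beta>) \<in> Ob (operad_alg_cat P M)"
    using alg by (simp add: operad_alg_cat_simps(1) \<beta>_def)
  ultimately show ?thesis by blast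
qed

text \<open>A component in \<open>monoid_cat\<close> is a monoid morphism together with its source
  and target, so naturality unpacks to the right side of \<open>algebra_hom_iff\<close>.\<close>

lemma canonical_natural_iff:
  assumes a: "is_operad_algebra P M (A, \<alpha>)" "is_operad_algebra P M (B, \<beta>)"
  shows "is_natural C (monoid_cat M) (canonical_ob C q (A, \<alpha>)) (canonical_ob C q (B, \<beta>))
      (\<lambda>c \<in> Ob C. (canonical_monoid C q (A, \<alpha>) c, canonical_monoid C q (B, \<beta>) c, \<phi> c)) \<longleftrightarrow>
    is_algebra_hom P M (A, \<alpha>) (B, \<beta>) \<phi>"
proof -
  interpret X: monoid_diagram M C A "cmu \<alpha>" "ceta \<alpha>" "cfa \<alpha>" by (rule pull_diagram[OF a(1)])
  interpret Y: monoid_diagram M C B "cmu \<beta>" "ceta \<beta>" "cfa \<beta>" by (rule pull_diagram[OF a(2)])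
  show ?thesis
    unfolding algebra_hom_iff[OF a] is_natural_def canonical_ob_eq[OF a(1)] canonical_ob_eq[OF a(2)]
      canonical_monoid_eq[OF a(1)] canonical_monoid_eq[OF a(2)]
    using X.mon Y.mon by (auto simp: diagram_functor_def Hom_monoid_cat monoid_cat_simps)
qed

lemma canonical_arrow_in:
  assumes "(X, Y, \<phi>) \<in> Ar (operad_alg_cat P M)"
  shows "snd (canonical_functor C q) (X, Y, \<phi>) \<in> Ar (perp_commutative_cat C M)"
proof -
  obtain A \<alpha> B \<beta> where XY: "X = (A, \<alpha>)" "Y = (B, \<beta>)" by (metis prod.collapse)
  have a: "is_operad_algebra P M (A, \<alpha>)" "is_operad_algebra P M (B, \<beta>)"
      "is_algebra_hom P M (A, \<alpha>) (B, \<beta>) \<phi>"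
    using assms by (auto simp: operad_alg_cat_simps XY)
  show ?thesis
    using canonical_ob_in[OF a(1)] canonical_ob_in[OF a(2)] canonical_natural_iff[OF a(1,2)] a(3)
    by (simp add: canonical_functor_def XY perp_commutative_cat_def full_subcat_simps
        functor_cat_simps)
qed

lemma canonical_arrow_surj:
  assumes "h \<in> Ar (perp_commutative_cat C M)"
  shows "\<exists>k \<in> Ar (operad_alg_cat P M). snd (canonical_functor C q) k = h"
proof -
  obtain F G \<eta> where h: "h = (F, G, \<eta>)" by (metis prod.collapse)
  have FG: "F \<in> Ob (perp_commutative_cat C M)" "G \<in> Ob (perp_commutative_cat C M)"
    and \<eta>: "\<eta> \<in> extensional (Ob C)" "is_natural C (monoid_cat M) F G \<eta>"
    using assms by (auto simp: h perp_commutative_cat_def full_subcat_simps functor_cat_simps)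
  obtain A \<alpha> B \<beta> where X: "(A, \<alpha>) \<in> Ob (operad_alg_cat P M)" "canonical_ob C q (A, \<alpha>) = F"
    and Y: "(B, \<beta>) \<in> Ob (operad_alg_cat P M)" "canonical_ob C q (B, \<beta>) = G"
    using canonical_ob_surj[OF FG(1)] canonical_ob_surj[OF FG(2)] by (metis prod.collapse)
  have a: "is_operad_algebra P M (A, \<alpha>)" "is_operad_algebra P M (B, \<beta>)"
    using X(1) Y(1) by (simp_all add: operad_alg_cat_simps)
  \<comment> \<open>Only the underlying arrow of a component is free; its source and target are
    values of F and G.\<close>
  define \<phi> where "\<phi> = (\<lambda>c \<in> Ob C. snd (snd (\<eta> c)))"
  have "\<eta> c = (canonical_monoid C q (A, \<alpha>) c, canonical_monoid C q (B, \<beta>) c, \<phi> c)" if "c \<in> Ob C"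
      for c
  proof -
    have "\<eta> c \<in> Hom (monoid_cat M) (fst F c) (fst G c)" using \<eta>(2) that by
        (simp add: is_natural_def)
    moreover have "fst F c = canonical_monoid C q (A, \<alpha>) c"
        "fst G c = canonical_monoid C q (B, \<beta>) c"
      using that unfolding X(2)[symmetric] Y(2)[symmetric] by (simp_all add: canonical_ob_def)
    ultimately show ?thesis using that by (auto simp: Hom_monoid_cat \<phi>_def)
  qed
  then have e: "\<eta> = (\<lambda>c \<in> Ob C. (canonical_monoid C q (A, \<alpha>) c, canonical_monoid C q (B, \<beta>) c,
      \<phi> c))"
    by (intro extensionalityI[OF \<eta>(1)]) auto
  have "is_algebra_hom P M (A, \<alpha>) (B, \<beta>) \<phi>"
    using canonical_natural_iff[OF a, of \<phi>] \<eta>(2) unfolding e X(2) Y(2) by simp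
  then have "((A, \<alpha>), (B, \<beta>), \<phi>) \<in> Ar (operad_alg_cat P M)"
    using X Y by (simp add: operad_alg_cat_simps(2) \<phi>_def)
  moreover have "snd (canonical_functor C q) ((A, \<alpha>), (B, \<beta>), \<phi>) = h"
    unfolding h e by (simp add: canonical_functor_def X(2) Y(2))
  ultimately show ?thesis by blast
qed

lemma canonical_ob_inj_on: "inj_on (canonical_ob C q) (Ob (operad_alg_cat P M))"
  by (rule inj_onI) (metis canonical_ob_inj prod.collapse)

lemma canonical_arrow_inj_on: "inj_on (snd (canonical_functor C q)) (Ar (operad_alg_cat P M))"
proof (rule inj_onI)
  fix h k assume hk: "h \<in> Ar (operad_alg_cat P M)" "k \<in> Ar (operad_alg_cat P M)"
    "snd (canonical_functor C q) h = snd (canonical_functor C q) k"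
  obtain X Y \<phi> X' Y' \<phi>' where h: "h = (X, Y, \<phi>)" and k: "k = (X', Y', \<phi>')" by (metis prod.collapse)
  have "X = X'" "Y = Y'"
    using hk inj_onD[OF canonical_ob_inj_on, of X X'] inj_onD[OF canonical_ob_inj_on, of Y Y']
    by (auto simp: h k operad_alg_cat_simps(2) canonical_functor_def)
  have eq: "(\<lambda>c \<in> Ob C. (canonical_monoid C q X c, canonical_monoid C q Y c, \<phi> c)) =
      (\<lambda>c \<in> Ob C. (canonical_monoid C q X' c, canonical_monoid C q Y' c, \<phi>' c))"
    using hk(3) unfolding h k canonical_functor_def snd_conv prod.case prod.inject by blast
  have "\<phi> \<in> extensional (Ob C)" "\<phi>' \<in> extensional (Ob C)"
    using hk by (simp_all add: h k operad_alg_cat_simps(2))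
  then have "\<phi> = \<phi>'"
  proof (rule extensionalityI)
    show "\<phi> c = \<phi>' c" if "c \<in> Ob C" for c using fun_cong[OF eq, of c] that by simp
  qed
  then show "h = k" using \<open>X = X'\<close> \<open>Y = Y'\<close> by (simp add: h k)
qed

lemma canonical_functor_functor:
  "is_functor (operad_alg_cat P M) (perp_commutative_cat C M) (canonical_functor C q)"
  unfolding is_functor_def
proof (intro conjI ballI impI)
  let ?K = "operad_alg_cat P M" and ?L = "perp_commutative_cat C M" and ?F = "canonical_functor C q"
  show "category ?K" by (rule operad_alg_cat_category)
  show "category ?L"
    unfolding perp_commutative_cat_def
    by (rule full_subcat_category[OF functor_cat_category[OF C.category_axioms
        monoid_cat_category]])
  show "fst ?F X \<in> Ob ?L" if "X \<in> Ob ?K" for X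
    using that canonical_ob_in by (cases X)
        (simp add: canonical_functor_def operad_alg_cat_simps(1))
  have L: "Dom ?L (F, G, \<eta>) = F" "Cod ?L (F, G, \<eta>) = G"
      "Ident ?L F = (F, F, \<lambda>x \<in> Ob C. Ident (monoid_cat M) (fst F x))"
    "(F', G', \<theta>) \<cdot>\<^bsub>?L\<^esub> (F, G, \<eta>) = (F, G', \<lambda>x \<in> Ob C. \<theta> x \<cdot>\<^bsub>monoid_cat M\<^esub> \<eta> x)" for F G \<eta> F' G' \<theta>
    by (simp_all add: perp_commutative_cat_def full_subcat_simps functor_cat_simps)
  show "snd ?F f \<in> Hom ?L (fst ?F (Dom ?K f)) (fst ?F (Cod ?K f))" if "f \<in> Ar ?K" for f
  proof -
    obtain X Y \<phi> where f: "f = (X, Y, \<phi>)" by (metis prod.collapse)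
    show ?thesis
      using canonical_arrow_in[of X Y \<phi>] that
      by (simp add: f Hom_def operad_alg_cat_simps(3,4) canonical_functor_def L)
  qed
  show "snd ?F (Ident ?K X) = Ident ?L (fst ?F X)" if "X \<in> Ob ?K" for X
  proof -
    obtain A \<alpha> where X: "X = (A, \<alpha>)" by (metis prod.collapse)
    show ?thesis
      by (auto simp: X canonical_functor_def operad_alg_cat_simps(5) L canonical_ob_def
          canonical_monoid_def
          monoid_cat_simps intro!: restrict_ext)
  qed
  show "snd ?F (g \<cdot>\<^bsub>?K\<^esub> f) = snd ?F g \<cdot>\<^bsub>?L\<^esub> snd ?F f" for f g
  proof -
    obtain X Y \<phi> Y' Z \<psi> where fg: "f = (X, Y, \<phi>)" "g = (Y', Z, \<psi>)" by (metis prod.collapse)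
    show ?thesis
      by (auto simp: fg canonical_functor_def operad_alg_cat_simps(6) L monoid_cat_simps intro!:
          restrict_ext)
  qed
qed

end

theorem theorem3p16:
  fixes M :: "('o, 'a) smc"
    and C :: "('c, 'd) orth_cat"
    and P :: "('c, 'd perm_op set) operad"
    and q :: "'c \<Rightarrow> 'c list \<Rightarrow> 'd perm_op \<Rightarrow> 'd perm_op set"
  assumes "closed_symmetric_monoidal_category M"
    and "bicomplete TYPE('i) M"
    and "orthogonal_category C"
    and "is_operad_coequalizer (cat_operad C) (perp_relations C) P q"
  shows "is_category_isomorphism (operad_alg_cat P M) (perp_commutative_cat C M)
           (canonical_functor C q)"
proof -
  interpret operad_coequalizer M C P q
    using assms by (simp add: operad_coequalizer_def operad_coequalizer_axioms_def
        closed_symmetric_monoidal_category_def)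
  show ?thesis
  proof (rule is_category_isomorphismI[OF canonical_functor_functor])
    have "canonical_ob C q X \<in> Ob (perp_commutative_cat C M)" if "X \<in> Ob (operad_alg_cat P M)" for X
      using that canonical_ob_in by (cases X) (simp add: operad_alg_cat_simps(1))
    then show "bij_betw (fst (canonical_functor C q)) (Ob (operad_alg_cat P M)) (Ob (perp_commutative_cat C M))"
      unfolding bij_betw_def canonical_functor_def fst_conv
      using canonical_ob_inj_on canonical_ob_surj by blast
    have "snd (canonical_functor C q) h \<in> Ar (perp_commutative_cat C M)" if "h \<in> Ar (operad_alg_cat P M)" for h
      using that canonical_arrow_in by (cases h) blast
    then show "bij_betw (snd (canonical_functor C q)) (Ar (operad_alg_cat P M)) (Ar (perp_commutative_cat C M))"
      unfolding bij_betw_def using canonical_arrow_inj_on canonical_arrow_surj by blast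
  qed
qed

end
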